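(* Let $n=1$, let $\Omega\subset\mathbb{R}$ be a bounded open interval, $w\in L^2(\Omega)$, $c_+>0$, $c_->0$, $p>1$. Then, for all $L>\hat L$ there exists $\hat k(L)\in\mathbb{N}$ such that $$\{T\in\mathcal{C}_L(P_k,\overline\Omega): T(P_k)=\overline\Omega\}\ne\emptyset\qquad\forall k\ge\hat k(L)$$ and $$\lim_{k\to\infty}\mathcal{L}(T^L_k)=\hat L .$$
   Context: Notation: $u^+=\max\{u,0\}$, $u^-=\max\{-u,0\}$. The energy functional is $$F(u)=\frac12\int_\Omega|u'|^2dx-\frac{c_+}{p+1}\int_\Omega(u^+)^{p+1}dx-\frac{c_-}{p+1}\int_\Omega(u^-)^{p+1}dx-\int_\Omega wu\,dx ,$$ for $u\in H^1_0(\Omega)$; for open $U\subset\Omega$, functions in $H^1_0(U)$ are extended by $0$ to $\Omega$. $F_0$ denotes the functional $F$ with $w=0$ (considered on the interval $]0,2[$ below). The number $\hat L$: $\hat L=\frac1{\min\{\hat t,\,2-\hat t\}}\ge1$, where $\hat t\in\,]0,2[$ is the unique number such that $$\min\{F_0(u): u\in H^1_0(]0,2[),\ u\ge0\text{ in }]0,\hat t[,\ u\le0\text{ in }]\hat t,2[,\ u^+\not\equiv0,\ u^-\not\equiv0,\ F_0'(u)[u^+]=0,\ F_0'(u)[u^-]=0\}$$ $$=\min\{F_0(u): u\in H^1_0(]0,2[),\ u^+\not\equiv0,\ u^-\not\equiv0,\ F_0'(u)[u^+]=0,\ F_0'(u)[u^-]=0\}.$$ Cells: $C_0=\,]0,1[$,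 $C_z=z+C_0$ and $\sigma(z)=(-1)^{z}$ for $z\in\mathbb{Z}$; for $k\in\mathbb{N}$, $Z_k=\{z\in\mathbb{Z}:\frac1kC_z\subset\Omega\}$ and $P_k=\bigcup_{z\in Z_k}\frac1k\overline{C}_z$. Fix $k_\Omega\in\mathbb{N}$ with $Z_k\ne\emptyset$ for all $k\ge k_\Omega$. Maps: for $L\ge1$ and $P,Q\subset\mathbb{R}$, $\mathcal{C}_L(P,Q)$ is the set of $T:P\to Q$ with $\frac1L|x-y|\le|T(x)-T(y)|\le L|x-y|$ for all $x,y\in P$. For $T\in\mathcal{C}_L(P_k,\overline\Omega)$, $\mathcal{L}(T)=\inf\{\ell\ge1:\frac1\ell|x-y|\le|T(x)-T(y)|\le \ell|x-y|\ \forall x,y\in P_k\}$. The functions $\tilde u^T_{k,z}$: for every $L\ge1$ there is (and we fix) $k(L)\ge k_\Omega$ such that for all $k\ge k(L)$, $z\in Z_k$, $T\in\mathcal{C}_L(P_k,\overline\Omega)$, the minimum of $F(u)$ over $u\in H^1_0(T(\frac1kC_z))$ with $\int_{T(\frac1kC_z)}|u|^{p+1}dx<1$ is achieved by a unique function $\tilde u^T_{k,z}$. The functions $u^T_{k,z}$: for such $k,z,T$ and $u\in H^1_0(T(\frac1kC_z))$ set $M(u)=\max\{F(\tilde u^T_{k,z}+t(u-\tilde u^T_{k,z})):t\ge0\}$. There exists (and we fix one) $u^T_{k,z}\in H^1_0(T(\frac1kC_z))$ with $u^T_{k,z}\not\equiv\tilde u^T_{k,z}$, $\sigma(z)[u^T_{k,z}-\tilde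 u^T_{k,z}]\ge0$ in $T(\frac1kC_z)$ and $F(u^T_{k,z})=M(u^T_{k,z})=\min\{M(u): u\in H^1_0(T(\frac1kC_z)),\ u\not\equiv\tilde u^T_{k,z},\ \sigma(z)[u-\tilde u^T_{k,z}]\ge0 \text{ in }T(\frac1kC_z)\}$. The maps $T^L_k$: for $L\ge 1$ and $k\ge k(L)$ such that $\{T\in\mathcal{C}_L(P_k,\overline\Omega):T(P_k)=\overline\Omega\}\ne\emptyset$, let $\widetilde T^L_k$ be a minimizer of $T\mapsto\sum_{z\in Z_k}F(u^T_{k,z})$ over this set (it exists). Then $T^L_k$ denotes a minimizer of $\mathcal{L}(T)$ among all $T\in\mathcal{C}_L(P_k,\overline\Omega)$ such that $T(\frac1kC_z)=\widetilde T^L_k(\frac1kC_z)$ for all $z\in Z_k$ (it exists). *)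

theory Defs
  imports "HOL-Analysis.Analysis"
begin

text \<open>
  Elements of function spaces are represented by functions \<^typ>\<open>real \<Rightarrow> real\<close>; identities and
  inequalities between them are understood almost everywhere.
\<close>

definition L2 :: "real set \<Rightarrow> (real \<Rightarrow> real) set" where
  "L2 U = {f. f \<in> borel_measurable (lebesgue_on U) \<and> integrable (lebesgue_on U) (\<lambda>x. (f x)\<^sup>2)}"

definition test_functions :: "real set \<Rightarrow> (real \<Rightarrow> real) set" where
  "test_functions U = {\<phi>. (\<forall>m. (deriv ^^ m) \<phi> differentiable_on UNIV) \<and>
     compact (closure {x. \<phi> x \<noteq> 0}) \<and> closure {x. \<phi> x \<noteq> 0} \<subseteq> U}"

definition locally_integrable :: "real set \<Rightarrow> (real \<Rightarrow> real) \<Rightarrow> bool" where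
  "locally_integrable U f \<longleftrightarrow> (\<forall>K. compact K \<and> K \<subseteq> U \<longrightarrow> integrable (lebesgue_on K) f)"

definition has_weak_deriv :: "real set \<Rightarrow> (real \<Rightarrow> real) \<Rightarrow> (real \<Rightarrow> real) \<Rightarrow> bool" where
  "has_weak_deriv U u g \<longleftrightarrow> locally_integrable U u \<and> locally_integrable U g \<and>
     (\<forall>\<phi>\<in>test_functions U.
        (LINT x|lebesgue_on U. u x * deriv \<phi> x) = - (LINT x|lebesgue_on U. g x * \<phi> x))"

text \<open>Weak derivatives are determined up to a null set, so the choice is immaterial.\<close>

definition weak_deriv :: "real set \<Rightarrow> (real \<Rightarrow> real) \<Rightarrow> real \<Rightarrow> real" where
  "weak_deriv U u = (SOME g. has_weak_deriv U u g)"

definition H1 :: "real set \<Rightarrow> (real \<Rightarrow> real) set" where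
  "H1 U = {u \<in> L2 U. \<exists>g\<in>L2 U. has_weak_deriv U u g}"

definition H1_norm :: "real set \<Rightarrow> (real \<Rightarrow> real) \<Rightarrow> real" where
  "H1_norm U u =
     sqrt ((LINT x|lebesgue_on U. (u x)\<^sup>2) + (LINT x|lebesgue_on U. (weak_deriv U u x)\<^sup>2))"

text \<open>
  \<open>H10 U\<close> is the closure of the test functions in \<open>H1 U\<close>; its elements are taken to be extended by
  zero outside \<open>U\<close>.
\<close>

definition H10 :: "real set \<Rightarrow> (real \<Rightarrow> real) set" where
  "H10 U = {u \<in> H1 U. (\<forall>x. x \<notin> U \<longrightarrow> u x = 0) \<and>
     (\<exists>\<phi>. (\<forall>n. \<phi> n \<in> test_functions U) \<and>
          (\<lambda>n::nat. H1_norm U (\<lambda>x. \<phi> n x - u x)) \<longlonglongrightarrow> 0)}"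

definition ae_equal :: "real set \<Rightarrow> (real \<Rightarrow> real) \<Rightarrow> (real \<Rightarrow> real) \<Rightarrow> bool" where
  "ae_equal U u v \<longleftrightarrow> (AE x in lebesgue_on U. u x = v x)"

definition pos_part :: "(real \<Rightarrow> real) \<Rightarrow> real \<Rightarrow> real" where
  "pos_part u = (\<lambda>x. max (u x) 0)"

definition neg_part :: "(real \<Rightarrow> real) \<Rightarrow> real \<Rightarrow> real" where
  "neg_part u = (\<lambda>x. max (- u x) 0)"

definition energy ::
    "real \<Rightarrow> real \<Rightarrow> real \<Rightarrow> real set \<Rightarrow> (real \<Rightarrow> real) \<Rightarrow> (real \<Rightarrow> real) \<Rightarrow> real" where
  "energy cp cm p \<Omega> w u =
     1 / 2 * (LINT x|lebesgue_on \<Omega>. \<bar>weak_deriv \<Omega> u x\<bar>\<^sup>2)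
     - cp / (p + 1) * (LINT x|lebesgue_on \<Omega>. pos_part u x powr (p + 1))
     - cm / (p + 1) * (LINT x|lebesgue_on \<Omega>. neg_part u x powr (p + 1))
     - (LINT x|lebesgue_on \<Omega>. w x * u x)"

text \<open>
  \<open>F'(u)[v]\<close>, as a directional derivative; the energy is continuously differentiable on \<open>H10\<close>, so
  this is the value of the Frechet derivative.
\<close>

definition dir_deriv :: "((real \<Rightarrow> real) \<Rightarrow> real) \<Rightarrow> (real \<Rightarrow> real) \<Rightarrow> (real \<Rightarrow> real) \<Rightarrow> real" where
  "dir_deriv F u v = deriv (\<lambda>s. F (\<lambda>x. u x + s * v x)) 0"

definition is_minimum :: "real set \<Rightarrow> real \<Rightarrow> bool" where
  "is_minimum S m \<longleftrightarrow> m \<in> S \<and> (\<forall>y\<in>S. m \<le> y)"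

definition F0 :: "real \<Rightarrow> real \<Rightarrow> real \<Rightarrow> (real \<Rightarrow> real) \<Rightarrow> real" where
  "F0 cp cm p = energy cp cm p {0<..<2} (\<lambda>_. 0)"

definition nodal_set :: "real \<Rightarrow> real \<Rightarrow> real \<Rightarrow> (real \<Rightarrow> real) set" where
  "nodal_set cp cm p = {u \<in> H10 {0<..<2}.
     \<not> ae_equal {0<..<2} (pos_part u) (\<lambda>_. 0) \<and> \<not> ae_equal {0<..<2} (neg_part u) (\<lambda>_. 0) \<and>
     dir_deriv (F0 cp cm p) u (pos_part u) = 0 \<and> dir_deriv (F0 cp cm p) u (neg_part u) = 0}"

definition nodal_set_at :: "real \<Rightarrow> real \<Rightarrow> real \<Rightarrow> real \<Rightarrow> (real \<Rightarrow> real) set" where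
  "nodal_set_at cp cm p t = {u \<in> nodal_set cp cm p.
     (AE x in lebesgue_on {0<..<t}. u x \<ge> 0) \<and> (AE x in lebesgue_on {t<..<2}. u x \<le> 0)}"

definition optimal_node :: "real \<Rightarrow> real \<Rightarrow> real \<Rightarrow> real \<Rightarrow> bool" where
  "optimal_node cp cm p t \<longleftrightarrow> 0 < t \<and> t < 2 \<and>
     (\<exists>m. is_minimum (F0 cp cm p ` nodal_set_at cp cm p t) m \<and>
          is_minimum (F0 cp cm p ` nodal_set cp cm p) m)"

text \<open>To be applied to the optimal node \<open>t\<close>.\<close>

definition L_hat :: "real \<Rightarrow> real" where
  "L_hat t = 1 / min t (2 - t)"

definition cell :: "int \<Rightarrow> real set" where
  "cell z = (\<lambda>x. of_int z + x) ` {0<..<1}"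

definition sgn_cell :: "int \<Rightarrow> real" where
  "sgn_cell z = (- 1) powi z"

definition rescale :: "nat \<Rightarrow> real set \<Rightarrow> real set" where
  "rescale k S = (\<lambda>x. 1 / real k * x) ` S"

definition grid_cells :: "real set \<Rightarrow> nat \<Rightarrow> int set" where
  "grid_cells \<Omega> k = {z. rescale k (cell z) \<subseteq> \<Omega>}"

definition grid_domain :: "real set \<Rightarrow> nat \<Rightarrow> real set" where
  "grid_domain \<Omega> k = (\<Union>z\<in>grid_cells \<Omega> k. rescale k (closure (cell z)))"

definition bilip :: "real \<Rightarrow> real set \<Rightarrow> (real \<Rightarrow> real) \<Rightarrow> bool" where
  "bilip L A T \<longleftrightarrow>
     (\<forall>x\<in>A. \<forall>y\<in>A. 1 / L * \<bar>x - y\<bar> \<le> \<bar>T x - T y\<bar> \<and> \<bar>T x - T y\<bar> \<le> L * \<bar>x - y\<bar>)"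

definition bilip_maps :: "real \<Rightarrow> real set \<Rightarrow> real set \<Rightarrow> (real \<Rightarrow> real) set" where
  "bilip_maps L A B = {T \<in> A \<rightarrow>\<^sub>E B. bilip L A T}"

definition bilip_const :: "real set \<Rightarrow> (real \<Rightarrow> real) \<Rightarrow> real" where
  "bilip_const A T = Inf {l. l \<ge> 1 \<and> bilip l A T}"

definition onto_maps :: "real \<Rightarrow> real set \<Rightarrow> nat \<Rightarrow> (real \<Rightarrow> real) set" where
  "onto_maps L \<Omega> k = {T \<in> bilip_maps L (grid_domain \<Omega> k) (closure \<Omega>). T ` grid_domain \<Omega> k = closure \<Omega>}"

text \<open>
  In the following \<open>F\<close> is the energy functional, \<open>U\<close> the image of a cell, \<open>v\<close> the local minimizer
  on \<open>U\<close> and \<open>s\<close> the sign of the cell.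
\<close>

definition unique_local_minimizer ::
    "((real \<Rightarrow> real) \<Rightarrow> real) \<Rightarrow> real \<Rightarrow> real set \<Rightarrow> (real \<Rightarrow> real) \<Rightarrow> bool" where
  "unique_local_minimizer F p U v \<longleftrightarrow>
     (let adm = (\<lambda>u. u \<in> H10 U \<and> (LINT x|lebesgue_on U. \<bar>u x\<bar> powr (p + 1)) < 1)
      in is_arg_min F adm v \<and> (\<forall>u. is_arg_min F adm u \<longrightarrow> ae_equal U u v))"

text \<open>The maximum exists whenever \<open>u\<close> is admissible in \<open>minmax_function\<close> below.\<close>

definition ray_max :: "((real \<Rightarrow> real) \<Rightarrow> real) \<Rightarrow> (real \<Rightarrow> real) \<Rightarrow> (real \<Rightarrow> real) \<Rightarrow> real" where
  "ray_max F v u = (GREATEST y. \<exists>t\<ge>0. y = F (\<lambda>x. v x + t * (u x - v x)))"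

definition minmax_function ::
    "((real \<Rightarrow> real) \<Rightarrow> real) \<Rightarrow> real \<Rightarrow> real set \<Rightarrow> (real \<Rightarrow> real) \<Rightarrow> (real \<Rightarrow> real) \<Rightarrow> bool" where
  "minmax_function F s U v u \<longleftrightarrow>
     is_arg_min (ray_max F v)
       (\<lambda>u. u \<in> H10 U \<and> \<not> ae_equal U u v \<and> (AE x in lebesgue_on U. s * (u x - v x) \<ge> 0)) u \<and>
     F u = ray_max F v u"

end

theory Submission
  imports Defs
begin

text \<open>
  In one dimension the ground state energy on an interval of length \<open>l\<close> is, for either sign, a
  constant multiple of \<open>l powr (- \<beta>)\<close> with \<open>\<beta> = (p + 3) / (p - 1)\<close>, the constant being
  expressed by the optimal Sobolev constant; no minimizers are needed for this. On a cell image of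
  length of order \<open>1 / k\<close> the local minimizer is of lower order, and the min-max value \<open>F u\<close> equals
  the ground state energy up to \<open>O(k powr (\<beta> / 2 - 1))\<close>. Hence, up to a relative error
  \<open>O(k powr (- \<beta> / 2))\<close>, the minimizing map minimizes a sum of strictly convex functions of the
  cell lengths whose sum is prescribed. Minimality of the optimal node is the Lagrange condition for
  this problem, so strict convexity forces \<open>k\<close> times the cell lengths to converge uniformly to \<open>t\<close>
  or \<open>2 - t\<close>, according to the sign of the cell. Straightening the map on each cell yields the
  bilipschitz constant \<open>max (1 / t) (1 / (2 - t))\<close> in the limit, and no map with the same cell
  images does better.
\<close>


section \<open>Smooth functions\<close>

text \<open>The exponent \<open>decay p\<close> is forced by the Nehari balance: an extremal of the
  Sobolev inequality on length \<open>l\<close> has squared derivative norm \<open>R^2\<close> equal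
  to a constant times \<open>l powr ((p + 3) / 2) * R powr (p + 1)\<close>, hence \<open>R^2\<close>
  is a multiple of \<open>l powr (- decay p)\<close>. The local minimizer has derivative norm
  \<open>O(l)\<close> only, and the mixed terms of size \<open>l * R\<close> make the error on one
  cell. Uniformity over a growing number of cells is the delicate point: after division by
  \<open>k powr decay p\<close> even the sum of all cell errors tends to zero, and strict convexity
  bounds the sum of all squared deviations, hence each single one, by that total. A second obstacle
  is that the ideal lengths do not add up to the prescribed total, because of incomplete cells at
  the ends and a possible surplus of one sign; multiplying all of them by one common factor repairs
  the sum and preserves the Lagrange condition. Since extremals are never constructed, upper bounds
  come from near-extremal test functions whose loss is made arbitrarily small.\<close>

primrec ndiff :: "nat \<Rightarrow> (real \<Rightarrow> real) \<Rightarrow> bool" where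
  "ndiff 0 f \<longleftrightarrow> True"
| "ndiff (Suc n) f \<longleftrightarrow> f differentiable_on UNIV \<and> ndiff n (deriv f)"

text \<open>Handing the derivative down in \<open>ndiff\<close> turns closure under sums, products
  and composition into inductions on the order of differentiability, with the functions left
  arbitrary.\<close>

definition smooth :: "(real \<Rightarrow> real) \<Rightarrow> bool" where
  "smooth f \<longleftrightarrow> (\<forall>n. ndiff n f)"

lemma ndiff_iff: "ndiff n f \<longleftrightarrow> (\<forall>m<n. (deriv ^^ m) f differentiable_on UNIV)"
proof (induction n arbitrary: f)
  case (Suc n)
  show ?case by (simp only: ndiff.simps Suc All_less_Suc2 funpow_Suc_right funpow.simps(1) o_def id_def)
qed simp

lemma smooth_iff: "smooth f \<longleftrightarrow> (\<forall>m. (deriv ^^ m) f differentiable_on UNIV)"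
  unfolding smooth_def ndiff_iff by auto

lemma ndiff_SucI:
  assumes "\<And>x. (f has_real_derivative f' x) (at x)" "ndiff n f'"
  shows "ndiff (Suc n) f"
proof -
  have "deriv f = f'" using assms(1) by (auto intro: DERIV_imp_deriv)
  moreover have "f differentiable_on UNIV"
    unfolding differentiable_on_def
    using assms(1) real_differentiable_def differentiable_at_withinI by blast
  ultimately show ?thesis using assms(2) by simp
qed

lemma ndiff_SucD:
  assumes "ndiff (Suc n) f"
  shows "(f has_real_derivative deriv f x) (at x)" "ndiff n (deriv f)"
  using assms by (auto simp: differentiable_on_def DERIV_deriv_iff_real_differentiable)

lemma ndiff_mono: "ndiff (Suc n) f \<Longrightarrow> ndiff n f"
  unfolding ndiff_iff by auto

lemma ndiff_const: "ndiff n (\<lambda>x. c)"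
proof (induction n arbitrary: c)
  case (Suc n)
  show ?case by (rule ndiff_SucI[where f'="\<lambda>x. 0"]) (auto intro: Suc)
qed simp

lemma ndiff_ident: "ndiff n (\<lambda>x. x)"
proof (cases n)
  case (Suc m)
  show ?thesis unfolding Suc by (rule ndiff_SucI[where f'="\<lambda>x. 1"]) (auto intro: ndiff_const)
qed simp

lemma ndiff_add: "ndiff n f \<Longrightarrow> ndiff n g \<Longrightarrow> ndiff n (\<lambda>x. f x + g x)"
proof (induction n arbitrary: f g)
  case (Suc n)
  show ?case
    by (rule ndiff_SucI[OF DERIV_add[OF ndiff_SucD(1)[OF Suc.prems(1)] ndiff_SucD(1)[OF Suc.prems(2)]]
          Suc.IH[OF ndiff_SucD(2)[OF Suc.prems(1)] ndiff_SucD(2)[OF Suc.prems(2)]]])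
qed simp

lemma ndiff_mult: "ndiff n f \<Longrightarrow> ndiff n g \<Longrightarrow> ndiff n (\<lambda>x. f x * g x)"
proof (induction n arbitrary: f g)
  case (Suc n)
  have "ndiff n (\<lambda>x. deriv f x * g x + deriv g x * f x)"
    by (intro ndiff_add Suc.IH ndiff_SucD(2)[OF Suc.prems(1)] ndiff_SucD(2)[OF Suc.prems(2)]
        ndiff_mono[OF Suc.prems(1)] ndiff_mono[OF Suc.prems(2)])
  then show ?case
    by (rule ndiff_SucI[rotated])
      (intro DERIV_mult ndiff_SucD(1)[OF Suc.prems(1)] ndiff_SucD(1)[OF Suc.prems(2)])
qed simp

lemma ndiff_compose: "ndiff n f \<Longrightarrow> ndiff n g \<Longrightarrow> ndiff n (\<lambda>x. f (g x))"
proof (induction n arbitrary: f g)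
  case (Suc n)
  have "ndiff n (\<lambda>x. deriv f (g x) * deriv g x)"
    by (rule ndiff_mult[OF Suc.IH[OF ndiff_SucD(2)[OF Suc.prems(1)] ndiff_mono[OF Suc.prems(2)]]
          ndiff_SucD(2)[OF Suc.prems(2)]])
  then show ?case
    by (rule ndiff_SucI[rotated])
      (rule DERIV_chain2[OF ndiff_SucD(1)[OF Suc.prems(1)] ndiff_SucD(1)[OF Suc.prems(2)]])
qed simp

lemma smooth_const: "smooth (\<lambda>x. c)"
  and smooth_ident: "smooth (\<lambda>x. x)"
  and smooth_add: "smooth f \<Longrightarrow> smooth g \<Longrightarrow> smooth (\<lambda>x. f x + g x)"
  and smooth_mult: "smooth f \<Longrightarrow> smooth g \<Longrightarrow> smooth (\<lambda>x. f x * g x)"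
  and smooth_compose: "smooth f \<Longrightarrow> smooth g \<Longrightarrow> smooth (\<lambda>x. f (g x))"
  by (simp_all add: smooth_def ndiff_const ndiff_ident ndiff_add ndiff_mult ndiff_compose)

lemma smooth_cmult: "smooth f \<Longrightarrow> smooth (\<lambda>x. c * f x)"
  by (intro smooth_mult smooth_const)

lemma smooth_diff: "smooth f \<Longrightarrow> smooth g \<Longrightarrow> smooth (\<lambda>x. f x - g x)"
  using smooth_add[of f "\<lambda>x. (-1) * g x"] smooth_cmult[of g "-1"] by simp

lemma smooth_power: "smooth f \<Longrightarrow> smooth (\<lambda>x. f x ^ n)"
  by (induction n) (auto intro: smooth_const smooth_mult)

lemmas smooth_intros = smooth_const smooth_ident smooth_add smooth_mult smooth_diff smooth_power

lemma smooth_DERIV: "smooth f \<Longrightarrow> (f has_real_derivative deriv f x) (at x)"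
  unfolding smooth_def using ndiff_SucD(1) by blast

lemma smooth_deriv: "smooth f \<Longrightarrow> smooth (deriv f)"
  unfolding smooth_def using ndiff_SucD(2) by blast

lemma smooth_isCont: "smooth f \<Longrightarrow> isCont f x"
  using smooth_DERIV DERIV_isCont by blast

lemma smooth_continuous_on: "smooth f \<Longrightarrow> continuous_on S f"
  using smooth_isCont continuous_at_imp_continuous_on by blast

text \<open>The family is closed under differentiation up to linear combinations, since
  \<open>E\<^sub>j' = E\<^sub>j\<^sub>+\<^sub>2 - j E\<^sub>j\<^sub>+\<^sub>1\<close>; this is what makes it smooth.\<close>

definition flat :: "nat \<Rightarrow> real \<Rightarrow> real" where
  "flat j x = (if x > 0 then (1 / x) ^ j * exp (- (1 / x)) else 0)"

text \<open>With \<open>y = 1 / x\<close>, the single term \<open>y ^ (j + 2) / fact (j + 2)\<close>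
  of the exponential series is at most \<open>exp y\<close>. The quadratic bound yields derivative
  zero at the origin.\<close>

lemma flat_le: "\<bar>flat j x\<bar> \<le> fact (j + 2) * x\<^sup>2"
proof (cases "x > 0")
  case True
  define y where "y = 1 / x"
  have y: "y > 0" using True by (simp add: y_def)
  have le: "y ^ (j + 2) / fact (j + 2) \<le> exp y"
  proof -
    have s: "(\<lambda>n. y ^ n /\<^sub>R fact n) sums exp y" by (rule exp_converges)
    have "sum (\<lambda>n. y ^ n /\<^sub>R fact n) {j+2} \<le> (\<Sum>n. y ^ n /\<^sub>R fact n)"
      using s y by (intro sum_le_suminf) (auto simp: sums_iff)
    then show ?thesis using s by (simp add: sums_iff divide_inverse mult.commute)
  qed
  have "y ^ (j + 2) * exp (- y) = fact (j + 2) * (y ^ (j + 2) / fact (j + 2)) * exp (- y)"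
    by simp
  also have "\<dots> \<le> fact (j + 2) * exp y * exp (- y)"
    using le by (intro mult_right_mono mult_left_mono) auto
  also have "\<dots> = fact (j + 2)" by (simp add: exp_minus)
  finally have "y ^ (j + 2) * exp (- y) \<le> fact (j + 2)" .
  then have "y ^ j * exp (- y) * y\<^sup>2 \<le> fact (j + 2)"
    by (simp add: power_add mult_ac power2_eq_square)
  then have "y ^ j * exp (- y) \<le> fact (j + 2) * x\<^sup>2"
    using True by (simp add: y_def field_simps)
  then show ?thesis using True y by (simp add: flat_def y_def)
qed (simp add: flat_def)

lemma DERIV_zero_if_quadratic:
  fixes f :: "real \<Rightarrow> real"
  assumes "\<And>x. \<bar>f x\<bar> \<le> C * x\<^sup>2"
  shows "(f has_real_derivative 0) (at 0)"
proof -
  have f0: "f 0 = 0" using assms[of 0] by simp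
  have lim: "((\<lambda>h. C * \<bar>h\<bar>) \<longlongrightarrow> 0) (at 0)"
    by (rule tendsto_eq_intros refl | simp)+
  have le: "norm (f h / h) \<le> C * \<bar>h\<bar>" for h
  proof (cases "h = 0")
    case False
    then show ?thesis using assms[of h] by (simp add: field_simps power2_eq_square abs_mult)
  qed simp
  have "((\<lambda>h. f h / h) \<longlongrightarrow> 0) (at 0)"
    by (rule Lim_null_comparison[OF always_eventually lim]) (use le in auto)
  then show ?thesis by (simp add: DERIV_def f0)
qed

lemma DERIV_transfer:
  fixes f g :: "real \<Rightarrow> real"
  assumes "(f has_real_derivative D) (at x)" "eventually (\<lambda>y. f y = g y) (nhds x)"
  shows "(g has_real_derivative D) (at x)"
  using DERIV_cong_ev[OF refl assms(2) refl] assms(1) by simp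

lemma DERIV_flat:
  "(flat j has_real_derivative flat (j + 2) x - real j * flat (j + 1) x) (at x)"
proof -
  consider "x > 0" | "x < 0" | "x = 0" by linarith
  then show ?thesis
  proof cases
    case 1
    define y where "y = 1 / x"
    have D: "((\<lambda>x. 1 / x) has_real_derivative - (y\<^sup>2)) (at x)"
      using 1 by (auto intro!: derivative_eq_intros simp: y_def power2_eq_square)
    have "((\<lambda>x. (1 / x) ^ j * exp (- (1 / x))) has_real_derivative
        of_nat j * (- (y\<^sup>2) * y ^ (j - Suc 0)) * exp (- y) + exp (- y) * (- (- (y\<^sup>2))) * y ^ j) (at x)"
      using DERIV_mult[OF DERIV_power[OF D, of j] DERIV_fun_exp[OF DERIV_minus[OF D]]]
      by (simp add: y_def)
    moreover have "of_nat j * (- (y\<^sup>2) * y ^ (j - Suc 0)) * exp (- y) + exp (- y) * (- (- (y\<^sup>2))) * y ^ j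
        = flat (j + 2) x - real j * flat (j + 1) x"
      using 1 by (cases j) (simp_all add: flat_def y_def[symmetric] power2_eq_square algebra_simps)
    ultimately have "((\<lambda>x. (1 / x) ^ j * exp (- (1 / x))) has_real_derivative
        flat (j + 2) x - real j * flat (j + 1) x) (at x)" by simp
    moreover have "eventually (\<lambda>y. (1 / y) ^ j * exp (- (1 / y)) = flat j y) (nhds x)"
      using eventually_nhds_in_open[of "{0<..}" x] 1 by (auto elim!: eventually_mono simp: flat_def)
    ultimately show ?thesis by (rule DERIV_transfer)
  next
    case 2
    have "((\<lambda>x. 0) has_real_derivative flat (j + 2) x - real j * flat (j + 1) x) (at x)"
      using 2 by (simp add: flat_def)
    moreover have "eventually (\<lambda>y. 0 = flat j y) (nhds x)"
      using eventually_nhds_in_open[of "{..<0}" x] 2 by (auto elim!: eventually_mono simp: flat_def)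
    ultimately show ?thesis by (rule DERIV_transfer)
  next
    case 3
    then show ?thesis using DERIV_zero_if_quadratic[OF flat_le[of j]] by (simp add: flat_def[of _ 0])
  qed
qed

lemma smooth_flat: "smooth (flat j)"
proof -
  have "ndiff n (flat j)" for n
  proof (induction n arbitrary: j)
    case (Suc n)
    have "ndiff n (\<lambda>x. flat (j + 2) x + (- real j) * flat (j + 1) x)"
      by (intro ndiff_add ndiff_mult ndiff_const Suc)
    then show ?case
      by (rule ndiff_SucI[rotated]) (use DERIV_flat[of j] in simp)
  qed simp
  then show ?thesis by (simp add: smooth_def)
qed

text \<open>A smooth substitute for the positive part. The bound on its derivative is
  \<open>exp y \<ge> 1 + y\<close> at \<open>y = 1 / x\<close>.\<close>

definition soft :: "real \<Rightarrow> real" where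
  "soft x = x * flat 0 x"

lemma smooth_soft: "smooth soft"
  unfolding soft_def[abs_def] by (intro smooth_intros smooth_flat)

lemma soft_bounds: "soft x \<ge> 0" "soft x \<le> max x 0" "max x 0 - 1 \<le> soft x" "x \<le> 0 \<Longrightarrow> soft x = 0"
proof -
  have "x - 1 \<le> x * exp (- (1 / x))" if "x > 0"
  proof -
    have "x * (1 + (- (1 / x))) \<le> x * exp (- (1 / x))"
      using that by (intro mult_left_mono exp_ge_add_one_self) auto
    moreover have "x * (1 + (- (1 / x))) = x - 1" using that by (simp add: field_simps)
    ultimately show ?thesis by simp
  qed
  then show "soft x \<ge> 0" "soft x \<le> max x 0" "max x 0 - 1 \<le> soft x" "x \<le> 0 \<Longrightarrow> soft x = 0"
    by (auto simp: soft_def flat_def max_def)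
qed

lemma deriv_soft: "0 \<le> deriv soft x" "deriv soft x \<le> 1"
proof -
  have "(soft has_real_derivative flat 0 x + x * flat 2 x) (at x)"
    unfolding soft_def[abs_def] using DERIV_mult[OF DERIV_ident DERIV_flat[of 0 x]] by (simp add: mult.commute numeral_2_eq_2)
  then have d: "deriv soft x = flat 0 x + x * flat 2 x" by (rule DERIV_imp_deriv)
  show "0 \<le> deriv soft x" unfolding d by (auto simp: flat_def)
  show "deriv soft x \<le> 1"
  proof (cases "x > 0")
    case True
    have "(1 + 1 / x) * exp (- (1 / x)) \<le> exp (1 / x) * exp (- (1 / x))"
      by (intro mult_right_mono exp_ge_add_one_self) auto
    also have "\<dots> = 1" by (simp add: exp_minus)
    finally show ?thesis unfolding d using True by (simp add: flat_def field_simps power2_eq_square)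
  qed (simp add: d flat_def)
qed

text \<open>Shifting by one unit before rescaling makes the function vanish up to \<open>e\<close>
  and not merely up to \<open>0\<close>: a function that is below \<open>e\<close> near an endpoint
  is turned into one that is exactly zero there. The shift costs \<open>e\<close>, the defect of
  \<open>soft\<close> another \<open>e\<close>.\<close>

definition soft_cut :: "real \<Rightarrow> real \<Rightarrow> real" where
  "soft_cut e x = e * soft (x / e - 1)"

lemma smooth_soft_cut: "smooth (soft_cut e)"
  unfolding soft_cut_def[abs_def] divide_inverse
  by (rule smooth_cmult, rule smooth_compose[OF smooth_soft], intro smooth_intros)

lemma soft_cut_bounds:
  assumes "e > 0"
  shows "soft_cut e x \<ge> 0" "soft_cut e x \<le> max x 0" "max x 0 - 2 * e \<le> soft_cut e x"
    "x \<le> e \<Longrightarrow> soft_cut e x = 0"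
proof -
  have *: "e * max (x / e - 1) 0 = max (x - e) 0"
    using assms by (auto simp: max_def field_simps)
  show "soft_cut e x \<ge> 0" using assms soft_bounds by (simp add: soft_cut_def)
  show "x \<le> e \<Longrightarrow> soft_cut e x = 0" using assms soft_bounds(4) by (simp add: soft_cut_def field_simps)
  have "e * soft (x / e - 1) \<le> e * max (x / e - 1) 0"
    using assms soft_bounds by (intro mult_left_mono) auto
  then show "soft_cut e x \<le> max x 0" using * assms by (auto simp: soft_cut_def)
  have "e * (max (x / e - 1) 0 - 1) \<le> e * soft (x / e - 1)"
    using assms soft_bounds by (intro mult_left_mono) auto
  then show "max x 0 - 2 * e \<le> soft_cut e x" using * assms by (auto simp: soft_cut_def right_diff_distrib)
qed

lemma deriv_soft_cut:
  assumes "e > 0"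
  shows "\<bar>deriv (soft_cut e) x\<bar> \<le> 1"
proof -
  have "((\<lambda>x. e * soft (x / e - 1)) has_real_derivative e * (deriv soft (x / e - 1) * (1 / e))) (at x)"
  proof -
    have "((\<lambda>x. x / e - 1) has_real_derivative 1 / e) (at x)"
      using assms by (auto intro!: derivative_eq_intros)
    from DERIV_cmult[OF DERIV_chain2[OF smooth_DERIV[OF smooth_soft] this]] show ?thesis .
  qed
  then have "deriv (soft_cut e) x = deriv soft (x / e - 1)"
    using assms by (simp add: soft_cut_def[abs_def] DERIV_imp_deriv)
  then show ?thesis using deriv_soft[of "x / e - 1"] by simp
qed

text \<open>Both \<open>A\<close> and \<open>B\<close> are open and together cover the line, so near
  each point the glued function is either \<open>f\<close> or zero. The derivative of
  \<open>f\<close> also vanishes on the overlap, which lets the induction continue.\<close>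

lemma smooth_restrict:
  assumes "smooth f" and "open A" "open B" "A \<union> B = UNIV" "A \<inter> B \<subseteq> {x. f x = 0}"
  shows "smooth (\<lambda>x. if x \<in> A then f x else 0)"
proof -
  have "ndiff n f \<Longrightarrow> A \<inter> B \<subseteq> {x. f x = 0} \<Longrightarrow> ndiff n (\<lambda>x. if x \<in> A then f x else 0)" for n
  proof (induction n arbitrary: f)
    case (Suc n)
    note D = ndiff_SucD[OF Suc.prems(1)]
    have "A \<inter> B \<subseteq> {x. deriv f x = 0}"
    proof
      fix x assume x: "x \<in> A \<inter> B"
      have "eventually (\<lambda>y. f y = 0) (nhds x)"
        by (rule eventually_mono[OF eventually_nhds_in_open[of "A \<inter> B" x]])
          (use x assms(2,3) Suc.prems(2) in auto)
      then have "((\<lambda>x. 0) has_real_derivative deriv f x) (at x)"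
        by (rule DERIV_transfer[OF D(1)])
      then show "x \<in> {x. deriv f x = 0}" using DERIV_unique[OF _ DERIV_const] by simp
    qed
    then have n: "ndiff n (\<lambda>x. if x \<in> A then deriv f x else 0)" using Suc.IH D(2) by blast
    have "((\<lambda>x. if x \<in> A then f x else 0) has_real_derivative (if x \<in> A then deriv f x else 0)) (at x)" for x
    proof (cases "x \<in> A")
      case True
      have "eventually (\<lambda>y. f y = (if y \<in> A then f y else 0)) (nhds x)"
        by (rule eventually_mono[OF eventually_nhds_in_open[of A x]]) (use True assms(2) in auto)
      then show ?thesis using True DERIV_transfer[OF D(1)] by simp
    next
      case False
      then have "x \<in> B" using assms(4) by blast
      have "eventually (\<lambda>y. 0 = (if y \<in> A then f y else 0)) (nhds x)"
        by (rule eventually_mono[OF eventually_nhds_in_open[of B x]])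
          (use \<open>x \<in> B\<close> assms(3) Suc.prems(2) in auto)
      then have "((\<lambda>x. if x \<in> A then f x else 0) has_real_derivative 0) (at x)"
        by (rule DERIV_transfer[OF DERIV_const])
      then show ?thesis using False by simp
    qed
    then show ?case using n by (rule ndiff_SucI)
  qed simp
  then show ?thesis using assms by (auto simp: smooth_def)
qed

section \<open>Test functions\<close>

abbreviation tests :: "real \<Rightarrow> real \<Rightarrow> (real \<Rightarrow> real) set" where
  "tests c d \<equiv> test_functions {c<..<d}"

lemma testsI:
  assumes "smooth f" "c < c'" "d' < d" "\<And>x. x < c' \<or> d' < x \<Longrightarrow> f x = 0"
  shows "f \<in> tests c d"
proof -
  have "{x. f x \<noteq> 0} \<subseteq> {c'..d'}" using assms(4) by force
  then have "closure {x. f x \<noteq> 0} \<subseteq> {c'..d'}" by (intro closure_minimal) auto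
  moreover then have "compact (closure {x. f x \<noteq> 0})"
    by (meson bounded_closed_interval bounded_subset closed_closure compact_eq_bounded_closed)
  ultimately show ?thesis using assms by (auto simp: test_functions_def smooth_iff)
qed

lemma testsE:
  assumes "f \<in> tests c d" "c < d"
  obtains c' d' where "smooth f" "c < c'" "c' \<le> d'" "d' < d" "\<And>x. x < c' \<or> d' < x \<Longrightarrow> f x = 0"
proof -
  define K where "K = closure {x. f x \<noteq> 0}"
  have K: "compact K" "K \<subseteq> {c<..<d}" "smooth f" using assms by (auto simp: test_functions_def smooth_iff K_def)
  have sub: "f x = 0" if "x \<notin> K" for x using that closure_subset[of "{x. f x \<noteq> 0}"] by (auto simp: K_def)
  show ?thesis
  proof (cases "K = {}")
    case True
    \<comment> \<open>An empty support belongs to the zero function; the midpoint serves as both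
      ends.\<close>
    then show ?thesis using that[of "(c+d)/2" "(c+d)/2"] K sub assms(2) by auto
  next
    case False
    obtain l where l: "l \<in> K" "\<forall>t\<in>K. l \<le> t" using compact_attains_inf[OF K(1) False] by blast
    obtain r where r: "r \<in> K" "\<forall>t\<in>K. t \<le> r" using compact_attains_sup[OF K(1) False] by blast
    have "f x = 0" if "x < l \<or> r < x" for x
      using that l(2) r(2) by (intro sub) force
    moreover have "c < l" "l \<le> r" "r < d" using K(2) l r by auto
    ultimately show ?thesis using that[of l r] K(3) by blast
  qed
qed

lemma tests_smooth: "f \<in> tests c d \<Longrightarrow> smooth f"
  by (auto simp: test_functions_def smooth_iff)

lemma tests_outside: "f \<in> tests c d \<Longrightarrow> x \<notin> {c<..<d} \<Longrightarrow> f x = 0"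
  using closure_subset[of "{x. f x \<noteq> 0}"] by (auto simp: test_functions_def)

lemma tests_mono:
  assumes "f \<in> tests c d" "a \<le> c" "d \<le> b"
  shows "f \<in> tests a b"
  using assms by (auto simp: test_functions_def)

lemma tests_zero: "(\<lambda>x. 0) \<in> tests c d"
  using smooth_const[of 0] by (simp add: test_functions_def smooth_iff)

lemma tests_add:
  assumes "f \<in> tests c d" "g \<in> tests c d" "c < d"
  shows "(\<lambda>x. f x + g x) \<in> tests c d"
proof -
  obtain c1 d1 where 1: "smooth f" "c < c1" "c1 \<le> d1" "d1 < d" "\<And>x. x < c1 \<or> d1 < x \<Longrightarrow> f x = 0"
    using testsE[OF assms(1,3)] by blast
  obtain c2 d2 where 2: "smooth g" "c < c2" "c2 \<le> d2" "d2 < d" "\<And>x. x < c2 \<or> d2 < x \<Longrightarrow> g x = 0"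
    using testsE[OF assms(2,3)] by blast
  show ?thesis
  proof (rule testsI[OF smooth_add[OF 1(1) 2(1)], of _ "min c1 c2" "max d1 d2"])
    show "f x + g x = 0" if "x < min c1 c2 \<or> max d1 d2 < x" for x
      using that by (subst 1(5), fastforce, subst 2(5)) auto
  qed (use 1 2 in auto)
qed

lemma tests_mult:
  assumes "f \<in> tests c d" "smooth g" "c < d"
  shows "(\<lambda>x. g x * f x) \<in> tests c d"
proof -
  obtain c1 d1 where 1: "smooth f" "c < c1" "c1 \<le> d1" "d1 < d" "\<And>x. x < c1 \<or> d1 < x \<Longrightarrow> f x = 0"
    using testsE[OF assms(1,3)] by blast
  show ?thesis
    by (rule testsI[OF smooth_mult[OF assms(2) 1(1)] 1(2,4)]) (simp add: 1(5))
qed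

lemma tests_cmult: "f \<in> tests c d \<Longrightarrow> c < d \<Longrightarrow> (\<lambda>x. r * f x) \<in> tests c d"
  by (rule tests_mult[OF _ smooth_const])

lemma tests_diff:
  assumes "f \<in> tests c d" "g \<in> tests c d" "c < d"
  shows "(\<lambda>x. f x - g x) \<in> tests c d"
  using tests_add[OF assms(1) tests_cmult[OF assms(2,3), of "-1"] assms(3)] by simp

lemma tests_DERIV: "f \<in> tests c d \<Longrightarrow> (f has_real_derivative deriv f x) (at x)"
  using tests_smooth smooth_DERIV by blast

lemma tests_deriv:
  assumes "f \<in> tests c d" "c < d"
  shows "deriv f \<in> tests c d"
proof -
  obtain c1 d1 where 1: "smooth f" "c < c1" "c1 \<le> d1" "d1 < d" "\<And>x. x < c1 \<or> d1 < x \<Longrightarrow> f x = 0"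
    using testsE[OF assms] by blast
  have "deriv f x = 0" if "x < c1 \<or> d1 < x" for x
  proof -
    have "eventually (\<lambda>y. f y = 0) (nhds x)"
      by (rule eventually_mono[OF eventually_nhds_in_open[of "{..<c1} \<union> {d1<..}" x]])
        (use that 1(5) in auto)
    then have "((\<lambda>x. 0) has_real_derivative deriv f x) (at x)"
      by (rule DERIV_transfer[OF smooth_DERIV[OF 1(1)]])
    then show ?thesis by (rule DERIV_unique[OF _ DERIV_const])
  qed
  then show ?thesis by (intro testsI[OF smooth_deriv[OF 1(1)] 1(2,4)])
qed

lemma tests_deriv_outside: "f \<in> tests c d \<Longrightarrow> c < d \<Longrightarrow> x \<notin> {c<..<d} \<Longrightarrow> deriv f x = 0"
  using tests_deriv tests_outside by blast

lemma tests_compose: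
  assumes "f \<in> tests c d" "smooth g" "g 0 = 0" "c < d"
  shows "(\<lambda>x. g (f x)) \<in> tests c d"
proof -
  obtain c1 d1 where 1: "smooth f" "c < c1" "c1 \<le> d1" "d1 < d" "\<And>x. x < c1 \<or> d1 < x \<Longrightarrow> f x = 0"
    using testsE[OF assms(1,4)] by blast
  show ?thesis
    by (rule testsI[OF smooth_compose[OF assms(2) 1(1)] 1(2,4)]) (simp add: 1(5) assms(3))
qed

lemma tests_affine:
  assumes "f \<in> tests 0 1" "c < d"
  shows "(\<lambda>x. f ((x - c) / (d - c))) \<in> tests c d"
proof -
  obtain c1 d1 where 1: "smooth f" "0 < c1" "c1 \<le> d1" "d1 < 1" "\<And>x. x < c1 \<or> d1 < x \<Longrightarrow> f x = 0"
    using testsE[OF assms(1)] by auto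
  have d: "d - c > 0" using assms by simp
  have "smooth (\<lambda>x. f ((x - c) / (d - c)))" unfolding divide_inverse
    by (rule smooth_compose[OF 1(1)]) (intro smooth_intros)
  then show ?thesis
  proof (rule testsI[of _ _ "c + (d - c) * c1" "c + (d - c) * d1"])
    show "c < c + (d - c) * c1" using d 1 by simp
    show "c + (d - c) * d1 < d" using mult_strict_left_mono[OF 1(4) d] by simp
    show "f ((x - c) / (d - c)) = 0" if "x < c + (d - c) * c1 \<or> c + (d - c) * d1 < x" for x
      using that d by (intro 1(5)) (auto simp: field_simps)
  qed
qed

lemma tests_rescale_unit:
  assumes "f \<in> tests c d" "c < d"
  shows "(\<lambda>x. f (c + (d - c) * x)) \<in> tests 0 1"
proof -
  obtain c1 d1 where 1: "smooth f" "c < c1" "c1 \<le> d1" "d1 < d" "\<And>x. x < c1 \<or> d1 < x \<Longrightarrow> f x = 0"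
    using testsE[OF assms] by auto
  have d: "d - c > 0" using assms by simp
  have "smooth (\<lambda>x. f (c + (d - c) * x))"
    by (rule smooth_compose[OF 1(1)]) (intro smooth_intros)
  then show ?thesis
  proof (rule testsI[of _ _ "(c1 - c) / (d - c)" "(d1 - c) / (d - c)"])
    show "0 < (c1 - c) / (d - c)" using d 1 by simp
    show "(d1 - c) / (d - c) < 1" using d 1 by simp
    show "f (c + (d - c) * x) = 0" if "x < (c1 - c) / (d - c) \<or> (d1 - c) / (d - c) < x" for x
      using that d by (intro 1(5)) (auto simp: field_simps)
  qed
qed

text \<open>A smooth bump that is positive exactly on \<open>{a<..<b}\<close>; the powers below turn it into an
  approximation of the indicator function.\<close>

definition bump :: "real \<Rightarrow> real \<Rightarrow> real \<Rightarrow> real" where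
  "bump a b x = flat 0 (x - a) * flat 0 (b - x)"

lemma smooth_bump: "smooth (bump a b)"
  unfolding bump_def[abs_def]
  by (rule smooth_mult; rule smooth_compose[OF smooth_flat]; intro smooth_intros)

lemma bump_bounds: "0 \<le> bump a b x" "bump a b x \<le> 1" "bump a b x > 0 \<longleftrightarrow> x \<in> {a<..<b}"
  by (simp_all add: bump_def flat_def mult_le_one)

lemma tests_bump:
  assumes "c < a" "b < d"
  shows "bump a b \<in> tests c d"
  by (rule testsI[OF smooth_bump, of _ a b]) (use assms in \<open>auto simp: bump_def flat_def\<close>)

section \<open>Square-integrable functions on the line\<close>

text \<open>Functions on an interval are extended by zero, so that all norms and integrals refer to
  one measure and functions living on different intervals can be compared directly.\<close>

definition sq_int :: "(real \<Rightarrow> real) \<Rightarrow> bool" where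
  "sq_int f \<longleftrightarrow> f \<in> borel_measurable lebesgue \<and> integrable lebesgue (\<lambda>x. (f x)\<^sup>2)"

definition nrm :: "(real \<Rightarrow> real) \<Rightarrow> real" where
  "nrm f = sqrt (LINT x|lebesgue. (f x)\<^sup>2)"

lemma nrm_nonneg [simp]: "nrm f \<ge> 0"
  by (simp add: nrm_def)

lemma nrm_sq: "(nrm f)\<^sup>2 = (LINT x|lebesgue. (f x)\<^sup>2)"
  by (simp add: nrm_def)

lemma sq_int_measurable: "sq_int f \<Longrightarrow> f \<in> borel_measurable lebesgue"
  by (simp add: sq_int_def)

lemma sq_int_mult:
  assumes "sq_int f" "sq_int g"
  shows "integrable lebesgue (\<lambda>x. f x * g x)"
proof (rule Bochner_Integration.integrable_bound)
  show "integrable lebesgue (\<lambda>x. (f x)\<^sup>2 + (g x)\<^sup>2)"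
    using assms by (auto simp: sq_int_def)
  show "(\<lambda>x. f x * g x) \<in> borel_measurable lebesgue"
    using assms by (auto simp: sq_int_def)
  have "\<bar>a * b\<bar> \<le> a\<^sup>2 + b\<^sup>2" for a b :: real
  proof -
    have "2 * \<bar>a\<bar> * \<bar>b\<bar> \<le> a\<^sup>2 + b\<^sup>2" using sum_squares_bound[of "\<bar>a\<bar>" "\<bar>b\<bar>"] by simp
    moreover have "0 \<le> \<bar>a\<bar> * \<bar>b\<bar>" by simp
    ultimately show ?thesis unfolding abs_mult by linarith
  qed
  then show "AE x in lebesgue. norm (f x * g x) \<le> norm ((f x)\<^sup>2 + (g x)\<^sup>2)" by simp
qed

text \<open>The quadratic polynomial \<open>t^2 * A - 2 * t * C + B\<close> is the integral of a
  square, hence never negative; it is evaluated at its minimum \<open>t = C / A\<close>.\<close>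

lemma Cauchy_Schwarz_abs:
  assumes f: "sq_int f" and g: "sq_int g"
  shows "(LINT x|lebesgue. \<bar>f x * g x\<bar>) \<le> nrm f * nrm g"
proof -
  define A where "A = (LINT x|lebesgue. (f x)\<^sup>2)"
  define B where "B = (LINT x|lebesgue. (g x)\<^sup>2)"
  define C where "C = (LINT x|lebesgue. \<bar>f x * g x\<bar>)"
  have nn: "A \<ge> 0" "B \<ge> 0" "C \<ge> 0" by (simp_all add: A_def B_def C_def)
  have q: "0 \<le> t\<^sup>2 * A - 2 * t * C + B" for t
  proof -
    have i: "integrable lebesgue (\<lambda>x. t\<^sup>2 * (f x)\<^sup>2)" "integrable lebesgue (\<lambda>x. 2 * t * \<bar>f x * g x\<bar>)"
      "integrable lebesgue (\<lambda>x. (g x)\<^sup>2)"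
      using f g sq_int_mult[OF f g] by (auto simp: sq_int_def)
    have "0 \<le> (LINT x|lebesgue. (t * \<bar>f x\<bar> - \<bar>g x\<bar>)\<^sup>2)" by simp
    also have "\<dots> = (LINT x|lebesgue. t\<^sup>2 * (f x)\<^sup>2 - 2 * t * \<bar>f x * g x\<bar> + (g x)\<^sup>2)"
      by (rule Bochner_Integration.integral_cong) (simp_all add: power2_diff power_mult_distrib abs_mult algebra_simps)
    also have "\<dots> = t\<^sup>2 * A - 2 * t * C + B"
      using i by (simp add: A_def B_def C_def)
    finally show ?thesis .
  qed
  have "C\<^sup>2 \<le> A * B"
  proof (cases "A = 0")
    case True
    have "C \<le> 0"
    proof (rule ccontr)
      assume "\<not> C \<le> 0"
      \<comment> \<open>For \<open>A = 0\<close> the polynomial is linear in \<open>t\<close>; at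
        this \<open>t\<close> it equals \<open>-1\<close>.\<close>
      then show False using q[of "(B + 1) / (2 * C)"] True nn by (simp add: field_simps)
    qed
    then have "C = 0" using nn by simp
    then show ?thesis using nn by simp
  next
    case False
    then have "A > 0" using nn by simp
    then have "A * ((C / A)\<^sup>2 * A - 2 * (C / A) * C + B) = A * B - C\<^sup>2"
      by (simp add: field_simps power2_eq_square)
    moreover have "0 \<le> A * ((C / A)\<^sup>2 * A - 2 * (C / A) * C + B)"
      using q[of "C / A"] \<open>A > 0\<close> by (intro mult_nonneg_nonneg) auto
    ultimately show ?thesis by simp
  qed
  then have "sqrt (C\<^sup>2) \<le> sqrt (A * B)" by (rule real_sqrt_le_mono)
  then show ?thesis using nn by (simp add: nrm_def A_def B_def C_def real_sqrt_mult)
qed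

lemma Cauchy_Schwarz:
  assumes "sq_int f" "sq_int g"
  shows "\<bar>LINT x|lebesgue. f x * g x\<bar> \<le> nrm f * nrm g"
  using Cauchy_Schwarz_abs[OF assms] integral_abs_bound[of lebesgue "\<lambda>x. f x * g x"] by linarith

lemma sq_int_add:
  assumes "sq_int f" "sq_int g"
  shows "sq_int (\<lambda>x. f x + g x)"
proof -
  have "integrable lebesgue (\<lambda>x. (f x)\<^sup>2 + (g x)\<^sup>2 + 2 * (f x * g x))"
    using assms sq_int_mult[OF assms] by (auto simp: sq_int_def)
  then show ?thesis using assms by (auto simp: sq_int_def power2_sum mult.assoc)
qed

lemma sq_int_cmult: "sq_int f \<Longrightarrow> sq_int (\<lambda>x. c * f x)"
  by (auto simp: sq_int_def power_mult_distrib)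

lemma sq_int_diff:
  assumes "sq_int f" "sq_int g"
  shows "sq_int (\<lambda>x. f x - g x)"
  using sq_int_add[OF assms(1) sq_int_cmult[OF assms(2), of "-1"]] by simp

lemma sq_int_zero: "sq_int (\<lambda>x. 0)"
  by (simp add: sq_int_def)

lemma sq_int_indicator:
  assumes "sq_int f" "X \<in> sets lebesgue"
  shows "sq_int (\<lambda>x. indicator X x * f x)"
proof -
  have "(\<lambda>x. (indicator X x * f x)\<^sup>2) = (\<lambda>x. indicator X x *\<^sub>R (f x)\<^sup>2)"
    by (auto simp: indicator_def)
  then show ?thesis using assms integrable_mult_indicator[of X lebesgue "\<lambda>x. (f x)\<^sup>2"]
    by (auto simp: sq_int_def)
qed

lemma nrm_cmult: "nrm (\<lambda>x. c * f x) = \<bar>c\<bar> * nrm f"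
  by (simp add: nrm_def power_mult_distrib real_sqrt_mult)

lemma nrm_add_sq:
  assumes "sq_int f" "sq_int g"
  shows "(nrm (\<lambda>x. f x + g x))\<^sup>2 = (nrm f)\<^sup>2 + 2 * (LINT x|lebesgue. f x * g x) + (nrm g)\<^sup>2"
proof -
  have "(LINT x|lebesgue. (f x + g x)\<^sup>2) = (LINT x|lebesgue. (f x)\<^sup>2 + 2 * (f x * g x) + (g x)\<^sup>2)"
    by (rule Bochner_Integration.integral_cong) (simp_all add: power2_sum)
  then show ?thesis using assms sq_int_mult[OF assms] by (simp add: nrm_sq sq_int_def)
qed

lemma nrm_triangle:
  assumes "sq_int f" "sq_int g"
  shows "nrm (\<lambda>x. f x + g x) \<le> nrm f + nrm g"
proof (rule power2_le_imp_le)
  have "(LINT x|lebesgue. f x * g x) \<le> nrm f * nrm g" using Cauchy_Schwarz[OF assms] by linarith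
  then show "(nrm (\<lambda>x. f x + g x))\<^sup>2 \<le> (nrm f + nrm g)\<^sup>2"
    unfolding nrm_add_sq[OF assms] by (simp add: power2_sum)
qed simp

lemma nrm_minus: "nrm (\<lambda>x. - f x) = nrm f"
  by (simp add: nrm_def)

lemma nrm_diff_commute: "nrm (\<lambda>x. f x - g x) = nrm (\<lambda>x. g x - f x)"
  by (simp add: nrm_def power2_commute)

lemma nrm_triangle_diff:
  assumes "sq_int f" "sq_int g"
  shows "nrm (\<lambda>x. f x - g x) \<le> nrm f + nrm g"
  using nrm_triangle[OF assms(1) sq_int_cmult[OF assms(2), of "-1"]] by (simp add: nrm_minus)

lemma nrm_reverse_triangle:
  assumes "sq_int f" "sq_int g"
  shows "\<bar>nrm f - nrm g\<bar> \<le> nrm (\<lambda>x. f x - g x)"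
  using nrm_triangle[OF sq_int_diff[OF assms] assms(2)]
    nrm_triangle[OF sq_int_diff[OF assms(2,1)] assms(1)] nrm_diff_commute[of f g] by simp

lemma nrm_mono:
  assumes "sq_int g" "f \<in> borel_measurable lebesgue" "\<And>x. \<bar>f x\<bar> \<le> \<bar>g x\<bar>"
  shows "sq_int f" "nrm f \<le> nrm g"
proof -
  have le: "(f x)\<^sup>2 \<le> (g x)\<^sup>2" for x using assms(3) by (simp add: abs_le_square_iff)
  show 1: "sq_int f" using assms le
    by (auto simp: sq_int_def intro!: Bochner_Integration.integrable_bound[of lebesgue "\<lambda>x. (g x)\<^sup>2"])
  show "nrm f \<le> nrm g" unfolding nrm_def
    using 1 assms le by (intro real_sqrt_le_mono integral_mono) (auto simp: sq_int_def)
qed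

lemma nrm_indicator_le:
  assumes "sq_int f" "X \<in> sets lebesgue"
  shows "nrm (\<lambda>x. indicator X x * f x) \<le> nrm f"
  by (rule nrm_mono(2)[OF assms(1)])
    (use sq_int_indicator[OF assms] in \<open>auto simp: sq_int_def indicator_def\<close>)

lemma nrm_zero_AE:
  assumes "sq_int f" "nrm f = 0"
  shows "AE x in lebesgue. f x = 0"
proof -
  have "(LINT x|lebesgue. (f x)\<^sup>2) = 0" using assms(2) by (simp add: nrm_def)
  then have "AE x in lebesgue. (f x)\<^sup>2 = 0"
    using assms(1) by (subst (asm) integral_nonneg_eq_0_iff_AE) (auto simp: sq_int_def)
  then show ?thesis by simp
qed

lemma sq_int_cong_AE:
  assumes "sq_int f" "g \<in> borel_measurable lebesgue" "AE x in lebesgue. f x = g x"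
  shows "sq_int g"
proof -
  have "AE x in lebesgue. (f x)\<^sup>2 = (g x)\<^sup>2" using assms(3) by eventually_elim simp
  then show ?thesis using assms
    by (auto simp: sq_int_def intro: integrable_cong_AE_imp)
qed

text \<open>Lebesgue measure is complete, so a preimage that differs from a measurable set by a null
  set is itself measurable.\<close>

lemma lebesgue_measurable_cong_AE:
  fixes f g :: "real \<Rightarrow> real"
  assumes "f \<in> borel_measurable lebesgue" "AE x in lebesgue. f x = g x"
  shows "g \<in> borel_measurable lebesgue"
proof (rule measurableI)
  fix A :: "real set" assume A: "A \<in> sets borel"
  have 1: "f -` A \<inter> space lebesgue \<in> sets lebesgue" using assms(1) A by (rule measurable_sets)
  have "AE x in lebesgue. x \<in> f -` A \<inter> space lebesgue \<longleftrightarrow> x \<in> g -` A \<inter> space lebesgue"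
    using assms(2) by eventually_elim auto
  from completion.in_sets_AE[OF this 1] show "g -` A \<inter> space lebesgue \<in> sets lebesgue" by simp
qed simp

lemma continuous_lebesgue_measurable:
  "continuous_on UNIV f \<Longrightarrow> (f :: real \<Rightarrow> real) \<in> borel_measurable lebesgue"
  by (intro measurable_completion) (simp add: borel_measurable_continuous_onI)

lemma indicator_times_measurable:
  fixes f :: "real \<Rightarrow> real"
  assumes "f \<in> borel_measurable lebesgue" "X \<in> sets lebesgue"
  shows "(\<lambda>x. indicator X x * f x) \<in> borel_measurable lebesgue"
  using assms by (intro borel_measurable_times borel_measurable_indicator)

lemma interval_sets_lebesgue [simp]:
  "{a..b::real} \<in> sets lebesgue" "{a<..<b::real} \<in> sets lebesgue" "{a<..<b::real} \<inter> space lebesgue \<in> sets lebesgue"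
  by auto

lemma integrable_continuous_support:
  fixes f :: "real \<Rightarrow> real"
  assumes "continuous_on UNIV f" "\<And>x. x < c \<or> d < x \<Longrightarrow> f x = 0"
  shows "integrable lebesgue f"
proof -
  have "set_integrable lborel {c..d} f"
    by (rule borel_integrable_atLeastAtMost') (use assms(1) continuous_on_subset in blast)
  moreover have "(\<lambda>x. indicator {c..d} x *\<^sub>R f x) = f"
  proof
    fix x show "indicator {c..d} x *\<^sub>R f x = f x"
      using assms(2)[of x] by (cases "x < c \<or> d < x") (auto simp: indicator_def)
  qed
  ultimately have "integrable lborel f" by (simp add: set_integrable_def)
  then show ?thesis by (simp add: integrable_completion)
qed

lemma sq_int_continuous_support:
  fixes f :: "real \<Rightarrow> real"
  assumes "continuous_on UNIV f" "\<And>x. x < c \<or> d < x \<Longrightarrow> f x = 0"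
  shows "sq_int f"
  unfolding sq_int_def
  using integrable_continuous_support[of "\<lambda>x. (f x)\<^sup>2" c d] assms continuous_lebesgue_measurable
  by (auto intro: continuous_intros)

lemma tests_continuous: "f \<in> tests c d \<Longrightarrow> continuous_on S f"
  by (simp add: smooth_continuous_on tests_smooth)

lemma tests_sq_int: "f \<in> tests c d \<Longrightarrow> sq_int f"
  by (rule sq_int_continuous_support[of _ c d]) (auto simp: tests_continuous tests_outside)

lemma tests_integrable: "f \<in> tests c d \<Longrightarrow> integrable lebesgue f"
  by (rule integrable_continuous_support[of _ c d]) (auto simp: tests_continuous tests_outside)

lemma smooth_FTC:
  assumes "smooth f" "x \<le> y"
  shows "(LINT t|lebesgue. indicator {x..y} t * deriv f t) = f y - f x"
proof -
  have c: "continuous_on S (deriv f)" for S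
    using smooth_continuous_on smooth_deriv assms(1) by blast
  have "integral\<^sup>L lborel (\<lambda>t. indicator {x..y} t *\<^sub>R deriv f t) = f y - f x"
    using assms smooth_DERIV[OF assms(1)]
    by (intro integral_FTC_atLeastAtMost c)
      (auto simp: has_real_derivative_iff_has_vector_derivative has_vector_derivative_at_within)
  moreover have [measurable]: "deriv f \<in> borel_measurable borel"
    by (rule borel_measurable_continuous_onI[OF c])
  have "(\<lambda>t. indicator {x..y} t *\<^sub>R deriv f t) \<in> borel_measurable lborel"
    by measurable
  ultimately show ?thesis by (simp add: integral_completion)
qed

lemma nrm_indicator_Icc:
  assumes "x \<le> y"
  shows "sq_int (indicator {x..y})" "nrm (indicator {x..y}) = sqrt (y - x)"
proof -
  have "(\<lambda>t. (indicator {x..y} t :: real)\<^sup>2) = indicator {x..y}"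
    by (auto simp: indicator_def)
  then show "sq_int (indicator {x..y})" "nrm (indicator {x..y}) = sqrt (y - x)"
    using assms by (simp_all add: sq_int_def nrm_def emeasure_lborel_Icc_eq borel_measurable_indicator)
qed

text \<open>\<open>f x\<close> is the integral of the derivative over \<open>{c..x}\<close>, because
  \<open>f\<close> vanishes at \<open>c\<close>; Cauchy-Schwarz against the indicator gives the root
  of the length. This one-dimensional embedding is what later controls the nonlinear terms.\<close>

lemma tests_sup_bound:
  assumes "f \<in> tests c d" "c < d"
  shows "\<bar>f x\<bar> \<le> sqrt (d - c) * nrm (deriv f)"
proof (cases "x \<in> {c<..<d}")
  case True
  have "f x = (LINT t|lebesgue. indicator {c..x} t * deriv f t)"
    using smooth_FTC[OF tests_smooth[OF assms(1)], of c x] True tests_outside[OF assms(1), of c] by simp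
  also have "\<bar>\<dots>\<bar> \<le> nrm (indicator {c..x}) * nrm (deriv f)"
    using True by (intro Cauchy_Schwarz nrm_indicator_Icc tests_sq_int[OF tests_deriv[OF assms]]) auto
  also have "\<dots> \<le> sqrt (d - c) * nrm (deriv f)"
    using True by (intro mult_right_mono) (auto simp: nrm_indicator_Icc)
  finally show ?thesis by simp
next
  case False
  then show ?thesis using tests_outside[OF assms(1)] assms(2) by simp
qed

text \<open>Stopping at an inner point keeps the boundary term \<open>f t * h t\<close>. It
  disappears at a zero of \<open>f\<close>, so that cutting off at a node produces a weak derivative
  without a jump.\<close>

lemma tests_by_parts_half:
  assumes f: "f \<in> tests a b" and h: "smooth h" and ab: "a < b" "a \<le> t"
  shows "(LINT x|lebesgue. indicator {a..t} x * (deriv f x * h x))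
    = f t * h t - (LINT x|lebesgue. indicator {a..t} x * (f x * deriv h x))"
proof -
  have fh: "(\<lambda>x. h x * f x) \<in> tests a b" using tests_mult[OF f h ab(1)] .
  have d: "deriv (\<lambda>x. h x * f x) x = deriv f x * h x + f x * deriv h x" for x
    using DERIV_mult[OF smooth_DERIV[OF h] tests_DERIV[OF f]] by (intro DERIV_imp_deriv) (simp add: mult.commute add.commute)
  have i1: "integrable lebesgue (\<lambda>x. h x * deriv f x)"
    using tests_integrable[OF tests_mult[OF tests_deriv[OF f ab(1)] h ab(1)]] .
  have i2: "integrable lebesgue (\<lambda>x. deriv h x * f x)"
    using tests_integrable[OF tests_mult[OF f smooth_deriv[OF h] ab(1)]] .
  have I: "integrable lebesgue (\<lambda>x. indicator {a..t} x * (deriv f x * h x))"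
    "integrable lebesgue (\<lambda>x. indicator {a..t} x * (f x * deriv h x))"
    using integrable_mult_indicator[OF _ i1, of "{a..t}"] integrable_mult_indicator[OF _ i2, of "{a..t}"]
    by (simp_all add: mult.commute)
  have "h t * f t - h a * f a = (LINT x|lebesgue. indicator {a..t} x * deriv (\<lambda>x. h x * f x) x)"
    using smooth_FTC[OF tests_smooth[OF fh] ab(2)] by simp
  also have "\<dots> = (LINT x|lebesgue. indicator {a..t} x * (deriv f x * h x) + indicator {a..t} x * (f x * deriv h x))"
    by (simp add: d distrib_left)
  also have "\<dots> = (LINT x|lebesgue. indicator {a..t} x * (deriv f x * h x))
      + (LINT x|lebesgue. indicator {a..t} x * (f x * deriv h x))"
    using I by simp
  finally show ?thesis using tests_outside[OF f, of a] by (simp add: mult.commute)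
qed

lemma tests_by_parts:
  assumes f: "f \<in> tests a b" and h: "smooth h" and ab: "a < b"
  shows "(LINT x|lebesgue. deriv f x * h x) = - (LINT x|lebesgue. f x * deriv h x)"
proof -
  have e: "indicator {a..b} x * (deriv f x * h x) = deriv f x * h x"
    "indicator {a..b} x * (f x * deriv h x) = f x * deriv h x" for x
    by (cases "x \<in> {a<..<b}"; use tests_outside[OF f, of x] tests_deriv_outside[OF f ab, of x] in simp)+
  show ?thesis
    using tests_by_parts_half[OF f h ab, of b] ab tests_outside[OF f, of b] by (simp add: e)
qed

section \<open>Weak derivatives\<close>

text \<open>The Borel sets over which the integral vanishes form a Dynkin system containing the
  intervals. Closure under complements needs the integral over the whole line, which is zero as a
  limit over \<open>{- real n..real n}\<close>. The Borel representative \<open>k\<close> makes the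
  generation argument applicable.\<close>

lemma integral_zero_on_intervals_imp_AE_zero:
  fixes h :: "real \<Rightarrow> real"
  assumes h: "integrable lebesgue h"
    and z: "\<And>x y. x \<le> y \<Longrightarrow> (LINT t|lebesgue. indicator {x..y} t * h t) = 0"
  shows "AE x in lebesgue. h x = 0"
proof -
  obtain k where k: "k \<in> borel_measurable lborel" "AE x in lborel. h x = k x"
    using completion_ex_borel_measurable_real[of h lborel] h by auto
  have hk: "AE x in lebesgue. h x = k x" by (rule AE_completion[OF k(2)])
  have kl: "k \<in> borel_measurable lebesgue" using k(1) by (rule measurable_completion)
  have ki: "integrable lborel k"
    using integrable_cong_AE_imp[OF h kl hk] k(1) by (simp add: integrable_completion)
  have kz: "(LINT t|lborel. indicator {x..y} t *\<^sub>R k t) = 0" if "x \<le> y" for x y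
  proof -
    have "(LINT t|lborel. indicator {x..y} t *\<^sub>R k t) = (LINT t|lebesgue. indicator {x..y} t *\<^sub>R k t)"
      using k(1) by (intro integral_completion[symmetric]) auto
    also have "\<dots> = (LINT t|lebesgue. indicator {x..y} t *\<^sub>R h t)"
      using indicator_times_measurable[OF kl, of "{x..y}"] hk
        indicator_times_measurable[OF borel_measurable_integrable[OF h], of "{x..y}"]
      by (intro integral_cong_AE) (auto elim!: eventually_mono)
    finally show ?thesis using z[OF that] by simp
  qed
  have k0: "(LINT t|lborel. k t) = 0"
  proof -
    have "(\<lambda>n. LINT t|lborel. indicator {- real n..real n} t *\<^sub>R k t) \<longlonglongrightarrow> (LINT t|lborel. k t)"
    proof (rule integral_dominated_convergence[where w="\<lambda>t. \<bar>k t\<bar>"])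
      show "AE x in lborel. (\<lambda>n. indicator {- real n..real n} x *\<^sub>R k x) \<longlonglongrightarrow> k x"
      proof (intro AE_I2 tendsto_eventually)
        fix x :: real
        obtain N :: nat where "\<bar>x\<bar> \<le> real N" using real_arch_simple by blast
        then show "eventually (\<lambda>n. indicator {- real n..real n} x *\<^sub>R k x = k x) sequentially"
          by (intro eventually_sequentiallyI[of N]) (auto simp: indicator_def)
      qed
    qed (use k(1) ki in \<open>auto simp: indicator_def\<close>)
    moreover have "(LINT t|lborel. indicator {- real n..real n} t *\<^sub>R k t) = 0" for n
      by (rule kz) simp
    ultimately show ?thesis using LIMSEQ_unique[OF _ tendsto_const] by simp
  qed
  have si: "set_integrable lborel A k" if "A \<in> sets borel" for A
    using integrable_mult_indicator[OF _ ki, of A] that by (simp add: set_integrable_def)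
  have all: "(LINT t:A|lborel. k t) = 0" if "A \<in> sets borel" for A
    using that
  proof (induction rule: borel_set_induct)
    case empty
    then show ?case by (simp add: set_lebesgue_integral_def)
  next
    case (interval a b)
    then show ?case using kz by (simp add: set_lebesgue_integral_def)
  next
    case (compl A)
    have "(LINT t:UNIV|lborel. k t) = (LINT t:A|lborel. k t) + (LINT t:-A|lborel. k t)"
      using set_integral_Un[of A "-A" lborel k] si compl(1) by simp
    then show ?case using k0 compl(2) by (simp add: set_lebesgue_integral_def)
  next
    case (union f)
    have "(LINT x:(\<Union>i. f i)|lborel. k x) = (\<Sum>i. (LINT x:(f i)|lborel. k x))"
      using union si by (intro lebesgue_integral_countable_add) (auto simp: disjoint_family_on_def)
    then show ?case using union by simp
  qed
  have "AE x in lborel. k x = 0"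
  proof (rule density_unique_real[OF ki])
    show "(LINT x:A|lborel. k x) = (LINT x:A|lborel. 0)" if "A \<in> sets lborel" for A
      using all[of A] that by simp
  qed simp
  then have "AE x in lebesgue. k x = 0" by (rule AE_completion)
  with hk show ?thesis by eventually_elim simp
qed

section \<open>Restriction to a set as multiplication by its indicator\<close>

lemma LINT_on: "X \<in> sets lebesgue \<Longrightarrow> (LINT x|lebesgue_on X. f x) = (LINT x|lebesgue. indicator X x * f x)"
  for f :: "real \<Rightarrow> real"
  by (simp add: integral_restrict_space)

lemma integrable_on_iff: "X \<in> sets lebesgue \<Longrightarrow> integrable (lebesgue_on X) f \<longleftrightarrow> integrable lebesgue (\<lambda>x. indicator X x * f x)"
  for f :: "real \<Rightarrow> real"
  by (simp add: integrable_restrict_space)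

lemma measurable_on_iff: "X \<in> sets lebesgue \<Longrightarrow> f \<in> borel_measurable (lebesgue_on X) \<longleftrightarrow> (\<lambda>x. indicator X x * f x) \<in> borel_measurable lebesgue"
  for f :: "real \<Rightarrow> real"
  by (simp add: borel_measurable_restrict_space_iff)

lemma AE_on_iff: "X \<in> sets lebesgue \<Longrightarrow> (AE x in lebesgue_on X. P x) \<longleftrightarrow> (AE x in lebesgue. x \<in> X \<longrightarrow> P x)"
  for X :: "real set"
  by (simp add: AE_restrict_space_iff)

lemma L2_iff:
  assumes "X \<in> sets lebesgue"
  shows "f \<in> L2 X \<longleftrightarrow> sq_int (\<lambda>x. indicator X x * f x)"
proof -
  have "(\<lambda>x. (indicator X x * f x)\<^sup>2) = (\<lambda>x. indicator X x * (f x)\<^sup>2)" by (auto simp: indicator_def)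
  then show ?thesis using assms by (simp add: L2_def sq_int_def measurable_on_iff integrable_on_iff)
qed

lemma locally_integrable_Icc:
  assumes "locally_integrable {a<..<b} f" "a < x" "y < b"
  shows "integrable lebesgue (\<lambda>t. indicator {x..y} t * f t)"
proof -
  have "compact {x..y}" "{x..y} \<subseteq> {a<..<b}" using assms(2,3) by auto
  then have "integrable (lebesgue_on {x..y}) f" using assms(1) unfolding locally_integrable_def by blast
  then show ?thesis by (simp add: integrable_on_iff)
qed

lemma locally_integrable_mult:
  assumes f: "locally_integrable {a<..<b} f" and h: "h \<in> tests a b" and "a < b"
  shows "integrable lebesgue (\<lambda>x. f x * h x)"
proof -
  obtain c d where cd: "a < c" "c \<le> d" "d < b" "\<And>x. x < c \<or> d < x \<Longrightarrow> h x = 0"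
    using testsE[OF h assms(3)] by metis
  have I: "integrable lebesgue (\<lambda>t. indicator {c..d} t * f t)"
    by (rule locally_integrable_Icc[OF f cd(1,3)])
  obtain M where M: "\<And>x. \<bar>h x\<bar> \<le> M"
    using tests_sup_bound[OF h assms(3)] by blast
  have M0: "M \<ge> 0" using M[of 0] by linarith
  have e: "(\<lambda>x. f x * h x) = (\<lambda>x. (indicator {c..d} x * f x) * h x)"
    using cd(4) by (auto simp: indicator_def fun_eq_iff) (meson not_le)+
  have hm: "h \<in> borel_measurable lebesgue" using tests_sq_int[OF h] by (simp add: sq_int_def)
  show ?thesis unfolding e
  proof (rule Bochner_Integration.integrable_bound)
    show "integrable lebesgue (\<lambda>x. M * (indicator {c..d} x * f x))" using I by simp
    show "(\<lambda>x. (indicator {c..d} x * f x) * h x) \<in> borel_measurable lebesgue"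
      using borel_measurable_times[OF borel_measurable_integrable[OF I] hm] .
    show "AE x in lebesgue. norm (indicator {c..d} x * f x * h x) \<le> norm (M * (indicator {c..d} x * f x))"
    proof (rule AE_I2)
      fix x
      have "\<bar>indicator {c..d} x * f x\<bar> * \<bar>h x\<bar> \<le> \<bar>indicator {c..d} x * f x\<bar> * M"
        by (intro mult_left_mono M) auto
      then show "norm (indicator {c..d} x * f x * h x) \<le> norm (M * (indicator {c..d} x * f x))"
        using M0 by (simp only: real_norm_def abs_mult) (simp add: mult.commute)
    qed
  qed
qed

lemma sq_int_locally_integrable:
  assumes "sq_int f"
  shows "locally_integrable U f"
  unfolding locally_integrable_def
proof (intro allI impI)
  fix K assume K: "compact K \<and> K \<subseteq> U"
  then have "bounded K" by (simp add: compact_imp_bounded)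
  then obtain M where M: "\<And>x. x \<in> K \<Longrightarrow> \<bar>x\<bar> \<le> M"
    unfolding bounded_real by auto
  define c d where "c = - \<bar>M\<bar>" and "d = \<bar>M\<bar>"
  have cd: "K \<subseteq> {c..d}" "c \<le> d"
  proof
    show "x \<in> {c..d}" if "x \<in> K" for x using M[OF that] by (auto simp: c_def d_def)
  qed (simp add: c_def d_def)
  have Ks: "K \<in> sets lebesgue" using K by (simp add: borel_compact)
  have 1: "sq_int (indicator K)"
    by (rule nrm_mono(1)[OF nrm_indicator_Icc(1)[OF cd(2)]]) (use Ks cd in \<open>auto simp: indicator_def\<close>)
  show "integrable (lebesgue_on K) f"
    using sq_int_mult[OF 1 assms] Ks by (simp add: integrable_on_iff)
qed

text \<open>Test functions approximating the indicator of a subinterval show that \<open>f\<close>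
  has integral zero over each interval whose closure lies in \<open>{a<..<b}\<close>; the criterion
  for vanishing integrals over intervals then applies locally.\<close>

lemma fundamental_lemma:
  assumes f: "locally_integrable {a<..<b} f" and ab: "a < b"
    and z: "\<And>h. h \<in> tests a b \<Longrightarrow> (LINT x|lebesgue. f x * h x) = 0"
  shows "AE x in lebesgue. x \<in> {a<..<b} \<longrightarrow> f x = 0"
proof -
  have Ioo: "(LINT x|lebesgue. indicator {c<..<d} x * f x) = 0" if cd: "a < c" "d < b" for c d
  proof -
    \<comment> \<open>As \<open>bump c d\<close> lies in \<open>{0<..1}\<close> inside the interval
      and is zero outside, \<open>(1 - bump c d x) ^ n\<close> tends to \<open>0\<close> inside and
      stays \<open>1\<close> outside; so these test functions converge to the indicator of
      \<open>{c<..<d}\<close>.\<close>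
    define cut where "cut n x = 1 - (1 - bump c d x) ^ n" for n x
    have b01: "0 \<le> 1 - bump c d x" "1 - bump c d x \<le> 1" for x using bump_bounds[of c d x] by auto
    have p01: "0 \<le> (1 - bump c d x) ^ n" "(1 - bump c d x) ^ n \<le> 1" for x n
      using b01 by (auto intro: power_le_one)
    have out: "bump c d x = 0" if "x \<notin> {c<..<d}" for x
      using bump_bounds[of c d x] that by linarith
    have I: "integrable lebesgue (\<lambda>t. indicator {c..d} t * f t)"
      by (rule locally_integrable_Icc[OF f cd])
    have tst: "cut n \<in> tests a b" for n
      unfolding cut_def[abs_def]
      by (rule testsI[of _ _ c d]) (use cd out in \<open>auto intro!: smooth_intros smooth_bump\<close>)
    have "(\<lambda>n. LINT x|lebesgue. f x * cut n x) \<longlonglongrightarrow> (LINT x|lebesgue. indicator {c<..<d} x * f x)"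
    proof (rule integral_dominated_convergence[where w="\<lambda>x. \<bar>indicator {c..d} x * f x\<bar>"])
      have m: "(\<lambda>x. indicator {c<..<d} x * (indicator {c..d} x * f x)) \<in> borel_measurable lebesgue"
        by (intro indicator_times_measurable borel_measurable_integrable[OF I]) simp
      moreover have "(\<lambda>x. indicator {c<..<d} x * (indicator {c..d} x * f x)) = (\<lambda>x. indicator {c<..<d} x * f x)"
        by (auto simp: indicator_def)
      ultimately show "(\<lambda>x. indicator {c<..<d} x * f x) \<in> borel_measurable lebesgue" by (simp only:)
      show "(\<lambda>x. f x * cut n x) \<in> borel_measurable lebesgue" for n
        by (rule borel_measurable_integrable[OF locally_integrable_mult[OF f tst ab]])
      show "integrable lebesgue (\<lambda>x. \<bar>indicator {c..d} x * f x\<bar>)" using I by (rule integrable_abs)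
      show "AE x in lebesgue. norm (f x * cut n x) \<le> \<bar>indicator {c..d} x * f x\<bar>" for n
      proof (rule AE_I2)
        fix x
        show "norm (f x * cut n x) \<le> \<bar>indicator {c..d} x * f x\<bar>"
        proof (cases "x \<in> {c<..<d}")
          case True
          have "\<bar>cut n x\<bar> \<le> 1" using p01[of x n] by (simp add: cut_def)
          then have "\<bar>f x\<bar> * \<bar>cut n x\<bar> \<le> \<bar>f x\<bar> * 1" by (intro mult_left_mono) auto
          then show ?thesis using True by (simp add: abs_mult)
        next
          case False
          then show ?thesis using out[OF False] by (simp add: cut_def)
        qed
      qed
      show "AE x in lebesgue. (\<lambda>n. f x * cut n x) \<longlonglongrightarrow> indicator {c<..<d} x * f x"
      proof (rule AE_I2)
        fix x
        show "(\<lambda>n. f x * cut n x) \<longlonglongrightarrow> indicator {c<..<d} x * f x"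
        proof (cases "x \<in> {c<..<d}")
          case True
          then have "\<bar>1 - bump c d x\<bar> < 1" using bump_bounds[of c d x] by auto
          then have "(\<lambda>n. (1 - bump c d x) ^ n) \<longlonglongrightarrow> 0" by (rule LIMSEQ_abs_realpow_zero2)
          then have "(\<lambda>n. f x * (1 - (1 - bump c d x) ^ n)) \<longlonglongrightarrow> f x * (1 - 0)"
            by (intro tendsto_mult tendsto_diff tendsto_const)
          then show ?thesis using True by (simp only: cut_def) simp
        next
          case False
          then show ?thesis using out[OF False] by (simp add: cut_def)
        qed
      qed
    qed
    moreover have "(LINT x|lebesgue. f x * cut n x) = 0" for n by (rule z[OF tst])
    ultimately show ?thesis using LIMSEQ_unique[OF _ tendsto_const] by simp
  qed
  have Icc: "AE x in lebesgue. x \<in> {c<..<d} \<longrightarrow> f x = 0" if cd: "a < c" "d < b" for c d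
  proof -
    have I: "integrable lebesgue (\<lambda>t. indicator {c<..<d} t * f t)"
    proof -
      have "integrable lebesgue (\<lambda>t. indicator {c<..<d} t *\<^sub>R (indicator {c..d} t * f t))"
        by (intro integrable_mult_indicator locally_integrable_Icc[OF f cd]) auto
      moreover have "(\<lambda>t. indicator {c<..<d} t *\<^sub>R (indicator {c..d} t * f t)) = (\<lambda>t. indicator {c<..<d} t * f t)"
        by (auto simp: indicator_def)
      ultimately show ?thesis by (simp only:)
    qed
    have "AE x in lebesgue. indicator {c<..<d} x * f x = 0"
    proof (rule integral_zero_on_intervals_imp_AE_zero[OF I])
      fix x y :: real
      define c' d' where "c' = max x c" and "d' = min y d"
      have cd': "a < c'" "d' < b" using cd by (auto simp: c'_def d'_def)
      have I': "integrable lebesgue (\<lambda>t. indicator {c'..d'} t * f t)"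
        by (rule locally_integrable_Icc[OF f cd'])
      \<comment> \<open>Only the two points \<open>x\<close> and \<open>y\<close> can distinguish
        the intersection of \<open>{x..y}\<close> and \<open>{c<..<d}\<close> from the open interval
        \<open>{c'<..<d'}\<close>.\<close>
      have ae: "AE t in lebesgue. t \<notin> {x, y}"
        by (intro AE_completion AE_not_in finite_imp_null_set_lborel) simp
      have "(LINT t|lebesgue. indicator {x..y} t * (indicator {c<..<d} t * f t))
        = (LINT t|lebesgue. indicator {c'<..<d'} t * f t)"
      proof (rule integral_cong_AE)
        show "(\<lambda>t. indicator {x..y} t * (indicator {c<..<d} t * f t)) \<in> borel_measurable lebesgue"
          by (intro indicator_times_measurable borel_measurable_integrable[OF I]) simp
        have "(\<lambda>t. indicator {c'<..<d'} t * (indicator {c'..d'} t * f t)) \<in> borel_measurable lebesgue"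
          by (intro indicator_times_measurable borel_measurable_integrable[OF I']) simp
        moreover have "(\<lambda>t. indicator {c'<..<d'} t * (indicator {c'..d'} t * f t)) = (\<lambda>t. indicator {c'<..<d'} t * f t)"
          by (auto simp: indicator_def)
        ultimately show "(\<lambda>t. indicator {c'<..<d'} t * f t) \<in> borel_measurable lebesgue" by (simp only:)
        show "AE t in lebesgue. indicator {x..y} t * (indicator {c<..<d} t * f t) = indicator {c'<..<d'} t * f t"
          using ae by eventually_elim (auto simp: indicator_def c'_def d'_def)
      qed
      then show "(LINT t|lebesgue. indicator {x..y} t * (indicator {c<..<d} t * f t)) = 0"
        using Ioo[OF cd'] by simp
    qed
    then show ?thesis by eventually_elim (auto simp: indicator_def)
  qed
  \<comment> \<open>The open interval is exhausted by countably many subintervals, so the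
    exceptional null sets can be united.\<close>
  have "AE x in lebesgue. \<forall>n::nat. x \<in> {a + 1 / Suc n<..<b - 1 / Suc n} \<longrightarrow> f x = 0"
    unfolding AE_all_countable by (intro allI Icc) auto
  then show ?thesis
  proof eventually_elim
    case (elim x)
    show ?case
    proof
      assume x: "x \<in> {a<..<b}"
      then have "0 < min (x - a) (b - x)" by auto
      then obtain n where "1 / Suc n < min (x - a) (b - x)" using nat_approx_posE by metis
      then show "f x = 0" using elim[rule_format, of n] by auto
    qed
  qed
qed

section \<open>Weak derivatives on an open interval\<close>

lemma has_weak_deriv_iff:
  assumes "a < b"
  shows "has_weak_deriv {a<..<b} u g \<longleftrightarrow> locally_integrable {a<..<b} u \<and> locally_integrable {a<..<b} g \<and>
    (\<forall>h\<in>tests a b. (LINT x|lebesgue. u x * deriv h x) = - (LINT x|lebesgue. g x * h x))"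
proof -
  have e: "indicator {a<..<b} x * (u x * deriv h x) = u x * deriv h x"
    "indicator {a<..<b} x * (g x * h x) = g x * h x" if "h \<in> tests a b" for h x
    using tests_outside[OF that, of x] tests_deriv_outside[OF that assms, of x] by (auto simp: indicator_def)
  show ?thesis unfolding has_weak_deriv_def by (simp add: LINT_on e)
qed

lemma locally_integrable_lin:
  assumes "locally_integrable U u" "locally_integrable U v"
  shows "locally_integrable U (\<lambda>x. u x + t * v x)"
  using assms by (auto simp: locally_integrable_def)

lemma has_weak_deriv_lin:
  assumes u: "has_weak_deriv {a<..<b} u g" and v: "has_weak_deriv {a<..<b} v k" and ab: "a < b"
  shows "has_weak_deriv {a<..<b} (\<lambda>x. u x + t * v x) (\<lambda>x. g x + t * k x)"
  unfolding has_weak_deriv_iff[OF ab]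
proof (intro conjI ballI)
  note U = u[unfolded has_weak_deriv_iff[OF ab]] and V = v[unfolded has_weak_deriv_iff[OF ab]]
  show "locally_integrable {a<..<b} (\<lambda>x. u x + t * v x)" "locally_integrable {a<..<b} (\<lambda>x. g x + t * k x)"
    using U V by (auto intro: locally_integrable_lin)
  fix h assume h: "h \<in> tests a b"
  have h': "deriv h \<in> tests a b" using tests_deriv[OF h ab] .
  have "(LINT x|lebesgue. (u x + t * v x) * deriv h x) = (LINT x|lebesgue. u x * deriv h x + t * (v x * deriv h x))"
    by (simp add: algebra_simps)
  also have "\<dots> = (LINT x|lebesgue. u x * deriv h x) + t * (LINT x|lebesgue. v x * deriv h x)"
    using U V locally_integrable_mult[OF _ h' ab] by simp
  also have "\<dots> = - ((LINT x|lebesgue. g x * h x) + t * (LINT x|lebesgue. k x * h x))"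
    using U V h by simp
  also have "\<dots> = - (LINT x|lebesgue. g x * h x + t * (k x * h x))"
    using U V locally_integrable_mult[OF _ h ab] by simp
  finally show "(LINT x|lebesgue. (u x + t * v x) * deriv h x) = - (LINT x|lebesgue. (g x + t * k x) * h x)"
    by (simp add: algebra_simps)
qed

lemma has_weak_deriv_tests:
  assumes f: "f \<in> tests a b" and ab: "a < b"
  shows "has_weak_deriv {a<..<b} f (deriv f)"
  unfolding has_weak_deriv_iff[OF ab]
  using tests_by_parts[OF f tests_smooth ab] tests_sq_int[OF f] tests_sq_int[OF tests_deriv[OF f ab]]
  by (auto intro: sq_int_locally_integrable)

lemma has_weak_deriv_unique:
  assumes u: "has_weak_deriv {a<..<b} u g" and v: "has_weak_deriv {a<..<b} u k" and ab: "a < b"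
  shows "AE x in lebesgue. x \<in> {a<..<b} \<longrightarrow> g x = k x"
proof -
  note U = u[unfolded has_weak_deriv_iff[OF ab]] and V = v[unfolded has_weak_deriv_iff[OF ab]]
  have "AE x in lebesgue. x \<in> {a<..<b} \<longrightarrow> g x + (-1) * k x = 0"
  proof (rule fundamental_lemma[OF _ ab])
    show "locally_integrable {a<..<b} (\<lambda>x. g x + (-1) * k x)" using U V by (intro locally_integrable_lin) auto
    fix h assume h: "h \<in> tests a b"
    have "(LINT x|lebesgue. (g x + (-1) * k x) * h x) = (LINT x|lebesgue. g x * h x - k x * h x)"
      by (simp add: algebra_simps)
    also have "\<dots> = (LINT x|lebesgue. g x * h x) - (LINT x|lebesgue. k x * h x)"
      using U V locally_integrable_mult[OF _ h ab] by simp
    also have "\<dots> = 0" using U V h by simp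
    finally show "(LINT x|lebesgue. (g x + (-1) * k x) * h x) = 0" .
  qed
  then show ?thesis by eventually_elim auto
qed

text \<open>The derivative picked by choice is a weak derivative as soon as one exists, and
  uniqueness identifies it.\<close>

lemma weak_deriv_AE:
  assumes "has_weak_deriv {a<..<b} u g" "a < b"
  shows "AE x in lebesgue. x \<in> {a<..<b} \<longrightarrow> weak_deriv {a<..<b} u x = g x"
proof -
  have "has_weak_deriv {a<..<b} u (weak_deriv {a<..<b} u)"
    unfolding weak_deriv_def by (rule someI[of "has_weak_deriv {a<..<b} u", OF assms(1)])
  from has_weak_deriv_unique[OF this assms] show ?thesis .
qed

section \<open>Continuous representatives of zero-trace Sobolev functions\<close>

lemma squeeze_zero:
  fixes f h :: "nat \<Rightarrow> real"
  assumes "\<And>n. 0 \<le> f n" "\<And>n. f n \<le> h n" "h \<longlonglongrightarrow> 0"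
  shows "f \<longlonglongrightarrow> 0"
  by (rule tendsto_sandwich[OF _ _ tendsto_const assms(3)]) (use assms(1,2) in auto)

text \<open>\<open>u\<close> is the continuous representative of an element of \<open>H10 {c<..<d}\<close> and \<open>g\<close> its weak
  derivative, extended by zero; the approximation in \<open>H1_norm\<close> is replaced by uniform
  convergence of the functions and \<open>L2\<close>-convergence of the derivatives.\<close>

definition zero_sob :: "real \<Rightarrow> real \<Rightarrow> (real \<Rightarrow> real) \<Rightarrow> (real \<Rightarrow> real) \<Rightarrow> bool" where
  "zero_sob c d u g \<longleftrightarrow> c < d \<and> sq_int g \<and> (\<forall>x. x \<notin> {c<..<d} \<longrightarrow> g x = 0) \<and>
     (\<exists>\<phi>. (\<forall>n::nat. \<phi> n \<in> tests c d) \<and> uniform_limit UNIV \<phi> u sequentially \<and>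
          (\<lambda>n. nrm (\<lambda>x. deriv (\<phi> n) x - g x)) \<longlonglongrightarrow> 0)"

lemma zero_sobE:
  assumes "zero_sob c d u g"
  obtains \<phi> where "\<And>n::nat. \<phi> n \<in> tests c d" "uniform_limit UNIV \<phi> u sequentially"
    "(\<lambda>n. nrm (\<lambda>x. deriv (\<phi> n) x - g x)) \<longlonglongrightarrow> 0"
  using assms unfolding zero_sob_def by auto

lemma zero_sobD:
  assumes "zero_sob c d u g"
  shows "c < d" "sq_int g" "x \<notin> {c<..<d} \<Longrightarrow> g x = 0"
  using assms unfolding zero_sob_def by auto

lemma zero_sob_tests:
  assumes "f \<in> tests c d" "c < d"
  shows "zero_sob c d f (deriv f)"
  unfolding zero_sob_def
proof (intro conjI exI[of _ "\<lambda>n. f"])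
  show "(\<lambda>n. nrm (\<lambda>x. deriv f x - deriv f x)) \<longlonglongrightarrow> 0" by (simp add: nrm_def)
qed (use assms tests_sq_int[OF tests_deriv[OF assms]] tests_deriv_outside[OF assms] in
    \<open>auto simp: uniform_limit_const\<close>)

lemma zero_sob_mono:
  assumes "zero_sob c d u g" "a \<le> c" "d \<le> b"
  shows "zero_sob a b u g"
proof -
  obtain \<phi> where \<phi>: "\<And>n::nat. \<phi> n \<in> tests c d" "uniform_limit UNIV \<phi> u sequentially"
    "(\<lambda>n. nrm (\<lambda>x. deriv (\<phi> n) x - g x)) \<longlonglongrightarrow> 0"
    by (rule zero_sobE[OF assms(1)]) blast
  show ?thesis
    unfolding zero_sob_def
    by (intro conjI exI[of _ \<phi>] allI tests_mono[OF \<phi>(1)])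
      (use assms(2,3) zero_sobD[OF assms(1)] \<phi> in auto)
qed

lemma deriv_lin:
  assumes "f \<in> tests c d" "h \<in> tests c d"
  shows "deriv (\<lambda>x. f x + t * h x) x = deriv f x + t * deriv h x"
  by (rule DERIV_imp_deriv) (intro DERIV_add DERIV_cmult tests_DERIV[OF assms(1)] tests_DERIV[OF assms(2)])

lemma tests_lin:
  assumes "f \<in> tests c d" "h \<in> tests c d" "c < d"
  shows "(\<lambda>x. f x + t * h x) \<in> tests c d"
  by (rule tests_add[OF assms(1) tests_cmult[OF assms(2,3)] assms(3)])

lemma zero_sob_lin:
  assumes u: "zero_sob c d u g" and v: "zero_sob c d v k"
  shows "zero_sob c d (\<lambda>x. u x + t * v x) (\<lambda>x. g x + t * k x)"
proof -
  obtain \<phi> where \<phi>: "\<And>n::nat. \<phi> n \<in> tests c d" "uniform_limit UNIV \<phi> u sequentially"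
    "(\<lambda>n. nrm (\<lambda>x. deriv (\<phi> n) x - g x)) \<longlonglongrightarrow> 0"
    by (rule zero_sobE[OF u]) blast
  obtain \<psi> where \<psi>: "\<And>n::nat. \<psi> n \<in> tests c d" "uniform_limit UNIV \<psi> v sequentially"
    "(\<lambda>n. nrm (\<lambda>x. deriv (\<psi> n) x - k x)) \<longlonglongrightarrow> 0"
    by (rule zero_sobE[OF v]) blast
  note U = zero_sobD[OF u] and V = zero_sobD[OF v]
  have sq: "sq_int (\<lambda>x. deriv (\<phi> n) x - g x)" "sq_int (\<lambda>x. deriv (\<psi> n) x - k x)" for n
    by (rule sq_int_diff[OF tests_sq_int[OF tests_deriv[OF \<phi>(1) U(1)]] U(2)],
        rule sq_int_diff[OF tests_sq_int[OF tests_deriv[OF \<psi>(1) U(1)]] V(2)])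
  have le: "nrm (\<lambda>x. deriv (\<lambda>x. \<phi> n x + t * \<psi> n x) x - (g x + t * k x))
      \<le> nrm (\<lambda>x. deriv (\<phi> n) x - g x) + \<bar>t\<bar> * nrm (\<lambda>x. deriv (\<psi> n) x - k x)" for n
  proof -
    have "(\<lambda>x. deriv (\<lambda>x. \<phi> n x + t * \<psi> n x) x - (g x + t * k x))
        = (\<lambda>x. (deriv (\<phi> n) x - g x) + t * (deriv (\<psi> n) x - k x))"
      by (simp add: deriv_lin[OF \<phi>(1) \<psi>(1)] algebra_simps)
    then show ?thesis
      using nrm_triangle[OF sq(1)[of n] sq_int_cmult[OF sq(2)[of n], of t]] nrm_cmult[of t "\<lambda>x. deriv (\<psi> n) x - k x"]
      by simp
  qed
  have lim: "(\<lambda>n. nrm (\<lambda>x. deriv (\<phi> n) x - g x) + \<bar>t\<bar> * nrm (\<lambda>x. deriv (\<psi> n) x - k x)) \<longlonglongrightarrow> 0 + \<bar>t\<bar> * 0"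
    by (intro tendsto_add tendsto_mult tendsto_const \<phi> \<psi>)
  have "(\<lambda>n. nrm (\<lambda>x. deriv (\<lambda>x. \<phi> n x + t * \<psi> n x) x - (g x + t * k x))) \<longlonglongrightarrow> 0"
    by (rule squeeze_zero[OF nrm_nonneg le]) (use lim in simp)
  moreover have "uniform_limit UNIV (\<lambda>n x. \<phi> n x + t * \<psi> n x) (\<lambda>x. u x + t * v x) sequentially"
    by (intro uniform_limit_add \<phi>(2) bounded_linear.uniform_limit[OF bounded_linear_mult_right \<psi>(2)])
  moreover have "\<forall>n. (\<lambda>x. \<phi> n x + t * \<psi> n x) \<in> tests c d"
    using tests_lin[OF \<phi>(1) \<psi>(1) U(1)] by blast
  ultimately show ?thesis
    unfolding zero_sob_def using U V sq_int_add[OF U(2) sq_int_cmult[OF V(2)]]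
    by (intro conjI exI[of _ "\<lambda>n x. \<phi> n x + t * \<psi> n x"]) auto
qed

lemma zero_sob_continuous:
  assumes "zero_sob c d u g"
  shows "continuous_on S u"
proof -
  obtain \<phi> where \<phi>: "\<And>n::nat. \<phi> n \<in> tests c d" "uniform_limit UNIV \<phi> u sequentially"
    by (rule zero_sobE[OF assms]) blast
  have "continuous_on UNIV u"
    by (rule uniform_limit_theorem[OF always_eventually \<phi>(2)]) (use tests_continuous[OF \<phi>(1)] in auto)
  then show ?thesis using continuous_on_subset by blast
qed

lemma zero_sob_outside:
  assumes "zero_sob c d u g" "x \<notin> {c<..<d}"
  shows "u x = 0"
proof -
  obtain \<phi> where \<phi>: "\<And>n::nat. \<phi> n \<in> tests c d" "uniform_limit UNIV \<phi> u sequentially"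
    by (rule zero_sobE[OF assms(1)]) blast
  have "(\<lambda>n. \<phi> n x) \<longlonglongrightarrow> u x" by (rule tendsto_uniform_limitI[OF \<phi>(2)]) simp
  moreover have "\<phi> n x = 0" for n using tests_outside[OF \<phi>(1) assms(2)] .
  ultimately show ?thesis using LIMSEQ_unique[OF _ tendsto_const] by simp
qed

lemma zero_sob_sq_int: "zero_sob c d u g \<Longrightarrow> sq_int u"
  by (rule sq_int_continuous_support[of _ c d]) (auto intro: zero_sob_continuous zero_sob_outside)

lemma zero_sob_bound:
  assumes "zero_sob c d u g"
  shows "\<bar>u x\<bar> \<le> sqrt (d - c) * nrm g"
proof -
  obtain \<phi> where \<phi>: "\<And>n::nat. \<phi> n \<in> tests c d" "uniform_limit UNIV \<phi> u sequentially"
    "(\<lambda>n. nrm (\<lambda>x. deriv (\<phi> n) x - g x)) \<longlonglongrightarrow> 0"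
    by (rule zero_sobE[OF assms]) blast
  note U = zero_sobD[OF assms]
  have le: "\<bar>\<phi> n x\<bar> \<le> sqrt (d - c) * (nrm (\<lambda>x. deriv (\<phi> n) x - g x) + nrm g)" for n
  proof -
    have s: "sq_int (deriv (\<phi> n))" by (rule tests_sq_int[OF tests_deriv[OF \<phi>(1) U(1)]])
    have "nrm (deriv (\<phi> n)) \<le> nrm (\<lambda>x. deriv (\<phi> n) x - g x) + nrm g"
      using nrm_reverse_triangle[OF s U(2)] by linarith
    then have "sqrt (d - c) * nrm (deriv (\<phi> n)) \<le> sqrt (d - c) * (nrm (\<lambda>x. deriv (\<phi> n) x - g x) + nrm g)"
      using U(1) by (intro mult_left_mono) auto
    then show ?thesis using tests_sup_bound[OF \<phi>(1) U(1), of n x] by linarith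
  qed
  have 1: "(\<lambda>n. \<bar>\<phi> n x\<bar>) \<longlonglongrightarrow> \<bar>u x\<bar>"
    by (intro tendsto_rabs tendsto_uniform_limitI[OF \<phi>(2)]) simp
  have 2: "(\<lambda>n. sqrt (d - c) * (nrm (\<lambda>x. deriv (\<phi> n) x - g x) + nrm g)) \<longlonglongrightarrow> sqrt (d - c) * (0 + nrm g)"
    by (intro tendsto_mult tendsto_add tendsto_const \<phi>)
  show ?thesis using LIMSEQ_le[OF 1 2] le by auto
qed

lemma nrm_le_of_bounded_support:
  assumes "f \<in> borel_measurable lebesgue" "c \<le> d" "\<And>x. \<bar>f x\<bar> \<le> K" "\<And>x. x \<notin> {c..d} \<Longrightarrow> f x = 0"
  shows "nrm f \<le> K * sqrt (d - c)"
proof -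
  have K: "K \<ge> 0" using assms(3)[of 0] by linarith
  have "nrm f \<le> nrm (\<lambda>x. K * indicator {c..d} x)"
  proof (rule nrm_mono(2))
    show "sq_int (\<lambda>x. K * indicator {c..d} x)" by (intro sq_int_cmult nrm_indicator_Icc(1) assms)
    show "\<bar>f x\<bar> \<le> \<bar>K * indicator {c..d} x\<bar>" for x
      using assms(3,4)[of x] K by (auto simp: indicator_def)
  qed (rule assms)
  then show ?thesis using nrm_indicator_Icc(2)[OF assms(2)] K by (simp add: nrm_cmult)
qed

text \<open>Poincare inequality with a non-optimal constant, from the uniform bound on an interval
  of length \<open>d - c\<close>; only the power of the length matters later.\<close>

lemma zero_sob_nrm:
  assumes "zero_sob c d u g"
  shows "nrm u \<le> (d - c) * nrm g"
proof -
  have cd: "c < d" using zero_sobD[OF assms] by simp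
  have "nrm u \<le> (sqrt (d - c) * nrm g) * sqrt (d - c)"
    by (rule nrm_le_of_bounded_support)
      (use cd zero_sob_bound[OF assms] zero_sob_outside[OF assms] zero_sob_sq_int[OF assms] in \<open>auto simp: sq_int_def\<close>)
  also have "\<dots> = (sqrt (d - c) * sqrt (d - c)) * nrm g" by (simp only: ac_simps)
  also have "\<dots> = (d - c) * nrm g" using cd by simp
  finally show ?thesis .
qed

lemma tendsto_LINT_mult:
  assumes "\<And>n::nat. sq_int (f n)" "sq_int u" "(\<lambda>n. nrm (\<lambda>x. f n x - u x)) \<longlonglongrightarrow> 0" "sq_int h"
  shows "(\<lambda>n. LINT x|lebesgue. f n x * h x) \<longlonglongrightarrow> (LINT x|lebesgue. u x * h x)"
proof (rule Lim_transform2[OF tendsto_const])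
  have "\<bar>(LINT x|lebesgue. u x * h x) - (LINT x|lebesgue. f n x * h x)\<bar> \<le> nrm (\<lambda>x. f n x - u x) * nrm h" for n
  proof -
    have "(LINT x|lebesgue. u x * h x) - (LINT x|lebesgue. f n x * h x) = (LINT x|lebesgue. (u x - f n x) * h x)"
      using sq_int_mult[OF assms(2,4)] sq_int_mult[OF assms(1)[of n] assms(4)] by (simp add: left_diff_distrib)
    then show ?thesis
      using Cauchy_Schwarz[OF sq_int_diff[OF assms(2) assms(1)[of n]] assms(4)] nrm_diff_commute[of u "f n"] by simp
  qed
  then have 1: "\<forall>n. norm ((LINT x|lebesgue. u x * h x) - (LINT x|lebesgue. f n x * h x)) \<le> nrm (\<lambda>x. f n x - u x) * nrm h"
    by simp
  have "(\<lambda>n. nrm (\<lambda>x. f n x - u x) * nrm h) \<longlonglongrightarrow> 0 * nrm h"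
    by (rule tendsto_mult[OF assms(3) tendsto_const])
  then have 2: "(\<lambda>n. nrm (\<lambda>x. f n x - u x) * nrm h) \<longlonglongrightarrow> 0" by simp
  show "(\<lambda>n. (LINT x|lebesgue. u x * h x) - (LINT x|lebesgue. f n x * h x)) \<longlonglongrightarrow> 0"
    by (rule Lim_null_comparison[OF always_eventually[OF 1] 2])
qed

lemma tendsto_nrm:
  assumes "\<And>n::nat. sq_int (f n)" "sq_int u" "(\<lambda>n. nrm (\<lambda>x. f n x - u x)) \<longlonglongrightarrow> 0"
  shows "(\<lambda>n. nrm (f n)) \<longlonglongrightarrow> nrm u"
proof -
  have "(\<lambda>n. nrm (f n) - nrm u) \<longlonglongrightarrow> 0"
  proof (rule Lim_null_comparison[OF _ assms(3)])
    show "eventually (\<lambda>n. norm (nrm (f n) - nrm u) \<le> nrm (\<lambda>x. f n x - u x)) sequentially"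
      using nrm_reverse_triangle[OF assms(1,2)] by simp
  qed
  then show ?thesis by (rule LIM_zero_cancel)
qed

text \<open>Poincare inequality for the difference of \<open>\<phi> n\<close> and \<open>u\<close>,
  whose derivative tends to zero.\<close>

lemma zero_sob_approx_nrm:
  assumes u: "zero_sob c d u g" and "\<And>n::nat. \<phi> n \<in> tests c d"
    and "(\<lambda>n. nrm (\<lambda>x. deriv (\<phi> n) x - g x)) \<longlonglongrightarrow> 0" "uniform_limit UNIV \<phi> u sequentially"
  shows "(\<lambda>n. nrm (\<lambda>x. \<phi> n x - u x)) \<longlonglongrightarrow> 0"
proof -
  note U = zero_sobD[OF u]
  have "zero_sob c d (\<lambda>x. \<phi> n x + (-1) * u x) (\<lambda>x. deriv (\<phi> n) x + (-1) * g x)" for n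
    by (rule zero_sob_lin[OF zero_sob_tests[OF assms(2) U(1)] u])
  from zero_sob_nrm[OF this]
  have le: "nrm (\<lambda>x. \<phi> n x - u x) \<le> (d - c) * nrm (\<lambda>x. deriv (\<phi> n) x - g x)" for n by simp
  have "(\<lambda>n. (d - c) * nrm (\<lambda>x. deriv (\<phi> n) x - g x)) \<longlonglongrightarrow> (d - c) * 0"
    by (rule tendsto_mult[OF tendsto_const assms(3)])
  then have "(\<lambda>n. (d - c) * nrm (\<lambda>x. deriv (\<phi> n) x - g x)) \<longlonglongrightarrow> 0" by simp
  then show ?thesis using le by (rule squeeze_zero[OF nrm_nonneg, rotated])
qed

text \<open>The boundary term needs the value of \<open>u\<close> at one point; uniform convergence
  of the approximating test functions carries it to the limit, and the integrals follow by
  convergence in the square norm.\<close>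

lemma zero_sob_by_parts_half:
  assumes u: "zero_sob a b u g" and h: "h \<in> tests a b" and t: "a \<le> t"
  shows "(LINT x|lebesgue. indicator {a..t} x * (g x * h x))
    = u t * h t - (LINT x|lebesgue. indicator {a..t} x * (u x * deriv h x))"
proof -
  obtain \<phi> where \<phi>: "\<And>n::nat. \<phi> n \<in> tests a b" "uniform_limit UNIV \<phi> u sequentially"
    "(\<lambda>n. nrm (\<lambda>x. deriv (\<phi> n) x - g x)) \<longlonglongrightarrow> 0"
    by (rule zero_sobE[OF u]) blast
  note U = zero_sobD[OF u]
  have lim2: "(\<lambda>n. nrm (\<lambda>x. \<phi> n x - u x)) \<longlonglongrightarrow> 0"
    by (rule zero_sob_approx_nrm[OF u \<phi>(1) \<phi>(3) \<phi>(2)])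
  have sh: "sq_int (\<lambda>x. indicator {a..t} x * h x)" "sq_int (\<lambda>x. indicator {a..t} x * deriv h x)"
    using tests_sq_int[OF h] tests_sq_int[OF tests_deriv[OF h U(1)]] by (auto intro: sq_int_indicator)
  have 1: "(\<lambda>n. LINT x|lebesgue. deriv (\<phi> n) x * (indicator {a..t} x * h x))
      \<longlonglongrightarrow> (LINT x|lebesgue. g x * (indicator {a..t} x * h x))"
    by (rule tendsto_LINT_mult[OF tests_sq_int[OF tests_deriv[OF \<phi>(1) U(1)]] U(2) \<phi>(3) sh(1)])
  have 2: "(\<lambda>n. LINT x|lebesgue. \<phi> n x * (indicator {a..t} x * deriv h x))
      \<longlonglongrightarrow> (LINT x|lebesgue. u x * (indicator {a..t} x * deriv h x))"
    by (rule tendsto_LINT_mult[OF tests_sq_int[OF \<phi>(1)] zero_sob_sq_int[OF u] lim2 sh(2)])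
  have "(\<lambda>n. \<phi> n t * h t - (LINT x|lebesgue. \<phi> n x * (indicator {a..t} x * deriv h x)))
      \<longlonglongrightarrow> u t * h t - (LINT x|lebesgue. u x * (indicator {a..t} x * deriv h x))"
    by (intro tendsto_diff tendsto_mult tendsto_const 2 tendsto_uniform_limitI[OF \<phi>(2)]) simp
  moreover have "\<phi> n t * h t - (LINT x|lebesgue. \<phi> n x * (indicator {a..t} x * deriv h x))
      = (LINT x|lebesgue. deriv (\<phi> n) x * (indicator {a..t} x * h x))" for n
    using tests_by_parts_half[OF \<phi>(1) tests_smooth[OF h] U(1) t] by (simp add: ac_simps)
  ultimately show ?thesis using LIMSEQ_unique[OF 1] by (simp add: ac_simps)
qed

lemma zero_sob_has_weak_deriv:
  assumes u: "zero_sob a b u g"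
  shows "has_weak_deriv {a<..<b} u g"
proof -
  note U = zero_sobD[OF u]
  have "(LINT x|lebesgue. u x * deriv h x) = - (LINT x|lebesgue. g x * h x)" if h: "h \<in> tests a b" for h
  proof -
    have "indicator {a..b} x * (g x * h x) = g x * h x" "indicator {a..b} x * (u x * deriv h x) = u x * deriv h x" for x
      by (cases "x \<in> {a<..<b}"; use tests_outside[OF h, of x] tests_deriv_outside[OF h U(1), of x] in simp)+
    then have "(\<lambda>x. indicator {a..b} x * (g x * h x)) = (\<lambda>x. g x * h x)"
      "(\<lambda>x. indicator {a..b} x * (u x * deriv h x)) = (\<lambda>x. u x * deriv h x)" by blast+
    then show ?thesis
      using zero_sob_by_parts_half[OF u h, of b] U(1) tests_outside[OF h, of b] by (simp only:) simp
  qed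
  then show ?thesis
    unfolding has_weak_deriv_iff[OF U(1)]
    using sq_int_locally_integrable[OF U(2)] sq_int_locally_integrable[OF zero_sob_sq_int[OF u]] by blast
qed

lemma LINT_cong_AE:
  fixes f g :: "real \<Rightarrow> real"
  assumes "f \<in> borel_measurable lebesgue" "AE x in lebesgue. f x = g x"
  shows "(LINT x|lebesgue. g x) = (LINT x|lebesgue. f x)"
  using integral_cong_AE[OF assms(1) lebesgue_measurable_cong_AE[OF assms] assms(2)] by simp

text \<open>Convergence of the derivatives in the square norm makes the approximating test functions
  uniformly Cauchy by the sup bound. Their uniform limit \<open>v\<close> and the function
  \<open>u\<close> are limits of the same sequence in the square norm, so they agree almost
  everywhere.\<close>

lemma H10_representative:
  assumes u: "u \<in> H10 {c<..<d}" and cd: "c < d"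
  obtains v g where "zero_sob c d v g" "AE x in lebesgue. u x = v x" "sq_int u" "\<And>x. x \<notin> {c<..<d} \<Longrightarrow> u x = 0"
proof -
  obtain g0 \<phi> where u0: "u \<in> L2 {c<..<d}" "\<And>x. x \<notin> {c<..<d} \<Longrightarrow> u x = 0"
    and g0: "g0 \<in> L2 {c<..<d}" "has_weak_deriv {c<..<d} u g0"
    and \<phi>: "\<And>n. \<phi> n \<in> tests c d" "(\<lambda>n::nat. H1_norm {c<..<d} (\<lambda>x. \<phi> n x - u x)) \<longlonglongrightarrow> 0"
    using u unfolding H10_def H1_def by blast
  have "(\<lambda>x. indicator {c<..<d} x * u x) = u"
    using u0(2) by (auto simp: indicator_def fun_eq_iff)
  then have su: "sq_int u" using u0(1) by (simp add: L2_iff)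
  \<comment> \<open>\<open>g0\<close> is determined only inside the interval; setting it to zero
    outside changes no integral against test functions.\<close>
  define g where "g x = indicator {c<..<d} x * g0 x" for x
  have sg: "sq_int g" using g0(1) by (simp add: L2_iff g_def[abs_def])
  have gout: "g x = 0" if "x \<notin> {c<..<d}" for x using that by (simp add: g_def)
  have wg: "has_weak_deriv {c<..<d} u g"
  proof -
    have "g x * h x = g0 x * h x" if "h \<in> tests c d" for h x
      using tests_outside[OF that, of x] by (cases "x \<in> {c<..<d}") (auto simp: g_def)
    then have "(LINT x|lebesgue. g x * h x) = (LINT x|lebesgue. g0 x * h x)" if "h \<in> tests c d" for h
      using that by (intro Bochner_Integration.integral_cong) auto
    then show ?thesis
      using g0(2) sq_int_locally_integrable[OF sg] unfolding has_weak_deriv_iff[OF cd] by simp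
  qed
  \<comment> \<open>\<open>H1_norm\<close> is built on an arbitrarily chosen weak derivative; here
    it is expressed through the concrete differences.\<close>
  have norm_eq: "H1_norm {c<..<d} (\<lambda>x. \<phi> n x - u x)
      = sqrt ((nrm (\<lambda>x. \<phi> n x - u x))\<^sup>2 + (nrm (\<lambda>x. deriv (\<phi> n) x - g x))\<^sup>2)" for n
  proof -
    have "has_weak_deriv {c<..<d} (\<lambda>x. \<phi> n x + (-1) * u x) (\<lambda>x. deriv (\<phi> n) x + (-1) * g x)"
      by (rule has_weak_deriv_lin[OF has_weak_deriv_tests[OF \<phi>(1) cd] wg cd])
    then have w: "AE x in lebesgue. x \<in> {c<..<d} \<longrightarrow> weak_deriv {c<..<d} (\<lambda>x. \<phi> n x - u x) x = deriv (\<phi> n) x - g x"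
      using weak_deriv_AE[OF _ cd] by simp
    have s: "sq_int (\<lambda>x. deriv (\<phi> n) x - g x)"
      by (intro sq_int_diff tests_sq_int[OF tests_deriv[OF \<phi>(1) cd]] sg)
    have "(LINT x|lebesgue_on {c<..<d}. (weak_deriv {c<..<d} (\<lambda>x. \<phi> n x - u x) x)\<^sup>2)
      = (LINT x|lebesgue. indicator {c<..<d} x * (weak_deriv {c<..<d} (\<lambda>x. \<phi> n x - u x) x)\<^sup>2)"
      by (simp add: LINT_on)
    also have "\<dots> = (LINT x|lebesgue. (deriv (\<phi> n) x - g x)\<^sup>2)"
    proof (rule LINT_cong_AE)
      show "(\<lambda>x. (deriv (\<phi> n) x - g x)\<^sup>2) \<in> borel_measurable lebesgue"
        using s by (auto simp: sq_int_def intro: borel_measurable_integrable)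
      show "AE x in lebesgue. (deriv (\<phi> n) x - g x)\<^sup>2 =
          indicator {c<..<d} x * (weak_deriv {c<..<d} (\<lambda>x. \<phi> n x - u x) x)\<^sup>2"
        using w
      proof eventually_elim
        case (elim x)
        then show ?case using tests_deriv_outside[OF \<phi>(1) cd, of x n] gout[of x]
          by (cases "x \<in> {c<..<d}") auto
      qed
    qed
    finally have 1: "(LINT x|lebesgue_on {c<..<d}. (weak_deriv {c<..<d} (\<lambda>x. \<phi> n x - u x) x)\<^sup>2)
      = (nrm (\<lambda>x. deriv (\<phi> n) x - g x))\<^sup>2" by (simp add: nrm_sq)
    have "indicator {c<..<d} x * (\<phi> n x - u x)\<^sup>2 = (\<phi> n x - u x)\<^sup>2" for x
      using tests_outside[OF \<phi>(1), of x n] u0(2)[of x] by (cases "x \<in> {c<..<d}") auto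
    then have "(\<lambda>x. indicator {c<..<d} x * (\<phi> n x - u x)\<^sup>2) = (\<lambda>x. (\<phi> n x - u x)\<^sup>2)" by blast
    then have "(LINT x|lebesgue_on {c<..<d}. (\<phi> n x - u x)\<^sup>2) = (nrm (\<lambda>x. \<phi> n x - u x))\<^sup>2"
      by (simp only: LINT_on nrm_sq interval_sets_lebesgue)
    with 1 show ?thesis by (simp add: H1_norm_def)
  qed
  have lim1: "(\<lambda>n. nrm (\<lambda>x. \<phi> n x - u x)) \<longlonglongrightarrow> 0"
  proof (rule tendsto_sandwich[OF _ _ tendsto_const \<phi>(2)])
    show "eventually (\<lambda>n. nrm (\<lambda>x. \<phi> n x - u x) \<le> H1_norm {c<..<d} (\<lambda>x. \<phi> n x - u x)) sequentially"
      unfolding norm_eq by (intro always_eventually allI real_le_rsqrt) simp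
  qed simp
  have lim2: "(\<lambda>n. nrm (\<lambda>x. deriv (\<phi> n) x - g x)) \<longlonglongrightarrow> 0"
  proof (rule tendsto_sandwich[OF _ _ tendsto_const \<phi>(2)])
    show "eventually (\<lambda>n. nrm (\<lambda>x. deriv (\<phi> n) x - g x) \<le> H1_norm {c<..<d} (\<lambda>x. \<phi> n x - u x)) sequentially"
      unfolding norm_eq by (intro always_eventually allI real_le_rsqrt) simp
  qed simp
  have "uniformly_Cauchy_on UNIV \<phi>"
    unfolding uniformly_Cauchy_on_def
  proof (intro allI impI)
    fix e :: real assume e: "e > 0"
    \<comment> \<open>Two errors \<open>e'\<close>, each multiplied by \<open>sqrt (d - c)\<close>,
      have to add up to \<open>e\<close>.\<close>
    define e' where "e' = e / (2 * sqrt (d - c))"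
    have e': "e' > 0" using e cd by (simp add: e'_def)
    obtain N where N: "\<And>n. n \<ge> N \<Longrightarrow> nrm (\<lambda>x. deriv (\<phi> n) x - g x) < e'"
      using order_tendstoD(2)[OF lim2 e'] unfolding eventually_sequentially by blast
    show "\<exists>M. \<forall>x\<in>UNIV. \<forall>m\<ge>M. \<forall>n\<ge>M. dist (\<phi> m x) (\<phi> n x) < e"
    proof (intro exI[of _ N] ballI allI impI)
      fix x m n assume mn: "N \<le> m" "N \<le> n"
      have s: "sq_int (\<lambda>x. deriv (\<phi> n) x - g x)" for n
        by (intro sq_int_diff tests_sq_int[OF tests_deriv[OF \<phi>(1) cd]] sg)
      have "\<bar>\<phi> m x + (-1) * \<phi> n x\<bar> \<le> sqrt (d - c) * nrm (deriv (\<lambda>x. \<phi> m x + (-1) * \<phi> n x))"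
        by (rule tests_sup_bound[OF tests_lin[OF \<phi>(1) \<phi>(1) cd] cd])
      also have "deriv (\<lambda>x. \<phi> m x + (-1) * \<phi> n x) = (\<lambda>x. (deriv (\<phi> m) x - g x) - (deriv (\<phi> n) x - g x))"
        by (rule ext) (subst deriv_lin[OF \<phi>(1) \<phi>(1)], simp)
      also have "nrm \<dots> \<le> nrm (\<lambda>x. deriv (\<phi> m) x - g x) + nrm (\<lambda>x. deriv (\<phi> n) x - g x)"
        by (rule nrm_triangle_diff[OF s s])
      also have "\<dots> < e' + e'" using N mn by (intro add_strict_mono) auto
      finally have "\<bar>\<phi> m x + (-1) * \<phi> n x\<bar> < sqrt (d - c) * (e' + e')" using cd by simp
      also have "\<dots> = e" using cd by (simp add: e'_def)
      finally show "dist (\<phi> m x) (\<phi> n x) < e" by (simp add: dist_real_def)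
    qed
  qed
  then obtain v where v: "uniform_limit UNIV \<phi> v sequentially"
    using Cauchy_uniformly_convergent unfolding uniformly_convergent_on_def by blast
  have z: "zero_sob c d v g"
    unfolding zero_sob_def using cd sg gout \<phi>(1) v lim2 by blast
  have lim3: "(\<lambda>n. nrm (\<lambda>x. \<phi> n x - v x)) \<longlonglongrightarrow> 0"
    by (rule zero_sob_approx_nrm[OF z \<phi>(1) lim2 v])
  note sv = zero_sob_sq_int[OF z]
  have "nrm (\<lambda>x. u x - v x) \<le> nrm (\<lambda>x. \<phi> n x - u x) + nrm (\<lambda>x. \<phi> n x - v x)" for n
  proof -
    have "nrm (\<lambda>x. u x - v x) = nrm (\<lambda>x. (\<phi> n x - v x) - (\<phi> n x - u x))" by simp
    then show ?thesis
      using nrm_triangle_diff[OF sq_int_diff[OF tests_sq_int[OF \<phi>(1)[of n]] sv] sq_int_diff[OF tests_sq_int[OF \<phi>(1)[of n]] su]]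
      by simp
  qed
  then have "nrm (\<lambda>x. u x - v x) \<le> 0"
    using LIMSEQ_le_const[OF tendsto_add[OF lim1 lim3], of "nrm (\<lambda>x. u x - v x)"] by auto
  then have "nrm (\<lambda>x. u x - v x) = 0" using nrm_nonneg[of "\<lambda>x. u x - v x"] by linarith
  from nrm_zero_AE[OF sq_int_diff[OF su sv] this]
  have "AE x in lebesgue. u x = v x" by eventually_elim simp
  then show ?thesis using that[OF z _ su u0(2)] by blast
qed

lemma tests_in_H10:
  assumes "f \<in> tests c d" "c < d"
  shows "f \<in> H10 {c<..<d}"
proof -
  have e: "(\<lambda>x. indicator {c<..<d} x * f x) = f" "(\<lambda>x. indicator {c<..<d} x * deriv f x) = deriv f"
    using tests_outside[OF assms(1)] tests_deriv_outside[OF assms] by (auto simp: indicator_def fun_eq_iff)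
  have "f \<in> H1 {c<..<d}"
    unfolding H1_def using has_weak_deriv_tests[OF assms] e tests_sq_int[OF assms(1)] tests_sq_int[OF tests_deriv[OF assms]]
    by (auto simp: L2_iff)
  \<comment> \<open>Even for the zero function the chosen weak derivative is known only almost
    everywhere.\<close>
  moreover have "H1_norm {c<..<d} (\<lambda>x. f x - f x) = 0"
  proof -
    have "has_weak_deriv {c<..<d} (\<lambda>x. 0) (deriv (\<lambda>x. 0))"
      by (rule has_weak_deriv_tests[OF tests_zero assms(2)])
    then have w: "AE x in lebesgue. x \<in> {c<..<d} \<longrightarrow> weak_deriv {c<..<d} (\<lambda>x. 0) x = 0"
      using weak_deriv_AE[OF _ assms(2)] by simp
    have "(LINT x|lebesgue. indicator {c<..<d} x * (weak_deriv {c<..<d} (\<lambda>x. 0) x)\<^sup>2) = (LINT x|(lebesgue :: real measure). 0)"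
      by (rule LINT_cong_AE) (use w in \<open>auto elim!: eventually_mono simp: indicator_def\<close>)
    then show ?thesis by (simp add: H1_norm_def LINT_on)
  qed
  ultimately show ?thesis unfolding H10_def using assms(1) tests_outside[OF assms(1)]
    by (auto intro!: exI[of _ "\<lambda>n. f"])
qed

text \<open>Shifting the approximating sequence by \<open>f\<close> leaves the
  \<open>H1_norm\<close> distances unchanged. Competitors in the min-max problem are the local
  minimizer plus a test function, so this is the closure property they require.\<close>

lemma H10_add_tests:
  assumes u: "u \<in> H10 {c<..<d}" and f: "f \<in> tests c d" and cd: "c < d"
  shows "(\<lambda>x. u x + f x) \<in> H10 {c<..<d}"
proof -
  obtain g0 \<phi> where u0: "u \<in> L2 {c<..<d}" "\<And>x. x \<notin> {c<..<d} \<Longrightarrow> u x = 0"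
    and g0: "g0 \<in> L2 {c<..<d}" "has_weak_deriv {c<..<d} u g0"
    and \<phi>: "\<And>n. \<phi> n \<in> tests c d" "(\<lambda>n::nat. H1_norm {c<..<d} (\<lambda>x. \<phi> n x - u x)) \<longlonglongrightarrow> 0"
    using u unfolding H10_def H1_def by blast
  have L2a: "(\<lambda>x. h x + k x) \<in> L2 {c<..<d}" if "h \<in> L2 {c<..<d}" "sq_int k" for h k
    using sq_int_add[of "\<lambda>x. indicator {c<..<d} x * h x" "\<lambda>x. indicator {c<..<d} x * k x"]
      sq_int_indicator[OF that(2)] that(1) by (simp add: L2_iff distrib_left)
  have "has_weak_deriv {c<..<d} (\<lambda>x. u x + 1 * f x) (\<lambda>x. g0 x + 1 * deriv f x)"
    by (rule has_weak_deriv_lin[OF g0(2) has_weak_deriv_tests[OF f cd] cd])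
  moreover have "(\<lambda>x. u x + f x) \<in> L2 {c<..<d}" "(\<lambda>x. g0 x + deriv f x) \<in> L2 {c<..<d}"
    using u0(1) g0(1) f tests_deriv[OF f cd] by (auto intro!: L2a tests_sq_int)
  ultimately have "(\<lambda>x. u x + f x) \<in> H1 {c<..<d}" unfolding H1_def by auto
  moreover have "(\<lambda>n. H1_norm {c<..<d} (\<lambda>x. (\<phi> n x + f x) - (u x + f x))) \<longlonglongrightarrow> 0"
    using \<phi>(2) by simp
  ultimately show ?thesis
    unfolding H10_def using u0(2) tests_outside[OF f] tests_add[OF \<phi>(1) f cd]
    by (auto intro!: exI[of _ "\<lambda>n x. \<phi> n x + f x"])
qed

section \<open>The energy in terms of continuous representatives\<close>

text \<open>A primitive of the nonlinearity
  \<open>cp * max x 0 powr p - cm * max (- x) 0 powr p\<close> of the Euler-Lagrange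
  equation.\<close>

definition nl :: "real \<Rightarrow> real \<Rightarrow> real \<Rightarrow> real \<Rightarrow> real" where
  "nl cp cm p x = cp / (p + 1) * max x 0 powr (p + 1) + cm / (p + 1) * max (- x) 0 powr (p + 1)"

text \<open>The derivative \<open>g\<close> is a separate argument and \<open>W\<close> stands for
  the datum extended by zero, so that the energy becomes an expression in integrals over the line in
  which no choice of a weak derivative intervenes.\<close>

definition En :: "real \<Rightarrow> real \<Rightarrow> real \<Rightarrow> (real \<Rightarrow> real) \<Rightarrow> (real \<Rightarrow> real) \<Rightarrow> (real \<Rightarrow> real) \<Rightarrow> real" where
  "En cp cm p W v g = 1 / 2 * (nrm g)\<^sup>2 - (LINT x|lebesgue. nl cp cm p (v x)) - (LINT x|lebesgue. W x * v x)"

lemma continuous_on_powr_pos: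
  fixes f :: "real \<Rightarrow> real"
  assumes "continuous_on S f" "p > 0" "\<And>x. f x \<ge> 0"
  shows "continuous_on S (\<lambda>x. f x powr p)"
  using assms by (intro continuous_on_powr') (auto intro: continuous_on_const)

text \<open>Stated for continuous functions with a weak derivative and not for
  \<open>zero_sob\<close>, so that it also covers combinations of the parts of a sign-changing
  function, for which only these properties are established.\<close>

lemma energy_eq:
  assumes ab: "a < b" and p: "p > 1" and w: "w \<in> L2 {a<..<b}"
    and vg: "has_weak_deriv {a<..<b} v g" and sg: "sq_int g" "\<And>x. x \<notin> {a<..<b} \<Longrightarrow> g x = 0"
    and v: "continuous_on UNIV v" "\<And>x. x \<notin> {a<..<b} \<Longrightarrow> v x = 0"
    and uv: "AE x in lebesgue. u x = v x"
  shows "energy cp cm p {a<..<b} w u = En cp cm p (\<lambda>x. indicator {a<..<b} x * w x) v g"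
proof -
  have sv: "sq_int v" by (rule sq_int_continuous_support[of _ a b]) (use v in auto)
  have vm: "v \<in> borel_measurable lebesgue" using sv by (simp add: sq_int_def)
  have um: "u \<in> borel_measurable lebesgue"
    by (rule lebesgue_measurable_cong_AE[OF vm]) (use uv in \<open>eventually_elim, simp\<close>)
  have "has_weak_deriv {a<..<b} u g"
    unfolding has_weak_deriv_iff[OF ab]
  proof (intro conjI ballI)
    show "locally_integrable {a<..<b} u"
      by (rule sq_int_locally_integrable[OF sq_int_cong_AE[OF sv um]]) (use uv in \<open>eventually_elim, simp\<close>)
    show "locally_integrable {a<..<b} g" by (rule sq_int_locally_integrable[OF sg(1)])
    fix h assume h: "h \<in> tests a b"
    have "(LINT x|lebesgue. u x * deriv h x) = (LINT x|lebesgue. v x * deriv h x)"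
    proof (rule LINT_cong_AE)
      show "(\<lambda>x. v x * deriv h x) \<in> borel_measurable lebesgue"
        by (rule borel_measurable_integrable[OF sq_int_mult[OF sv tests_sq_int[OF tests_deriv[OF h ab]]]])
    qed (use uv in \<open>eventually_elim, simp\<close>)
    then show "(LINT x|lebesgue. u x * deriv h x) = - (LINT x|lebesgue. g x * h x)"
      using vg h unfolding has_weak_deriv_iff[OF ab] by simp
  qed
  from weak_deriv_AE[OF this ab]
  have wd: "AE x in lebesgue. x \<in> {a<..<b} \<longrightarrow> weak_deriv {a<..<b} u x = g x" .
  have 1: "(LINT x|lebesgue_on {a<..<b}. \<bar>weak_deriv {a<..<b} u x\<bar>\<^sup>2) = (nrm g)\<^sup>2"
  proof -
    have "(LINT x|lebesgue. indicator {a<..<b} x * \<bar>weak_deriv {a<..<b} u x\<bar>\<^sup>2) = (LINT x|lebesgue. (g x)\<^sup>2)"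
    proof (rule LINT_cong_AE)
      show "(\<lambda>x. (g x)\<^sup>2) \<in> borel_measurable lebesgue"
        using sg by (auto simp: sq_int_def intro: borel_measurable_integrable)
      show "AE x in lebesgue. (g x)\<^sup>2 = indicator {a<..<b} x * \<bar>weak_deriv {a<..<b} u x\<bar>\<^sup>2"
        using wd
      proof eventually_elim
        case (elim x)
        then show ?case using sg(2)[of x] by (cases "x \<in> {a<..<b}") auto
      qed
    qed
    then show ?thesis by (simp add: LINT_on nrm_sq)
  qed
  have nlv: "integrable lebesgue (\<lambda>x. max (v x) 0 powr (p + 1))" "integrable lebesgue (\<lambda>x. max (- v x) 0 powr (p + 1))"
  proof -
    show "integrable lebesgue (\<lambda>x. max (v x) 0 powr (p + 1))"
      by (rule integrable_continuous_support[of _ a b], rule continuous_on_powr_pos)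
        (use v p in \<open>auto intro!: continuous_on_max continuous_on_const\<close>)
    show "integrable lebesgue (\<lambda>x. max (- v x) 0 powr (p + 1))"
      by (rule integrable_continuous_support[of _ a b], rule continuous_on_powr_pos)
        (use v p in \<open>auto intro!: continuous_on_max continuous_on_const continuous_on_minus\<close>)
  qed
  have 2: "(LINT x|lebesgue_on {a<..<b}. pos_part u x powr (p + 1)) = (LINT x|lebesgue. max (v x) 0 powr (p + 1))"
    "(LINT x|lebesgue_on {a<..<b}. neg_part u x powr (p + 1)) = (LINT x|lebesgue. max (- v x) 0 powr (p + 1))"
  proof -
    have "AE x in lebesgue. max (v x) 0 powr (p + 1) = indicator {a<..<b} x * pos_part u x powr (p + 1)"
      "AE x in lebesgue. max (- v x) 0 powr (p + 1) = indicator {a<..<b} x * neg_part u x powr (p + 1)"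
      using uv
    proof (eventually_elim)
      case (elim x)
      then show "max (v x) 0 powr (p + 1) = indicator {a<..<b} x * pos_part u x powr (p + 1)"
        using v(2)[of x] by (cases "x \<in> {a<..<b}") (auto simp: pos_part_def)
    next
      show "AE x in lebesgue. max (- v x) 0 powr (p + 1) = indicator {a<..<b} x * neg_part u x powr (p + 1)"
        using uv
      proof (eventually_elim)
        case (elim x)
        then show "max (- v x) 0 powr (p + 1) = indicator {a<..<b} x * neg_part u x powr (p + 1)"
          using v(2)[of x] by (cases "x \<in> {a<..<b}") (auto simp: neg_part_def)
      qed
    qed
    then show "(LINT x|lebesgue_on {a<..<b}. pos_part u x powr (p + 1)) = (LINT x|lebesgue. max (v x) 0 powr (p + 1))"
      "(LINT x|lebesgue_on {a<..<b}. neg_part u x powr (p + 1)) = (LINT x|lebesgue. max (- v x) 0 powr (p + 1))"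
      using nlv by (auto simp: LINT_on intro!: LINT_cong_AE)
  qed
  have 3: "(LINT x|lebesgue_on {a<..<b}. w x * u x) = (LINT x|lebesgue. (indicator {a<..<b} x * w x) * v x)"
  proof -
    have "(LINT x|lebesgue. indicator {a<..<b} x * (w x * u x)) = (LINT x|lebesgue. (indicator {a<..<b} x * w x) * v x)"
    proof (rule LINT_cong_AE)
      show "(\<lambda>x. indicator {a<..<b} x * w x * v x) \<in> borel_measurable lebesgue"
        using w sv by (intro borel_measurable_integrable sq_int_mult) (simp_all add: L2_iff)
    qed (use uv in \<open>eventually_elim, simp\<close>)
    then show ?thesis by (simp add: LINT_on)
  qed
  have "(LINT x|lebesgue. nl cp cm p (v x)) = cp / (p + 1) * (LINT x|lebesgue. max (v x) 0 powr (p + 1))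
      + cm / (p + 1) * (LINT x|lebesgue. max (- v x) 0 powr (p + 1))"
    unfolding nl_def using nlv by simp
  then show ?thesis unfolding energy_def En_def 1 2 3 by simp
qed

lemma energy_zero_sob:
  assumes "a < b" "p > 1" "w \<in> L2 {a<..<b}" "zero_sob a b v g" "AE x in lebesgue. u x = v x"
  shows "energy cp cm p {a<..<b} w u = En cp cm p (\<lambda>x. indicator {a<..<b} x * w x) v g"
  by (rule energy_eq[OF assms(1-3) zero_sob_has_weak_deriv[OF assms(4)] zero_sobD(2,3)[OF assms(4)]
        zero_sob_continuous[OF assms(4)] zero_sob_outside[OF assms(4)] assms(5)])

section \<open>The optimal constant in the one-dimensional Sobolev inequality\<close>

definition pow_int :: "real \<Rightarrow> (real \<Rightarrow> real) \<Rightarrow> real" where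
  "pow_int p f = (LINT x|lebesgue. max (f x) 0 powr (p + 1))"

text \<open>Only the positive part enters, so that the same constant serves both signs and near-optimal
  functions can be taken nonnegative.\<close>

definition sob_const :: "real \<Rightarrow> real" where
  "sob_const p = Sup {pow_int p f | f. f \<in> tests 0 1 \<and> nrm (deriv f) \<le> 1}"

lemma pow_int_nonneg: "pow_int p f \<ge> 0"
  by (simp add: pow_int_def)

lemma pow_int_cmult:
  assumes "r \<ge> 0"
  shows "pow_int p (\<lambda>x. r * f x) = r powr (p + 1) * pow_int p f"
proof -
  have "max (r * f x) 0 powr (p + 1) = r powr (p + 1) * max (f x) 0 powr (p + 1)" for x
  proof -
    have "max (r * f x) 0 = r * max (f x) 0" using assms by (simp add: max_mult_distrib_left)
    then show ?thesis using assms by (simp add: powr_mult)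
  qed
  then show ?thesis by (simp add: pow_int_def)
qed

lemma pow_int_integrable:
  fixes f :: "real \<Rightarrow> real"
  assumes "continuous_on UNIV f" "\<And>x. x < c \<or> d < x \<Longrightarrow> f x = 0" "p > 0"
  shows "integrable lebesgue (\<lambda>x. max (f x) 0 powr (p + 1))"
  by (rule integrable_continuous_support[of _ c d], rule continuous_on_powr_pos)
    (use assms in \<open>auto intro!: continuous_on_max continuous_on_const\<close>)

lemma tests_pow_int_integrable:
  assumes "f \<in> tests c d" "p > 0"
  shows "integrable lebesgue (\<lambda>x. max (f x) 0 powr (p + 1))"
  by (rule pow_int_integrable[of _ c d]) (use assms tests_outside[OF assms(1)] tests_continuous in auto)

lemma LINT_affine:
  fixes f :: "real \<Rightarrow> real" and c :: real
  assumes "l > 0"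
  shows "(LINT x|lebesgue. f (c + l * x)) = (LINT x|lebesgue. f x) / l"
  using lebesgue_integral_real_affine[of l f c] assms by simp

lemma pow_int_affine: "l > 0 \<Longrightarrow> pow_int p (\<lambda>x. f (c + l * x)) = pow_int p f / l"
  unfolding pow_int_def by (rule LINT_affine)

lemma nrm_affine:
  assumes "l > 0"
  shows "nrm (\<lambda>x. f (c + l * x)) = nrm f / sqrt l"
  unfolding nrm_def using LINT_affine[of l "\<lambda>x. (f x)\<^sup>2" c] assms by (simp add: real_sqrt_divide)

lemma deriv_affine:
  assumes "smooth f"
  shows "deriv (\<lambda>x. f (c + l * x)) x = l * deriv f (c + l * x)"
proof (rule DERIV_imp_deriv)
  have "((\<lambda>x. c + l * x) has_real_derivative l) (at x)" by (auto intro!: derivative_eq_intros)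
  from DERIV_chain2[OF smooth_DERIV[OF assms] this]
  show "((\<lambda>x. f (c + l * x)) has_real_derivative l * deriv f (c + l * x)) (at x)" by (simp add: mult.commute)
qed

lemma nrm_deriv_affine:
  assumes "smooth f" "l > 0"
  shows "nrm (deriv (\<lambda>x. f (c + l * x))) = sqrt l * nrm (deriv f)"
proof -
  have "deriv (\<lambda>x. f (c + l * x)) = (\<lambda>x. l * deriv f (c + l * x))"
    using deriv_affine[OF assms(1)] by blast
  then have "nrm (deriv (\<lambda>x. f (c + l * x))) = l * (nrm (deriv f) / sqrt l)"
    using assms(2) nrm_cmult[of l "\<lambda>x. deriv f (c + l * x)"] nrm_affine[OF assms(2), of "deriv f" c] by simp
  also have "\<dots> = (l / sqrt l) * nrm (deriv f)" by simp
  also have "l / sqrt l = sqrt l" using assms(2) by (simp add: real_div_sqrt)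
  finally show ?thesis .
qed

lemma deriv_cmult_tests: "f \<in> tests c d \<Longrightarrow> deriv (\<lambda>x. r * f x) = (\<lambda>x. r * deriv f x)"
  by (rule ext, rule DERIV_imp_deriv, rule DERIV_cmult, rule tests_DERIV)

lemma nrm_deriv_cmult:
  assumes "f \<in> tests c d" "r \<ge> 0"
  shows "nrm (deriv (\<lambda>x. r * f x)) = r * nrm (deriv f)"
  using deriv_cmult_tests[OF assms(1)] nrm_cmult[of r "deriv f"] assms(2) by simp

text \<open>On the unit interval the sup bound gives \<open>\<bar>f x\<bar> \<le> 1\<close>; thus
  the supremum defining \<open>sob_const\<close> is finite.\<close>

lemma pow_int_le_one:
  assumes f: "f \<in> tests 0 1" and n: "nrm (deriv f) \<le> 1" and p: "p > 0"
  shows "pow_int p f \<le> 1"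
proof -
  have "pow_int p f \<le> (LINT x|lebesgue. indicator {0..1::real} x)"
    unfolding pow_int_def
  proof (rule integral_mono)
    show "integrable lebesgue (\<lambda>x. max (f x) 0 powr (p + 1))" by (rule tests_pow_int_integrable[OF f p])
    show "integrable lebesgue (indicator {0..1::real} :: real \<Rightarrow> real)" by simp
    fix x :: real
    show "max (f x) 0 powr (p + 1) \<le> indicator {0..1} x"
    proof (cases "x \<in> {0<..<1}")
      case True
      have "\<bar>f x\<bar> \<le> 1" using tests_sup_bound[OF f, of x] n by simp
      then have "max (f x) 0 powr (p + 1) \<le> 1 powr (p + 1)" using p by (intro powr_mono2) auto
      then show ?thesis using True by simp
    qed (use tests_outside[OF f] in simp)
  qed
  then show ?thesis by simp
qed

lemma pow_int_le_sob_const: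
  assumes "f \<in> tests 0 1" "nrm (deriv f) \<le> 1" "p > 0"
  shows "pow_int p f \<le> sob_const p"
  unfolding sob_const_def
  by (rule cSup_upper) (use assms pow_int_le_one[OF _ _ assms(3)] in \<open>auto intro!: bdd_aboveI\<close>)

lemma sob_const_pos:
  assumes p: "p > 0"
  shows "sob_const p > 0"
proof -
  define f where "f = bump (1/4) (3/4)"
  have f: "f \<in> tests 0 1" unfolding f_def by (rule tests_bump) auto
  \<comment> \<open>Adding \<open>1\<close> keeps the divisor positive without knowing that the
    derivative of the bump is nonzero.\<close>
  define r where "r = 1 / (nrm (deriv f) + 1)"
  have r: "r > 0" unfolding r_def using nrm_nonneg[of "deriv f"] by (simp add: add_nonneg_pos)
  have pos: "pow_int p f > 0"
  proof (rule ccontr)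
    assume "\<not> pow_int p f > 0"
    then have "pow_int p f = 0" using pow_int_nonneg[of p f] by linarith
    then have "AE x in lebesgue. max (f x) 0 powr (p + 1) = 0"
      using tests_pow_int_integrable[OF f p] unfolding pow_int_def
      by (subst (asm) integral_nonneg_eq_0_iff_AE) auto
    \<comment> \<open>A closed condition that holds almost everywhere on an open interval holds
      everywhere on it; with the empty set as the condition this is the contradiction.\<close>
    then have "AE x \<in> {1/4<..<3/4::real} in lebesgue. x \<in> {}"
    proof eventually_elim
      case (elim x)
      then show ?case using bump_bounds(3)[of "1/4" "3/4" x] by (auto simp: f_def)
    qed
    from mem_closed_if_AE_lebesgue_open[OF _ _ this, of "1/2"] show False by simp
  qed
  have "r * nrm (deriv f) \<le> 1" using nrm_nonneg[of "deriv f"] by (auto simp: r_def divide_le_eq_1 add_nonneg_pos)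
  then have "pow_int p (\<lambda>x. r * f x) \<le> sob_const p"
    using r p by (intro pow_int_le_sob_const tests_cmult[OF f]) (simp_all add: nrm_deriv_cmult[OF f])
  moreover have "pow_int p (\<lambda>x. r * f x) > 0" using r pos by (simp add: pow_int_cmult)
  ultimately show ?thesis by linarith
qed

text \<open>Stretching the unit interval to length \<open>l\<close> multiplies the integral by
  \<open>l\<close>, and a derivative norm \<open>A\<close> on length \<open>l\<close> corresponds to
  \<open>sqrt l * A\<close> on the unit interval. The two contributions \<open>1\<close> and
  \<open>(p + 1) / 2\<close> add up to \<open>(p + 3) / 2\<close>.\<close>

lemma scaling_exponent:
  assumes "l > 0" "A \<ge> 0"
  shows "l * (sqrt l * A) powr (p + 1) = l powr ((p + 3) / 2) * A powr (p + 1)"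
proof -
  have "sqrt l powr (p + 1) = l powr ((p + 1) / 2)"
    using assms(1) by (simp add: powr_half_sqrt[symmetric] powr_powr)
  moreover have "l * l powr ((p + 1) / 2) = l powr (1 + (p + 1) / 2)"
    using assms(1) by (simp only: powr_add) simp
  moreover have "1 + (p + 1) / 2 = (p + 3) / 2" by (simp add: field_simps)
  ultimately show ?thesis using assms by (simp add: powr_mult mult.assoc[symmetric])
qed

text \<open>Transplantation to the unit interval and normalisation of the derivative norm reduce
  this to the definition of \<open>sob_const\<close>.\<close>

lemma sobolev_tests:
  assumes f: "f \<in> tests c d" and cd: "c < d" and p: "p > 0"
  shows "pow_int p f \<le> sob_const p * (d - c) powr ((p + 3) / 2) * nrm (deriv f) powr (p + 1)"
proof (cases "nrm (deriv f) = 0")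
  case True
  then have "f x = 0" for x using tests_sup_bound[OF f cd, of x] by simp
  then show ?thesis using True p by (simp add: pow_int_def)
next
  case False
  define A where "A = nrm (deriv f)"
  define l where "l = d - c"
  have l: "l > 0" and A: "A > 0" using cd False nrm_nonneg[of "deriv f"] by (auto simp: l_def A_def less_le)
  define h where "h = (\<lambda>x. f (c + l * x))"
  have h: "h \<in> tests 0 1" unfolding h_def l_def by (rule tests_rescale_unit[OF f cd])
  define r where "r = 1 / (sqrt l * A)"
  have r: "r > 0" using l A by (simp add: r_def)
  have nh: "nrm (deriv h) = sqrt l * A" unfolding h_def A_def by (rule nrm_deriv_affine[OF tests_smooth[OF f] l])
  have "nrm (deriv (\<lambda>x. r * h x)) = r * (sqrt l * A)" using r nh by (simp add: nrm_deriv_cmult[OF h])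
  also have "\<dots> = 1" using l A by (simp add: r_def)
  finally have "nrm (deriv (\<lambda>x. r * h x)) = 1" .
  then have "pow_int p (\<lambda>x. r * h x) \<le> sob_const p"
    by (intro pow_int_le_sob_const tests_cmult[OF h] p) auto
  then have 1: "r powr (p + 1) * (pow_int p f / l) \<le> sob_const p"
    using r l by (simp add: pow_int_cmult h_def pow_int_affine)
  define X where "X = (sqrt l * A) powr (p + 1)"
  have X: "X > 0" using l A by (simp add: X_def)
  have "r powr (p + 1) = 1 / X"
    unfolding r_def X_def using l A by (simp add: powr_divide)
  with 1 have "1 / X * (pow_int p f / l) \<le> sob_const p" by (simp only:)
  then have "pow_int p f \<le> sob_const p * (l * X)"
    using l X by (simp add: field_simps)
  then have "pow_int p f \<le> sob_const p * (l * (sqrt l * A) powr (p + 1))" by (simp add: X_def)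
  then show ?thesis using scaling_exponent[OF l, of A p] A by (simp add: l_def A_def mult.assoc)
qed

text \<open>Truncation and uniform approximation lower a function by at most a fixed multiple of a
  small level; nothing is lost when the level tends to zero, because the lowered integrands are
  dominated by the original one.\<close>

lemma tendsto_truncated_pow_int:
  fixes K :: real and u :: "real \<Rightarrow> real"
  assumes u: "continuous_on UNIV u" "\<And>x. x < c \<or> d < x \<Longrightarrow> u x = 0" and p: "p > 0" and K: "K \<ge> 0"
    and X: "X \<in> sets lebesgue"
  shows "(\<lambda>m. LINT x|lebesgue. indicator X x * max (u x - K / real (Suc m)) 0 powr (p + 1))
    \<longlonglongrightarrow> (LINT x|lebesgue. indicator X x * max (u x) 0 powr (p + 1))"
proof (rule integral_dominated_convergence[where w="\<lambda>x. max (u x) 0 powr (p + 1)"])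
  have "continuous_on UNIV (\<lambda>x. max (u x - k) 0 powr (p + 1))" for k
    by (rule continuous_on_powr_pos) (use u(1) p in \<open>auto intro!: continuous_on_max continuous_on_diff continuous_on_const\<close>)
  then have m: "(\<lambda>x. max (u x - k) 0 powr (p + 1)) \<in> borel_measurable lebesgue" for k
    by (rule continuous_lebesgue_measurable)
  show "(\<lambda>x. indicator X x * max (u x) 0 powr (p + 1)) \<in> borel_measurable lebesgue"
    by (rule indicator_times_measurable[OF _ X]) (use m[of 0] in simp)
  show "(\<lambda>x. indicator X x * max (u x - K / real (Suc k)) 0 powr (p + 1)) \<in> borel_measurable lebesgue" for k
    by (rule indicator_times_measurable[OF m X])
  show "integrable lebesgue (\<lambda>x. max (u x) 0 powr (p + 1))" by (rule pow_int_integrable[OF u p])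
  show "AE x in lebesgue. norm (indicator X x * max (u x - K / real (Suc k)) 0 powr (p + 1)) \<le> max (u x) 0 powr (p + 1)" for k
  proof (rule AE_I2)
    fix x
    have "0 \<le> K / real (Suc k)" using K by simp
    then have "max (u x - K / real (Suc k)) 0 powr (p + 1) \<le> max (u x) 0 powr (p + 1)"
      using p by (intro powr_mono2) auto
    then show "norm (indicator X x * max (u x - K / real (Suc k)) 0 powr (p + 1)) \<le> max (u x) 0 powr (p + 1)"
      by (simp add: indicator_def)
  qed
  show "AE x in lebesgue. (\<lambda>k. indicator X x * max (u x - K / real (Suc k)) 0 powr (p + 1)) \<longlonglongrightarrow> indicator X x * max (u x) 0 powr (p + 1)"
  proof (rule AE_I2)
    fix x
    have "(\<lambda>k. K / real (Suc k)) \<longlonglongrightarrow> 0" by (rule LIMSEQ_Suc[OF lim_const_over_n])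
    then have "(\<lambda>k. max (u x - K / real (Suc k)) 0) \<longlonglongrightarrow> max (u x - 0) 0"
      by (rule tendsto_max[OF tendsto_diff[OF tendsto_const] tendsto_const])
    then have "(\<lambda>k. max (u x - K / real (Suc k)) 0 powr (p + 1)) \<longlonglongrightarrow> max (u x - 0) 0 powr (p + 1)"
      by (rule tendsto_powr2[OF _ tendsto_const]) (use p in auto)
    from tendsto_mult[OF tendsto_const this, of "indicator X x"]
    show "(\<lambda>k. indicator X x * max (u x - K / real (Suc k)) 0 powr (p + 1)) \<longlonglongrightarrow> indicator X x * max (u x) 0 powr (p + 1)"
      by simp
  qed
qed

lemma deriv_soft_cut_tests:
  assumes "f \<in> tests c d" "e > 0"
  shows "\<bar>deriv (\<lambda>x. soft_cut e (f x)) x\<bar> \<le> \<bar>deriv f x\<bar>"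
proof -
  have "deriv (\<lambda>x. soft_cut e (f x)) x = deriv (soft_cut e) (f x) * deriv f x"
    by (rule DERIV_imp_deriv[OF DERIV_chain2[OF smooth_DERIV[OF smooth_soft_cut] tests_DERIV[OF assms(1)]]])
  moreover have "\<bar>deriv (soft_cut e) (f x)\<bar> * \<bar>deriv f x\<bar> \<le> 1 * \<bar>deriv f x\<bar>"
    by (intro mult_right_mono deriv_soft_cut assms) simp
  ultimately show ?thesis by (simp add: abs_mult)
qed

text \<open>The smooth truncation of an approximating test function vanishes near \<open>c\<close> and \<open>d\<close>, so it can
  be cut off there and is a test function on \<open>{c<..<d}\<close> again.\<close>

lemma sobolev_truncation:
  assumes \<phi>: "\<phi> \<in> tests a b" and ab: "a < b" and cd: "c < d" and p: "p > 0" and e: "e > 0"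
    and small: "\<phi> c < e" "\<phi> d < e"
  shows "(LINT x|lebesgue. indicator {c<..<d} x * max (soft_cut e (\<phi> x)) 0 powr (p + 1))
      \<le> sob_const p * (d - c) powr ((p + 3) / 2) * nrm (\<lambda>x. indicator {c<..<d} x * deriv \<phi> x) powr (p + 1)"
proof -
  define A where "A = {c<..<d}"
  have A: "A \<in> sets lebesgue" by (simp add: A_def)
  define f where "f x = (if x \<in> A then soft_cut e (\<phi> x) else 0)" for x
  have contp: "continuous_on UNIV \<phi>" by (rule tests_continuous[OF \<phi>])
  have op: "open {x. \<phi> x < e}" by (rule open_Collect_less[OF contp continuous_on_const])
  have zero: "soft_cut e (\<phi> x) = 0" if "\<phi> x < e" for x
    by (rule soft_cut_bounds(4)[OF e]) (use that in simp)
  have sf: "smooth f"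
    unfolding f_def[abs_def]
  proof (rule smooth_restrict)
    show "smooth (\<lambda>x. soft_cut e (\<phi> x))"
      by (rule smooth_compose[OF smooth_soft_cut tests_smooth[OF \<phi>]])
    show "open A" by (simp add: A_def)
    show "open ({..<c} \<union> {d<..} \<union> {x. \<phi> x < e})" using op by (intro open_Un) auto
    show "A \<union> ({..<c} \<union> {d<..} \<union> {x. \<phi> x < e}) = UNIV"
    proof -
      have "x \<in> A \<union> ({..<c} \<union> {d<..} \<union> {x. \<phi> x < e})" for x
        using small by (cases "x = c"; cases "x = d") (auto simp: A_def)
      then show ?thesis by blast
    qed
    show "A \<inter> ({..<c} \<union> {d<..} \<union> {x. \<phi> x < e}) \<subseteq> {x. soft_cut e (\<phi> x) = 0}"
      using zero by (auto simp: A_def)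
  qed
  obtain r1 where r1: "r1 > 0" "ball c r1 \<subseteq> {x. \<phi> x < e}"
    using openE[OF op, of c] small(1) by auto
  obtain r2 where r2: "r2 > 0" "ball d r2 \<subseteq> {x. \<phi> x < e}"
    using openE[OF op, of d] small(2) by auto
  have f: "f \<in> tests c d"
  proof (rule testsI[OF sf, of _ "c + r1 / 2" "d - r2 / 2"])
    show "f x = 0" if x: "x < c + r1 / 2 \<or> d - r2 / 2 < x" for x
    proof (cases "x \<in> A")
      case True
      then have "x \<in> ball c r1 \<or> x \<in> ball d r2" using x r1(1) r2(1) by (auto simp: A_def dist_real_def)
      then have "\<phi> x < e" using r1(2) r2(2) by blast
      then show ?thesis using zero by (simp add: f_def)
    qed (simp add: f_def)
  qed (use r1 r2 in auto)
  have df: "\<bar>deriv f x\<bar> \<le> \<bar>indicator A x * deriv \<phi> x\<bar>" for x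
  proof (cases "x \<in> A")
    case True
    have "eventually (\<lambda>y. f y = soft_cut e (\<phi> y)) (nhds x)"
      by (rule eventually_mono[OF eventually_nhds_in_open[of A x]]) (use True in \<open>auto simp: A_def f_def\<close>)
    then have "deriv f x = deriv (\<lambda>x. soft_cut e (\<phi> x)) x" by (rule deriv_cong_ev) simp
    then show ?thesis using deriv_soft_cut_tests[OF \<phi> e, of x] True by simp
  next
    case False
    then show ?thesis using tests_deriv_outside[OF f cd, of x] by (simp add: A_def)
  qed
  have "(\<lambda>x. indicator A x * max (soft_cut e (\<phi> x)) 0 powr (p + 1)) = (\<lambda>x. max (f x) 0 powr (p + 1))"
    using p by (auto simp: f_def indicator_def)
  then have "(LINT x|lebesgue. indicator A x * max (soft_cut e (\<phi> x)) 0 powr (p + 1)) = pow_int p f"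
    by (simp only: pow_int_def)
  also have "\<dots> \<le> sob_const p * (d - c) powr ((p + 3) / 2) * nrm (deriv f) powr (p + 1)"
    by (rule sobolev_tests[OF f cd p])
  also have "nrm (deriv f) \<le> nrm (\<lambda>x. indicator A x * deriv \<phi> x)"
    by (rule nrm_mono(2)[OF sq_int_indicator[OF tests_sq_int[OF tests_deriv[OF \<phi> ab]] A]
          sq_int_measurable[OF tests_sq_int[OF tests_deriv[OF f cd]]] df])
  then have "sob_const p * (d - c) powr ((p + 3) / 2) * nrm (deriv f) powr (p + 1)
      \<le> sob_const p * (d - c) powr ((p + 3) / 2) * nrm (\<lambda>x. indicator A x * deriv \<phi> x) powr (p + 1)"
    using sob_const_pos[OF p] p by (intro mult_left_mono powr_mono2 mult_nonneg_nonneg) auto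
  finally show ?thesis by (simp add: A_def)
qed

text \<open>\<open>u\<close> may live on another interval and change sign: what matters is
  nonpositivity at \<open>c\<close> and \<open>d\<close>, because only the positive part is
  measured. This serves single cells as well as the nodal intervals of a sign-changing
  function.\<close>

lemma sobolev_zero_sob:
  assumes u: "zero_sob a b u g" and cd: "c < d" and uc: "u c \<le> 0" "u d \<le> 0" and p: "p > 0"
  shows "(LINT x|lebesgue. indicator {c<..<d} x * max (u x) 0 powr (p + 1))
    \<le> sob_const p * (d - c) powr ((p + 3) / 2) * nrm (\<lambda>x. indicator {c<..<d} x * g x) powr (p + 1)"
proof -
  define A where "A = {c<..<d}"
  define K where "K = sob_const p * (d - c) powr ((p + 3) / 2)"
  have A: "A \<in> sets lebesgue" by (simp add: A_def)
  obtain \<phi> where \<phi>: "\<And>n::nat. \<phi> n \<in> tests a b" "uniform_limit UNIV \<phi> u sequentially"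
    "(\<lambda>n. nrm (\<lambda>x. deriv (\<phi> n) x - g x)) \<longlonglongrightarrow> 0"
    by (rule zero_sobE[OF u]) blast
  note U = zero_sobD[OF u]
  have sd: "sq_int (deriv (\<phi> n))" for n by (rule tests_sq_int[OF tests_deriv[OF \<phi>(1) U(1)]])
  have ucont: "continuous_on UNIV u" by (rule zero_sob_continuous[OF u])
  have uout: "u x = 0" if "x < a \<or> b < x" for x by (rule zero_sob_outside[OF u]) (use that in auto)
  have "(\<lambda>n. nrm (\<lambda>x. indicator A x * deriv (\<phi> n) x)) \<longlonglongrightarrow> nrm (\<lambda>x. indicator A x * g x)"
  proof (rule tendsto_nrm[OF sq_int_indicator[OF sd A] sq_int_indicator[OF U(2) A]])
    show "(\<lambda>n. nrm (\<lambda>x. indicator A x * deriv (\<phi> n) x - indicator A x * g x)) \<longlonglongrightarrow> 0"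
    proof (rule squeeze_zero[OF nrm_nonneg _ \<phi>(3)])
      show "nrm (\<lambda>x. indicator A x * deriv (\<phi> n) x - indicator A x * g x) \<le> nrm (\<lambda>x. deriv (\<phi> n) x - g x)" for n
        using nrm_indicator_le[OF sq_int_diff[OF sd U(2)] A, of n] by (simp add: right_diff_distrib)
    qed
  qed
  then have "(\<lambda>n. nrm (\<lambda>x. indicator A x * deriv (\<phi> n) x) powr (p + 1)) \<longlonglongrightarrow> nrm (\<lambda>x. indicator A x * g x) powr (p + 1)"
    by (rule tendsto_powr2[OF _ tendsto_const]) (use p in auto)
  from tendsto_mult[OF tendsto_const this, of K]
  have lim: "(\<lambda>n. K * nrm (\<lambda>x. indicator A x * deriv (\<phi> n) x) powr (p + 1)) \<longlonglongrightarrow> K * nrm (\<lambda>x. indicator A x * g x) powr (p + 1)" .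
  have bound: "(LINT x|lebesgue. indicator A x * max (u x - 3 / real (Suc m)) 0 powr (p + 1))
      \<le> K * nrm (\<lambda>x. indicator A x * g x) powr (p + 1)" for m
  proof (rule LIMSEQ_le_const[OF lim])
    define e where "e = 1 / real (Suc m)"
    have e: "e > 0" by (simp add: e_def)
    obtain N where N: "\<And>n x. n \<ge> N \<Longrightarrow> \<bar>\<phi> n x - u x\<bar> < e"
      using uniform_limitD[OF \<phi>(2) e] unfolding eventually_sequentially by (auto simp: dist_real_def)
    show "\<exists>N. \<forall>n\<ge>N. (LINT x|lebesgue. indicator A x * max (u x - 3 / real (Suc m)) 0 powr (p + 1))
      \<le> K * nrm (\<lambda>x. indicator A x * deriv (\<phi> n) x) powr (p + 1)"
    proof (intro exI[of _ N] allI impI)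
      fix n assume n: "n \<ge> N"
      have close: "\<bar>\<phi> n x - u x\<bar> < e" for x by (rule N[OF n])
      \<comment> \<open>Nonpositive endpoint values of \<open>u\<close> become values below
        \<open>e\<close>, the level under which the soft truncation is zero.\<close>
      have small: "\<phi> n c < e" "\<phi> n d < e" using close[of c] close[of d] uc by linarith+
      have "(LINT x|lebesgue. indicator A x * max (u x - 3 * e) 0 powr (p + 1))
          \<le> (LINT x|lebesgue. indicator A x * max (soft_cut e (\<phi> n x)) 0 powr (p + 1))"
      proof (rule integral_mono)
        have "integrable lebesgue (\<lambda>x. indicator A x *\<^sub>R max (soft_cut e (\<phi> n x)) 0 powr (p + 1))"
        proof (rule integrable_mult_indicator[OF A], rule tests_pow_int_integrable[OF _ p])
          show "(\<lambda>x. soft_cut e (\<phi> n x)) \<in> tests a b"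
            by (rule tests_compose[OF \<phi>(1) smooth_soft_cut _ U(1)]) (use soft_cut_bounds(4)[OF e, of 0] e in simp)
        qed
        then show "integrable lebesgue (\<lambda>x. indicator A x * max (soft_cut e (\<phi> n x)) 0 powr (p + 1))" by simp
        have "integrable lebesgue (\<lambda>x. indicator A x *\<^sub>R max (u x - 3 * e) 0 powr (p + 1))"
        proof (rule integrable_mult_indicator[OF A], rule integrable_continuous_support[of _ a b])
          show "continuous_on UNIV (\<lambda>x. max (u x - 3 * e) 0 powr (p + 1))"
            by (rule continuous_on_powr_pos)
              (use p in \<open>auto intro!: continuous_on_max continuous_on_diff ucont continuous_on_const\<close>)
          show "max (u x - 3 * e) 0 powr (p + 1) = 0" if "x < a \<or> b < x" for x
            using uout[OF that] e by simp
        qed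
        then show "integrable lebesgue (\<lambda>x. indicator A x * max (u x - 3 * e) 0 powr (p + 1))" by simp
        show "indicator A x * max (u x - 3 * e) 0 powr (p + 1) \<le> indicator A x * max (soft_cut e (\<phi> n x)) 0 powr (p + 1)" for x
        proof -
          \<comment> \<open>Of the loss \<open>3 * e\<close>, the truncation accounts for
            \<open>2 * e\<close> and the uniform distance of \<open>\<phi> n\<close> from
            \<open>u\<close> for one \<open>e\<close>.\<close>
          have "max (\<phi> n x) 0 - 2 * e \<le> soft_cut e (\<phi> n x)"
            by (rule soft_cut_bounds(3)[OF e])
          then have "max (u x - 3 * e) 0 \<le> max (soft_cut e (\<phi> n x)) 0" using close[of x] by linarith
          then show ?thesis using p by (intro mult_left_mono powr_mono2) auto
        qed
      qed
      also have "\<dots> \<le> K * nrm (\<lambda>x. indicator A x * deriv (\<phi> n) x) powr (p + 1)"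
        unfolding K_def A_def by (rule sobolev_truncation[OF \<phi>(1) U(1) cd p e small])
      finally show "(LINT x|lebesgue. indicator A x * max (u x - 3 / real (Suc m)) 0 powr (p + 1))
        \<le> K * nrm (\<lambda>x. indicator A x * deriv (\<phi> n) x) powr (p + 1)" by (simp add: e_def)
    qed
  qed
  have "(LINT x|lebesgue. indicator A x * max (u x) 0 powr (p + 1)) \<le> K * nrm (\<lambda>x. indicator A x * g x) powr (p + 1)"
    by (rule LIMSEQ_le_const2[OF tendsto_truncated_pow_int[where K=3, OF ucont uout p _ A]]) (use bound in auto)
  then show ?thesis by (simp add: A_def K_def)
qed

text \<open>The soft truncation makes an almost extremal test function nonnegative, keeps it smooth
  and does not enlarge its derivative; the loss vanishes with the level. The resulting derivative
  norm \<open>N\<close> is at most \<open>1\<close>, so normalising it can only increase the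
  integral.\<close>

lemma sobolev_near_optimal:
  assumes cd: "c < d" and \<eta>: "0 \<le> \<eta>" "\<eta> < sob_const p" and R: "R > 0" and p: "p > 0"
  obtains f where "f \<in> tests c d" "\<And>x. f x \<ge> 0" "nrm (deriv f) = R"
    "pow_int p f \<ge> \<eta> * (d - c) powr ((p + 3) / 2) * R powr (p + 1)"
proof -
  define \<S> where "\<S> = {pow_int p f | f. f \<in> tests 0 1 \<and> nrm (deriv f) \<le> 1}"
  have "\<S> \<noteq> {}"
    unfolding \<S>_def using tests_zero[of 0 1] by (auto simp: nrm_def intro!: exI[of _ "\<lambda>x. 0"])
  moreover have "\<eta> < Sup \<S>" using \<eta>(2) by (simp add: sob_const_def \<S>_def)
  ultimately obtain y where "y \<in> \<S>" "\<eta> < y" using less_cSupE by blast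
  then obtain f0 where f0: "f0 \<in> tests 0 1" "nrm (deriv f0) \<le> 1" "pow_int p f0 > \<eta>"
    unfolding \<S>_def by blast
  have "(\<lambda>m. LINT x|lebesgue. indicator UNIV x * max (f0 x - 2 / real (Suc m)) 0 powr (p + 1))
      \<longlonglongrightarrow> (LINT x|lebesgue. indicator UNIV x * max (f0 x) 0 powr (p + 1))"
    by (rule tendsto_truncated_pow_int[of _ 0 1]) (use f0 p tests_outside[OF f0(1)] tests_continuous[OF f0(1)] in auto)
  then have "(\<lambda>m. pow_int p (\<lambda>x. f0 x - 2 / real (Suc m))) \<longlonglongrightarrow> pow_int p f0"
    by (simp add: pow_int_def)
  from order_tendstoD(1)[OF this f0(3)] obtain m where m: "pow_int p (\<lambda>x. f0 x - 2 / real (Suc m)) > \<eta>"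
    unfolding eventually_sequentially by blast
  define e where "e = 1 / real (Suc m)"
  have e: "e > 0" by (simp add: e_def)
  define f1 where "f1 x = soft_cut e (f0 x)" for x
  have f1: "f1 \<in> tests 0 1"
    unfolding f1_def[abs_def]
    by (rule tests_compose[OF f0(1) smooth_soft_cut]) (use soft_cut_bounds(4)[OF e, of 0] e in simp_all)
  have f1nn: "f1 x \<ge> 0" for x unfolding f1_def by (rule soft_cut_bounds(1)[OF e])
  have "pow_int p (\<lambda>x. f0 x - 2 / real (Suc m)) \<le> pow_int p f1"
    unfolding pow_int_def
  proof (rule integral_mono)
    show "integrable lebesgue (\<lambda>x. max (f1 x) 0 powr (p + 1))" by (rule tests_pow_int_integrable[OF f1 p])
    show "integrable lebesgue (\<lambda>x. max (f0 x - 2 / real (Suc m)) 0 powr (p + 1))"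
    proof (rule integrable_continuous_support[of _ 0 1])
      show "continuous_on UNIV (\<lambda>x. max (f0 x - 2 / real (Suc m)) 0 powr (p + 1))"
        by (rule continuous_on_powr_pos)
          (use p in \<open>auto intro!: continuous_on_max continuous_on_diff tests_continuous[OF f0(1)] continuous_on_const\<close>)
      show "max (f0 x - 2 / real (Suc m)) 0 powr (p + 1) = 0" if "x < 0 \<or> 1 < x" for x
        using tests_outside[OF f0(1), of x] that by auto
    qed
    fix x
    have "f0 x - 2 / real (Suc m) \<le> f1 x"
      using soft_cut_bounds(3)[OF e, of "f0 x"] by (simp add: f1_def e_def max_def split: if_splits)
    then show "max (f0 x - 2 / real (Suc m)) 0 powr (p + 1) \<le> max (f1 x) 0 powr (p + 1)"
      using p by (intro powr_mono2) auto
  qed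
  with m have pf1: "pow_int p f1 > \<eta>" by linarith
  have "nrm (deriv f1) \<le> nrm (deriv f0)"
    unfolding f1_def[abs_def]
    by (rule nrm_mono(2)[OF tests_sq_int[OF tests_deriv[OF f0(1)]] sq_int_measurable[OF tests_sq_int[OF tests_deriv]]])
      (use f1[unfolded f1_def[abs_def]] deriv_soft_cut_tests[OF f0(1) e] in auto)
  then have n1: "nrm (deriv f1) \<le> 1" using f0(2) by linarith
  define N where "N = nrm (deriv f1)"
  have N: "N > 0"
  proof (rule ccontr)
    assume "\<not> N > 0"
    then have "N = 0" using nrm_nonneg[of "deriv f1"] by (simp add: N_def)
    then have "f1 x = 0" for x using tests_sup_bound[OF f1, of x] by (simp add: N_def)
    then have "pow_int p f1 = 0" using p by (simp add: pow_int_def)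
    then show False using pf1 \<eta> by simp
  qed
  define l where "l = d - c"
  have l: "l > 0" using cd by (simp add: l_def)
  define h where "h x = f1 ((x - c) / l)" for x
  have h: "h \<in> tests c d" unfolding h_def[abs_def] l_def by (rule tests_affine[OF f1 cd])
  have h_eq: "h = (\<lambda>x. f1 (- c / l + 1 / l * x))" by (simp add: h_def[abs_def] diff_divide_distrib)
  have nh: "nrm (deriv h) = N / sqrt l"
    unfolding h_eq using nrm_deriv_affine[OF tests_smooth[OF f1], of "1 / l" "- c / l"] l by (simp add: N_def real_sqrt_divide)
  have ph: "pow_int p h = l * pow_int p f1"
    unfolding h_eq using pow_int_affine[of "1 / l" p f1 "- c / l"] l by simp
  \<comment> \<open>Rescaling to length \<open>l\<close> divides the derivative norm
    \<open>N\<close> by \<open>sqrt l\<close>; this factor brings it to exactly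
    \<open>R\<close>.\<close>
  define r where "r = R * sqrt l / N"
  have r: "r > 0" using R l N by (simp add: r_def)
  have "pow_int p (\<lambda>x. r * h x) = r powr (p + 1) * (l * pow_int p f1)" using r by (simp add: pow_int_cmult ph)
  also have "\<dots> \<ge> (sqrt l * R) powr (p + 1) * (l * \<eta>)"
  proof (rule mult_mono)
    have "sqrt l * R \<le> r"
    proof -
      have "R * sqrt l * N \<le> R * sqrt l * 1" using n1 R l by (intro mult_left_mono) (auto simp: N_def)
      then show ?thesis using N by (simp add: r_def field_simps)
    qed
    then show "(sqrt l * R) powr (p + 1) \<le> r powr (p + 1)" using l R p by (intro powr_mono2) auto
  qed (use pf1 l \<eta> in auto)
  also have "(sqrt l * R) powr (p + 1) * (l * \<eta>) = \<eta> * l powr ((p + 3) / 2) * R powr (p + 1)"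
    using scaling_exponent[OF l, of R p] R by (simp add: ac_simps)
  finally have 1: "pow_int p (\<lambda>x. r * h x) \<ge> \<eta> * (d - c) powr ((p + 3) / 2) * R powr (p + 1)" by (simp add: l_def)
  have "nrm (deriv (\<lambda>x. r * h x)) = r * (N / sqrt l)" using r nh by (simp add: nrm_deriv_cmult[OF h])
  also have "\<dots> = R" using l N by (simp add: r_def)
  finally have 2: "nrm (deriv (\<lambda>x. r * h x)) = R" .
  show ?thesis
    by (rule that[OF tests_cmult[OF h cd, of r] _ 2 1]) (use r f1nn in \<open>simp add: h_def\<close>)
qed

section \<open>The min-max value on a short interval\<close>

lemma powr_diff_le:
  fixes x y :: real
  assumes "x \<ge> 0" "y \<ge> 0" "p > 0"
  shows "\<bar>x powr (p + 1) - y powr (p + 1)\<bar> \<le> (p + 1) * \<bar>x - y\<bar> * (x + y) powr p"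
proof -
  have main: "\<bar>x powr (p + 1) - y powr (p + 1)\<bar> \<le> (p + 1) * \<bar>x - y\<bar> * (x + y) powr p"
    if xy: "0 \<le> x" "x < y" for x y :: real
  proof -
    have "\<exists>l z. x < z \<and> z < y \<and> ((\<lambda>t. t powr (p + 1)) has_real_derivative l) (at z)
        \<and> y powr (p + 1) - x powr (p + 1) = (y - x) * l"
    proof (rule MVT[OF xy(2)])
      show "continuous_on {x..y} (\<lambda>t. t powr (p + 1))"
        using xy assms(3) by (intro continuous_on_powr') (auto intro!: continuous_intros)
      show "(\<lambda>t. t powr (p + 1)) differentiable (at z)" if "x < z" "z < y" for z
        using has_real_derivative_powr[of z "p + 1"] that xy real_differentiable_def by fastforce
    qed
    then obtain l z where z: "x < z" "z < y" "((\<lambda>t. t powr (p + 1)) has_real_derivative l) (at z)"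
      "y powr (p + 1) - x powr (p + 1) = (y - x) * l" by blast
    have "l = (p + 1) * z powr p"
      using DERIV_unique[OF z(3) has_real_derivative_powr[of z "p + 1"]] z(1) xy by simp
    moreover have "z powr p \<le> (x + y) powr p" using z xy assms(3) by (intro powr_mono2) auto
    ultimately have "l \<le> (p + 1) * (x + y) powr p" "l \<ge> 0" using assms(3) by (auto intro!: mult_left_mono)
    then have "(y - x) * l \<le> (y - x) * ((p + 1) * (x + y) powr p)" "0 \<le> (y - x) * l"
      using xy by (auto intro!: mult_left_mono)
    then show ?thesis using z(4) xy by (simp add: abs_minus_commute ac_simps)
  qed
  consider "x < y" | "y < x" | "x = y" by linarith
  then show ?thesis
  proof cases
    case 2
    then show ?thesis using main[of y x] assms by (simp add: abs_minus_commute add.commute)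
  qed (use main[of x y] assms in simp_all)
qed

lemma nl_diff_le:
  assumes c: "cp \<ge> 0" "cm \<ge> 0" and p: "p > 0"
  shows "\<bar>nl cp cm p x - nl cp cm p y\<bar> \<le> (cp + cm) * \<bar>x - y\<bar> * (\<bar>x\<bar> + \<bar>y\<bar>) powr p"
proof -
  have part: "c / (p + 1) * \<bar>max x 0 powr (p + 1) - max y 0 powr (p + 1)\<bar> \<le> c * \<bar>x - y\<bar> * (\<bar>x\<bar> + \<bar>y\<bar>) powr p"
    if "c \<ge> 0" for c x y :: real
  proof -
    have "\<bar>max x 0 powr (p + 1) - max y 0 powr (p + 1)\<bar> \<le> (p + 1) * \<bar>max x 0 - max y 0\<bar> * (max x 0 + max y 0) powr p"
      by (rule powr_diff_le) (use p in auto)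
    also have "\<dots> \<le> (p + 1) * \<bar>x - y\<bar> * (\<bar>x\<bar> + \<bar>y\<bar>) powr p"
    proof (intro mult_mono powr_mono2)
      show "\<bar>max x 0 - max y 0\<bar> \<le> \<bar>x - y\<bar>" by linarith
      show "max x 0 + max y 0 \<le> \<bar>x\<bar> + \<bar>y\<bar>" by linarith
    qed (use p in auto)
    finally have "c / (p + 1) * \<bar>max x 0 powr (p + 1) - max y 0 powr (p + 1)\<bar>
        \<le> c / (p + 1) * ((p + 1) * \<bar>x - y\<bar> * (\<bar>x\<bar> + \<bar>y\<bar>) powr p)"
      using that p by (intro mult_left_mono) auto
    then show ?thesis using p by simp
  qed
  have "\<bar>nl cp cm p x - nl cp cm p y\<bar> = \<bar>cp / (p + 1) * (max x 0 powr (p + 1) - max y 0 powr (p + 1))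
      + cm / (p + 1) * (max (- x) 0 powr (p + 1) - max (- y) 0 powr (p + 1))\<bar>"
    by (simp add: nl_def algebra_simps)
  also have "\<dots> \<le> \<bar>cp / (p + 1) * (max x 0 powr (p + 1) - max y 0 powr (p + 1))\<bar>
      + \<bar>cm / (p + 1) * (max (- x) 0 powr (p + 1) - max (- y) 0 powr (p + 1))\<bar>" by (rule abs_triangle_ineq)
  also have "\<dots> = cp / (p + 1) * \<bar>max x 0 powr (p + 1) - max y 0 powr (p + 1)\<bar>
      + cm / (p + 1) * \<bar>max (- x) 0 powr (p + 1) - max (- y) 0 powr (p + 1)\<bar>"
    using c p by (simp add: abs_mult)
  also have "\<dots> \<le> cp * \<bar>x - y\<bar> * (\<bar>x\<bar> + \<bar>y\<bar>) powr p + cm * \<bar>- x - - y\<bar> * (\<bar>- x\<bar> + \<bar>- y\<bar>) powr p"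
    by (intro add_mono part c)
  also have "\<dots> = (cp + cm) * \<bar>x - y\<bar> * (\<bar>x\<bar> + \<bar>y\<bar>) powr p"
    by (simp add: abs_minus_commute algebra_simps)
  finally show ?thesis .
qed

lemma nl_le:
  assumes c: "cp \<ge> 0" "cm \<ge> 0" and p: "p > 0"
  shows "nl cp cm p x \<le> (cp + cm) * \<bar>x\<bar> powr (p + 1)"
proof -
  have part: "c / (p + 1) * max x 0 powr (p + 1) \<le> c * \<bar>x\<bar> powr (p + 1)" if "c \<ge> 0" for c x :: real
  proof (rule mult_mono)
    show "c / (p + 1) \<le> c" using p that by (simp add: divide_le_eq mult_left_mono ring_distribs)
    show "max x 0 powr (p + 1) \<le> \<bar>x\<bar> powr (p + 1)" using p by (intro powr_mono2) auto
  qed (use that in auto)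
  show ?thesis unfolding nl_def using part[OF c(1), of x] part[OF c(2), of "- x"] by (simp add: distrib_right)
qed

lemma continuous_nl:
  fixes u :: "real \<Rightarrow> real"
  assumes "continuous_on UNIV u" "p > 0"
  shows "continuous_on UNIV (\<lambda>x. nl cp cm p (u x))"
proof -
  have "continuous_on UNIV (\<lambda>x. max (u x) 0 powr (p + 1))"
    by (rule continuous_on_powr_pos)
      (use assms in \<open>auto intro!: continuous_on_max continuous_on_const\<close>)
  moreover have "continuous_on UNIV (\<lambda>x. max (- u x) 0 powr (p + 1))"
    by (rule continuous_on_powr_pos)
      (use assms in \<open>auto intro!: continuous_on_max continuous_on_const continuous_on_minus\<close>)
  ultimately show ?thesis unfolding nl_def by (intro continuous_on_add continuous_on_mult continuous_on_const)
qed

lemma nl_zero [simp]: "nl cp cm p 0 = 0"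
  by (simp add: nl_def)

lemma nl_integrable:
  assumes "zero_sob c d u g" "p > 0"
  shows "integrable lebesgue (\<lambda>x. nl cp cm p (u x))"
proof (rule integrable_continuous_support[of _ c d])
  show "continuous_on UNIV (\<lambda>x. nl cp cm p (u x))"
    by (rule continuous_nl[OF zero_sob_continuous[OF assms(1)] assms(2)])
  show "nl cp cm p (u x) = 0" if "x < c \<or> d < x" for x
    using zero_sob_outside[OF assms(1), of x] that by auto
qed

definition sgn_coeff :: "real \<Rightarrow> real \<Rightarrow> real \<Rightarrow> real" where
  "sgn_coeff cp cm s = (if s = 1 then cp else cm)"

lemma nl_signed:
  assumes "s = 1 \<or> s = -1" "h \<ge> 0"
  shows "nl cp cm p (s * h) = sgn_coeff cp cm s / (p + 1) * max h 0 powr (p + 1)"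
  using assms by (auto simp: nl_def sgn_coeff_def max_def)

lemma LINT_nl_signed:
  assumes "s = 1 \<or> s = -1" "\<And>x. h x \<ge> 0"
  shows "(LINT x|lebesgue. nl cp cm p (s * h x)) = sgn_coeff cp cm s / (p + 1) * pow_int p h"
  unfolding pow_int_def nl_signed[OF assms(1) assms(2)] by simp

lemma sobolev_zero_sob_full:
  assumes "zero_sob c d u g" "p > 0"
  shows "pow_int p u \<le> sob_const p * (d - c) powr ((p + 3) / 2) * nrm g powr (p + 1)"
proof -
  note U = zero_sobD[OF assms(1)]
  have "(\<lambda>x. indicator {c<..<d} x * g x) = g" using U(3) by (auto simp: indicator_def fun_eq_iff)
  moreover have "(\<lambda>x. indicator {c<..<d} x * max (u x) 0 powr (p + 1)) = (\<lambda>x. max (u x) 0 powr (p + 1))"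
  proof
    show "indicator {c<..<d} x * max (u x) 0 powr (p + 1) = max (u x) 0 powr (p + 1)" for x
      using zero_sob_outside[OF assms(1), of x] assms(2) by (cases "x \<in> {c<..<d}") auto
  qed
  ultimately show ?thesis
    using sobolev_zero_sob[OF assms(1) U(1) _ _ assms(2)] zero_sob_outside[OF assms(1), of c] zero_sob_outside[OF assms(1), of d]
    by (simp add: pow_int_def)
qed

lemma zero_sob_cmult:
  assumes "zero_sob c d u g"
  shows "zero_sob c d (\<lambda>x. t * u x) (\<lambda>x. t * g x)"
  using zero_sob_lin[OF zero_sob_tests[OF tests_zero zero_sobD(1)[OF assms]] assms, of t] by simp

lemma integrable_indicator_Icc: "integrable lebesgue (indicator {c..d::real} :: real \<Rightarrow> real)"
  by (simp add: emeasure_lborel_Icc_eq)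

lemma LINT_nl_diff_le:
  assumes v: "zero_sob c d v gv" and h: "zero_sob c d h gh" and c: "cp \<ge> 0" "cm \<ge> 0" and p: "p > 0"
    and B: "\<And>x. \<bar>v x - h x\<bar> \<le> B" and M: "\<And>x. \<bar>v x\<bar> + \<bar>h x\<bar> \<le> M"
  shows "\<bar>(LINT x|lebesgue. nl cp cm p (v x)) - (LINT x|lebesgue. nl cp cm p (h x))\<bar>
    \<le> (cp + cm) * (d - c) * B * M powr p"
proof -
  have cd: "c < d" using zero_sobD[OF v] by simp
  have B0: "B \<ge> 0" using B[of 0] by linarith
  have M0: "M \<ge> 0" using M[of 0] by linarith
  have I: "integrable lebesgue (\<lambda>x. nl cp cm p (v x))" "integrable lebesgue (\<lambda>x. nl cp cm p (h x))"
    by (rule nl_integrable[OF v p], rule nl_integrable[OF h p])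
  have "\<bar>(LINT x|lebesgue. nl cp cm p (v x)) - (LINT x|lebesgue. nl cp cm p (h x))\<bar>
      = \<bar>LINT x|lebesgue. nl cp cm p (v x) - nl cp cm p (h x)\<bar>" using I by simp
  also have "\<dots> \<le> (LINT x|lebesgue. \<bar>nl cp cm p (v x) - nl cp cm p (h x)\<bar>)"
    by (rule integral_abs_bound)
  also have "\<dots> \<le> (LINT x|lebesgue. (cp + cm) * B * M powr p * indicator {c..d} x)"
  proof (rule integral_mono)
    fix x
    show "\<bar>nl cp cm p (v x) - nl cp cm p (h x)\<bar> \<le> (cp + cm) * B * M powr p * indicator {c..d} x"
    proof (cases "x \<in> {c<..<d}")
      case True
      have "\<bar>nl cp cm p (v x) - nl cp cm p (h x)\<bar> \<le> (cp + cm) * \<bar>v x - h x\<bar> * (\<bar>v x\<bar> + \<bar>h x\<bar>) powr p"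
        by (rule nl_diff_le[OF c p])
      also have "\<dots> \<le> (cp + cm) * B * M powr p"
        using c p B M B0 by (intro mult_mono powr_mono2) auto
      finally show ?thesis using True by simp
    next
      case False
      then show ?thesis using zero_sob_outside[OF v False] zero_sob_outside[OF h False] c B0 by simp
    qed
  qed (use I integrable_indicator_Icc in auto)
  also have "\<dots> = (cp + cm) * (d - c) * B * M powr p" using cd by simp
  finally show ?thesis .
qed

text \<open>The energy of \<open>v + h\<close> is compared with that of \<open>h\<close> alone
  without the datum. Every term containing \<open>v\<close> or \<open>W\<close> goes into the error,
  through Cauchy-Schwarz, the sup bound and the Poincare inequality, so that the powers of
  \<open>d - c\<close> become explicit.\<close>

lemma En_perturbation:
  assumes v: "zero_sob c d v gv" and h: "zero_sob c d h gh" and cc: "cp \<ge> 0" "cm \<ge> 0" and p: "p > 0"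
    and W: "sq_int W"
  shows "\<bar>En cp cm p W (\<lambda>x. v x + h x) (\<lambda>x. gv x + gh x) - (1 / 2 * (nrm gh)\<^sup>2 - (LINT x|lebesgue. nl cp cm p (h x)))\<bar>
    \<le> 1 / 2 * (nrm gv)\<^sup>2 + nrm gv * nrm gh
      + (cp + cm) * (d - c) * (sqrt (d - c) * nrm gv) * (sqrt (d - c) * nrm gv + 2 * (sqrt (d - c) * nrm gh)) powr p
      + nrm W * ((d - c) * nrm gv) + nrm W * ((d - c) * nrm gh)"
proof -
  have vh: "zero_sob c d (\<lambda>x. v x + h x) (\<lambda>x. gv x + gh x)" using zero_sob_lin[OF v h, of 1] by simp
  note V = zero_sobD[OF v] and H = zero_sobD[OF h]
  have 1: "\<bar>LINT x|lebesgue. gv x * gh x\<bar> \<le> nrm gv * nrm gh" by (rule Cauchy_Schwarz[OF V(2) H(2)])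
  have 2: "\<bar>(LINT x|lebesgue. nl cp cm p (v x + h x)) - (LINT x|lebesgue. nl cp cm p (h x))\<bar>
      \<le> (cp + cm) * (d - c) * (sqrt (d - c) * nrm gv) * (sqrt (d - c) * nrm gv + 2 * (sqrt (d - c) * nrm gh)) powr p"
  proof (rule LINT_nl_diff_le[OF vh h cc p])
    show "\<bar>v x + h x - h x\<bar> \<le> sqrt (d - c) * nrm gv" for x using zero_sob_bound[OF v, of x] by simp
    show "\<bar>v x + h x\<bar> + \<bar>h x\<bar> \<le> sqrt (d - c) * nrm gv + 2 * (sqrt (d - c) * nrm gh)" for x
      using zero_sob_bound[OF v, of x] zero_sob_bound[OF h, of x] by linarith
  qed
  have 3: "\<bar>LINT x|lebesgue. W x * (v x + h x)\<bar> \<le> nrm W * ((d - c) * nrm gv) + nrm W * ((d - c) * nrm gh)"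
  proof -
    have "\<bar>LINT x|lebesgue. W x * (v x + h x)\<bar> \<le> nrm W * nrm (\<lambda>x. v x + h x)"
      by (rule Cauchy_Schwarz[OF W zero_sob_sq_int[OF vh]])
    also have "nrm (\<lambda>x. v x + h x) \<le> nrm v + nrm h"
      by (rule nrm_triangle[OF zero_sob_sq_int[OF v] zero_sob_sq_int[OF h]])
    also have "nrm v + nrm h \<le> (d - c) * nrm gv + (d - c) * nrm gh"
      by (intro add_mono zero_sob_nrm v h)
    finally show ?thesis by (simp add: distrib_left mult_left_mono)
  qed
  have "En cp cm p W (\<lambda>x. v x + h x) (\<lambda>x. gv x + gh x) - (1 / 2 * (nrm gh)\<^sup>2 - (LINT x|lebesgue. nl cp cm p (h x)))
      = 1 / 2 * (nrm gv)\<^sup>2 + (LINT x|lebesgue. gv x * gh x)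
        - ((LINT x|lebesgue. nl cp cm p (v x + h x)) - (LINT x|lebesgue. nl cp cm p (h x)))
        - (LINT x|lebesgue. W x * (v x + h x))"
    unfolding En_def nrm_add_sq[OF V(2) H(2)] by (simp add: field_simps)
  moreover have "0 \<le> 1 / 2 * (nrm gv)\<^sup>2" by simp
  ultimately show ?thesis using 1 2 3 unfolding abs_le_iff by linarith
qed

text \<open>A bootstrap: nonpositive energy and the integral constraint bound \<open>nrm gv\<close>
  independently of the length. Because \<open>p + 1 > 2\<close>, the nonlinear term on a short
  interval is then at most a quarter of \<open>(nrm gv)^2\<close>, and the datum term
  \<open>nrm W * (d - c) * nrm gv\<close> has to carry the remaining quarter.\<close>

lemma local_minimizer_small:
  assumes v: "zero_sob c d v gv" and cc: "cp \<ge> 0" "cm \<ge> 0" and p: "p > 1" and W: "sq_int W"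
    and En: "En cp cm p W v gv \<le> 0" and pw: "(LINT x|lebesgue. \<bar>v x\<bar> powr (p + 1)) \<le> 1"
    and l1: "d - c \<le> 1"
    and l2: "(cp + cm) * (d - c) * sqrt (4 * (cp + cm) + 4 * (nrm W)\<^sup>2) powr (p - 1) \<le> 1 / 4"
  shows "nrm gv \<le> 4 * nrm W * (d - c)"
proof -
  define D where "D = nrm gv"
  define l where "l = d - c"
  define K where "K = cp + cm"
  define om where "om = nrm W"
  have l: "l > 0" "l \<le> 1" using zero_sobD[OF v] l1 by (auto simp: l_def)
  have nn: "D \<ge> 0" "K \<ge> 0" "om \<ge> 0" using cc by (auto simp: D_def K_def om_def)
  have absint: "integrable lebesgue (\<lambda>x. \<bar>v x\<bar> powr (p + 1))"
  proof (rule integrable_continuous_support[of _ c d])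
    show "continuous_on UNIV (\<lambda>x. \<bar>v x\<bar> powr (p + 1))"
      by (rule continuous_on_powr_pos) (use p in \<open>auto intro!: continuous_on_rabs zero_sob_continuous[OF v]\<close>)
    show "\<bar>v x\<bar> powr (p + 1) = 0" if "x < c \<or> d < x" for x
      using zero_sob_outside[OF v, of x] that by auto
  qed
  have nl1: "(LINT x|lebesgue. nl cp cm p (v x)) \<le> K * (LINT x|lebesgue. \<bar>v x\<bar> powr (p + 1))"
  proof -
    have "(LINT x|lebesgue. nl cp cm p (v x)) \<le> (LINT x|lebesgue. K * \<bar>v x\<bar> powr (p + 1))"
      using absint nl_integrable[OF v] nl_le[OF cc] p by (intro integral_mono) (auto simp: K_def)
    then show ?thesis by simp
  qed
  have Wv: "\<bar>LINT x|lebesgue. W x * v x\<bar> \<le> om * (l * D)"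
  proof -
    have "\<bar>LINT x|lebesgue. W x * v x\<bar> \<le> nrm W * nrm v"
      by (rule Cauchy_Schwarz[OF W zero_sob_sq_int[OF v]])
    also have "\<dots> \<le> nrm W * ((d - c) * nrm gv)" by (intro mult_left_mono zero_sob_nrm[OF v]) simp
    finally show ?thesis by (simp add: om_def l_def D_def)
  qed
  have main: "1 / 2 * D\<^sup>2 \<le> (LINT x|lebesgue. nl cp cm p (v x)) + om * (l * D)"
    using En Wv unfolding En_def D_def by linarith
  have D0: "D\<^sup>2 \<le> 4 * K + 4 * om\<^sup>2"
  proof -
    have "K * (LINT x|lebesgue. \<bar>v x\<bar> powr (p + 1)) \<le> K * 1" using pw nn by (intro mult_left_mono)
    then have "(LINT x|lebesgue. nl cp cm p (v x)) \<le> K" using nl1 by linarith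
    moreover have "om * (l * D) \<le> om * D"
      using nn l by (intro mult_left_mono) (auto intro: mult_left_le_one_le)
    \<comment> \<open>Young's inequality in the form
      \<open>om * D \<le> om\<^sup>2 + D\<^sup>2 / 4\<close>, so that \<open>D\<^sup>2 / 4\<close>
      can be absorbed on the left.\<close>
    moreover have "2 * (2 * om) * D \<le> (2 * om)\<^sup>2 + D\<^sup>2" by (rule sum_squares_bound)
    moreover have "(2 * om)\<^sup>2 = 4 * om\<^sup>2" by (simp add: power_mult_distrib)
    ultimately show ?thesis using main by linarith
  qed
  have nl2: "(LINT x|lebesgue. nl cp cm p (v x)) \<le> D\<^sup>2 / 4"
  proof -
    have "(LINT x|lebesgue. nl cp cm p (v x)) \<le> (LINT x|lebesgue. K * D powr (p + 1) * indicator {c..d} x)"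
    proof (rule integral_mono)
      fix x
      show "nl cp cm p (v x) \<le> K * D powr (p + 1) * indicator {c..d} x"
      proof (cases "x \<in> {c<..<d}")
        case True
        have "\<bar>v x\<bar> \<le> sqrt l * D" using zero_sob_bound[OF v] by (simp add: l_def D_def)
        also have "\<dots> \<le> 1 * D" using l nn by (intro mult_right_mono) auto
        finally have "\<bar>v x\<bar> powr (p + 1) \<le> D powr (p + 1)" using p by (intro powr_mono2) auto
        then have "K * \<bar>v x\<bar> powr (p + 1) \<le> K * D powr (p + 1)" using nn by (intro mult_left_mono)
        moreover have "nl cp cm p (v x) \<le> K * \<bar>v x\<bar> powr (p + 1)" unfolding K_def by (rule nl_le) (use cc p in auto)
        ultimately show ?thesis using True by simp
      next
        case False
        then show ?thesis using zero_sob_outside[OF v False] nn by simp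
      qed
    qed (use nl_integrable[OF v] integrable_indicator_Icc p in auto)
    also have "\<dots> = K * D powr (p + 1) * l" using l by (simp add: l_def)
    also have "D powr (p + 1) = D powr (p - 1) * D\<^sup>2"
    proof (cases "D = 0")
      case False
      then have "D powr ((p - 1) + 2) = D powr (p - 1) * D powr 2" by (rule_tac powr_add)
      then show ?thesis using False nn by (simp add: add.commute)
    qed (use p in simp)
    also have "K * (D powr (p - 1) * D\<^sup>2) * l = (K * l * D powr (p - 1)) * D\<^sup>2" by (simp only: ac_simps)
    also have "\<dots> \<le> (1 / 4) * D\<^sup>2"
    proof (rule mult_right_mono)
      have "D \<le> sqrt (4 * K + 4 * om\<^sup>2)" using D0 by (rule real_le_rsqrt)
      then have "D powr (p - 1) \<le> sqrt (4 * K + 4 * om\<^sup>2) powr (p - 1)" using nn p by (intro powr_mono2) auto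
      then have "K * l * D powr (p - 1) \<le> K * l * sqrt (4 * K + 4 * om\<^sup>2) powr (p - 1)"
        using nn l by (intro mult_left_mono) auto
      then show "K * l * D powr (p - 1) \<le> 1 / 4" using l2 by (simp add: K_def l_def om_def)
    qed simp
    finally show ?thesis by simp
  qed
  have "D * D \<le> (4 * om * l) * D" using main nl2 by (simp add: power2_eq_square field_simps)
  then have "D \<le> 4 * om * l"
  proof (cases "D = 0")
    case False
    then show ?thesis using \<open>D * D \<le> (4 * om * l) * D\<close> nn mult_le_cancel_right[of D D "4 * om * l"] by linarith
  qed (use nn l in simp)
  then show ?thesis by (simp add: D_def om_def l_def)
qed

text \<open>For \<open>t \<ge> 1\<close> the exponent \<open>max 2 p\<close> dominates the powers
  \<open>1\<close>, \<open>t\<close>, \<open>t^2\<close> and \<open>t powr p\<close> occurring along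
  a ray, and it is below \<open>p + 1\<close> since \<open>p > 1\<close>.\<close>

lemma dominated_by_power:
  fixes p J C :: real
  assumes "p > 1" "J > 0"
  obtains T where "T \<ge> 1" "\<And>t. t \<ge> T \<Longrightarrow> C * t powr (max 2 p) \<le> J * t powr (p + 1)"
proof -
  define e where "e = p + 1 - max 2 p"
  have e: "e > 0" using assms by (simp add: e_def)
  define T where "T = max 1 ((max 0 C / J) powr (1 / e))"
  have "C * t powr (max 2 p) \<le> J * t powr (p + 1)" if t: "t \<ge> T" for t
  proof -
    have t1: "t \<ge> 1" "t \<ge> (max 0 C / J) powr (1 / e)" using t by (auto simp: T_def)
    have "max 0 C / J = ((max 0 C / J) powr (1 / e)) powr e"
      using e assms by (simp add: powr_powr)
    also have "\<dots> \<le> t powr e" using t1 e by (intro powr_mono2) auto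
    finally have "max 0 C \<le> J * t powr e" using assms by (simp add: field_simps)
    then have "C \<le> J * t powr e" by linarith
    then have "C * t powr (max 2 p) \<le> J * t powr e * t powr (max 2 p)" by (intro mult_right_mono) auto
    also have "\<dots> = J * t powr (e + max 2 p)" by (simp add: powr_add)
    finally show ?thesis by (simp add: e_def)
  qed
  then show ?thesis using that[of T] by (simp add: T_def)
qed

text \<open>\<open>GREATEST\<close> has the intended meaning only if the maximum is attained;
  continuity on a compact interval and the comparison with \<open>t = 0\<close> beyond
  \<open>T\<close> provide this.\<close>

lemma ray_max_attained:
  assumes eq: "\<And>t. t \<ge> 0 \<Longrightarrow> F (\<lambda>x. v x + t * (u x - v x)) = f t"
    and cont: "\<And>T. continuous_on {0..T} f" and dec: "\<And>t. t \<ge> T \<Longrightarrow> f t \<le> f 0"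
  shows "\<And>t. t \<ge> 0 \<Longrightarrow> f t \<le> ray_max F v u" "\<exists>t\<ge>0. ray_max F v u = f t"
proof -
  have "\<exists>x\<in>{0..max T 0}. \<forall>y\<in>{0..max T 0}. f y \<le> f x"
    by (rule continuous_attains_sup) (use cont in auto)
  then obtain t1 where t1: "t1 \<in> {0..max T 0}" "\<And>t. t \<in> {0..max T 0} \<Longrightarrow> f t \<le> f t1" by blast
  have le: "f t \<le> f t1" if "t \<ge> 0" for t
  proof (cases "t \<le> max T 0")
    case False
    then have "f t \<le> f 0" using dec by simp
    also have "f 0 \<le> f t1" by (rule t1(2)) simp
    finally show ?thesis .
  qed (use t1(2) that in simp)
  have "ray_max F v u = f t1"
    unfolding ray_max_def
  proof (rule Greatest_equality)
    show "\<exists>t\<ge>0. f t1 = F (\<lambda>x. v x + t * (u x - v x))" using t1(1) eq[of t1] by (intro exI[of _ t1]) auto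
    show "y \<le> f t1" if "\<exists>t\<ge>0. y = F (\<lambda>x. v x + t * (u x - v x))" for y
      using that eq le by auto
  qed
  then show "\<And>t. t \<ge> 0 \<Longrightarrow> f t \<le> ray_max F v u" "\<exists>t\<ge>0. ray_max F v u = f t"
    using le t1(1) by auto
qed

text \<open>The quadratic and linear parts are polynomials in \<open>t\<close>; the nonlinear
  integral is Lipschitz on bounded ranges of \<open>t\<close>.\<close>

lemma En_ray_continuous:
  assumes v: "zero_sob c d v gv" and h: "zero_sob c d h gh" and cc: "cp \<ge> 0" "cm \<ge> 0" and p: "p > 0"
    and W: "sq_int W"
  shows "continuous_on {0..T} (\<lambda>t. En cp cm p W (\<lambda>x. v x + t * h x) (\<lambda>x. gv x + t * gh x))"
proof -
  note V = zero_sobD[OF v] and H = zero_sobD[OF h]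
  define B where "B = sqrt (d - c) * nrm gh"
  define M where "M = 2 * (sqrt (d - c) * nrm gv + T * B)"
  have B0: "B \<ge> 0" using V(1) by (simp add: B_def)
  have hB: "\<bar>h x\<bar> \<le> B" for x unfolding B_def by (rule zero_sob_bound[OF h])
  have vB: "\<bar>v x\<bar> \<le> sqrt (d - c) * nrm gv" for x by (rule zero_sob_bound[OF v])
  have "continuous_on {0..T} (\<lambda>t. LINT x|lebesgue. nl cp cm p (v x + t * h x))"
  proof (rule lipschitz_on_continuous_on, rule lipschitz_onI)
    fix t t' assume t: "t \<in> {0..T}" "t' \<in> {0..T}"
    have "\<bar>(LINT x|lebesgue. nl cp cm p (v x + t * h x)) - (LINT x|lebesgue. nl cp cm p (v x + t' * h x))\<bar>
        \<le> (cp + cm) * (d - c) * (\<bar>t - t'\<bar> * B) * M powr p"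
    proof (rule LINT_nl_diff_le[OF zero_sob_lin[OF v h] zero_sob_lin[OF v h] cc p])
      fix x
      have "v x + t * h x - (v x + t' * h x) = (t - t') * h x" by (simp add: left_diff_distrib)
      then show "\<bar>v x + t * h x - (v x + t' * h x)\<bar> \<le> \<bar>t - t'\<bar> * B"
        using mult_left_mono[OF hB[of x], of "\<bar>t - t'\<bar>"] by (simp add: abs_mult)
      have *: "\<bar>r * h x\<bar> \<le> T * B" if "r \<in> {0..T}" for r
        using that hB[of x] B0 by (auto simp: abs_mult intro!: mult_mono)
      have "\<bar>v x + r * h x\<bar> \<le> sqrt (d - c) * nrm gv + T * B" if "r \<in> {0..T}" for r
        by (rule order_trans[OF abs_triangle_ineq add_mono[OF vB *[OF that]]])
      from add_mono[OF this[OF t(1)] this[OF t(2)]]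
      show "\<bar>v x + t * h x\<bar> + \<bar>v x + t' * h x\<bar> \<le> M" by (simp only: M_def mult_2)
    qed
    then show "dist (LINT x|lebesgue. nl cp cm p (v x + t * h x)) (LINT x|lebesgue. nl cp cm p (v x + t' * h x))
        \<le> ((cp + cm) * (d - c) * B * M powr p) * dist t t'"
      by (simp add: dist_real_def ac_simps)
    next
    show "0 \<le> (cp + cm) * (d - c) * B * M powr p" using cc V(1) B0 by simp
  qed
  moreover have "(nrm (\<lambda>x. gv x + t * gh x))\<^sup>2 = (nrm gv)\<^sup>2 + 2 * (t * (LINT x|lebesgue. gv x * gh x)) + t\<^sup>2 * (nrm gh)\<^sup>2" for t
    using nrm_add_sq[OF V(2) sq_int_cmult[OF H(2), of t]]
    by (simp add: nrm_cmult power_mult_distrib mult.left_commute[of _ t])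
  moreover have "(LINT x|lebesgue. W x * (v x + t * h x)) = (LINT x|lebesgue. W x * v x) + t * (LINT x|lebesgue. W x * h x)" for t
  proof -
    have "(LINT x|lebesgue. W x * (v x + t * h x)) = (LINT x|lebesgue. W x * v x + t * (W x * h x))"
      by (simp add: algebra_simps)
    then show ?thesis using sq_int_mult[OF W zero_sob_sq_int[OF v]] sq_int_mult[OF W zero_sob_sq_int[OF h]] by simp
  qed
  ultimately show ?thesis unfolding En_def by (auto intro!: continuous_intros)
qed

section \<open>The scale of a ground state and the size of the perturbation\<close>

definition decay :: "real \<Rightarrow> real" where
  "decay p = (p + 3) / (p - 1)"

text \<open>The \<open>L2\<close>-norm of the derivative of a ground state on an interval of length \<open>l\<close>; the ground state
  energy is \<open>1/2 - 1/(p+1)\<close> times its square.\<close>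

definition ground_norm :: "real \<Rightarrow> real \<Rightarrow> real \<Rightarrow> real" where
  "ground_norm p c l = (c * sob_const p) powr (- 1 / (p - 1)) * l powr (- decay p / 2)"

lemma ground_norm_pos:
  assumes "p > 1" "c > 0" "l > 0"
  shows "ground_norm p c l > 0"
  using assms sob_const_pos[of p] by (simp add: ground_norm_def)

text \<open>This is the Nehari condition combined with equality in the Sobolev inequality, the
  identity that a ground state would satisfy; it determines both the constant and the exponent in
  \<open>ground_norm\<close>.\<close>

lemma ground_norm_eq:
  assumes p: "p > 1" and c: "c > 0" and l: "l > 0"
  shows "c * (sob_const p * l powr ((p + 3) / 2) * ground_norm p c l powr (p + 1)) = (ground_norm p c l)\<^sup>2"
proof -
  define X where "X = c * sob_const p"
  have X: "X > 0" using c sob_const_pos[of p] p by (simp add: X_def)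
  have "c * (sob_const p * l powr ((p + 3) / 2) * ground_norm p c l powr (p + 1))
      = X powr 1 * l powr ((p + 3) / 2) * (X powr (- 1 / (p - 1) * (p + 1)) * l powr (- decay p / 2 * (p + 1)))"
    using X l by (simp add: ground_norm_def X_def[symmetric] powr_mult powr_powr mult.assoc[symmetric])
  also have "\<dots> = X powr (1 + - 1 / (p - 1) * (p + 1)) * l powr ((p + 3) / 2 + - decay p / 2 * (p + 1))"
    by (simp only: powr_add ac_simps)
  also have "1 + - 1 / (p - 1) * (p + 1) = - 1 / (p - 1) * 2" using p by (simp add: field_simps)
  also have "(p + 3) / 2 + - decay p / 2 * (p + 1) = - decay p / 2 * 2" using p by (simp add: decay_def field_simps)
  also have "X powr (- 1 / (p - 1) * 2) * l powr (- decay p / 2 * 2) = (ground_norm p c l) powr 2"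
    using X l by (simp only: ground_norm_def X_def[symmetric]) (simp add: powr_mult powr_powr)
  finally show ?thesis using ground_norm_pos[OF p c l] by simp
qed

text \<open>\<open>A\<close> is \<open>t\<close> times a ground norm, and every error term is
  compared with \<open>y = l powr (1 - decay p / 2)\<close>, the size of the mixed terms
  \<open>D * A\<close> and \<open>om * (l * A)\<close>. The constants add up over the terms:
  \<open>12 = 8 + 4\<close> for \<open>om^2\<close> and \<open>5 = 4 + 1\<close> for
  \<open>om * r0\<close>.\<close>

lemma perturbation_error_bound:
  fixes p l om K r0 D t :: real
  assumes p: "p > 1" and l: "0 < l" "l \<le> 1" and nn: "om \<ge> 0" "K \<ge> 0" "r0 \<ge> 0"
    and D: "0 \<le> D" "D \<le> 4 * om * l" and t: "t \<ge> 0" and A: "A = t * (r0 * l powr (- decay p / 2))"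
  shows "1 / 2 * D\<^sup>2 + D * A + K * l * (sqrt l * D) * (sqrt l * D + 2 * (sqrt l * A)) powr p + om * (l * D) + om * (l * A)
    \<le> (12 * om\<^sup>2 + 5 * om * r0 + 4 * K * om * (4 * om + 2 * r0) powr p) * l powr (1 - decay p / 2) * (1 + t powr p)"
proof -
  define y where "y = l powr (1 - decay p / 2)"
  \<comment> \<open>The order of \<open>sqrt l\<close> times a ground norm, which is the scale of
    the sup bound.\<close>
  define z where "z = l powr ((1 - decay p) / 2)"
  have b: "decay p > 1" using p by (simp add: decay_def)
  have y: "y > 0" using l by (simp add: y_def)
  have z: "z \<ge> 1"
    using powr_mono'[of "(1 - decay p) / 2" 0 l] l b by (simp add: z_def)
  have tp: "t \<le> 1 + t powr p"
  proof (cases "t \<le> 1")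
    case False
    then have "t powr 1 \<le> t powr p" using p by (intro powr_mono) auto
    then show ?thesis using False by simp
  qed (simp add: add_increasing2)
  have tp1: "1 \<le> 1 + t powr p" by simp
  have l2: "l * l \<le> y"
  proof -
    have "l powr 2 \<le> y" unfolding y_def using l b by (intro powr_mono') auto
    then show ?thesis using l by (simp add: power2_eq_square)
  qed
  have ly: "l * l powr (- decay p / 2) = y"
    using l powr_add[of l 1 "- decay p / 2"] by (simp add: y_def)
  have sz: "sqrt l * l powr (- decay p / 2) = z"
    using l by (simp add: z_def powr_half_sqrt[symmetric] powr_add[symmetric] diff_divide_distrib)
  have T1: "1 / 2 * D\<^sup>2 \<le> 8 * om\<^sup>2 * y"
  proof -
    have "D\<^sup>2 \<le> (4 * om * l)\<^sup>2" using D by (intro power_mono) auto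
    also have "\<dots> = 16 * om\<^sup>2 * (l * l)" by (simp add: power2_eq_square)
    also have "\<dots> \<le> 16 * om\<^sup>2 * y" using l2 by (intro mult_left_mono) auto
    finally show ?thesis by simp
  qed
  have A0: "A \<ge> 0" using A t nn by simp
  have lA: "l * A = t * r0 * y" 
  proof -
    have "l * A = t * r0 * (l * l powr (- decay p / 2))" unfolding A by (simp only: ac_simps)
    then show ?thesis by (simp only: ly)
  qed
  have T2: "D * A \<le> 4 * om * r0 * y * t"
  proof -
    have "D * A \<le> 4 * om * l * A" using D A0 by (intro mult_right_mono) auto
    also have "\<dots> = 4 * om * (l * A)" by simp
    finally show ?thesis unfolding lA by (simp add: ac_simps)
  qed
  have T4: "om * (l * D) \<le> 4 * om\<^sup>2 * y"
  proof -
    have "om * (l * D) \<le> om * (l * (4 * om * l))" using D nn l by (intro mult_left_mono) auto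
    also have "\<dots> = 4 * om\<^sup>2 * (l * l)" by (simp add: power2_eq_square)
    also have "\<dots> \<le> 4 * om\<^sup>2 * y" using l2 by (intro mult_left_mono) auto
    finally show ?thesis .
  qed
  have T5: "om * (l * A) = om * r0 * y * t" unfolding lA by (simp add: ac_simps)
  have T3: "K * l * (sqrt l * D) * (sqrt l * D + 2 * (sqrt l * A)) powr p
      \<le> 4 * K * om * (4 * om + 2 * r0) powr p * y * (1 + t powr p)"
  proof -
    have sD: "sqrt l * D \<le> 4 * om * (l * sqrt l)"
      using mult_left_mono[OF D(2), of "sqrt l"] l by (simp add: ac_simps)
    have "l * sqrt l \<le> 1" using l mult_le_one[of l "sqrt l"] by simp
    then have "4 * om * (l * sqrt l) \<le> 4 * om * z" using nn z by (intro mult_left_mono) auto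
    then have sD': "sqrt l * D \<le> 4 * om * z" using sD by linarith
    have sA: "sqrt l * A = t * r0 * z" 
    proof -
      have "sqrt l * A = t * r0 * (sqrt l * l powr (- decay p / 2))" unfolding A by (simp only: ac_simps)
      then show ?thesis by (simp only: sz)
    qed
    have "sqrt l * D + 2 * (sqrt l * A) \<le> z * ((4 * om + 2 * r0) * max 1 t)"
    proof -
      have "4 * om * 1 \<le> 4 * om * max 1 t" "2 * r0 * t \<le> 2 * r0 * max 1 t" using nn by (intro mult_left_mono; simp)+
      then have "4 * om + 2 * r0 * t \<le> (4 * om + 2 * r0) * max 1 t" by (simp add: distrib_right)
      then have "z * (4 * om + 2 * r0 * t) \<le> z * ((4 * om + 2 * r0) * max 1 t)" using z by (intro mult_left_mono) auto
      then show ?thesis using sD' unfolding sA by (simp add: algebra_simps)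
    qed
    then have "(sqrt l * D + 2 * (sqrt l * A)) powr p \<le> (z * ((4 * om + 2 * r0) * max 1 t)) powr p"
      using p l D A0 by (intro powr_mono2) auto
    also have "\<dots> = z powr p * ((4 * om + 2 * r0) powr p * max 1 t powr p)"
      using z nn by (simp add: powr_mult)
    also have "\<dots> \<le> z powr p * ((4 * om + 2 * r0) powr p * (1 + t powr p))"
      by (intro mult_left_mono) (auto simp: max_def)
    finally have 1: "(sqrt l * D + 2 * (sqrt l * A)) powr p \<le> z powr p * ((4 * om + 2 * r0) powr p * (1 + t powr p))" .
    have "K * l * (sqrt l * D) * (sqrt l * D + 2 * (sqrt l * A)) powr p
      \<le> K * l * (4 * om * (l * sqrt l)) * (z powr p * ((4 * om + 2 * r0) powr p * (1 + t powr p)))"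
    proof (rule mult_mono[OF _ 1])
      show "K * l * (sqrt l * D) \<le> K * l * (4 * om * (l * sqrt l))"
        by (rule mult_left_mono[OF sD]) (use nn l in simp)
    qed (use nn l in simp_all)
    also have "\<dots> = 4 * K * om * (4 * om + 2 * r0) powr p * (l * l * sqrt l * z powr p) * (1 + t powr p)"
      by (simp only: ac_simps)
    also have "l * l * sqrt l * z powr p = y"
    proof -
      have "l * l * sqrt l * z powr p = l powr 1 * l powr 1 * l powr (1 / 2) * l powr ((1 - decay p) / 2 * p)"
        using l by (simp add: z_def powr_powr powr_half_sqrt)
      also have "\<dots> = l powr (1 + 1 + 1 / 2 + (1 - decay p) / 2 * p)" by (simp only: powr_add)
      \<comment> \<open>By the value of \<open>decay p\<close> the nonlinear term has exactly the
        same order in \<open>l\<close> as the mixed terms.\<close>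
      also have "1 + 1 + 1 / 2 + (1 - decay p) / 2 * p = 1 - decay p / 2" using p by (simp add: decay_def field_simps)
      finally show ?thesis by (simp add: y_def)
    qed
    finally show ?thesis .
  qed
  have U: "12 * om\<^sup>2 * y \<le> 12 * om\<^sup>2 * y * (1 + t powr p)" "5 * om * r0 * y * t \<le> 5 * om * r0 * y * (1 + t powr p)"
  proof -
    have "12 * om\<^sup>2 * y * 1 \<le> 12 * om\<^sup>2 * y * (1 + t powr p)" using y by (intro mult_left_mono tp1) simp
    then show "12 * om\<^sup>2 * y \<le> 12 * om\<^sup>2 * y * (1 + t powr p)" by simp
    show "5 * om * r0 * y * t \<le> 5 * om * r0 * y * (1 + t powr p)" using y nn by (intro mult_left_mono tp) simp
  qed
  have "1 / 2 * D\<^sup>2 + D * A + K * l * (sqrt l * D) * (sqrt l * D + 2 * (sqrt l * A)) powr p + om * (l * D) + om * (l * A)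
      \<le> 12 * om\<^sup>2 * y + 5 * om * r0 * y * t + 4 * K * om * (4 * om + 2 * r0) powr p * y * (1 + t powr p)"
    using T1 T2 T3 T4 T5 by linarith
  also have "\<dots> \<le> 12 * om\<^sup>2 * y * (1 + t powr p) + 5 * om * r0 * y * (1 + t powr p) + 4 * K * om * (4 * om + 2 * r0) powr p * y * (1 + t powr p)"
    using U by linarith
  also have "\<dots> = (12 * om\<^sup>2 + 5 * om * r0 + 4 * K * om * (4 * om + 2 * r0) powr p) * y * (1 + t powr p)"
    by (simp add: algebra_simps)
  finally show ?thesis by (simp add: y_def)
qed

text \<open>A direction of one sign with positive \<open>pow_int\<close> contributes
  \<open>- J * t powr (p + 1)\<close>, which beats every other term for large
  \<open>t\<close>.\<close>

lemma En_ray_coercive: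
  assumes v: "zero_sob c d v gv" and h: "zero_sob c d h gh" and cc: "cp > 0" "cm > 0" and p: "p > 1"
    and W: "sq_int W" and s: "s = 1 \<or> s = -1" and sh: "\<And>x. s * h x \<ge> 0" and pos: "pow_int p (\<lambda>x. s * h x) > 0"
  obtains T where "\<And>t. t \<ge> T \<Longrightarrow> En cp cm p W (\<lambda>x. v x + t * h x) (\<lambda>x. gv x + t * gh x) \<le> En cp cm p W v gv"
proof -
  define l where "l = d - c"
  define D where "D = nrm gv"
  define A where "A = nrm gh"
  define K where "K = cp + cm"
  define om where "om = nrm W"
  define J where "J = sgn_coeff cp cm s / (p + 1) * pow_int p (\<lambda>x. s * h x)"
  define Z where "Z = K * l * (sqrt l * D) * (sqrt l * D + 2 * (sqrt l * A)) powr p"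
  \<comment> \<open>The coefficients of all terms that grow at most like
    \<open>t powr (max 2 p)\<close> are added up; the absolute value of the energy at
    \<open>t = 0\<close> is included so that the final bound falls below that energy itself.\<close>
  define C where "C = 1 / 2 * A\<^sup>2 + 1 / 2 * D\<^sup>2 + D * A + Z + om * (l * D) + om * (l * A) + \<bar>En cp cm p W v gv\<bar>"
  have l: "l > 0" using zero_sobD[OF v] by (simp add: l_def)
  have nn: "D \<ge> 0" "A \<ge> 0" "K \<ge> 0" "om \<ge> 0" using cc by (auto simp: D_def A_def K_def om_def)
  have J: "J > 0" using pos cc p by (auto simp: J_def sgn_coeff_def)
  obtain T where T: "T \<ge> 1" "\<And>t. t \<ge> T \<Longrightarrow> C * t powr (max 2 p) \<le> J * t powr (p + 1)"
    by (rule dominated_by_power[OF p J, of C]) blast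
  have "En cp cm p W (\<lambda>x. v x + t * h x) (\<lambda>x. gv x + t * gh x) \<le> En cp cm p W v gv" if "t \<ge> T" for t
  proof -
    have t: "t \<ge> 1" using that T by simp
    have nlt: "(LINT x|lebesgue. nl cp cm p (t * h x)) = J * t powr (p + 1)"
    proof -
      have "(LINT x|lebesgue. nl cp cm p (t * h x)) = (LINT x|lebesgue. nl cp cm p (s * (t * (s * h x))))"
        using s by auto
      also have "\<dots> = sgn_coeff cp cm s / (p + 1) * pow_int p (\<lambda>x. t * (s * h x))"
        by (rule LINT_nl_signed[OF s]) (use sh t in simp)
      also have "\<dots> = J * t powr (p + 1)" using t by (simp add: pow_int_cmult J_def)
      finally show ?thesis .
    qed
    have nt: "nrm (\<lambda>x. t * gh x) = t * A" using t by (simp add: nrm_cmult A_def)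
    define m where "m = t powr (max 2 p)"
    have m: "1 \<le> m" "t \<le> m" "t\<^sup>2 \<le> m" "t powr p \<le> m"
    proof -
      show "1 \<le> m" unfolding m_def using t by (intro ge_one_powr_ge_zero) auto
      have "t powr 1 \<le> m" "t powr 2 \<le> m" "t powr p \<le> m" unfolding m_def using t by (intro powr_mono; simp)+
      then show "t \<le> m" "t\<^sup>2 \<le> m" "t powr p \<le> m" using t by auto
    qed
    have P: "(sqrt l * D + 2 * (sqrt l * (t * A))) powr p \<le> (sqrt l * D + 2 * (sqrt l * A)) powr p * m"
    proof -
      have "sqrt l * D * 1 \<le> sqrt l * D * t" using nn l t by (intro mult_left_mono) auto
      then have "sqrt l * D + 2 * (sqrt l * (t * A)) \<le> (sqrt l * D + 2 * (sqrt l * A)) * t" by (simp add: algebra_simps)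
      then have "(sqrt l * D + 2 * (sqrt l * (t * A))) powr p \<le> ((sqrt l * D + 2 * (sqrt l * A)) * t) powr p"
        using nn l t p by (intro powr_mono2) auto
      also have "\<dots> = (sqrt l * D + 2 * (sqrt l * A)) powr p * t powr p" using nn l t by (simp add: powr_mult)
      also have "\<dots> \<le> (sqrt l * D + 2 * (sqrt l * A)) powr p * m" using m by (intro mult_left_mono) auto
      finally show ?thesis .
    qed
    have "En cp cm p W (\<lambda>x. v x + t * h x) (\<lambda>x. gv x + t * gh x) \<le> 1 / 2 * (t * A)\<^sup>2 - J * t powr (p + 1)
      + (1 / 2 * D\<^sup>2 + D * (t * A) + K * l * (sqrt l * D) * (sqrt l * D + 2 * (sqrt l * (t * A))) powr p
        + om * (l * D) + om * (l * (t * A)))"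
      using En_perturbation[OF v zero_sob_cmult[OF h, of t], of cp cm p W] cc p W
      unfolding nlt nt by (simp add: D_def K_def om_def l_def abs_le_iff)
    also have "\<dots> \<le> (1 / 2 * A\<^sup>2) * m - J * t powr (p + 1) + ((1 / 2 * D\<^sup>2) * m + (D * A) * m + Z * m + (om * (l * D)) * m + (om * (l * A)) * m)"
    proof -
      have "1 / 2 * (t * A)\<^sup>2 \<le> (1 / 2 * A\<^sup>2) * m" using mult_left_mono[OF m(3), of "1 / 2 * A\<^sup>2"] by (simp add: power_mult_distrib ac_simps)
      moreover have "(1 / 2 * D\<^sup>2) * 1 \<le> (1 / 2 * D\<^sup>2) * m" by (rule mult_left_mono) (use m in auto)
      moreover have "(D * A) * t \<le> (D * A) * m" by (rule mult_left_mono) (use m nn in auto)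
      moreover have "K * l * (sqrt l * D) * (sqrt l * D + 2 * (sqrt l * (t * A))) powr p
          \<le> K * l * (sqrt l * D) * ((sqrt l * D + 2 * (sqrt l * A)) powr p * m)"
        by (rule mult_left_mono[OF P]) (use nn l in simp)
      moreover have "(om * (l * D)) * 1 \<le> (om * (l * D)) * m" by (rule mult_left_mono) (use m nn l in auto)
      moreover have "(om * (l * A)) * t \<le> (om * (l * A)) * m" by (rule mult_left_mono) (use m nn l in auto)
      ultimately show ?thesis unfolding Z_def by (simp add: ac_simps)
    qed
    also have "\<dots> = (C - \<bar>En cp cm p W v gv\<bar>) * m - J * t powr (p + 1)" by (simp add: C_def algebra_simps)
    also have "\<dots> \<le> C * m - \<bar>En cp cm p W v gv\<bar> - J * t powr (p + 1)"
      using mult_left_mono[OF m(1), of "\<bar>En cp cm p W v gv\<bar>"] by (simp add: left_diff_distrib)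
    also have "\<dots> \<le> En cp cm p W v gv" using T(2)[OF that] by (simp add: m_def)
    finally show ?thesis .
  qed
  then show ?thesis using that by blast
qed

text \<open>The left side is the normalised energy along the ray through a ground state, with
  maximum at \<open>t = 1\<close>. It follows from Young's inequality for \<open>t^2 * 1\<close>
  with the conjugate exponents \<open>(p + 1) / 2\<close> and
  \<open>(p + 1) / (p - 1)\<close>.\<close>

lemma power_balance:
  fixes p t :: real
  assumes p: "p > 1" and t: "t \<ge> 0"
  shows "t\<^sup>2 / 2 - t powr (p + 1) / (p + 1) \<le> 1 / 2 - 1 / (p + 1)"
proof -
  have "t\<^sup>2 / 2 \<le> t powr (p + 1) / (p + 1) + (1 / 2 - 1 / (p + 1))"
  proof (cases "t = 0")
    case False
    then have t: "t > 0" using t by auto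
    have "t\<^sup>2 * 1 \<le> t\<^sup>2 powr ((p + 1) / 2) / ((p + 1) / 2) + 1 powr ((p + 1) / (p - 1)) / ((p + 1) / (p - 1))"
    proof (rule Youngs_inequality)
      show "1 / ((p + 1) / 2) + 1 / ((p + 1) / (p - 1)) = 1"
        using p by (simp add: add_divide_distrib[symmetric])
    qed (use p in \<open>auto simp: field_simps\<close>)
    moreover have "t\<^sup>2 powr ((p + 1) / 2) = t powr (p + 1)"
    proof -
      have "t\<^sup>2 = t powr 2" using t by simp
      then have "t\<^sup>2 powr ((p + 1) / 2) = t powr (2 * ((p + 1) / 2))" by (simp only: powr_powr)
      also have "2 * ((p + 1) / 2) = p + 1" by (simp add: field_simps)
      finally show ?thesis .
    qed
    ultimately have "t\<^sup>2 \<le> t powr (p + 1) / ((p + 1) / 2) + 1 / ((p + 1) / (p - 1))" by simp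
    moreover have "(p - 1) / (p + 1) = 1 - 2 / (p + 1)" using p by (simp add: field_simps)
    ultimately have "t\<^sup>2 \<le> 2 * (t powr (p + 1) / (p + 1)) + (1 - 2 * (1 / (p + 1)))" by (simp add: mult.commute)
    then show ?thesis by linarith
  qed (use p in simp)
  then show ?thesis by linarith
qed

text \<open>For a continuous function the sign condition is closed, so it extends from almost every
  point of an open interval to all of it.\<close>

lemma zero_sob_AE_nonneg:
  assumes u: "zero_sob c d u g" and s: "AE x in lebesgue. x \<in> {c<..<d} \<longrightarrow> s * u x \<ge> 0"
  shows "s * u x \<ge> 0"
proof (cases "x \<in> {c<..<d}")
  case True
  have "closed {x. 0 \<le> s * u x}"
    by (intro closed_Collect_le continuous_on_const continuous_on_mult zero_sob_continuous[OF u])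
  moreover have "AE x \<in> {c<..<d} in lebesgue. x \<in> {x. 0 \<le> s * u x}" using s by eventually_elim simp
  ultimately have "x \<in> {x. 0 \<le> s * u x}"
    by (intro mem_closed_if_AE_lebesgue_open[OF open_greaterThanLessThan _ _ True])
  then show ?thesis by simp
qed (use zero_sob_outside[OF u] in simp)

lemma pow_int_zero_AE:
  assumes u: "zero_sob c d u g" and p: "p > 0" and z: "pow_int p u = 0"
  shows "AE x in lebesgue. u x \<le> 0"
proof -
  have i: "integrable lebesgue (\<lambda>x. max (u x) 0 powr (p + 1))"
    by (rule pow_int_integrable[of _ c d]) (use zero_sob_continuous[OF u] zero_sob_outside[OF u] p in auto)
  have "AE x in lebesgue. max (u x) 0 powr (p + 1) = 0"
    using z unfolding pow_int_def by (subst (asm) integral_nonneg_eq_0_iff_AE[OF i]) auto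
  then show ?thesis by eventually_elim (auto simp: max_def split: if_splits)
qed

lemma ground_norm_sq:
  assumes "l > 0"
  shows "(ground_norm p c l)\<^sup>2 = ((c * sob_const p) powr (- 1 / (p - 1)))\<^sup>2 * l powr (- decay p)"
proof -
  have "(l powr (- decay p / 2))\<^sup>2 = l powr (- decay p / 2 + - decay p / 2)"
    by (simp only: powr_add power2_eq_square)
  then show ?thesis unfolding ground_norm_def by (simp add: power_mult_distrib)
qed

section \<open>Two-sided comparison of the min-max value with the ground state energy\<close>

locale dirichlet_energy =
  fixes a b cp cm p :: real and w :: "real \<Rightarrow> real"
  assumes ab: "a < b" and cp: "cp > 0" and cm: "cm > 0" and p: "p > 1" and w: "w \<in> L2 {a<..<b}"
begin

definition W where "W x = indicator {a<..<b} x * w x"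

abbreviation F where "F \<equiv> energy cp cm p {a<..<b} w"

abbreviation coeff where "coeff \<equiv> sgn_coeff cp cm"

text \<open>If the squared derivative norm equals the coefficient times \<open>pow_int\<close>, the
  energy without datum is this multiple of the squared norm.\<close>

abbreviation kap where "kap \<equiv> 1 / 2 - 1 / (p + 1)"

abbreviation gn where "gn s \<equiv> ground_norm p (coeff s)"

definition pre where "pre s = (coeff s * sob_const p) powr (- 1 / (p - 1))"

text \<open>The constant of \<open>perturbation_error_bound\<close> for \<open>om = nrm W\<close>,
  \<open>K = cp + cm\<close> and \<open>r0 = pre s\<close>.\<close>

definition err where
  "err s = 12 * (nrm W)\<^sup>2 + 5 * nrm W * pre s + 4 * (cp + cm) * nrm W * (4 * nrm W + 2 * pre s) powr p"

lemma W: "sq_int W"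
  using w by (simp add: W_def[abs_def] L2_iff)

lemma coeff_pos: "coeff s > 0"
  using cp cm by (simp add: sgn_coeff_def)

lemma pre_pos: "pre s > 0"
  using coeff_pos[of s] sob_const_pos[of p] p by (simp add: pre_def)

lemma err_nonneg: "err s \<ge> 0"
  using pre_pos[of s] cp cm by (simp add: err_def)

lemma gn_eq: "gn s l = pre s * l powr (- decay p / 2)"
  by (simp add: ground_norm_def pre_def)

lemma gn_sq: "l > 0 \<Longrightarrow> (gn s l)\<^sup>2 = (pre s)\<^sup>2 * l powr (- decay p)"
  by (simp add: ground_norm_sq pre_def)

lemma F_eq:
  assumes "zero_sob c d v g" "a \<le> c" "d \<le> b" "AE x in lebesgue. u x = v x"
  shows "F u = En cp cm p W v g"
  using energy_zero_sob[OF ab p w zero_sob_mono[OF assms(1-3)] assms(4)] by (simp add: W_def[abs_def])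

lemma energy_ray:
  assumes v: "zero_sob c d v gv" and u: "zero_sob c d u gu" and cd: "a \<le> c" "d \<le> b"
    and ae: "AE x in lebesgue. v' x = v x" "AE x in lebesgue. u' x = u x"
  shows "F (\<lambda>x. v' x + t * (u' x - v' x)) =
    En cp cm p W (\<lambda>x. v x + t * (u x + (-1) * v x)) (\<lambda>x. gv x + t * (gu x + (-1) * gv x))"
proof (rule F_eq[OF zero_sob_lin[OF v zero_sob_lin[OF u v]] cd])
  show "AE x in lebesgue. v' x + t * (u' x - v' x) = v x + t * (u x + (-1) * v x)"
    using ae by eventually_elim simp
qed

lemma ray_max_facts:
  assumes v: "zero_sob c d v gv" and u: "zero_sob c d u gu" and cd: "a \<le> c" "d \<le> b"
    and ae: "AE x in lebesgue. v' x = v x" "AE x in lebesgue. u' x = u x"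
    and s: "s = 1 \<or> s = -1" and sh: "\<And>x. s * (u x + (-1) * v x) \<ge> 0"
    and pos: "pow_int p (\<lambda>x. s * (u x + (-1) * v x)) > 0"
  shows "\<And>t. t \<ge> 0 \<Longrightarrow> En cp cm p W (\<lambda>x. v x + t * (u x + (-1) * v x)) (\<lambda>x. gv x + t * (gu x + (-1) * gv x)) \<le> ray_max F v' u'"
    "\<exists>t\<ge>0. ray_max F v' u' = En cp cm p W (\<lambda>x. v x + t * (u x + (-1) * v x)) (\<lambda>x. gv x + t * (gu x + (-1) * gv x))"
proof -
  note h = zero_sob_lin[OF u v, of "-1"]
  define f where "f t = En cp cm p W (\<lambda>x. v x + t * (u x + (-1) * v x)) (\<lambda>x. gv x + t * (gu x + (-1) * gv x))" for t
  have p0: "p > 0" and c0: "cp \<ge> 0" "cm \<ge> 0" using p cp cm by auto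
  obtain T where T: "\<And>t. t \<ge> T \<Longrightarrow> En cp cm p W (\<lambda>x. v x + t * (u x + (-1) * v x)) (\<lambda>x. gv x + t * (gu x + (-1) * gv x)) \<le> En cp cm p W v gv"
    by (rule En_ray_coercive[OF v h cp cm p W s sh pos]) blast
  have eq: "F (\<lambda>x. v' x + t * (u' x - v' x)) = f t" if "t \<ge> 0" for t
    unfolding f_def by (rule energy_ray[OF v u cd ae])
  have cont: "continuous_on {0..T} f" for T
    unfolding f_def[abs_def] by (rule En_ray_continuous[OF v h c0 p0 W])
  have dec: "f t \<le> f 0" if "t \<ge> T" for t using T[OF that] by (simp add: f_def)
  note R = ray_max_attained[of F v' u' f T, OF eq cont dec]
  show "\<And>t. t \<ge> 0 \<Longrightarrow> En cp cm p W (\<lambda>x. v x + t * (u x + (-1) * v x)) (\<lambda>x. gv x + t * (gu x + (-1) * gv x)) \<le> ray_max F v' u'"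
    using R(1) unfolding f_def by blast
  show "\<exists>t\<ge>0. ray_max F v' u' = En cp cm p W (\<lambda>x. v x + t * (u x + (-1) * v x)) (\<lambda>x. gv x + t * (gu x + (-1) * gv x))"
    using R(2) unfolding f_def by blast
qed

lemma En_near:
  assumes v: "zero_sob c d v gv" and h: "zero_sob c d h gh" and l: "d - c \<le> 1"
    and small: "nrm gv \<le> 4 * nrm W * (d - c)" and t: "t \<ge> 0" and nh: "nrm gh = t * gn s (d - c)"
  shows "\<bar>En cp cm p W (\<lambda>x. v x + h x) (\<lambda>x. gv x + gh x) - (1 / 2 * (t * gn s (d - c))\<^sup>2 - (LINT x|lebesgue. nl cp cm p (h x)))\<bar>
    \<le> err s * (d - c) powr (1 - decay p / 2) * (1 + t powr p)"
proof -
  have cd: "c < d" using zero_sobD[OF v] by simp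
  have "\<bar>En cp cm p W (\<lambda>x. v x + h x) (\<lambda>x. gv x + gh x) - (1 / 2 * (nrm gh)\<^sup>2 - (LINT x|lebesgue. nl cp cm p (h x)))\<bar>
    \<le> 1 / 2 * (nrm gv)\<^sup>2 + nrm gv * nrm gh
      + (cp + cm) * (d - c) * (sqrt (d - c) * nrm gv) * (sqrt (d - c) * nrm gv + 2 * (sqrt (d - c) * nrm gh)) powr p
      + nrm W * ((d - c) * nrm gv) + nrm W * ((d - c) * nrm gh)"
    by (rule En_perturbation[OF v h _ _ _ W]) (use cp cm p in auto)
  also have "\<dots> \<le> err s * (d - c) powr (1 - decay p / 2) * (1 + t powr p)"
    unfolding err_def
    by (rule perturbation_error_bound[OF p])
      (use cd l small t nh pre_pos[of s] cp cm in \<open>auto simp: gn_eq\<close>)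
  finally show ?thesis unfolding nh .
qed

text \<open>The direction of the ray is rescaled to have exactly the ground norm \<open>R\<close>;
  there the Sobolev inequality bounds the nonlinear term by \<open>R^2 / (p + 1)\<close>, which
  leaves \<open>kap * R^2\<close> up to the perturbation error. The factor \<open>2\<close> is
  \<open>1 + 1 powr p\<close>.\<close>

lemma minmax_lower:
  assumes v: "zero_sob c d v gv" and u: "zero_sob c d u gu" and cd: "a \<le> c" "d \<le> b"
    and ae: "AE x in lebesgue. v' x = v x" "AE x in lebesgue. u' x = u x"
    and s: "s = 1 \<or> s = -1" and sh: "\<And>x. s * (u x + (-1) * v x) \<ge> 0"
    and pos: "pow_int p (\<lambda>x. s * (u x + (-1) * v x)) > 0"
    and l: "d - c \<le> 1" and small: "nrm gv \<le> 4 * nrm W * (d - c)"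
  shows "ray_max F v' u' \<ge> kap * (gn s (d - c))\<^sup>2 - 2 * err s * (d - c) powr (1 - decay p / 2)"
proof -
  define h gh where "h x = u x + (-1) * v x" and "gh x = gu x + (-1) * gv x" for x
  have h: "zero_sob c d h gh" unfolding h_def[abs_def] gh_def[abs_def] by (rule zero_sob_lin[OF u v])
  have l0: "d - c > 0" using zero_sobD[OF v] by simp
  have p0: "p > 0" using p by simp
  define R where "R = gn s (d - c)"
  have R: "R > 0" unfolding R_def by (rule ground_norm_pos[OF p coeff_pos l0])
  define A where "A = nrm gh"
  have sh': "zero_sob c d (\<lambda>x. s * h x) (\<lambda>x. s * gh x)" by (rule zero_sob_cmult[OF h])
  have nsh: "nrm (\<lambda>x. s * gh x) = A" using s by (auto simp: nrm_cmult A_def nrm_minus)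
  have A: "A > 0"
  proof (rule ccontr)
    assume "\<not> A > 0"
    then have "A = 0" using nrm_nonneg[of gh] by (simp add: A_def)
    then have "pow_int p (\<lambda>x. s * h x) \<le> 0"
      using sobolev_zero_sob_full[OF sh' p0] nsh p by simp
    then show False using pos by (simp add: h_def)
  qed
  define t where "t = R / A"
  have t: "t > 0" using R A by (simp add: t_def)
  have nth: "nrm (\<lambda>x. t * gh x) = 1 * gn s (d - c)" 
  proof -
    have "nrm (\<lambda>x. t * gh x) = t * A" using t by (simp add: nrm_cmult A_def)
    also have "\<dots> = R" using A by (simp add: t_def)
    finally show ?thesis by (simp add: R_def)
  qed
  have th: "zero_sob c d (\<lambda>x. t * h x) (\<lambda>x. t * gh x)" by (rule zero_sob_cmult[OF h])
  have "\<bar>En cp cm p W (\<lambda>x. v x + t * h x) (\<lambda>x. gv x + t * gh x) - (1 / 2 * (1 * gn s (d - c))\<^sup>2 - (LINT x|lebesgue. nl cp cm p (t * h x)))\<bar>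
    \<le> err s * (d - c) powr (1 - decay p / 2) * (1 + 1 powr p)"
    by (rule En_near[OF v th l small _ nth]) simp
  moreover have "(LINT x|lebesgue. nl cp cm p (t * h x)) \<le> R\<^sup>2 / (p + 1)"
  proof -
    have "(LINT x|lebesgue. nl cp cm p (t * h x)) = (LINT x|lebesgue. nl cp cm p (s * (t * (s * h x))))"
      using s by auto
    also have "\<dots> = coeff s / (p + 1) * pow_int p (\<lambda>x. t * (s * h x))"
      by (rule LINT_nl_signed[OF s]) (use sh t in \<open>simp add: h_def\<close>)
    also have "pow_int p (\<lambda>x. t * (s * h x)) \<le> sob_const p * (d - c) powr ((p + 3) / 2) * nrm (\<lambda>x. t * (s * gh x)) powr (p + 1)"
      by (rule sobolev_zero_sob_full[OF zero_sob_cmult[OF sh'] p0])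
    also have "nrm (\<lambda>x. t * (s * gh x)) = R" using R t A nsh nrm_cmult[of t "\<lambda>x. s * gh x"] by (simp add: t_def)
    finally have "(LINT x|lebesgue. nl cp cm p (t * h x)) \<le> coeff s / (p + 1) * (sob_const p * (d - c) powr ((p + 3) / 2) * R powr (p + 1))"
      using coeff_pos[of s] p by (simp add: mult_left_mono divide_right_mono)
    also have "\<dots> = (coeff s * (sob_const p * (d - c) powr ((p + 3) / 2) * R powr (p + 1))) / (p + 1)" by simp
    also have "\<dots> = R\<^sup>2 / (p + 1)" unfolding R_def ground_norm_eq[OF p coeff_pos l0] ..
    finally show ?thesis .
  qed
  ultimately have "En cp cm p W (\<lambda>x. v x + t * h x) (\<lambda>x. gv x + t * gh x)
      \<ge> 1 / 2 * R\<^sup>2 - R\<^sup>2 / (p + 1) - 2 * err s * (d - c) powr (1 - decay p / 2)"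
    by (simp add: R_def abs_le_iff)
  moreover have "En cp cm p W (\<lambda>x. v x + t * h x) (\<lambda>x. gv x + t * gh x) \<le> ray_max F v' u'"
    using ray_max_facts(1)[OF v u cd ae s sh pos, of t] t by (simp add: h_def gh_def)
  ultimately show ?thesis by (simp add: R_def left_diff_distrib)
qed

text \<open>The competitor is the local minimizer plus \<open>s\<close> times a nonnegative, almost
  extremal test function of ground norm. Below \<open>T\<close> the ray energy is bounded by
  \<open>power_balance\<close>; beyond \<open>T\<close> it is nonpositive, because the power term
  outweighs even the perturbation error. The condition on \<open>T\<close> involves only
  \<open>p\<close>, so the error constant is uniform in the interval and in
  \<open>\<delta>\<close>.\<close>

lemma minmax_competitor:
  assumes v: "zero_sob c d v gv" and cd: "a \<le> c" "d \<le> b" and ae: "AE x in lebesgue. v' x = v x"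
    and v': "v' \<in> H10 {c<..<d}" and s: "s = 1 \<or> s = -1"
    and l: "d - c \<le> 1" and small: "nrm gv \<le> 4 * nrm W * (d - c)"
    and ldecay: "err s * (d - c) \<le> (pre s)\<^sup>2"
    and T: "T \<ge> 0" "\<And>t. t \<ge> T \<Longrightarrow> t\<^sup>2 / 2 + 1 + t powr p \<le> t powr (p + 1) / (2 * (p + 1))"
    and \<delta>: "0 < \<delta>" "\<delta> \<le> 1 / 2"
  obtains u' where "u' \<in> H10 {c<..<d}" "\<not> ae_equal {c<..<d} u' v'" "AE x in lebesgue_on {c<..<d}. s * (u' x - v' x) \<ge> 0"
    "ray_max F v' u' \<le> kap * (gn s (d - c))\<^sup>2 + err s * (1 + T powr p) * (d - c) powr (1 - decay p / 2)
      + \<delta> * ((gn s (d - c))\<^sup>2 * T powr (p + 1))"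
proof -
  have cd': "c < d" using zero_sobD[OF v] by simp
  have p0: "p > 0" using p by simp
  define lw where "lw = d - c"
  have l0: "lw > 0" using cd' by (simp add: lw_def)
  define R where "R = gn s lw"
  have R: "R > 0" unfolding R_def by (rule ground_norm_pos[OF p coeff_pos l0])
  define y where "y = lw powr (1 - decay p / 2)"
  have S: "sob_const p > 0" by (rule sob_const_pos[OF p0])
  have "0 \<le> (1 - \<delta>) * sob_const p" "(1 - \<delta>) * sob_const p < sob_const p" using S \<delta> by auto
  from sobolev_near_optimal[OF cd' this R p0]
  obtain f where f: "f \<in> tests c d" "\<And>x. f x \<ge> 0" "nrm (deriv f) = R"
    "pow_int p f \<ge> (1 - \<delta>) * sob_const p * (d - c) powr ((p + 3) / 2) * R powr (p + 1)" by metis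
  have coeff_pow: "coeff s * pow_int p f \<ge> (1 - \<delta>) * R\<^sup>2"
  proof -
    have "coeff s * pow_int p f \<ge> coeff s * ((1 - \<delta>) * sob_const p * (d - c) powr ((p + 3) / 2) * R powr (p + 1))"
      using coeff_pos[of s] f(4) by (intro mult_left_mono) auto
    also have "coeff s * ((1 - \<delta>) * sob_const p * (d - c) powr ((p + 3) / 2) * R powr (p + 1))
        = (1 - \<delta>) * (coeff s * (sob_const p * lw powr ((p + 3) / 2) * R powr (p + 1)))" by (simp add: lw_def)
    also have "\<dots> = (1 - \<delta>) * R\<^sup>2" unfolding R_def ground_norm_eq[OF p coeff_pos l0] ..
    finally show ?thesis .
  qed
  have fpos: "pow_int p f > 0"
  proof -
    have "(1 - \<delta>) * R\<^sup>2 > 0" using R \<delta> by simp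
    then have "coeff s * pow_int p f > 0" using coeff_pow by linarith
    then show ?thesis using coeff_pos[of s] by (simp add: zero_less_mult_iff)
  qed
  have sf: "(\<lambda>x. s * f x) \<in> tests c d" by (rule tests_cmult[OF f(1) cd'])
  define u' where "u' x = v' x + s * f x" for x
  define u where "u x = v x + s * f x" for x
  define gu where "gu x = gv x + s * deriv f x" for x
  have u: "zero_sob c d u gu" unfolding u_def[abs_def] gu_def[abs_def]
    by (rule zero_sob_lin[OF v zero_sob_tests[OF f(1) cd']])
  have aeu: "AE x in lebesgue. u' x = u x" using ae by eventually_elim (simp add: u_def u'_def)
  have huv: "u x + (-1) * v x = s * f x" "gu x + (-1) * gv x = s * deriv f x" for x
    by (simp_all add: u_def gu_def)
  have ss: "s * (s * z) = z" for z using s by auto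
  have 1: "u' \<in> H10 {c<..<d}" unfolding u'_def[abs_def] by (rule H10_add_tests[OF v' sf cd'])
  have 2: "\<not> ae_equal {c<..<d} u' v'"
  proof
    assume "ae_equal {c<..<d} u' v'"
    then have "AE x in lebesgue. x \<in> {c<..<d} \<longrightarrow> u' x = v' x" by (simp add: ae_equal_def AE_on_iff)
    then have z: "AE x in lebesgue. 0 = max (f x) 0 powr (p + 1)"
    proof eventually_elim
      case (elim x)
      have "f x = 0"
      proof (cases "x \<in> {c<..<d}")
        case True
        then show ?thesis using elim s by (auto simp: u'_def)
      qed (use tests_outside[OF f(1)] in simp)
      then show ?case by simp
    qed
    have "pow_int p f = (LINT x|(lebesgue :: real measure). 0)"
      unfolding pow_int_def by (rule LINT_cong_AE[OF _ z]) simp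
    then show False using fpos by simp
  qed
  have 3: "AE x in lebesgue_on {c<..<d}. s * (u' x - v' x) \<ge> 0"
  proof (rule AE_I2)
    show "s * (u' x - v' x) \<ge> 0" for x using f(2)[of x] ss[of "f x"] by (simp only: u'_def add_diff_cancel_left')
  qed
  have "\<exists>t\<ge>0. ray_max F v' u' = En cp cm p W (\<lambda>x. v x + t * (u x + (-1) * v x)) (\<lambda>x. gv x + t * (gu x + (-1) * gv x))"
    by (rule ray_max_facts(2)[OF v u cd ae aeu s]) (simp_all only: huv ss f(2) fpos)
  then obtain t where t: "t \<ge> 0" "ray_max F v' u' = En cp cm p W (\<lambda>x. v x + t * (s * f x)) (\<lambda>x. gv x + t * (s * deriv f x))"
    unfolding huv by blast
  have "nrm (\<lambda>x. t * (s * deriv f x)) = t * gn s (d - c)"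
    using t(1) s f(3) nrm_cmult[of t "\<lambda>x. s * deriv f x"] by (auto simp: nrm_cmult nrm_minus R_def lw_def)
  from En_near[OF v zero_sob_cmult[OF zero_sob_cmult[OF zero_sob_tests[OF f(1) cd']]] l small t(1) this]
  have "ray_max F v' u' \<le> 1 / 2 * (t * R)\<^sup>2 - (LINT x|lebesgue. nl cp cm p (t * (s * f x))) + err s * y * (1 + t powr p)"
    unfolding t(2) by (simp add: R_def y_def lw_def abs_le_iff)
  also have "(LINT x|lebesgue. nl cp cm p (t * (s * f x))) = coeff s / (p + 1) * pow_int p (\<lambda>x. t * f x)"
    using LINT_nl_signed[OF s, of "\<lambda>x. t * f x" cp cm p] t(1) f(2) by (simp add: mult.left_commute)
  also have "\<dots> = (coeff s * pow_int p f) * t powr (p + 1) / (p + 1)" using t(1) by (simp add: pow_int_cmult)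
  finally have "ray_max F v' u' \<le> 1 / 2 * (t * R)\<^sup>2 - (coeff s * pow_int p f) * t powr (p + 1) / (p + 1) + err s * y * (1 + t powr p)" .
  moreover have "(coeff s * pow_int p f) * t powr (p + 1) / (p + 1) \<ge> ((1 - \<delta>) * R\<^sup>2) * t powr (p + 1) / (p + 1)"
    using coeff_pow p by (intro divide_right_mono mult_right_mono) auto
  ultimately have main: "ray_max F v' u' \<le> R\<^sup>2 * (t\<^sup>2 / 2 - (1 - \<delta>) * (t powr (p + 1) / (p + 1))) + err s * y * (1 + t powr p)"
    by (simp add: power_mult_distrib algebra_simps)
  \<comment> \<open>On short intervals the error factor is at most the squared ground norm, so that
    for large \<open>t\<close> the error can be weighed against the power term.\<close>
  have errR: "err s * y \<le> R\<^sup>2"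
  proof -
    have "decay p > 1" using p by (simp add: decay_def)
    then have "y \<le> lw powr (1 - decay p)" unfolding y_def using l0 l
      by (intro powr_mono') (auto simp: lw_def)
    then have "err s * y \<le> err s * lw powr (1 - decay p)" using err_nonneg by (intro mult_left_mono) auto
    also have "lw powr (1 - decay p) = lw * lw powr (- decay p)" using l0 powr_add[of lw 1 "- decay p"] by simp
    also have "err s * (lw * lw powr (- decay p)) = (err s * lw) * lw powr (- decay p)" by simp
    also have "\<dots> \<le> (pre s)\<^sup>2 * lw powr (- decay p)" using ldecay by (intro mult_right_mono) (auto simp: lw_def)
    also have "\<dots> = R\<^sup>2" using gn_sq[OF l0, of s] by (simp add: R_def)
    finally show ?thesis .
  qed
  have y0: "y \<ge> 0" by (simp add: y_def)
  have 4: "ray_max F v' u' \<le> kap * R\<^sup>2 + err s * (1 + T powr p) * y + \<delta> * (R\<^sup>2 * T powr (p + 1))"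
  proof (cases "t \<ge> T")
    case True
    \<comment> \<open>\<open>\<delta> \<le> 1 / 2\<close> leaves at least half of the power term,
      which is why the threshold condition carries the factor \<open>2\<close>.\<close>
    have "t powr (p + 1) / (2 * (p + 1)) = 1 / 2 * (t powr (p + 1) / (p + 1))" by simp
    also have "\<dots> \<le> (1 - \<delta>) * (t powr (p + 1) / (p + 1))" using \<delta> p by (intro mult_right_mono) auto
    finally have "t\<^sup>2 / 2 - (1 - \<delta>) * (t powr (p + 1) / (p + 1)) \<le> - (1 + t powr p)" using T(2)[OF True] by linarith
    then have "R\<^sup>2 * (t\<^sup>2 / 2 - (1 - \<delta>) * (t powr (p + 1) / (p + 1))) \<le> R\<^sup>2 * - (1 + t powr p)"
      by (intro mult_left_mono) auto
    moreover have "err s * y * (1 + t powr p) \<le> R\<^sup>2 * (1 + t powr p)" using errR by (intro mult_right_mono) auto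
    ultimately have "ray_max F v' u' \<le> R\<^sup>2 * - (1 + t powr p) + R\<^sup>2 * (1 + t powr p)" using main by linarith
    also have "\<dots> = 0" by (simp only: mult_minus_right add.left_inverse)
    finally have "ray_max F v' u' \<le> 0" .
    also have "0 \<le> kap * R\<^sup>2 + err s * (1 + T powr p) * y + \<delta> * (R\<^sup>2 * T powr (p + 1))"
      using p err_nonneg[of s] y0 \<delta> by (intro add_nonneg_nonneg mult_nonneg_nonneg) (auto simp: field_simps)
    finally show ?thesis .
  next
    case False
    have tT: "t powr (p + 1) \<le> T powr (p + 1)" "t powr p \<le> T powr p" using False t p by (auto intro!: powr_mono2)
    have "t\<^sup>2 / 2 - (1 - \<delta>) * (t powr (p + 1) / (p + 1)) \<le> kap + \<delta> * T powr (p + 1)"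
    proof -
      have "t powr (p + 1) / (p + 1) \<le> t powr (p + 1) / 1" using p by (intro divide_left_mono) auto
      then have "t powr (p + 1) / (p + 1) \<le> T powr (p + 1)" using tT by simp
      then have "\<delta> * (t powr (p + 1) / (p + 1)) \<le> \<delta> * T powr (p + 1)" using \<delta> by (intro mult_left_mono) auto
      moreover have "(1 - \<delta>) * (t powr (p + 1) / (p + 1)) = t powr (p + 1) / (p + 1) - \<delta> * (t powr (p + 1) / (p + 1))"
        by (simp only: left_diff_distrib mult_1)
      ultimately show ?thesis using power_balance[OF p t(1)] by linarith
    qed
    then have "R\<^sup>2 * (t\<^sup>2 / 2 - (1 - \<delta>) * (t powr (p + 1) / (p + 1))) \<le> R\<^sup>2 * (kap + \<delta> * T powr (p + 1))"
      by (intro mult_left_mono) auto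
    moreover have "err s * y * (1 + t powr p) \<le> err s * y * (1 + T powr p)"
      using tT err_nonneg[of s] y0 by (intro mult_left_mono) auto
    ultimately show ?thesis using main by (simp add: algebra_simps)
  qed
  show ?thesis using that[OF 1 2 3] 4 by (simp add: R_def y_def lw_def)
qed

lemma ray_threshold:
  obtains T where "T \<ge> 0" "\<And>t. t \<ge> T \<Longrightarrow> t\<^sup>2 / 2 + 1 + t powr p \<le> t powr (p + 1) / (2 * (p + 1))"
proof -
  have "1 / (2 * (p + 1)) > 0" using p by simp
  \<comment> \<open>Each of the three terms to be dominated is at most
    \<open>t powr (max 2 p)\<close>.\<close>
  from dominated_by_power[OF p this, of 3]
  obtain T where T: "T \<ge> 1" "\<And>t. t \<ge> T \<Longrightarrow> 3 * t powr (max 2 p) \<le> 1 / (2 * (p + 1)) * t powr (p + 1)" by metis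
  have "t\<^sup>2 / 2 + 1 + t powr p \<le> t powr (p + 1) / (2 * (p + 1))" if "t \<ge> T" for t
  proof -
    have t: "t \<ge> 1" using that T by simp
    have m: "1 \<le> t powr (max 2 p)" using t by (intro ge_one_powr_ge_zero) auto
    have "t powr 2 \<le> t powr (max 2 p)" "t powr p \<le> t powr (max 2 p)" using t by (intro powr_mono; simp)+
    then show ?thesis using T(2)[OF that] m t by simp
  qed
  then show ?thesis using that[of T] T(1) by simp
qed

text \<open>The zero function is admissible and has energy zero, so the minimizer has nonpositive
  energy; from this its smallness is derived.\<close>

lemma local_minimizer_rep:
  assumes ulm: "unique_local_minimizer F p {c<..<d} v'" and cd: "a \<le> c" "c < d" "d \<le> b"
    and l1: "d - c \<le> 1"
    and l2: "(cp + cm) * (d - c) * sqrt (4 * (cp + cm) + 4 * (nrm W)\<^sup>2) powr (p - 1) \<le> 1 / 4"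
  obtains v gv where "v' \<in> H10 {c<..<d}" "zero_sob c d v gv" "AE x in lebesgue. v' x = v x" "nrm gv \<le> 4 * nrm W * (d - c)"
proof -
  have p0: "p > 0" and c0: "cp \<ge> 0" "cm \<ge> 0" using p cp cm by auto
  define adm where "adm u \<longleftrightarrow> u \<in> H10 {c<..<d} \<and> (LINT x|lebesgue_on {c<..<d}. \<bar>u x\<bar> powr (p + 1)) < 1" for u :: "real \<Rightarrow> real"
  have am: "is_arg_min F adm v'"
    using ulm unfolding unique_local_minimizer_def Let_def adm_def[abs_def] by blast
  then have v': "v' \<in> H10 {c<..<d}" "(LINT x|lebesgue_on {c<..<d}. \<bar>v' x\<bar> powr (p + 1)) < 1"
    by (auto simp: is_arg_min_def adm_def)
  have "adm (\<lambda>x. 0)" unfolding adm_def using tests_in_H10[OF tests_zero cd(2)] by simp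
  then have F0: "F v' \<le> F (\<lambda>x. 0)" using am by (auto simp: is_arg_min_def not_less)
  obtain v gv where v: "zero_sob c d v gv" "AE x in lebesgue. v' x = v x" "sq_int v'" "\<And>x. x \<notin> {c<..<d} \<Longrightarrow> v' x = 0"
    by (rule H10_representative[OF v'(1) cd(2)]) blast
  have z: "zero_sob c d (\<lambda>x. 0) (deriv (\<lambda>x. 0))" by (rule zero_sob_tests[OF tests_zero cd(2)])
  have "F (\<lambda>x. 0) = En cp cm p W (\<lambda>x. 0) (deriv (\<lambda>x. 0))" by (rule F_eq[OF z cd(1,3)]) simp
  then have "F (\<lambda>x. 0) = 0" by (simp add: En_def nrm_def)
  then have En0: "En cp cm p W v gv \<le> 0" using F0 F_eq[OF v(1) cd(1,3) v(2)] by simp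
  have "(LINT x|lebesgue. \<bar>v x\<bar> powr (p + 1)) = (LINT x|lebesgue. indicator {c<..<d} x * \<bar>v' x\<bar> powr (p + 1))"
  proof (rule sym, rule LINT_cong_AE)
    have "continuous_on UNIV (\<lambda>x. \<bar>v x\<bar> powr (p + 1))"
      by (rule continuous_on_powr_pos) (use p in \<open>auto intro!: continuous_on_rabs zero_sob_continuous[OF v(1)]\<close>)
    then show "(\<lambda>x. \<bar>v x\<bar> powr (p + 1)) \<in> borel_measurable lebesgue" by (rule continuous_lebesgue_measurable)
    show "AE x in lebesgue. \<bar>v x\<bar> powr (p + 1) = indicator {c<..<d} x * \<bar>v' x\<bar> powr (p + 1)"
      using v(2)
    proof eventually_elim
      case (elim x)
      then show ?case using zero_sob_outside[OF v(1), of x] p by (cases "x \<in> {c<..<d}") auto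
    qed
  qed
  then have pw: "(LINT x|lebesgue. \<bar>v x\<bar> powr (p + 1)) \<le> 1" using v'(2) by (simp add: LINT_on)
  have "nrm gv \<le> 4 * nrm W * (d - c)"
    by (rule local_minimizer_small[OF v(1) c0 p W En0 pw l1 l2])
  then show ?thesis using that[OF v'(1) v(1,2)] by blast
qed

text \<open>The constants must not depend on the interval: \<open>l0\<close> and \<open>C\<close>
  are built from \<open>p\<close>, the coefficients and \<open>nrm W\<close> alone, with both signs
  taken together.\<close>

lemma cell_energy:
  obtains C l0 where "l0 > 0" "C \<ge> 0"
    "\<And>c d s v u. a \<le> c \<Longrightarrow> c < d \<Longrightarrow> d \<le> b \<Longrightarrow> d - c \<le> l0 \<Longrightarrow> s = 1 \<or> s = -1 \<Longrightarrow>
      unique_local_minimizer F p {c<..<d} v \<Longrightarrow> minmax_function F s {c<..<d} v u \<Longrightarrow>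
      \<bar>F u - kap * (gn s (d - c))\<^sup>2\<bar> \<le> C * (d - c) powr (1 - decay p / 2)"
proof -
  obtain T where T: "T \<ge> 0" "\<And>t. t \<ge> T \<Longrightarrow> t\<^sup>2 / 2 + 1 + t powr p \<le> t powr (p + 1) / (2 * (p + 1))"
    using ray_threshold by metis
  define Q where "Q = (cp + cm) * sqrt (4 * (cp + cm) + 4 * (nrm W)\<^sup>2) powr (p - 1)"
  have Q: "Q \<ge> 0" using cp cm by (simp add: Q_def)
  define lf where "lf s = (pre s)\<^sup>2 / (err s + 1)" for s
  have lf: "lf s > 0" for s using pre_pos[of s] err_nonneg[of s] by (simp add: lf_def)
  \<comment> \<open>The terms secure, in this order, length at most \<open>1\<close>, the smallness
    needed for the local minimizer, and the comparison of the error with the ground norm for each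
    sign.\<close>
  define l0 where "l0 = min (min 1 (1 / (4 * (Q + 1)))) (min (lf 1) (lf (-1)))"
  have l0: "l0 > 0" using Q lf by (simp add: l0_def)
  define C where "C = (err 1 + err (-1)) * (2 + (1 + T powr p))"
  have C: "C \<ge> 0" using err_nonneg by (simp add: C_def)
  have "\<bar>F u - kap * (gn s (d - c))\<^sup>2\<bar> \<le> C * (d - c) powr (1 - decay p / 2)"
    if cd: "a \<le> c" "c < d" "d \<le> b" and l: "d - c \<le> l0" and s: "s = 1 \<or> s = -1"
      and ulm: "unique_local_minimizer F p {c<..<d} v'" and mm: "minmax_function F s {c<..<d} v' u" for c d s v' u
  proof -
    define y where "y = (d - c) powr (1 - decay p / 2)"
    have y: "y \<ge> 0" by (simp add: y_def)
    have l1: "d - c \<le> 1" "d - c \<le> 1 / (4 * (Q + 1))" "d - c \<le> lf s" using l s by (auto simp: l0_def)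
    have l2: "(cp + cm) * (d - c) * sqrt (4 * (cp + cm) + 4 * (nrm W)\<^sup>2) powr (p - 1) \<le> 1 / 4"
    proof -
      define m where "m = d - c"
      have "m * (4 * (Q + 1)) \<le> 1" using l1(2) Q by (simp add: m_def pos_le_divide_eq)
      moreover have "m * (4 * (Q + 1)) = 4 * (m * Q) + 4 * m" by (simp add: algebra_simps)
      moreover have "m > 0" using cd(2) by (simp add: m_def)
      ultimately have "m * Q \<le> 1 / 4" by linarith
      then have "(d - c) * Q \<le> 1 / 4" by (simp add: m_def)
      then show ?thesis by (simp add: Q_def ac_simps)
    qed
    have l3: "err s * (d - c) \<le> (pre s)\<^sup>2"
    proof -
      have "(err s + 1) * (d - c) \<le> (err s + 1) * lf s" using l1(3) err_nonneg[of s] by (intro mult_left_mono) auto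
      also have "\<dots> = (pre s)\<^sup>2" using err_nonneg[of s] by (simp add: lf_def)
      finally show ?thesis using cd(2) by (simp add: distrib_right)
    qed
    obtain v gv where v: "v' \<in> H10 {c<..<d}" "zero_sob c d v gv" "AE x in lebesgue. v' x = v x" "nrm gv \<le> 4 * nrm W * (d - c)"
      by (rule local_minimizer_rep[OF ulm cd l1(1) l2]) blast
    define adm where "adm u \<longleftrightarrow> u \<in> H10 {c<..<d} \<and> \<not> ae_equal {c<..<d} u v' \<and> (AE x in lebesgue_on {c<..<d}. s * (u x - v' x) \<ge> 0)" for u
    have am: "is_arg_min (ray_max F v') adm u" and Fu: "F u = ray_max F v' u"
      using mm unfolding minmax_function_def adm_def[abs_def] by blast+
    have admu: "u \<in> H10 {c<..<d}" "\<not> ae_equal {c<..<d} u v'" "AE x in lebesgue_on {c<..<d}. s * (u x - v' x) \<ge> 0"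
      using am by (auto simp: is_arg_min_def adm_def)
    have best: "ray_max F v' u \<le> ray_max F v' u'" if "adm u'" for u'
      using am that by (auto simp: is_arg_min_def not_less)
    obtain uu gu where uu: "zero_sob c d uu gu" "AE x in lebesgue. u x = uu x"
      by (rule H10_representative[OF admu(1) cd(2)]) blast
    have hz: "zero_sob c d (\<lambda>x. uu x + (-1) * v x) (\<lambda>x. gu x + (-1) * gv x)" by (rule zero_sob_lin[OF uu(1) v(2)])
    have sh: "s * (uu x + (-1) * v x) \<ge> 0" for x
    proof (rule zero_sob_AE_nonneg[OF hz])
      have "AE x in lebesgue. x \<in> {c<..<d} \<longrightarrow> s * (u x - v' x) \<ge> 0" using admu(3) by (simp add: AE_on_iff)
      then show "AE x in lebesgue. x \<in> {c<..<d} \<longrightarrow> s * (uu x + (-1) * v x) \<ge> 0"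
        using uu(2) v(3) by eventually_elim simp
    qed
    have pos: "pow_int p (\<lambda>x. s * (uu x + (-1) * v x)) > 0"
    proof (rule ccontr)
      assume "\<not> ?thesis"
      then have "pow_int p (\<lambda>x. s * (uu x + (-1) * v x)) = 0"
        using pow_int_nonneg[of p "\<lambda>x. s * (uu x + (-1) * v x)"] by linarith
      from pow_int_zero_AE[OF zero_sob_cmult[OF hz] _ this] p
      have "AE x in lebesgue. s * (uu x + (-1) * v x) \<le> 0" by simp
      then have "AE x in lebesgue. x \<in> {c<..<d} \<longrightarrow> u x = v' x"
        using uu(2) v(3)
      proof eventually_elim
        case (elim x)
        then have "s * (uu x + (-1) * v x) = 0" using sh[of x] by linarith
        then show ?case using s elim by auto
      qed
      then show False using admu(2) by (simp add: ae_equal_def AE_on_iff)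
    qed
    have errC: "2 * err s \<le> C" "err s * (1 + T powr p) \<le> C"
    proof -
      define X where "X = err 1 + err (-1)"
      define Y where "Y = X * (1 + T powr p)"
      have X: "err s \<le> X" "0 \<le> X" using s err_nonneg[of 1] err_nonneg[of "-1"] by (auto simp: X_def)
      have "C = X * 2 + Y" by (simp add: C_def X_def Y_def distrib_left)
      moreover have "err s * (1 + T powr p) \<le> Y" unfolding Y_def using X by (intro mult_right_mono) auto
      moreover have "0 \<le> Y" unfolding Y_def using X by (intro mult_nonneg_nonneg) auto
      ultimately have "2 * err s \<le> C \<and> err s * (1 + T powr p) \<le> C" using X by linarith
      then show "2 * err s \<le> C" "err s * (1 + T powr p) \<le> C" by auto
    qed
    have lower: "kap * (gn s (d - c))\<^sup>2 - 2 * err s * y \<le> F u"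
      unfolding Fu y_def by (rule minmax_lower[OF v(2) uu(1) cd(1,3) v(3) uu(2) s sh pos l1(1) v(4)])
    have upper: "F u \<le> kap * (gn s (d - c))\<^sup>2 + err s * (1 + T powr p) * y"
    proof (rule ccontr)
      assume "\<not> ?thesis"
      then have gap: "F u - (kap * (gn s (d - c))\<^sup>2 + err s * (1 + T powr p) * y) > 0" (is "?g > 0") by linarith
      define Z where "Z = (gn s (d - c))\<^sup>2 * T powr (p + 1)"
      have Z: "Z \<ge> 0" by (simp add: Z_def)
      \<comment> \<open>Extremals are only approached, so a violation of the upper bound is assumed
        and the loss \<open>\<delta>\<close> is fitted to the gap: its effect
        \<open>\<delta> * Z\<close> is smaller than the gap. \<open>Z + 1\<close> guards against
        \<open>Z = 0\<close>.\<close>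
      define \<delta> where "\<delta> = min (1 / 2) (?g / (2 * (Z + 1)))"
      have \<delta>: "0 < \<delta>" unfolding \<delta>_def using gap Z by simp
      have \<delta>2: "\<delta> \<le> 1 / 2" unfolding \<delta>_def by (rule min.cobounded1)
      obtain u' where u': "u' \<in> H10 {c<..<d}" "\<not> ae_equal {c<..<d} u' v'" "AE x in lebesgue_on {c<..<d}. s * (u' x - v' x) \<ge> 0"
        "ray_max F v' u' \<le> kap * (gn s (d - c))\<^sup>2 + err s * (1 + T powr p) * (d - c) powr (1 - decay p / 2)
          + \<delta> * ((gn s (d - c))\<^sup>2 * T powr (p + 1))"
        by (rule minmax_competitor[OF v(2) cd(1,3) v(3) v(1) s l1(1) v(4) l3 T \<delta> \<delta>2]) blast+
      have "F u \<le> ray_max F v' u'" unfolding Fu by (rule best) (use u' in \<open>simp add: adm_def\<close>)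
      then have "?g \<le> \<delta> * Z" using u'(4) by (simp add: y_def Z_def)
      also have "\<dots> \<le> ?g / (2 * (Z + 1)) * Z" unfolding \<delta>_def using Z by (intro mult_right_mono min.cobounded2)
      also have "\<dots> < ?g"
      proof -
        have "?g * Z < ?g * (2 * (Z + 1))" using gap Z by (intro mult_strict_left_mono) auto
        then show ?thesis using Z by (simp add: divide_less_eq)
      qed
      finally show False by simp
    qed
    have "2 * err s * y \<le> C * y" "err s * (1 + T powr p) * y \<le> C * y" using errC y by (auto intro: mult_right_mono)
    then show ?thesis using lower upper unfolding y_def[symmetric] by (simp add: abs_le_iff)
  qed
  then show ?thesis using that[OF l0 C] by blast
qed

end

section \<open>The optimal node\<close>

text \<open>Dividing by \<open>A^2\<close> leaves \<open>1 \<le> Y * A powr (p - 1)\<close>, whose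
  right side increases in \<open>A\<close> and equals \<open>1\<close> at the ground norm.\<close>

lemma ground_norm_le:
  assumes p: "p > 1" and c: "c > 0" and l: "l > 0" and A: "A > 0"
    and le: "A\<^sup>2 \<le> c * (sob_const p * l powr ((p + 3) / 2) * A powr (p + 1))"
  shows "ground_norm p c l \<le> A"
proof (rule ccontr)
  define Y where "Y = c * (sob_const p * l powr ((p + 3) / 2))"
  define R where "R = ground_norm p c l"
  have R: "R > 0" unfolding R_def by (rule ground_norm_pos[OF p c l])
  have Y: "Y > 0" using c l sob_const_pos[of p] p by (simp add: Y_def)
  assume "\<not> ground_norm p c l \<le> A"
  then have AR: "A < R" by (simp add: R_def)
  have sp: "z powr (p + 1) = z powr (p - 1) * z\<^sup>2" if "z > 0" for z :: real
    using that powr_add[of z "p - 1" 2] by (simp add: add.commute)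
  have "A\<^sup>2 \<le> Y * A powr (p - 1) * A\<^sup>2" using le sp[OF A] by (simp add: Y_def ac_simps)
  then have 1: "1 \<le> Y * A powr (p - 1)" using A by simp
  have "R\<^sup>2 = Y * R powr (p - 1) * R\<^sup>2" using ground_norm_eq[OF p c l] sp[OF R] by (simp add: Y_def R_def ac_simps)
  then have 2: "1 = Y * R powr (p - 1)" using R by simp
  have "A powr (p - 1) < R powr (p - 1)" using AR A p by (intro powr_less_mono2) auto
  then have "Y * A powr (p - 1) < Y * R powr (p - 1)" using Y by simp
  then show False using 1 2 by linarith
qed

text \<open>A sign-changing function split into parts with disjoint supports, together with the
  derivatives of the parts.\<close>

locale nodal_split = dirichlet_energy 0 2 cp cm p "\<lambda>_. 0" for cp cm p :: real +
  fixes vp vm gp gm :: "real \<Rightarrow> real"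
  assumes wd: "has_weak_deriv {0<..<2} vp gp" "has_weak_deriv {0<..<2} vm gm"
    and sq: "sq_int gp" "sq_int gm"
    and gout: "\<And>x. x \<notin> {0<..<2} \<Longrightarrow> gp x = 0" "\<And>x. x \<notin> {0<..<2} \<Longrightarrow> gm x = 0"
    and cont: "continuous_on UNIV vp" "continuous_on UNIV vm"
    and vout: "\<And>x. x \<notin> {0<..<2} \<Longrightarrow> vp x = 0" "\<And>x. x \<notin> {0<..<2} \<Longrightarrow> vm x = 0"
    and nonneg: "\<And>x. vp x \<ge> 0" "\<And>x. vm x \<ge> 0"
    and disj: "\<And>x. vp x * vm x = 0" "\<And>x. gp x * gm x = 0"
begin

lemma split_integrable:
  "integrable lebesgue (\<lambda>x. max (vp x) 0 powr (p + 1))" "integrable lebesgue (\<lambda>x. max (vm x) 0 powr (p + 1))"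
  by (rule pow_int_integrable[of _ 0 2]; use cont vout p in auto)+

text \<open>Disjointness of the parts and of their derivatives removes all mixed terms; nonnegative
  coefficients preserve the signs of the parts.\<close>

lemma split_energy:
  assumes ae: "AE x in lebesgue. y x = \<alpha> * vp x - \<gamma> * vm x" and pos: "\<alpha> \<ge> 0" "\<gamma> \<ge> 0"
  shows "F0 cp cm p y = 1 / 2 * (\<alpha>\<^sup>2 * (nrm gp)\<^sup>2 + \<gamma>\<^sup>2 * (nrm gm)\<^sup>2)
    - cp / (p + 1) * (\<alpha> powr (p + 1) * pow_int p vp) - cm / (p + 1) * (\<gamma> powr (p + 1) * pow_int p vm)"
proof -
  have "has_weak_deriv {0<..<2} (\<lambda>x. 0 + \<alpha> * vp x) (\<lambda>x. deriv (\<lambda>x. 0) x + \<alpha> * gp x)"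
    by (rule has_weak_deriv_lin[OF has_weak_deriv_tests[OF tests_zero] wd(1)]) simp_all
  then have "has_weak_deriv {0<..<2} (\<lambda>x. \<alpha> * vp x) (\<lambda>x. \<alpha> * gp x)" by simp
  from has_weak_deriv_lin[OF this wd(2), of "- \<gamma>"]
  have h: "has_weak_deriv {0<..<2} (\<lambda>x. \<alpha> * vp x + - \<gamma> * vm x) (\<lambda>x. \<alpha> * gp x + - \<gamma> * gm x)" by simp
  have s: "sq_int (\<lambda>x. \<alpha> * gp x + - \<gamma> * gm x)" by (intro sq_int_add sq_int_cmult sq)
  have "F0 cp cm p y = En cp cm p (\<lambda>x. indicator {0<..<2} x * 0) (\<lambda>x. \<alpha> * vp x + - \<gamma> * vm x) (\<lambda>x. \<alpha> * gp x + - \<gamma> * gm x)"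
    unfolding F0_def
  proof (rule energy_eq[OF ab p w h s])
    show "continuous_on UNIV (\<lambda>x. \<alpha> * vp x + - \<gamma> * vm x)"
      by (intro continuous_on_add continuous_on_mult continuous_on_const cont)
    show "AE x in lebesgue. y x = \<alpha> * vp x + - \<gamma> * vm x" using ae by eventually_elim simp
  qed (use gout vout in simp_all)
  moreover have "(nrm (\<lambda>x. \<alpha> * gp x + - \<gamma> * gm x))\<^sup>2 = \<alpha>\<^sup>2 * (nrm gp)\<^sup>2 + \<gamma>\<^sup>2 * (nrm gm)\<^sup>2"
  proof -
    have z: "(\<alpha> * gp x) * (- \<gamma> * gm x) = 0" for x using disj(2)[of x] by auto
    show ?thesis
      unfolding nrm_add_sq[OF sq_int_cmult[OF sq(1)] sq_int_cmult[OF sq(2)]] z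
      by (simp add: nrm_cmult power_mult_distrib nrm_minus)
  qed
  moreover have "(LINT x|lebesgue. nl cp cm p (\<alpha> * vp x + - \<gamma> * vm x))
      = cp / (p + 1) * (\<alpha> powr (p + 1) * pow_int p vp) + cm / (p + 1) * (\<gamma> powr (p + 1) * pow_int p vm)"
  proof -
    have e: "nl cp cm p (\<alpha> * vp x + - \<gamma> * vm x) = cp / (p + 1) * (\<alpha> powr (p + 1) * max (vp x) 0 powr (p + 1))
        + cm / (p + 1) * (\<gamma> powr (p + 1) * max (vm x) 0 powr (p + 1))" for x
    proof (cases "vp x = 0")
      case True
      then show ?thesis using nonneg[of x] pos by (simp add: nl_def powr_mult max_def mult_le_0_iff)
    next
      case False
      then have "vm x = 0" using disj(1)[of x] by simp
      then show ?thesis using nonneg[of x] pos by (simp add: nl_def powr_mult max_def mult_le_0_iff)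
    qed
    show ?thesis unfolding e pow_int_def using split_integrable by simp
  qed
  ultimately show ?thesis by (simp add: En_def)
qed

text \<open>For small \<open>s\<close> the variation multiplies one part by \<open>1 + s\<close> or
  by \<open>1 - s\<close>: adding \<open>s\<close> times the negative part of \<open>u\<close>
  shrinks that part, whence the reversed sign. The energy is then an explicit differentiable
  function of \<open>s\<close> near \<open>0\<close>.\<close>

lemma split_dir_deriv:
  assumes u: "AE x in lebesgue. u x = vp x - vm x"
  shows "dir_deriv (F0 cp cm p) u (pos_part u) = (nrm gp)\<^sup>2 - cp * pow_int p vp"
    "dir_deriv (F0 cp cm p) u (neg_part u) = cm * pow_int p vm - (nrm gm)\<^sup>2"
    "F0 cp cm p u = 1 / 2 * ((nrm gp)\<^sup>2 + (nrm gm)\<^sup>2) - cp / (p + 1) * pow_int p vp - cm / (p + 1) * pow_int p vm"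
proof -
  have part: "AE x in lebesgue. pos_part u x = vp x" "AE x in lebesgue. neg_part u x = vm x"
  proof -
    have "pos_part u x = vp x \<and> neg_part u x = vm x" if "u x = vp x - vm x" for x
      using that nonneg[of x] disj(1)[of x] by (auto simp: pos_part_def neg_part_def max_def)
    then show "AE x in lebesgue. pos_part u x = vp x" "AE x in lebesgue. neg_part u x = vm x"
      using u by (auto elim!: eventually_mono)
  qed
  show "F0 cp cm p u = 1 / 2 * ((nrm gp)\<^sup>2 + (nrm gm)\<^sup>2) - cp / (p + 1) * pow_int p vp - cm / (p + 1) * pow_int p vm"
    using split_energy[of u 1 1] u by simp
  have p1: "p + 1 \<noteq> 0" using p by simp
  have cancel: "(- p - 1) * x * y / (p + 1) = - (y * x)" for x y
  proof -
    have "(- p - 1) * x * y = - (y * x) * (p + 1)" by (simp add: algebra_simps)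
    then show ?thesis using nonzero_mult_div_cancel_right[OF p1, of "- (y * x)"] by (simp only:)
  qed
  have nb: "eventually (\<lambda>s. s \<in> {-1<..<1}) (nhds (0::real))"
    by (rule eventually_nhds_in_open) auto
  have 1: "((\<lambda>s. F0 cp cm p (\<lambda>x. u x + s * pos_part u x)) has_real_derivative ((nrm gp)\<^sup>2 - cp * pow_int p vp)) (at 0)"
  proof (rule DERIV_transfer)
    show "((\<lambda>s. 1 / 2 * ((1 + s)\<^sup>2 * (nrm gp)\<^sup>2 + 1\<^sup>2 * (nrm gm)\<^sup>2)
      - cp / (p + 1) * ((1 + s) powr (p + 1) * pow_int p vp) - cm / (p + 1) * (1 powr (p + 1) * pow_int p vm))
      has_real_derivative ((nrm gp)\<^sup>2 - cp * pow_int p vp)) (at 0)"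
      using p1 by (auto intro!: derivative_eq_intros)
    show "eventually (\<lambda>s. 1 / 2 * ((1 + s)\<^sup>2 * (nrm gp)\<^sup>2 + 1\<^sup>2 * (nrm gm)\<^sup>2)
      - cp / (p + 1) * ((1 + s) powr (p + 1) * pow_int p vp) - cm / (p + 1) * (1 powr (p + 1) * pow_int p vm)
      = F0 cp cm p (\<lambda>x. u x + s * pos_part u x)) (nhds 0)"
      using nb
    proof eventually_elim
      case (elim s)
      show ?case
      proof (rule split_energy[symmetric])
        show "AE x in lebesgue. u x + s * pos_part u x = (1 + s) * vp x - 1 * vm x"
          using u part(1) by eventually_elim (simp add: algebra_simps)
      qed (use elim in auto)
    qed
  qed
  have 2: "((\<lambda>s. F0 cp cm p (\<lambda>x. u x + s * neg_part u x)) has_real_derivative (cm * pow_int p vm - (nrm gm)\<^sup>2)) (at 0)"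
  proof (rule DERIV_transfer)
    show "((\<lambda>s. 1 / 2 * (1\<^sup>2 * (nrm gp)\<^sup>2 + (1 - s)\<^sup>2 * (nrm gm)\<^sup>2)
      - cp / (p + 1) * (1 powr (p + 1) * pow_int p vp) - cm / (p + 1) * ((1 - s) powr (p + 1) * pow_int p vm))
      has_real_derivative (cm * pow_int p vm - (nrm gm)\<^sup>2)) (at 0)"
      using p1 by (auto intro!: derivative_eq_intros simp: cancel)
    show "eventually (\<lambda>s. 1 / 2 * (1\<^sup>2 * (nrm gp)\<^sup>2 + (1 - s)\<^sup>2 * (nrm gm)\<^sup>2)
      - cp / (p + 1) * (1 powr (p + 1) * pow_int p vp) - cm / (p + 1) * ((1 - s) powr (p + 1) * pow_int p vm)
      = F0 cp cm p (\<lambda>x. u x + s * neg_part u x)) (nhds 0)"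
      using nb
    proof eventually_elim
      case (elim s)
      show ?case
      proof (rule split_energy[symmetric])
        show "AE x in lebesgue. u x + s * neg_part u x = 1 * vp x - (1 - s) * vm x"
          using u part(2) by eventually_elim (simp add: algebra_simps)
      qed (use elim in auto)
    qed
  qed
  show "dir_deriv (F0 cp cm p) u (pos_part u) = (nrm gp)\<^sup>2 - cp * pow_int p vp"
    "dir_deriv (F0 cp cm p) u (neg_part u) = cm * pow_int p vm - (nrm gm)\<^sup>2"
    unfolding dir_deriv_def by (rule DERIV_imp_deriv[OF 1], rule DERIV_imp_deriv[OF 2])
qed

lemma split_ae_zero:
  assumes u: "AE x in lebesgue. u x = vp x - vm x"
  shows "ae_equal {0<..<2} (pos_part u) (\<lambda>_. 0) \<longleftrightarrow> pow_int p vp = 0"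
    "ae_equal {0<..<2} (neg_part u) (\<lambda>_. 0) \<longleftrightarrow> pow_int p vm = 0"
proof -
  have iff: "(AE x in lebesgue. x \<in> {0<..<2} \<longrightarrow> q x = 0) \<longleftrightarrow> pow_int p h = 0"
    if h: "\<And>x. h x \<ge> 0" "\<And>x. x \<notin> {0<..<2} \<Longrightarrow> h x = 0" "integrable lebesgue (\<lambda>x. max (h x) 0 powr (p + 1))"
      and q: "AE x in lebesgue. q x = h x" for h q :: "real \<Rightarrow> real"
  proof -
    have "pow_int p h = 0 \<longleftrightarrow> (AE x in lebesgue. max (h x) 0 powr (p + 1) = 0)"
      unfolding pow_int_def by (rule integral_nonneg_eq_0_iff_AE[OF h(3)]) simp
    also have "\<dots> \<longleftrightarrow> (AE x in lebesgue. x \<in> {0<..<2} \<longrightarrow> q x = 0)"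
    proof
      assume "AE x in lebesgue. max (h x) 0 powr (p + 1) = 0"
      then show "AE x in lebesgue. x \<in> {0<..<2} \<longrightarrow> q x = 0"
        using q
      proof eventually_elim
        case (elim x)
        then show ?case using h(1)[of x] by (simp add: max_def split: if_splits)
      qed
    next
      assume "AE x in lebesgue. x \<in> {0<..<2} \<longrightarrow> q x = 0"
      then show "AE x in lebesgue. max (h x) 0 powr (p + 1) = 0"
        using q
      proof eventually_elim
        case (elim x)
        then show ?case using h(2)[of x] by (cases "x \<in> {0<..<2}") auto
      qed
    qed
    finally show ?thesis by simp
  qed
  have part: "pos_part u x = vp x \<and> neg_part u x = vm x" if "u x = vp x - vm x" for x
    using that nonneg[of x] disj(1)[of x] by (auto simp: pos_part_def neg_part_def max_def)
  have "AE x in lebesgue. pos_part u x = vp x" "AE x in lebesgue. neg_part u x = vm x"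
    using u part by (auto elim!: eventually_mono)
  then show "ae_equal {0<..<2} (pos_part u) (\<lambda>_. 0) \<longleftrightarrow> pow_int p vp = 0"
    "ae_equal {0<..<2} (neg_part u) (\<lambda>_. 0) \<longleftrightarrow> pow_int p vm = 0"
    using iff[OF nonneg(1) vout(1) split_integrable(1)] iff[OF nonneg(2) vout(2) split_integrable(2)]
    by (simp_all add: ae_equal_def AE_on_iff)
qed

end

section \<open>The minimal energy as a function of the node\<close>

definition split_energy_min :: "real \<Rightarrow> real \<Rightarrow> real \<Rightarrow> real \<Rightarrow> real" where
  "split_energy_min cp cm p t = (1 / 2 - 1 / (p + 1)) * ((ground_norm p cp t)\<^sup>2 + (ground_norm p cm (2 - t))\<^sup>2)"

text \<open>Vanishing directional derivatives are Nehari conditions for the two parts. With the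
  Sobolev inequality on \<open>{0<..<t}\<close> and \<open>{t<..<2}\<close>, each derivative norm is
  at least the ground norm there, and the energy is \<open>1 / 2 - 1 / (p + 1)\<close> times the sum
  of their squares.\<close>

lemma nodal_set_at_ge:
  assumes cp: "cp > 0" and cm: "cm > 0" and p: "p > 1" and t: "0 < t" "t < 2"
    and u: "u \<in> nodal_set_at cp cm p t"
  shows "split_energy_min cp cm p t \<le> F0 cp cm p u"
proof -
  have p0: "p > 0" using p by simp
  have uH: "u \<in> H10 {0<..<2}" "\<not> ae_equal {0<..<2} (pos_part u) (\<lambda>_. 0)" "\<not> ae_equal {0<..<2} (neg_part u) (\<lambda>_. 0)"
    "dir_deriv (F0 cp cm p) u (pos_part u) = 0" "dir_deriv (F0 cp cm p) u (neg_part u) = 0"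
    "AE x in lebesgue_on {0<..<t}. u x \<ge> 0" "AE x in lebesgue_on {t<..<2}. u x \<le> 0"
    using u by (auto simp: nodal_set_at_def nodal_set_def)
  obtain v g where v: "zero_sob 0 2 v g" "AE x in lebesgue. u x = v x"
    by (rule H10_representative[OF uH(1)]) auto
  note V = zero_sobD[OF v(1)]
  have vc: "continuous_on UNIV v" by (rule zero_sob_continuous[OF v(1)])
  have vo: "v x = 0" if "x \<notin> {0<..<2}" for x by (rule zero_sob_outside[OF v(1) that])
  have cl: "closed {x. 0 \<le> v x}" "closed {x. v x \<le> 0}"
    by (intro closed_Collect_le continuous_on_const vc)+
  have vpos: "v x \<ge> 0" if x: "x \<in> {0<..<t}" for x
  proof -
    have "AE x \<in> {0<..<t} in lebesgue. x \<in> {x. 0 \<le> v x}"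
      using uH(6) v(2) by (auto simp: AE_on_iff elim: eventually_elim2)
    from mem_closed_if_AE_lebesgue_open[OF open_greaterThanLessThan cl(1) this x] show ?thesis by simp
  qed
  have vneg: "v x \<le> 0" if x: "x \<in> {t<..<2}" for x
  proof -
    have "AE x \<in> {t<..<2} in lebesgue. x \<in> {x. v x \<le> 0}"
      using uH(7) v(2) by (auto simp: AE_on_iff elim: eventually_elim2)
    from mem_closed_if_AE_lebesgue_open[OF open_greaterThanLessThan cl(2) this x] show ?thesis by simp
  qed
  \<comment> \<open>By continuity the sign conditions on the two sides extend to \<open>t\<close>,
    where both hold.\<close>
  have vt: "v t = 0"
  proof -
    have "closure {0<..<t} \<subseteq> {x. 0 \<le> v x}" by (rule closure_minimal[OF _ cl(1)]) (use vpos in auto)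
    moreover have "closure {t<..<2} \<subseteq> {x. v x \<le> 0}" by (rule closure_minimal[OF _ cl(2)]) (use vneg in auto)
    ultimately show ?thesis using t by (auto simp: closure_greaterThanLessThan subset_iff intro: antisym)
  qed
  define vp vm where "vp x = max (v x) 0" and "vm x = max (- v x) 0" for x
  define gp gm where "gp x = indicator {0..t} x * g x" and "gm x = - (indicator {t<..<2} x * g x)" for x
  have vp_eq: "vp x = indicator {0..t} x * v x" for x
  proof -
    consider "x \<in> {0<..<t}" | "x = t" | "x \<in> {t<..<2}" | "x \<notin> {0<..<2}" by fastforce
    then show ?thesis
      using vpos[of x] vneg[of x] vo[of x] vt t by cases (auto simp: vp_def)
  qed
  have vpm: "v x = vp x - vm x" for x by (auto simp: vp_def vm_def)
  have gpm: "gm x = gp x + (-1) * g x" for x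
    using V(3)[of x] t by (cases "x \<in> {0<..<2}") (auto simp: gp_def gm_def indicator_def)
  have sqp: "sq_int gp" unfolding gp_def[abs_def] by (rule sq_int_indicator[OF V(2)]) simp
  have sqm: "sq_int gm" unfolding gpm[abs_def] by (intro sq_int_add sqp sq_int_cmult V(2))
  \<comment> \<open>Since \<open>v t = 0\<close>, the positive part is \<open>v\<close> cut off at
    \<open>t\<close>, and integration by parts up to \<open>t\<close> leaves no boundary term. This
    takes the place of a chain rule for the positive part.\<close>
  have wp: "has_weak_deriv {0<..<2} vp gp"
  proof -
    have c: "continuous_on UNIV vp" unfolding vp_def[abs_def] by (intro continuous_on_max vc continuous_on_const)
    have "sq_int vp" by (rule sq_int_continuous_support[OF c, of 0 2]) (use vo in \<open>auto simp: vp_def\<close>)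
    moreover have "(LINT x|lebesgue. vp x * deriv h x) = - (LINT x|lebesgue. gp x * h x)" if h: "h \<in> tests 0 2" for h
      using zero_sob_by_parts_half[OF v(1) h, of t] t vt by (simp add: vp_eq gp_def mult.assoc)
    ultimately show ?thesis
      unfolding has_weak_deriv_iff[OF V(1)] using sq_int_locally_integrable sqp by blast
  qed
  have wm: "has_weak_deriv {0<..<2} vm gm"
  proof -
    have "(\<lambda>x. vp x + (-1) * v x) = vm" using vpm by (simp add: fun_eq_iff)
    moreover have "(\<lambda>x. gp x + (-1) * g x) = gm" using gpm by (simp add: fun_eq_iff)
    ultimately show ?thesis using has_weak_deriv_lin[OF wp zero_sob_has_weak_deriv[OF v(1)] V(1), of "-1"] by simp
  qed
  interpret nodal_split cp cm p vp vm gp gm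
  proof unfold_locales
    show "continuous_on UNIV vp" "continuous_on UNIV vm"
      unfolding vp_def[abs_def] vm_def[abs_def] by (intro continuous_on_max vc continuous_on_const continuous_on_minus)+
  qed (use cp cm p wp wm sqp sqm V(3) vo in \<open>auto simp: vp_def vm_def gp_def gm_def L2_iff sq_int_zero indicator_def max_def\<close>)
  have uv: "AE x in lebesgue. u x = vp x - vm x" using v(2) by eventually_elim (simp add: vpm[symmetric])
  note D = split_dir_deriv[OF uv] and Z = split_ae_zero[OF uv]
  have P: "pow_int p vp > 0" "pow_int p vm > 0"
    using Z uH(2,3) pow_int_nonneg[of p vp] pow_int_nonneg[of p vm] by (auto simp: less_le)
  have A: "(nrm gp)\<^sup>2 = cp * pow_int p vp" "(nrm gm)\<^sup>2 = cm * pow_int p vm" using D(1,2) uH(4,5) by auto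
  have npos: "nrm gp > 0" "nrm gm > 0"
  proof -
    have "(nrm gp)\<^sup>2 > 0" "(nrm gm)\<^sup>2 > 0" using A P cp cm by auto
    then show "nrm gp > 0" "nrm gm > 0" using nrm_nonneg[of gp] nrm_nonneg[of gm] by (auto simp: less_le)
  qed
  have S0: "sob_const p * l powr e \<ge> 0" for l e using sob_const_pos[OF p0] by simp
  have bp: "pow_int p vp \<le> sob_const p * t powr ((p + 3) / 2) * nrm gp powr (p + 1)"
  proof -
    have "pow_int p vp = (LINT x|lebesgue. indicator {0<..<t} x * max (v x) 0 powr (p + 1))"
      unfolding pow_int_def
    proof (rule Bochner_Integration.integral_cong[OF refl])
      fix x
      have "vp x = 0" if "x \<notin> {0<..<t}" using that vp_eq[of x] vt vo[of x] t by (auto simp: indicator_def)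
      then show "max (vp x) 0 powr (p + 1) = indicator {0<..<t} x * max (v x) 0 powr (p + 1)"
        using p by (cases "x \<in> {0<..<t}") (auto simp: vp_def)
    qed
    also have "\<dots> \<le> sob_const p * (t - 0) powr ((p + 3) / 2) * nrm (\<lambda>x. indicator {0<..<t} x * g x) powr (p + 1)"
      by (rule sobolev_zero_sob[OF v(1) t(1) _ _ p0]) (use vo[of 0] vt in auto)
    also have "\<dots> \<le> sob_const p * (t - 0) powr ((p + 3) / 2) * nrm gp powr (p + 1)"
    proof (intro mult_left_mono powr_mono2)
      have "(\<lambda>x. indicator {0<..<t} x * g x) = (\<lambda>x. indicator {0<..<t} x * gp x)"
        by (auto simp: gp_def indicator_def)
      then show "nrm (\<lambda>x. indicator {0<..<t} x * g x) \<le> nrm gp" using nrm_indicator_le[OF sqp, of "{0<..<t}"] by simp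
    qed (use p S0 in auto)
    finally show ?thesis by simp
  qed
  have bm: "pow_int p vm \<le> sob_const p * (2 - t) powr ((p + 3) / 2) * nrm gm powr (p + 1)"
  proof -
    have "pow_int p vm = (LINT x|lebesgue. indicator {t<..<2} x * max ((-1) * v x) 0 powr (p + 1))"
      unfolding pow_int_def
    proof (rule Bochner_Integration.integral_cong[OF refl])
      fix x
      have "vm x = 0" if "x \<notin> {t<..<2}"
      proof -
        consider "x \<in> {0<..<t}" | "x = t" | "x \<notin> {0<..<2}" using \<open>x \<notin> {t<..<2}\<close> by fastforce
        then show ?thesis using vpos[of x] vo[of x] vt by cases (auto simp: vm_def)
      qed
      then show "max (vm x) 0 powr (p + 1) = indicator {t<..<2} x * max ((-1) * v x) 0 powr (p + 1)"
        using p by (cases "x \<in> {t<..<2}") (auto simp: vm_def)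
    qed
    also have "\<dots> \<le> sob_const p * (2 - t) powr ((p + 3) / 2) * nrm (\<lambda>x. indicator {t<..<2} x * ((-1) * g x)) powr (p + 1)"
      by (rule sobolev_zero_sob[OF zero_sob_cmult[OF v(1)] t(2) _ _ p0]) (use vo[of 2] vt in auto)
    also have "(\<lambda>x. indicator {t<..<2} x * ((-1) * g x)) = gm" by (auto simp: gm_def)
    finally show ?thesis .
  qed
  have "ground_norm p cp t \<le> nrm gp"
    by (rule ground_norm_le[OF p cp t(1) npos(1)]) (use A(1) bp cp in simp)
  moreover have "ground_norm p cm (2 - t) \<le> nrm gm"
    by (rule ground_norm_le[OF p cm _ npos(2)]) (use t A(2) bm cm in simp_all)
  ultimately have "(ground_norm p cp t)\<^sup>2 + (ground_norm p cm (2 - t))\<^sup>2 \<le> (nrm gp)\<^sup>2 + (nrm gm)\<^sup>2"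
    using ground_norm_pos[OF p cp t(1)] ground_norm_pos[OF p cm, of "2 - t"] t
    by (intro add_mono power_mono) auto
  then have "split_energy_min cp cm p t \<le> (1 / 2 - 1 / (p + 1)) * ((nrm gp)\<^sup>2 + (nrm gm)\<^sup>2)"
    unfolding split_energy_min_def using p by (intro mult_left_mono) (auto simp: field_simps)
  also have "\<dots> = F0 cp cm p u" unfolding D(3) using A by (simp add: field_simps)
  finally show ?thesis .
qed

text \<open>Test functions that are almost extremal on the two nodal intervals are multiplied by
  constants that make them satisfy the Nehari conditions. The loss \<open>\<eta>\<close> in the
  Sobolev inequality costs only a factor that tends to \<open>1\<close> with
  \<open>\<eta>\<close>.\<close>

lemma nodal_set_le:
  assumes cp: "cp > 0" and cm: "cm > 0" and p: "p > 1" and t: "0 < t" "t < 2" and \<eta>: "0 < \<eta>" "\<eta> < 1"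
  obtains u where "u \<in> nodal_set cp cm p" "F0 cp cm p u \<le> \<eta> powr (- 2 / (p - 1)) * split_energy_min cp cm p t"
proof -
  have p0: "p > 0" using p by simp
  have S: "sob_const p > 0" by (rule sob_const_pos[OF p0])
  have piece: "\<exists>f. f \<in> tests c d \<and> (\<forall>x. f x \<ge> 0) \<and> pow_int p f > 0 \<and> (nrm (deriv f))\<^sup>2 = k * pow_int p f
      \<and> (nrm (deriv f))\<^sup>2 \<le> \<eta> powr (- 2 / (p - 1)) * (ground_norm p k (d - c))\<^sup>2"
    if cd: "c < d" and k: "k > 0" for c d k
  proof -
    have l: "d - c > 0" using cd by simp
    define R where "R = ground_norm p k (d - c)"
    have R: "R > 0" unfolding R_def by (rule ground_norm_pos[OF p k l])
    have "0 \<le> \<eta> * sob_const p" "\<eta> * sob_const p < sob_const p" using S \<eta> by auto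
    then obtain f where f: "f \<in> tests c d" "\<And>x. f x \<ge> 0" "nrm (deriv f) = R"
      "pow_int p f \<ge> \<eta> * sob_const p * (d - c) powr ((p + 3) / 2) * R powr (p + 1)"
      using sobolev_near_optimal[OF cd _ _ R p0] by blast
    define P where "P = k * pow_int p f"
    have Pge: "P \<ge> \<eta> * R\<^sup>2"
    proof -
      have "P \<ge> k * (\<eta> * sob_const p * (d - c) powr ((p + 3) / 2) * R powr (p + 1))"
        unfolding P_def using k f(4) by (intro mult_left_mono) auto
      also have "k * (\<eta> * sob_const p * (d - c) powr ((p + 3) / 2) * R powr (p + 1))
          = \<eta> * (k * (sob_const p * (d - c) powr ((p + 3) / 2) * R powr (p + 1)))" by (simp only: ac_simps)
      also have "\<dots> = \<eta> * R\<^sup>2" unfolding R_def ground_norm_eq[OF p k l] ..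
      finally show ?thesis .
    qed
    have R2: "\<eta> * R\<^sup>2 > 0" using \<eta> R by simp
    have P: "P > 0" using Pge R2 by linarith
    \<comment> \<open>This solves the Nehari condition for \<open>r * f\<close>, that is
      \<open>r^2 * R^2 = r powr (p + 1) * P\<close>.\<close>
    define r where "r = (R\<^sup>2 / P) powr (1 / (p - 1))"
    have r: "r > 0" using R P by (simp add: r_def)
    have rp: "r powr (p - 1) = R\<^sup>2 / P" unfolding r_def using R P p by (simp add: powr_powr)
    have rp1: "r powr (p + 1) = r\<^sup>2 * (R\<^sup>2 / P)"
      using r powr_add[of r "p - 1" 2] by (simp add: rp[symmetric] add.commute mult.commute)
    have n2: "(nrm (deriv (\<lambda>x. r * f x)))\<^sup>2 = r\<^sup>2 * R\<^sup>2"
      using r f(3) by (simp add: nrm_deriv_cmult[OF f(1)] power_mult_distrib)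
    have i: "k * pow_int p (\<lambda>x. r * f x) = r\<^sup>2 * R\<^sup>2"
    proof -
      have "k * pow_int p (\<lambda>x. r * f x) = r powr (p + 1) * P" using r by (simp add: pow_int_cmult P_def)
      then show ?thesis unfolding rp1 using P by simp
    qed
    have "r\<^sup>2 \<le> \<eta> powr (- 2 / (p - 1))"
    proof -
      have "R\<^sup>2 / P \<le> 1 / \<eta>" using Pge P \<eta> by (simp add: field_simps)
      then have "(R\<^sup>2 / P) powr (2 / (p - 1)) \<le> (1 / \<eta>) powr (2 / (p - 1))" using p P \<eta> by (intro powr_mono2) auto
      moreover have "(1 / \<eta>) powr (2 / (p - 1)) = \<eta> powr (- 2 / (p - 1))" using \<eta> by (simp add: powr_divide powr_minus_divide)
      moreover have "r\<^sup>2 = (R\<^sup>2 / P) powr (2 / (p - 1))"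
      proof -
        have "r\<^sup>2 = r powr 2" using r by simp
        also have "\<dots> = (R\<^sup>2 / P) powr (1 / (p - 1) * 2)" unfolding r_def by (rule powr_powr)
        finally show ?thesis by simp
      qed
      ultimately show ?thesis by simp
    qed
    then have "r\<^sup>2 * R\<^sup>2 \<le> \<eta> powr (- 2 / (p - 1)) * R\<^sup>2" by (intro mult_right_mono) auto
    moreover have "pow_int p (\<lambda>x. r * f x) > 0"
    proof -
      have "k * pow_int p (\<lambda>x. r * f x) > 0" unfolding i using r R by simp
      then show ?thesis using k by (simp add: zero_less_mult_iff)
    qed
    ultimately show ?thesis using tests_cmult[OF f(1) cd, of r] f(2) r i n2
      by (intro exI[of _ "\<lambda>x. r * f x"]) (auto simp: R_def)
  qed
  obtain f where f: "f \<in> tests 0 t" "\<And>x. f x \<ge> 0" "pow_int p f > 0" "(nrm (deriv f))\<^sup>2 = cp * pow_int p f"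
    "(nrm (deriv f))\<^sup>2 \<le> \<eta> powr (- 2 / (p - 1)) * (ground_norm p cp t)\<^sup>2"
    using piece[OF t(1) cp] by auto
  obtain h where h: "h \<in> tests t 2" "\<And>x. h x \<ge> 0" "pow_int p h > 0" "(nrm (deriv h))\<^sup>2 = cm * pow_int p h"
    "(nrm (deriv h))\<^sup>2 \<le> \<eta> powr (- 2 / (p - 1)) * (ground_norm p cm (2 - t))\<^sup>2"
    using piece[OF t(2) cm] by auto
  have f2: "f \<in> tests 0 2" by (rule tests_mono[OF f(1)]) (use t in auto)
  have h2: "h \<in> tests 0 2" by (rule tests_mono[OF h(1)]) (use t in auto)
  have fo: "f x = 0" "deriv f x = 0" if "x \<notin> {0<..<t}" for x
    using tests_outside[OF f(1) that] tests_deriv_outside[OF f(1) t(1) that] by auto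
  have ho: "h x = 0" "deriv h x = 0" if "x \<notin> {t<..<2}" for x
    using tests_outside[OF h(1) that] tests_deriv_outside[OF h(1) t(2) that] by auto
  have dis: "f x * h x = 0" "deriv f x * deriv h x = 0" for x
    using fo[of x] ho[of x] by (cases "x < t"; auto)+
  interpret nodal_split cp cm p f h "deriv f" "deriv h"
  proof unfold_locales
    show "has_weak_deriv {0<..<2} f (deriv f)" "has_weak_deriv {0<..<2} h (deriv h)"
      by (rule has_weak_deriv_tests[OF f2], simp, rule has_weak_deriv_tests[OF h2], simp)
    show "sq_int (deriv f)" "sq_int (deriv h)"
      by (rule tests_sq_int[OF tests_deriv[OF f2]], simp, rule tests_sq_int[OF tests_deriv[OF h2]], simp)
  qed (use cp cm p f(2) h(2) dis tests_continuous[OF f2] tests_continuous[OF h2] tests_outside[OF f2] tests_outside[OF h2]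
      tests_deriv_outside[OF f2] tests_deriv_outside[OF h2] in \<open>auto simp: L2_iff sq_int_zero\<close>)
  define u where "u x = f x - h x" for x
  have uv: "AE x in lebesgue. u x = f x - h x" by (simp add: u_def)
  note D = split_dir_deriv[OF uv] and Z = split_ae_zero[OF uv]
  have "u \<in> H10 {0<..<2}" unfolding u_def[abs_def] by (rule tests_in_H10[OF tests_diff[OF f2 h2]]) auto
  then have "u \<in> nodal_set cp cm p" unfolding nodal_set_def using D(1,2) Z f(3,4) h(3,4) by simp
  moreover have "F0 cp cm p u \<le> \<eta> powr (- 2 / (p - 1)) * split_energy_min cp cm p t"
  proof -
    have "F0 cp cm p u = (1 / 2 - 1 / (p + 1)) * ((nrm (deriv f))\<^sup>2 + (nrm (deriv h))\<^sup>2)"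
      unfolding D(3) using f(4) h(4) by (simp add: field_simps)
    also have "\<dots> \<le> (1 / 2 - 1 / (p + 1)) * (\<eta> powr (- 2 / (p - 1)) * (ground_norm p cp t)\<^sup>2 + \<eta> powr (- 2 / (p - 1)) * (ground_norm p cm (2 - t))\<^sup>2)"
      using p f(5) h(5) by (intro mult_left_mono add_mono) (auto simp: field_simps)
    also have "\<dots> = \<eta> powr (- 2 / (p - 1)) * split_energy_min cp cm p t"
      by (simp only: split_energy_min_def distrib_left ac_simps)
    finally show ?thesis .
  qed
  ultimately show ?thesis using that by blast
qed

text \<open>The common minimum \<open>m\<close> is attained with node \<open>t\<close>, hence is at
  least the split energy at \<open>t\<close>; for any \<open>\<tau>\<close> it is at most the split
  energy at \<open>\<tau>\<close> up to the factor in \<open>\<eta>\<close>, which disappears as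
  \<open>\<eta>\<close> tends to \<open>1\<close> from the left.\<close>

lemma optimal_node_minimizes:
  assumes cp: "cp > 0" and cm: "cm > 0" and p: "p > 1" and o: "optimal_node cp cm p t" and \<tau>: "0 < \<tau>" "\<tau> < 2"
  shows "split_energy_min cp cm p t \<le> split_energy_min cp cm p \<tau>"
proof -
  obtain m where t: "0 < t" "t < 2" and m: "is_minimum (F0 cp cm p ` nodal_set_at cp cm p t) m"
    "is_minimum (F0 cp cm p ` nodal_set cp cm p) m"
    using o unfolding optimal_node_def by blast
  have ge: "split_energy_min cp cm p t \<le> m"
    using m(1) nodal_set_at_ge[OF cp cm p t] unfolding is_minimum_def by blast
  have le: "m \<le> \<eta> powr (- 2 / (p - 1)) * split_energy_min cp cm p \<tau>" if eta: "0 < \<eta>" "\<eta> < 1" for \<eta>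
  proof -
    obtain u where "u \<in> nodal_set cp cm p" "F0 cp cm p u \<le> \<eta> powr (- 2 / (p - 1)) * split_energy_min cp cm p \<tau>"
      by (rule nodal_set_le[OF cp cm p \<tau> eta]) blast
    then show ?thesis using m(2) unfolding is_minimum_def by (meson image_eqI order_trans)
  qed
  have "((\<lambda>\<eta>. \<eta> powr (- 2 / (p - 1)) * split_energy_min cp cm p \<tau>) \<longlongrightarrow> 1 powr (- 2 / (p - 1)) * split_energy_min cp cm p \<tau>) (at_left 1)"
    by (intro tendsto_intros) auto
  moreover have "eventually (\<lambda>\<eta>. m \<le> \<eta> powr (- 2 / (p - 1)) * split_energy_min cp cm p \<tau>) (at_left 1)"
    by (rule eventually_mono[OF eventually_at_left_real[of 0 "1::real"]], simp, rule le) auto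
  ultimately have "m \<le> 1 powr (- 2 / (p - 1)) * split_energy_min cp cm p \<tau>"
    by (rule tendsto_lowerbound) simp
  then show ?thesis using ge by simp
qed

text \<open>Fermat's rule at an interior minimum of the split energy, with the common nonzero
  factors divided out.\<close>

lemma optimal_node_balance:
  assumes cp: "cp > 0" and cm: "cm > 0" and p: "p > 1" and o: "optimal_node cp cm p t"
  shows "((cp * sob_const p) powr (- 1 / (p - 1)))\<^sup>2 * t powr (- decay p - 1)
    = ((cm * sob_const p) powr (- 1 / (p - 1)))\<^sup>2 * (2 - t) powr (- decay p - 1)"
proof -
  have t: "0 < t" "t < 2" using o unfolding optimal_node_def by auto
  define X Y where "X = ((cp * sob_const p) powr (- 1 / (p - 1)))\<^sup>2" and "Y = ((cm * sob_const p) powr (- 1 / (p - 1)))\<^sup>2"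
  define f where "f \<tau> = (1 / 2 - 1 / (p + 1)) * (X * \<tau> powr (- decay p) + Y * (2 - \<tau>) powr (- decay p))" for \<tau>
  have f: "split_energy_min cp cm p \<tau> = f \<tau>" if "0 < \<tau>" "\<tau> < 2" for \<tau>
    using that ground_norm_sq[of \<tau> p cp] ground_norm_sq[of "2 - \<tau>" p cm] by (simp add: split_energy_min_def f_def X_def Y_def)
  have "(f has_real_derivative (1 / 2 - 1 / (p + 1)) * (X * (- decay p * t powr (- decay p - 1)) - Y * (- decay p * (2 - t) powr (- decay p - 1)))) (at t)"
    unfolding f_def[abs_def] using t by (auto intro!: derivative_eq_intros)
  then have "(1 / 2 - 1 / (p + 1)) * (X * (- decay p * t powr (- decay p - 1)) - Y * (- decay p * (2 - t) powr (- decay p - 1))) = 0"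
  proof (rule DERIV_local_min[of _ _ _ "min t (2 - t)"])
    show "\<forall>y. \<bar>t - y\<bar> < min t (2 - t) \<longrightarrow> f t \<le> f y"
    proof (intro allI impI)
      fix y assume "\<bar>t - y\<bar> < min t (2 - t)"
      then have y: "0 < y" "y < 2" by auto
      show "f t \<le> f y" using optimal_node_minimizes[OF cp cm p o y] f[OF t] f[OF y] by simp
    qed
  qed (use t in auto)
  moreover have "1 / 2 - 1 / (p + 1) \<noteq> 0" "decay p \<noteq> 0" using p by (auto simp: decay_def field_simps)
  ultimately have "X * (- decay p * t powr (- decay p - 1)) - Y * (- decay p * (2 - t) powr (- decay p - 1)) = 0"
    by (simp only: mult_eq_0_iff) simp
  then have "decay p * (Y * (2 - t) powr (- decay p - 1) - X * t powr (- decay p - 1)) = 0" by (simp add: algebra_simps)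
  then show ?thesis using \<open>decay p \<noteq> 0\<close> by (simp add: X_def Y_def)
qed

section \<open>Bilipschitz maps of the grid\<close>

text \<open>For \<open>y = real k * x - of_int z\<close> this is the fraction of the rescaled cell
  \<open>z\<close> that lies to the left of \<open>x\<close>.\<close>

definition clamp01 :: "real \<Rightarrow> real" where
  "clamp01 y = max 0 (min 1 y)"

lemma clamp01_mono: "x \<le> y \<Longrightarrow> clamp01 x \<le> clamp01 y"
  by (auto simp: clamp01_def)

lemma sum_clamp01:
  fixes m n :: int and y :: real
  assumes "m \<le> n"
  shows "(\<Sum>z\<in>{m..<n}. clamp01 (y - of_int z)) = max 0 (min (of_int n - of_int m) (y - of_int m))"
  using assms
proof (induction n rule: int_ge_induct)
  case (step i)
  have "{m..<i + 1} = insert i {m..<i}" using step by auto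
  then have "(\<Sum>z\<in>{m..<i + 1}. clamp01 (y - of_int z)) = clamp01 (y - of_int i) + (\<Sum>z\<in>{m..<i}. clamp01 (y - of_int z))"
    by simp
  also have "\<dots> = clamp01 (y - of_int i) + max 0 (min (of_int i - of_int m) (y - of_int m))" using step by simp
  also have "\<dots> = max 0 (min (of_int (i + 1) - of_int m) (y - of_int m))"
  proof -
    have "real_of_int m \<le> of_int i" using step by simp
    then show ?thesis by (auto simp: clamp01_def max_def min_def)
  qed
  finally show ?case .
qed simp

lemma sum_int_telescope:
  fixes f :: "int \<Rightarrow> real"
  assumes "m \<le> n"
  shows "(\<Sum>z\<in>{m..<n}. f (z + 1) - f z) = f n - f m"
  using assms
proof (induction n rule: int_ge_induct)
  case (step i)
  have "{m..<i + 1} = insert i {m..<i}" using step by auto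
  then show ?case using step by simp
qed simp

lemma bilip_iff_lt:
  "bilip L A T \<longleftrightarrow> (\<forall>x\<in>A. \<forall>y\<in>A. x < y \<longrightarrow> 1 / L * (y - x) \<le> \<bar>T y - T x\<bar> \<and> \<bar>T y - T x\<bar> \<le> L * (y - x))"
proof
  assume *: "\<forall>x\<in>A. \<forall>y\<in>A. x < y \<longrightarrow> 1 / L * (y - x) \<le> \<bar>T y - T x\<bar> \<and> \<bar>T y - T x\<bar> \<le> L * (y - x)"
  show "bilip L A T"
    unfolding bilip_def
  proof (intro ballI)
    fix x y assume xy: "x \<in> A" "y \<in> A"
    consider "x < y" | "y < x" | "x = y" by linarith
    then show "1 / L * \<bar>x - y\<bar> \<le> \<bar>T x - T y\<bar> \<and> \<bar>T x - T y\<bar> \<le> L * \<bar>x - y\<bar>"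
    proof cases
      case 1
      then show ?thesis using *[rule_format, OF xy 1] by (simp add: abs_minus_commute)
    next
      case 2
      then show ?thesis using *[rule_format, OF xy(2,1) 2] by simp
    qed simp
  qed
next
  assume "bilip L A T"
  then show "\<forall>x\<in>A. \<forall>y\<in>A. x < y \<longrightarrow> 1 / L * (y - x) \<le> \<bar>T y - T x\<bar> \<and> \<bar>T y - T x\<bar> \<le> L * (y - x)"
    unfolding bilip_def by (metis abs_of_pos diff_gt_0_iff_gt)
qed

lemma bilip_inj: "bilip L A T \<Longrightarrow> L > 0 \<Longrightarrow> inj_on T A"
proof (rule inj_onI, rule ccontr)
  fix x y assume *: "bilip L A T" "L > 0" "x \<in> A" "y \<in> A" "T x = T y" "x \<noteq> y"
  then have "1 / L * \<bar>x - y\<bar> \<le> 0" unfolding bilip_def by fastforce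
  moreover have "1 / L * \<bar>x - y\<bar> > 0" using * by simp
  ultimately show False by linarith
qed

lemma bilip_continuous: "bilip L A T \<Longrightarrow> L \<ge> 0 \<Longrightarrow> continuous_on A T"
  by (rule lipschitz_on_continuous_on[of L], rule lipschitz_onI) (auto simp: bilip_def dist_real_def)

lemma bilip_const_le: "bilip l A T \<Longrightarrow> l \<ge> 1 \<Longrightarrow> bilip_const A T \<le> l"
  unfolding bilip_const_def by (rule cInf_lower) (auto intro!: bdd_belowI[of _ 1])

lemma bilip_const_ge:
  assumes "bilip L A T" "L \<ge> 1" "\<And>l. bilip l A T \<Longrightarrow> l \<ge> 1 \<Longrightarrow> c \<le> l"
  shows "c \<le> bilip_const A T"
  unfolding bilip_const_def by (rule cInf_greatest) (use assms in auto)

section \<open>Nodes, cells and their images\<close>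

locale grid =
  fixes a b :: real and k :: nat
  assumes ab: "a < b" and k: "k \<ge> 1" and nonempty: "grid_cells {a<..<b} k \<noteq> {}"
begin

text \<open>\<open>m\<close> and \<open>n\<close> number the first and the last node in the closed
  interval, so the cells inside it are \<open>{m..<n}\<close>, a half-open range over which
  differences telescope.\<close>

definition m :: int where "m = \<lceil>real k * a\<rceil>"
definition n :: int where "n = \<lfloor>real k * b\<rfloor>"

definition node :: "int \<Rightarrow> real" where "node z = of_int z / real k"
abbreviation D where "D \<equiv> grid_domain {a<..<b} k"
abbreviation Z where "Z \<equiv> grid_cells {a<..<b} k"

text \<open>Node values suffice, because a bilipschitz map sends a cell onto the interval between
  the images of its two nodes.\<close>

definition len :: "(real \<Rightarrow> real) \<Rightarrow> int \<Rightarrow> real" where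
  "len T z = \<bar>T (node (z + 1)) - T (node z)\<bar>"

lemma kpos: "real k > 0"
  using k by simp

lemma scale_image: "(\<lambda>x. 1 / real k * x) ` {c<..<d} = {c / real k<..<d / real k}"
  "(\<lambda>x. 1 / real k * x) ` {c..d} = {c / real k..d / real k}"
proof -
  show "(\<lambda>x. 1 / real k * x) ` {c<..<d} = {c / real k<..<d / real k}"
  proof (intro set_eqI iffI)
    fix y assume "y \<in> {c / real k<..<d / real k}"
    then show "y \<in> (\<lambda>x. 1 / real k * x) ` {c<..<d}"
      using kpos by (intro image_eqI[of _ _ "real k * y"]) (auto simp: field_simps)
  qed (use kpos in \<open>auto simp: divide_strict_right_mono\<close>)
  show "(\<lambda>x. 1 / real k * x) ` {c..d} = {c / real k..d / real k}"
  proof (intro set_eqI iffI)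
    fix y assume "y \<in> {c / real k..d / real k}"
    then show "y \<in> (\<lambda>x. 1 / real k * x) ` {c..d}"
      using kpos by (intro image_eqI[of _ _ "real k * y"]) (auto simp: field_simps)
  qed (use kpos in \<open>auto simp: divide_right_mono\<close>)
qed

lemma cell_eq: "cell z = {of_int z<..<of_int z + 1}"
proof (intro set_eqI iffI)
  fix x assume "x \<in> {real_of_int z<..<of_int z + 1}"
  then show "x \<in> cell z" unfolding cell_def by (intro image_eqI[of _ _ "x - of_int z"]) auto
qed (auto simp: cell_def)

lemma rescale_cell: "rescale k (cell z) = {node z<..<node (z + 1)}"
  "rescale k (closure (cell z)) = {node z..node (z + 1)}"
proof -
  show "rescale k (cell z) = {node z<..<node (z + 1)}"
    unfolding rescale_def cell_eq scale_image by (simp add: node_def)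
  have "closure {real_of_int z<..<of_int z + 1} = {real_of_int z..of_int z + 1}" by simp
  then show "rescale k (closure (cell z)) = {node z..node (z + 1)}"
    unfolding rescale_def cell_eq by (simp only: scale_image) (simp add: node_def)
qed

lemma node_strict_mono: "x < y \<Longrightarrow> node x < node y"
  using kpos by (simp add: node_def divide_strict_right_mono)

lemma node_less: "node z < node (z + 1)"
  by (rule node_strict_mono) simp

lemma Z_eq: "Z = {m..<n}"
proof (rule set_eqI)
  fix z
  have "z \<in> Z \<longleftrightarrow> a \<le> node z \<and> node (z + 1) \<le> b"
    unfolding grid_cells_def mem_Collect_eq rescale_cell
    using node_less[of z] by (simp add: greaterThanLessThan_subseteq_greaterThanLessThan)
  also have "\<dots> \<longleftrightarrow> real k * a \<le> of_int z \<and> of_int (z + 1) \<le> real k * b"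
    using kpos by (simp add: node_def field_simps)
  also have "\<dots> \<longleftrightarrow> m \<le> z \<and> z + 1 \<le> n"
    by (simp only: m_def n_def ceiling_le_iff le_floor_iff)
  also have "\<dots> \<longleftrightarrow> z \<in> {m..<n}" by auto
  finally show "z \<in> Z \<longleftrightarrow> z \<in> {m..<n}" .
qed

lemma mn: "m < n"
  using nonempty unfolding Z_eq by auto

lemma finite_Z: "finite Z"
  by (simp add: Z_eq)

lemma node_mono: "x \<le> y \<Longrightarrow> node x \<le> node y"
  using kpos by (simp add: node_def divide_right_mono)

lemma D_eq: "D = {node m..node n}"
proof -
  have "(\<Union>z\<in>{m..<j}. {node z..node (z + 1)}) = {node m..node j}" if "m < j" for j
    using that
  proof (induction j rule: int_gr_induct)
    case base
    have "{m..<m + 1} = {m}" by auto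
    then show ?case by simp
  next
    case (step i)
    have "{m..<i + 1} = insert i {m..<i}" using step by auto
    then have "(\<Union>z\<in>{m..<i + 1}. {node z..node (z + 1)}) = {node i..node (i + 1)} \<union> {node m..node i}"
      using step by simp
    also have "\<dots> = {node m..node (i + 1)}"
      using node_mono[of m i] node_mono[of i "i + 1"] step by auto
    finally show ?case .
  qed
  then show ?thesis unfolding grid_domain_def rescale_cell Z_eq using mn by simp
qed

lemma node_in_D: "m \<le> z \<Longrightarrow> z \<le> n \<Longrightarrow> node z \<in> D"
  unfolding D_eq using node_mono by simp

lemma closure_Om: "closure {a<..<b} = {a..b}"
  using ab by simp

lemma bilip_segment:
  assumes T: "bilip L D T" and L: "L \<ge> 1" and xy: "x \<in> D" "y \<in> D" "x < y"
  shows "T ` {x<..<y} = {min (T x) (T y)<..<max (T x) (T y)}" "T ` {x..y} = {min (T x) (T y)..max (T x) (T y)}"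
proof -
  have sub: "{x..y} \<subseteq> D" using xy by (auto simp: D_eq)
  have c: "continuous_on {x..y} T" using bilip_continuous[OF T] L sub continuous_on_subset by fastforce
  have i: "inj_on T {x..y}" using bilip_inj[OF T] L sub inj_on_subset by fastforce
  have seg: "closed_segment x y = {x..y}" "open_segment x y = {x<..<y}"
    using xy(3) by (simp_all add: closed_segment_eq_real_ivl open_segment_eq_real_ivl)
  have "T ` open_segment x y = open_segment (T x) (T y)"
    by (rule continuous_injective_image_open_segment_1) (use c i seg in simp_all)
  then show "T ` {x<..<y} = {min (T x) (T y)<..<max (T x) (T y)}"
    unfolding seg by (auto simp: open_segment_eq_real_ivl)
  have "T ` closed_segment x y = closed_segment (T x) (T y)"
    by (rule continuous_injective_image_segment_1) (use c i seg in simp_all)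
  then show "T ` {x..y} = {min (T x) (T y)..max (T x) (T y)}"
    unfolding seg by (auto simp: closed_segment_eq_real_ivl)
qed

lemma cell_image:
  assumes T: "bilip L D T" and L: "L \<ge> 1" and z: "z \<in> Z"
  shows "T ` rescale k (cell z) = {min (T (node z)) (T (node (z + 1)))<..<max (T (node z)) (T (node (z + 1)))}"
  unfolding rescale_cell by (rule bilip_segment(1)[OF T L _ _ node_less]) (use z in \<open>auto simp: Z_eq intro!: node_in_D\<close>)

lemma len_bounds:
  assumes T: "bilip L D T" and z: "z \<in> Z"
  shows "1 / L \<le> real k * len T z" "real k * len T z \<le> L"
proof -
  have "1 / L * (node (z + 1) - node z) \<le> len T z \<and> len T z \<le> L * (node (z + 1) - node z)"
    unfolding len_def using T[unfolded bilip_iff_lt] node_less[of z] z node_in_D[of z] node_in_D[of "z + 1"] by (auto simp: Z_eq)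
  moreover have "node (z + 1) - node z = 1 / real k" using kpos by (simp add: node_def diff_divide_distrib[symmetric])
  ultimately have "1 / L / real k \<le> len T z" "len T z \<le> L / real k" by auto
  then show "1 / L \<le> real k * len T z" "real k * len T z \<le> L"
    using pos_divide_le_eq[OF kpos, of "1 / L" "len T z"] pos_le_divide_eq[OF kpos, of "len T z" L] by (simp_all only: mult.commute)
qed

lemma len_eq: "max (T (node z)) (T (node (z + 1))) - min (T (node z)) (T (node (z + 1))) = len T z"
  by (auto simp: len_def max_def min_def)

text \<open>A continuous injective map of an interval is strictly monotone, so one sign works for
  all cells and their images lie side by side.\<close>

lemma bilip_orientation:
  assumes T: "bilip L D T" and L: "L \<ge> 1"
  obtains s :: real where "s = 1 \<or> s = -1" "\<And>z. z \<in> Z \<Longrightarrow> T (node (z + 1)) - T (node z) = s * len T z"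
proof -
  have c: "continuous_on D T" using bilip_continuous[OF T] L by simp
  have i: "inj_on T D" using bilip_inj[OF T] L by simp
  have "strict_mono_on D T \<or> strict_antimono_on D T"
    using injective_eq_monotone_map[of D T] c i by (simp add: D_eq is_interval_cc)
  then show ?thesis
  proof
    assume "strict_mono_on D T"
    then have "T (node (z + 1)) - T (node z) = 1 * len T z" if "z \<in> Z" for z
      using that node_less[of z] node_in_D[of z] node_in_D[of "z + 1"]
      by (force simp: len_def Z_eq monotone_on_def)
    then show ?thesis using that[of 1] by blast
  next
    assume "strict_antimono_on D T"
    then have "T (node (z + 1)) - T (node z) = (-1) * len T z" if "z \<in> Z" for z
      using that node_less[of z] node_in_D[of z] node_in_D[of "z + 1"]
      by (force simp: len_def Z_eq monotone_on_def)
    then show ?thesis using that[of "-1"] by blast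
  qed
qed

text \<open>The signed lengths telescope to the difference of the images of the two end nodes, which
  for an onto map are \<open>a\<close> and \<open>b\<close> in some order.\<close>

lemma onto_sum_len:
  assumes "T \<in> onto_maps L {a<..<b} k" "L \<ge> 1"
  shows "(\<Sum>z\<in>Z. len T z) = b - a"
proof -
  have T: "bilip L D T" "T ` D = {a..b}" using assms by (auto simp: onto_maps_def bilip_maps_def closure_Om)
  obtain s :: real where s: "s = 1 \<or> s = -1" "\<And>z. z \<in> Z \<Longrightarrow> T (node (z + 1)) - T (node z) = s * len T z"
    using bilip_orientation[OF T(1) assms(2)] by blast
  have "s * (\<Sum>z\<in>Z. len T z) = (\<Sum>z\<in>Z. T (node (z + 1)) - T (node z))"
    using s(2) by (simp add: sum_distrib_left)
  also have "\<dots> = T (node n) - T (node m)"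
    unfolding Z_eq by (rule sum_int_telescope[of m n "\<lambda>z. T (node z)"]) (use mn in simp)
  finally have 1: "s * (\<Sum>z\<in>Z. len T z) = T (node n) - T (node m)" .
  have "node m < node n" by (rule node_strict_mono[OF mn])
  then have "T ` {node m..node n} = {min (T (node m)) (T (node n))..max (T (node m)) (T (node n))}"
    using mn by (intro bilip_segment(2)[OF T(1) assms(2)] node_in_D) auto
  then have "{a..b} = {min (T (node m)) (T (node n))..max (T (node m)) (T (node n))}" using T(2) by (simp only: D_eq)
  then have "a = min (T (node m)) (T (node n)) \<and> b = max (T (node m)) (T (node n))"
    using ab unfolding Icc_eq_Icc by (meson less_imp_le)
  moreover have "\<bar>y - x\<bar> = max x y - min x y" for x y :: real by (simp add: max_def min_def)
  ultimately have "\<bar>T (node n) - T (node m)\<bar> = b - a" by metis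
  then have "\<bar>\<Sum>z\<in>Z. len T z\<bar> = b - a" using s(1) 1 by (auto simp: abs_minus_commute)
  moreover have "(\<Sum>z\<in>Z. len T z) \<ge> 0" by (intro sum_nonneg) (simp add: len_def)
  ultimately show ?thesis by simp
qed

text \<open>Continuous, affine on each cell, with increment \<open>\<delta> z\<close> on cell
  \<open>z\<close>. Writing it as one sum over all cells spares a case distinction when two points
  lie in different cells.\<close>

definition pl :: "real \<Rightarrow> (int \<Rightarrow> real) \<Rightarrow> real \<Rightarrow> real" where
  "pl y0 \<delta> x = y0 + (\<Sum>z\<in>Z. \<delta> z * clamp01 (real k * x - of_int z))"

lemma pl_node:
  assumes "m \<le> j" "j \<le> n"
  shows "pl y0 \<delta> (node j) = y0 + (\<Sum>z\<in>{m..<j}. \<delta> z)"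
proof -
  have "(\<Sum>z\<in>Z. \<delta> z * clamp01 (real k * node j - of_int z)) = (\<Sum>z\<in>Z. if z \<in> {m..<j} then \<delta> z else 0)"
  proof (rule sum.cong[OF refl])
    fix z assume "z \<in> Z"
    have "real k * node j - of_int z = of_int (j - z)" using kpos by (simp add: node_def)
    moreover have "clamp01 (of_int (j - z)) = (if z < j then 1 else 0)" by (auto simp: clamp01_def max_def min_def)
    ultimately show "\<delta> z * clamp01 (real k * node j - of_int z) = (if z \<in> {m..<j} then \<delta> z else 0)"
      using \<open>z \<in> Z\<close> by (simp add: Z_eq)
  qed
  also have "\<dots> = (\<Sum>z\<in>{m..<j}. \<delta> z)"
  proof -
    have "Z \<inter> {m..<j} = {m..<j}" using assms by (auto simp: Z_eq)
    then show ?thesis using sum.inter_restrict[OF finite_Z, of \<delta> "{m..<j}"] by simp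
  qed
  finally show ?thesis by (simp add: pl_def)
qed

lemma pl_diff_node:
  assumes "z \<in> Z"
  shows "pl y0 \<delta> (node (z + 1)) - pl y0 \<delta> (node z) = \<delta> z"
proof -
  have "{m..<z + 1} = insert z {m..<z}" using assms by (auto simp: Z_eq)
  then show ?thesis using assms pl_node[of z] pl_node[of "z + 1"] by (simp add: Z_eq)
qed

text \<open>The weights \<open>c z\<close>, the fractions of the cells between \<open>x\<close> and
  \<open>y\<close>, are nonnegative with sum \<open>real k * (y - x)\<close>. Up to the sign
  \<open>s\<close> the increment is the sum of the \<open>l z\<close> with these weights, so bounds
  valid on every cell carry over to the whole map.\<close>

lemma pl_bilip:
  assumes s: "s = 1 \<or> s = -1" and L: "L \<ge> 1" and l: "\<And>z. z \<in> Z \<Longrightarrow> 1 / L \<le> real k * l z" "\<And>z. z \<in> Z \<Longrightarrow> real k * l z \<le> L"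
  shows "bilip L D (pl y0 (\<lambda>z. s * l z))"
  unfolding bilip_iff_lt
proof (intro ballI impI)
  fix x y assume xy: "x \<in> D" "y \<in> D" "x < y"
  define c where "c z = clamp01 (real k * y - of_int z) - clamp01 (real k * x - of_int z)" for z :: int
  have c0: "c z \<ge> 0" for z
    unfolding c_def using xy(3) kpos clamp01_mono[of "real k * x - of_int z" "real k * y - of_int z"] by simp
  have S: "(\<Sum>z\<in>Z. clamp01 (real k * v - of_int z)) = real k * v - of_int m" if "v \<in> D" for v
  proof -
    have "of_int m \<le> real k * v" "real k * v \<le> of_int n" using that kpos by (auto simp: D_eq node_def field_simps)
    then show ?thesis unfolding Z_eq using sum_clamp01[of m n "real k * v"] mn by simp
  qed
  have sc: "(\<Sum>z\<in>Z. c z) = real k * (y - x)"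
    unfolding c_def sum_subtractf S[OF xy(1)] S[OF xy(2)] by (simp add: right_diff_distrib)
  have "pl y0 (\<lambda>z. s * l z) y - pl y0 (\<lambda>z. s * l z) x = (\<Sum>z\<in>Z. s * l z * c z)"
    unfolding pl_def c_def by (simp add: sum_subtractf right_diff_distrib)
  also have "\<dots> = s * (\<Sum>z\<in>Z. l z * c z)" by (simp add: sum_distrib_left mult.assoc)
  finally have d: "pl y0 (\<lambda>z. s * l z) y - pl y0 (\<lambda>z. s * l z) x = s * (\<Sum>z\<in>Z. l z * c z)" .
  have up: "(\<Sum>z\<in>Z. l z * c z) \<le> L * (y - x)"
  proof -
    have "(\<Sum>z\<in>Z. l z * c z) \<le> (\<Sum>z\<in>Z. L / real k * c z)"
      using l(2) c0 kpos by (intro sum_mono mult_right_mono) (auto simp: field_simps)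
    also have "\<dots> = L / real k * (\<Sum>z\<in>Z. c z)" by (simp add: sum_distrib_left)
    also have "\<dots> = L * (y - x)" unfolding sc using kpos by simp
    finally show ?thesis .
  qed
  have lo: "1 / L * (y - x) \<le> (\<Sum>z\<in>Z. l z * c z)"
  proof -
    have "1 / L * (y - x) = 1 / L / real k * (\<Sum>z\<in>Z. c z)" unfolding sc using kpos by simp
    also have "\<dots> = (\<Sum>z\<in>Z. 1 / L / real k * c z)" by (simp add: sum_distrib_left)
    also have "\<dots> \<le> (\<Sum>z\<in>Z. l z * c z)"
    proof (intro sum_mono mult_right_mono c0)
      show "1 / L / real k \<le> l z" if "z \<in> Z" for z
        using l(1)[OF that] pos_divide_le_eq[OF kpos, of "1 / L" "l z"] by (simp only: mult.commute)
    qed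
    finally show ?thesis .
  qed
  have "\<bar>s * (\<Sum>z\<in>Z. l z * c z)\<bar> = (\<Sum>z\<in>Z. l z * c z)"
  proof -
    have "l z * c z \<ge> 0" if z: "z \<in> Z" for z
    proof -
      have "0 \<le> 1 / L" using L by simp
      then have "0 \<le> real k * l z" using l(1)[OF z] by linarith
      then show ?thesis using kpos c0 by (simp add: zero_le_mult_iff)
    qed
    then have "(\<Sum>z\<in>Z. l z * c z) \<ge> 0" by (rule sum_nonneg)
    then show ?thesis using s by auto
  qed
  then show "1 / L * (y - x) \<le> \<bar>pl y0 (\<lambda>z. s * l z) y - pl y0 (\<lambda>z. s * l z) x\<bar> \<and>
      \<bar>pl y0 (\<lambda>z. s * l z) y - pl y0 (\<lambda>z. s * l z) x\<bar> \<le> L * (y - x)"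
    unfolding d using up lo by simp
qed

lemma bilip_restrict: "bilip L D (restrict T D) \<longleftrightarrow> bilip L D T"
  by (simp add: bilip_def)

lemma len_restrict: "z \<in> Z \<Longrightarrow> len (restrict T D) z = len T z"
  using node_in_D[of z] node_in_D[of "z + 1"] by (simp add: len_def Z_eq)

lemma onto_map_exists:
  assumes L: "L \<ge> 1" and l: "\<And>z. z \<in> Z \<Longrightarrow> 1 / L \<le> real k * l z" "\<And>z. z \<in> Z \<Longrightarrow> real k * l z \<le> L"
    and sum: "(\<Sum>z\<in>Z. l z) = b - a"
  obtains T where "T \<in> onto_maps L {a<..<b} k" "\<And>z. z \<in> Z \<Longrightarrow> len T z = l z"
proof -
  define P where "P = pl a (\<lambda>z. 1 * l z)"
  have B: "bilip L D P" unfolding P_def by (rule pl_bilip[OF _ L l]) simp_all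
  have "node m < node n" by (rule node_strict_mono[OF mn])
  then have "P ` D = {min (P (node m)) (P (node n))..max (P (node m)) (P (node n))}"
    unfolding D_eq using mn by (intro bilip_segment(2)[OF B L] node_in_D) auto
  moreover have "P (node m) = a" "P (node n) = b"
    unfolding P_def using mn sum by (simp_all add: pl_node Z_eq)
  ultimately have im: "P ` D = {a..b}" using ab by simp
  \<comment> \<open>\<open>bilip_maps\<close> consists of extensional functions, hence the
    restriction.\<close>
  have "restrict P D \<in> onto_maps L {a<..<b} k"
    using B im by (auto simp: onto_maps_def bilip_maps_def bilip_restrict closure_Om)
  moreover have "len (restrict P D) z = l z" if z: "z \<in> Z" for z
  proof -
    have "0 \<le> 1 / L" using L by simp
    then have "0 \<le> real k * l z" using l(1)[OF z] by linarith
    then have "l z \<ge> 0" using kpos by (simp add: zero_le_mult_iff)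
    then show ?thesis using pl_diff_node[OF z, of a "\<lambda>z. 1 * l z"] z by (simp add: len_restrict) (simp add: len_def P_def)
  qed
  ultimately show ?thesis using that by blast
qed

text \<open>The piecewise affine interpolation of \<open>T\<close> at the nodes has the same cell
  images, and its bilipschitz bounds depend on the cell lengths alone.\<close>

lemma straightened_map:
  assumes T: "T \<in> bilip_maps L D (closure {a<..<b})" and L: "L \<ge> 1"
  obtains T' where "T' \<in> bilip_maps L D (closure {a<..<b})"
    "\<And>z. z \<in> Z \<Longrightarrow> T' ` rescale k (cell z) = T ` rescale k (cell z)"
    "\<And>l. l \<ge> 1 \<Longrightarrow> (\<And>z. z \<in> Z \<Longrightarrow> 1 / l \<le> real k * len T z) \<Longrightarrow> (\<And>z. z \<in> Z \<Longrightarrow> real k * len T z \<le> l) \<Longrightarrow> bilip l D T'"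
proof -
  have B: "bilip L D T" and im: "T ` D \<subseteq> {a..b}" using T by (auto simp: bilip_maps_def closure_Om)
  obtain s :: real where s: "s = 1 \<or> s = -1" "\<And>z. z \<in> Z \<Longrightarrow> T (node (z + 1)) - T (node z) = s * len T z"
    using bilip_orientation[OF B L] by blast
  define P where "P = pl (T (node m)) (\<lambda>z. s * len T z)"
  have Bl: "bilip l D P" if "l \<ge> 1" "\<And>z. z \<in> Z \<Longrightarrow> 1 / l \<le> real k * len T z" "\<And>z. z \<in> Z \<Longrightarrow> real k * len T z \<le> l" for l
    unfolding P_def by (rule pl_bilip[OF s(1) that])
  have BP: "bilip L D P" by (rule Bl[OF L len_bounds[OF B]])
  have nodes: "P (node j) = T (node j)" if j: "m \<le> j" "j \<le> n" for j
  proof -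
    have "P (node j) = T (node m) + (\<Sum>z\<in>{m..<j}. s * len T z)" unfolding P_def by (rule pl_node[OF j])
    also have "(\<Sum>z\<in>{m..<j}. s * len T z) = (\<Sum>z\<in>{m..<j}. T (node (z + 1)) - T (node z))"
      by (rule sum.cong[OF refl]) (use s(2) j in \<open>simp add: Z_eq\<close>)
    also have "\<dots> = T (node j) - T (node m)" by (rule sum_int_telescope[of m j "\<lambda>z. T (node z)"]) (use j in simp)
    finally show ?thesis by simp
  qed
  have mn': "node m < node n" by (rule node_strict_mono[OF mn])
  have "P ` D = T ` D"
    unfolding D_eq using bilip_segment(2)[OF BP L node_in_D node_in_D mn'] bilip_segment(2)[OF B L node_in_D node_in_D mn'] mn nodes
    by simp
  then have 1: "restrict P D \<in> bilip_maps L D (closure {a<..<b})"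
    using BP im by (auto simp: bilip_maps_def bilip_restrict closure_Om)
  have 2: "restrict P D ` rescale k (cell z) = T ` rescale k (cell z)" if z: "z \<in> Z" for z
  proof -
    have "{node z<..<node (z + 1)} \<subseteq> D" using z node_mono[of m z] node_mono[of "z + 1" n] by (auto simp: D_eq Z_eq)
    then have "restrict P D ` rescale k (cell z) = P ` rescale k (cell z)" unfolding rescale_cell by (auto simp: subset_iff)
    also have "\<dots> = T ` rescale k (cell z)"
      unfolding cell_image[OF BP L z] cell_image[OF B L z] using z nodes[of z] nodes[of "z + 1"] by (simp add: Z_eq)
    finally show ?thesis .
  qed
  show ?thesis by (rule that[OF 1 2]) (simp_all add: bilip_restrict Bl)
qed

lemma len_eq_of_same_image:
  assumes T: "bilip L D T" "L \<ge> 1" and T': "bilip L' D T'" "L' \<ge> 1" and z: "z \<in> Z"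
    and same: "T ` rescale k (cell z) = T' ` rescale k (cell z)"
  shows "len T z = len T' z"
proof -
  define c d c' d' where "c = min (T (node z)) (T (node (z + 1)))" and "d = max (T (node z)) (T (node (z + 1)))"
    and "c' = min (T' (node z)) (T' (node (z + 1)))" and "d' = max (T' (node z)) (T' (node (z + 1)))"
  have eq: "{c<..<d} = {c'<..<d'}"
    using same unfolding cell_image[OF T z] cell_image[OF T' z] c_def d_def c'_def d'_def .
  have pos: "c < d" if "bilip L D T" "L \<ge> 1" "c = min (T (node z)) (T (node (z + 1)))" "d = max (T (node z)) (T (node (z + 1)))" for L T c d
  proof -
    have "0 < 1 / L" using that by simp
    then have "0 < real k * len T z" using len_bounds(1)[OF that(1) z] by linarith
    then have "0 < len T z" using kpos by (simp add: zero_less_mult_iff)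
    then show ?thesis using len_eq[of T z] that by linarith
  qed
  have "c < d" "c' < d'" using pos[OF T c_def d_def] pos[OF T' c'_def d'_def] .
  then have "c = c'" "d = d'" using eq by (simp_all add: greaterThanLessThan_eq_iff)
  then show ?thesis using len_eq[of T z] len_eq[of T' z] by (simp add: c_def d_def c'_def d'_def)
qed

text \<open>Every admissible constant is tested on two neighbouring nodes, at distance
  \<open>1 / real k\<close>.\<close>

lemma bilip_const_bounds:
  assumes T: "bilip L D T" "L \<ge> 1" and z: "z \<in> Z"
  shows "real k * len T z \<le> bilip_const D T" "1 / (real k * len T z) \<le> bilip_const D T"
proof -
  show "real k * len T z \<le> bilip_const D T"
    by (rule bilip_const_ge[OF T]) (rule len_bounds(2)[OF _ z])
  show "1 / (real k * len T z) \<le> bilip_const D T"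
  proof (rule bilip_const_ge[OF T])
    fix l assume l: "bilip l D T" "l \<ge> 1"
    have "0 < 1 / l" using l(2) by simp
    then have "0 < real k * len T z" using len_bounds(1)[OF l(1) z] by linarith
    then show "1 / (real k * len T z) \<le> l" using len_bounds(1)[OF l(1) z] l(2) by (simp add: field_simps)
  qed
qed

end

section \<open>Convergence of the bilipschitz constants\<close>

text \<open>On \<open>{0<..<M}\<close> the second derivative of \<open>x powr (- \<beta>)\<close> is
  at least \<open>\<mu>\<close>, its value at \<open>M\<close>. Subtracting
  \<open>\<mu> / 2 * x^2\<close> therefore leaves a convex function, which lies above its
  tangents.\<close>

lemma powr_convexity_gap:
  fixes \<beta> M :: real
  assumes "\<beta> > 0" "M > 0"
  obtains \<delta> where "\<delta> > 0" "\<And>x y. 0 < x \<Longrightarrow> x < M \<Longrightarrow> 0 < y \<Longrightarrow> y < M \<Longrightarrow>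
    x powr (- \<beta>) \<ge> y powr (- \<beta>) - \<beta> * y powr (- \<beta> - 1) * (x - y) + \<delta> * (x - y)\<^sup>2"
proof -
  define \<mu> where "\<mu> = \<beta> * (\<beta> + 1) * M powr (- \<beta> - 2)"
  have \<mu>: "\<mu> > 0" using assms by (simp add: \<mu>_def)
  define f where "f x = x powr (- \<beta>) - \<mu> / 2 * x\<^sup>2" for x
  define f' where "f' x = - \<beta> * x powr (- \<beta> - 1) - \<mu> * x" for x
  have D1: "(f has_real_derivative f' x) (at x)" if "x \<in> {0<..<M}" for x
    unfolding f_def[abs_def] f'_def using that by (auto intro!: derivative_eq_intros)
  have D2: "(f' has_real_derivative (- \<beta>) * ((- \<beta> - 1) * x powr (- \<beta> - 2)) - \<mu>) (at x)" if "x \<in> {0<..<M}" for x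
    unfolding f'_def[abs_def] using that by (auto intro!: derivative_eq_intros simp: diff_diff_eq)
  have conv: "convex_on {0<..<M} f"
  proof (rule f''_ge0_imp_convex[OF _ D1 D2])
    show "convex {0<..<M}" by simp
    fix x assume x: "x \<in> {0<..<M}"
    have "M powr (- \<beta> - 2) \<le> x powr (- \<beta> - 2)" using x assms by (intro powr_mono2') auto
    then have "\<mu> \<le> \<beta> * (\<beta> + 1) * x powr (- \<beta> - 2)" unfolding \<mu>_def using assms by (intro mult_left_mono) auto
    also have "\<dots> = (- \<beta>) * ((- \<beta> - 1) * x powr (- \<beta> - 2))" by (simp add: algebra_simps)
    finally show "0 \<le> (- \<beta>) * ((- \<beta> - 1) * x powr (- \<beta> - 2)) - \<mu>" by simp
  qed
  have "x powr (- \<beta>) \<ge> y powr (- \<beta>) - \<beta> * y powr (- \<beta> - 1) * (x - y) + \<mu> / 2 * (x - y)\<^sup>2"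
    if xy: "0 < x" "x < M" "0 < y" "y < M" for x y
  proof -
    have "f x - f y \<ge> f' y * (x - y)"
      by (rule convex_on_imp_above_tangent[OF conv]) (use xy D1[of y] in \<open>auto intro: has_field_derivative_at_within\<close>)
    then show ?thesis by (simp add: f_def f'_def power2_eq_square algebra_simps)
  qed
  then show ?thesis using that[of "\<mu> / 2"] \<mu> by simp
qed

section \<open>Alternating signs and the ideal cell lengths\<close>

lemma sgn_cell_cases: "sgn_cell z = 1 \<or> sgn_cell z = -1"
  by (cases "even z") (auto simp: sgn_cell_def power_int_minus_left)

lemma sgn_cell_Suc: "sgn_cell (z + 1) = - sgn_cell z"
  by (simp add: sgn_cell_def power_int_add_1)

lemma sum_sgn_cell: "m \<le> n \<Longrightarrow> \<bar>\<Sum>z\<in>{m..<n}. sgn_cell z\<bar> \<le> 1"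
proof -
  assume mn: "m \<le> n"
  \<comment> \<open>Each sign is half of its difference from the next one, so the alternating sum
    telescopes.\<close>
  have "(\<Sum>z\<in>{m..<n}. sgn_cell z) = (\<Sum>z\<in>{m..<n}. - sgn_cell (z + 1) / 2 - - sgn_cell z / 2)"
    by (simp add: sgn_cell_Suc)
  also have "\<dots> = - sgn_cell n / 2 - - sgn_cell m / 2" by (rule sum_int_telescope[OF mn])
  finally show ?thesis using sgn_cell_cases[of n] sgn_cell_cases[of m] by auto
qed

text \<open>The ideal length, in units of \<open>1 / k\<close>, of the image of a cell of sign
  \<open>s\<close>. For \<open>s\<close> equal to \<open>1\<close> or \<open>-1\<close> it is affine
  in \<open>s\<close>, so that its sums reduce to alternating sums.\<close>

definition part_len :: "real \<Rightarrow> real \<Rightarrow> real" where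
  "part_len t s = (if s = 1 then t else 2 - t)"

lemma part_len_eq: "s = 1 \<or> s = -1 \<Longrightarrow> part_len t s = 1 + s * (t - 1)"
  by (auto simp: part_len_def)

context grid
begin

lemma card_bounds: "real (card Z) \<le> real k * (b - a)" "real (card Z) \<ge> real k * (b - a) - 2"
proof -
  have c: "real (card Z) = of_int n - of_int m" using mn by (simp add: Z_eq)
  have "of_int n \<le> real k * b" "real k * b - 1 < of_int n" "real k * a \<le> of_int m" "of_int m < real k * a + 1"
    unfolding m_def n_def by linarith+
  then show "real (card Z) \<le> real k * (b - a)" "real (card Z) \<ge> real k * (b - a) - 2"
    unfolding c right_diff_distrib by linarith+
qed

text \<open>The error \<open>3\<close> consists of \<open>2\<close> for the incomplete cells at the
  two ends and \<open>1\<close> for a possible surplus of one sign.\<close>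

lemma sum_part_len:
  assumes "0 < t" "t < 2"
  shows "\<bar>(\<Sum>z\<in>Z. part_len t (sgn_cell z)) - real k * (b - a)\<bar> \<le> 3"
proof -
  have "(\<Sum>z\<in>Z. part_len t (sgn_cell z)) = (\<Sum>z\<in>Z. 1 + sgn_cell z * (t - 1))"
    by (simp add: part_len_eq[OF sgn_cell_cases])
  also have "\<dots> = real (card Z) + (\<Sum>z\<in>Z. sgn_cell z) * (t - 1)" by (simp add: sum.distrib sum_distrib_right)
  finally have e: "(\<Sum>z\<in>Z. part_len t (sgn_cell z)) = real (card Z) + (\<Sum>z\<in>Z. sgn_cell z) * (t - 1)" .
  have "\<bar>\<Sum>z\<in>Z. sgn_cell z\<bar> * \<bar>t - 1\<bar> \<le> 1 * 1"
    using sum_sgn_cell[of m n] mn assms by (intro mult_mono) (auto simp: Z_eq)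
  then have "\<bar>(\<Sum>z\<in>Z. sgn_cell z) * (t - 1)\<bar> \<le> 1" by (simp add: abs_mult)
  then show ?thesis unfolding e using card_bounds by linarith
qed

text \<open>\<open>\<theta>\<close> is the quotient of the prescribed total and the sum of the ideal
  lengths, which differ by at most \<open>3\<close>.\<close>

lemma scaled_part_len:
  assumes t: "0 < t" "t < 2" and large: "real k * (b - a) > 3"
  obtains \<theta> where "\<theta> > 0" "\<bar>\<theta> - 1\<bar> \<le> 3 / (real k * (b - a) - 3)"
    "(\<Sum>z\<in>Z. \<theta> * part_len t (sgn_cell z)) = real k * (b - a)"
proof -
  define S where "S = (\<Sum>z\<in>Z. part_len t (sgn_cell z))"
  define Q where "Q = real k * (b - a)"
  have S: "\<bar>S - Q\<bar> \<le> 3" unfolding S_def Q_def by (rule sum_part_len[OF t])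
  have Q: "Q > 3" using large by (simp add: Q_def)
  have S0: "S \<ge> Q - 3" "S > 0" using S Q by linarith+
  have "Q / S - 1 = (Q - S) / S" using S0 by (simp add: field_simps)
  then have "\<bar>Q / S - 1\<bar> = \<bar>Q - S\<bar> / S" using S0 by simp
  also have "\<dots> \<le> 3 / (Q - 3)" using S S0 Q by (intro frac_le) auto
  finally have "\<bar>Q / S - 1\<bar> \<le> 3 / (Q - 3)" .
  moreover have "(\<Sum>z\<in>Z. Q / S * part_len t (sgn_cell z)) = Q"
  proof -
    have "(\<Sum>z\<in>Z. Q / S * part_len t (sgn_cell z)) = Q / S * S" by (simp only: sum_distrib_left[symmetric] S_def[symmetric])
    then show ?thesis using S0 by simp
  qed
  ultimately show ?thesis using that[of "Q / S"] S0 Q by (simp add: Q_def)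
qed

lemma cell_of_sign:
  assumes "real k * (b - a) \<ge> 4" "s = 1 \<or> s = -1"
  obtains z where "z \<in> Z" "sgn_cell z = s"
proof -
  have "real (card Z) \<ge> 2" using card_bounds assms by linarith
  then have "m + 1 < n" by (simp add: Z_eq)
  then have z: "m \<in> Z" "m + 1 \<in> Z" by (auto simp: Z_eq)
  show ?thesis
  proof (cases "sgn_cell m = s")
    case False
    then have "sgn_cell (m + 1) = s" using sgn_cell_cases[of m] assms(2) by (auto simp: sgn_cell_Suc)
    then show ?thesis using that z by blast
  qed (use that z in blast)
qed

end

text \<open>Comparison with the lengths that are optimal under the constraint on their sum: by the Lagrange
  condition the linear terms cancel, and the energy excess controls the squared deviations.\<close>

lemma quadratic_stability:
  fixes x y B :: "'i \<Rightarrow> real"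
  assumes fin: "finite I" and gap: "\<And>x y. 0 < x \<Longrightarrow> x < M \<Longrightarrow> 0 < y \<Longrightarrow> y < M \<Longrightarrow>
      x powr (- \<beta>) \<ge> y powr (- \<beta>) - \<beta> * y powr (- \<beta> - 1) * (x - y) + \<delta> * (x - y)\<^sup>2"
    and x: "\<And>i. i \<in> I \<Longrightarrow> 0 < x i \<and> x i < M" and y: "\<And>i. i \<in> I \<Longrightarrow> 0 < y i \<and> y i < M"
    and B: "\<And>i. i \<in> I \<Longrightarrow> b0 \<le> B i" "0 < b0" and \<delta>: "\<delta> > 0"
    and bal: "\<And>i. i \<in> I \<Longrightarrow> B i * y i powr (- \<beta> - 1) = \<Lambda>"
    and sum: "(\<Sum>i\<in>I. x i) = (\<Sum>i\<in>I. y i)" and i: "i \<in> I"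
    and e: "(\<Sum>i\<in>I. B i * x i powr (- \<beta>)) \<le> (\<Sum>i\<in>I. B i * y i powr (- \<beta>)) + e"
  shows "\<bar>x i - y i\<bar> \<le> sqrt (e / (b0 * \<delta>))"
proof -
  have "(\<Sum>i\<in>I. B i * y i powr (- \<beta>) - \<beta> * \<Lambda> * (x i - y i) + b0 * \<delta> * (x i - y i)\<^sup>2) \<le> (\<Sum>i\<in>I. B i * x i powr (- \<beta>))"
  proof (rule sum_mono)
    fix j assume j: "j \<in> I"
    have "B j * (y j powr (- \<beta>) - \<beta> * y j powr (- \<beta> - 1) * (x j - y j) + \<delta> * (x j - y j)\<^sup>2) \<le> B j * x j powr (- \<beta>)"
      using gap[of "x j" "y j"] x[OF j] y[OF j] B(1)[OF j] B(2) by (intro mult_left_mono) auto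
    moreover have "B j * (y j powr (- \<beta>) - \<beta> * y j powr (- \<beta> - 1) * (x j - y j) + \<delta> * (x j - y j)\<^sup>2)
      = B j * y j powr (- \<beta>) - \<beta> * (B j * y j powr (- \<beta> - 1)) * (x j - y j) + B j * \<delta> * (x j - y j)\<^sup>2"
      by (simp add: algebra_simps)
    moreover have "b0 * \<delta> * (x j - y j)\<^sup>2 \<le> B j * \<delta> * (x j - y j)\<^sup>2"
      using B(1)[OF j] \<delta> by (intro mult_right_mono) auto
    ultimately show "B j * y j powr (- \<beta>) - \<beta> * \<Lambda> * (x j - y j) + b0 * \<delta> * (x j - y j)\<^sup>2 \<le> B j * x j powr (- \<beta>)"
      unfolding bal[OF j] by linarith
  qed
  moreover have "(\<Sum>i\<in>I. B i * y i powr (- \<beta>) - \<beta> * \<Lambda> * (x i - y i) + b0 * \<delta> * (x i - y i)\<^sup>2)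
      = (\<Sum>i\<in>I. B i * y i powr (- \<beta>)) - \<beta> * \<Lambda> * ((\<Sum>i\<in>I. x i) - (\<Sum>i\<in>I. y i)) + b0 * \<delta> * (\<Sum>i\<in>I. (x i - y i)\<^sup>2)"
    by (simp only: sum.distrib sum_subtractf sum_distrib_left right_diff_distrib)
  ultimately have "b0 * \<delta> * (\<Sum>i\<in>I. (x i - y i)\<^sup>2) \<le> e" using e sum by simp
  moreover have "(x i - y i)\<^sup>2 \<le> (\<Sum>i\<in>I. (x i - y i)\<^sup>2)" by (rule member_le_sum[OF i _ fin]) simp
  then have "b0 * \<delta> * (x i - y i)\<^sup>2 \<le> b0 * \<delta> * (\<Sum>i\<in>I. (x i - y i)\<^sup>2)" using B \<delta> by (intro mult_left_mono) auto
  ultimately have "b0 * \<delta> * (x i - y i)\<^sup>2 \<le> e" by linarith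
  then have "(x i - y i)\<^sup>2 \<le> e / (b0 * \<delta>)" using B(2) \<delta> by (simp add: field_simps)
  then have "sqrt ((x i - y i)\<^sup>2) \<le> sqrt (e / (b0 * \<delta>))" by (rule real_sqrt_le_mono)
  then show ?thesis by simp
qed

text \<open>Applied to the exponent \<open>1 - decay p / 2\<close>, whose sign changes at
  \<open>p = 5\<close>; hence the bound with the absolute value.\<close>

lemma powr_le_abs_exponent:
  fixes x L e :: real
  assumes "1 / L \<le> x" "x \<le> L" "L \<ge> 1"
  shows "x powr e \<le> L powr \<bar>e\<bar>"
proof (cases "e \<ge> 0")
  case True
  have "0 \<le> 1 / L" using assms by simp
  then have "0 \<le> x" using assms(1) by linarith
  then show ?thesis using True assms by (intro order_trans[OF powr_mono2[of e x L]]) auto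
next
  case False
  have "0 < 1 / L" using assms by simp
  then have x: "x > 0" using assms(1) by linarith
  have "x powr e \<le> (1 / L) powr e" using False assms \<open>0 < 1 / L\<close> by (intro powr_mono2') auto
  also have "\<dots> = L powr (- e)" using assms by (simp add: powr_divide powr_minus_divide)
  finally show ?thesis using False by simp
qed

text \<open>With \<open>\<mu>\<close> the smaller of \<open>t\<close> and \<open>2 - t\<close>, the
  longer part satisfies \<open>2 - \<mu> \<le> 1 / \<mu>\<close>, as \<open>(1 - \<mu>)^2\<close> is
  nonnegative. So the shorter part alone determines the constant.\<close>

lemma L_hat_bounds:
  assumes "0 < t" "t < 2" "s = 1 \<or> s = -1"
  shows "L_hat t \<ge> 1" "1 / L_hat t \<le> part_len t s" "part_len t s \<le> L_hat t"
proof -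
  define \<mu> where "\<mu> = min t (2 - t)"
  have \<mu>: "0 < \<mu>" "\<mu> \<le> 1" using assms by (auto simp: \<mu>_def)
  have L: "L_hat t = 1 / \<mu>" by (simp add: L_hat_def \<mu>_def)
  show "L_hat t \<ge> 1" unfolding L using \<mu> by simp
  have ps: "part_len t s = \<mu> \<or> part_len t s = 2 - \<mu>" using assms by (auto simp: part_len_def \<mu>_def min_def)
  then show "1 / L_hat t \<le> part_len t s" unfolding L using \<mu> by auto
  have "(2 - \<mu>) * \<mu> \<le> 1" using zero_le_power2[of "1 - \<mu>"] by (simp add: power2_eq_square algebra_simps)
  then have "2 - \<mu> \<le> 1 / \<mu>" using \<mu> by (simp add: field_simps)
  then show "part_len t s \<le> L_hat t" unfolding L using ps \<mu> by auto
qed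

lemma L_hat_attained:
  assumes "0 < t" "t < 2"
  obtains s where "s = 1 \<or> s = -1" "part_len t s = 1 / L_hat t"
proof (cases "t \<le> 1")
  case True
  then show ?thesis using that[of 1] by (simp add: part_len_def L_hat_def)
next
  case False
  then show ?thesis using that[of "-1"] by (simp add: part_len_def L_hat_def)
qed

context grid
begin

text \<open>For the upper bound the straightened map is a competitor whose scaled cell lengths are
  all close to the ideal ones. For the lower bound a single cell of the sign with the shorter ideal
  length already forces almost \<open>L_hat t\<close>. The conditions on \<open>r\<close> translate
  closeness of lengths into closeness of constants.\<close>

lemma bilip_const_close:
  assumes T: "T \<in> bilip_maps L D (closure {a<..<b})" and L: "L \<ge> 1"
    and arg: "is_arg_min (bilip_const D) (\<lambda>T'. T' \<in> bilip_maps L D (closure {a<..<b}) \<and>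
        (\<forall>z\<in>Z. T' ` rescale k (cell z) = T ` rescale k (cell z))) T1"
    and t: "0 < t" "t < 2" and large: "real k * (b - a) \<ge> 4"
    and close: "\<And>z. z \<in> Z \<Longrightarrow> \<bar>real k * len T z - part_len t (sgn_cell z)\<bar> \<le> r"
    and e: "e > 0" and r: "r \<le> e" "r \<le> 1 / L_hat t - 1 / (L_hat t + e)"
      "L_hat t - e \<le> 1 / (1 / L_hat t + r)" 
  shows "\<bar>bilip_const D T1 - L_hat t\<bar> \<le> e"
proof -
  have Lh: "L_hat t \<ge> 1" by (rule L_hat_bounds(1)[OF t, of 1]) simp
  have T1: "T1 \<in> bilip_maps L D (closure {a<..<b})" "\<And>z. z \<in> Z \<Longrightarrow> T1 ` rescale k (cell z) = T ` rescale k (cell z)"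
    and best: "\<And>T'. T' \<in> bilip_maps L D (closure {a<..<b}) \<Longrightarrow> (\<And>z. z \<in> Z \<Longrightarrow> T' ` rescale k (cell z) = T ` rescale k (cell z))
      \<Longrightarrow> bilip_const D T1 \<le> bilip_const D T'"
    using arg unfolding is_arg_min_def by (blast, blast, meson not_less)
  have B: "bilip L D T" "bilip L D T1" using T T1(1) by (auto simp: bilip_maps_def)
  have same: "len T1 z = len T z" if "z \<in> Z" for z
    by (rule len_eq_of_same_image[OF B(2) L B(1) L that T1(2)[OF that]])
  have upper: "bilip_const D T1 \<le> L_hat t + e"
  proof -
    obtain T' where T': "T' \<in> bilip_maps L D (closure {a<..<b})"
      "\<And>z. z \<in> Z \<Longrightarrow> T' ` rescale k (cell z) = T ` rescale k (cell z)"
      "\<And>l. l \<ge> 1 \<Longrightarrow> (\<And>z. z \<in> Z \<Longrightarrow> 1 / l \<le> real k * len T z) \<Longrightarrow> (\<And>z. z \<in> Z \<Longrightarrow> real k * len T z \<le> l) \<Longrightarrow> bilip l D T'"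
      by (rule straightened_map[OF T L]) blast
    have l1: "L_hat t + e \<ge> 1" using Lh e by linarith
    have "bilip (L_hat t + e) D T'"
    proof (rule T'(3)[OF l1])
      fix z assume z: "z \<in> Z"
      note P = L_hat_bounds(2,3)[OF t sgn_cell_cases[of z]]
      show "1 / (L_hat t + e) \<le> real k * len T z" using close[OF z] P r(2) by linarith
      show "real k * len T z \<le> L_hat t + e" using close[OF z] P r(1) by linarith
    qed
    then have "bilip_const D T' \<le> L_hat t + e" by (rule bilip_const_le[OF _ l1])
    then show ?thesis using best[OF T'(1,2)] by linarith
  qed
  have lower: "L_hat t - e \<le> bilip_const D T1"
  proof -
    obtain s where s: "s = 1 \<or> s = -1" "part_len t s = 1 / L_hat t" by (rule L_hat_attained[OF t])
    obtain z where z: "z \<in> Z" "sgn_cell z = s" by (rule cell_of_sign[OF large s(1)])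
    have "0 < 1 / L" using L by simp
    then have pos: "0 < real k * len T z" using len_bounds(1)[OF B(1) z(1)] by linarith
    have "real k * len T z \<le> 1 / L_hat t + r" using close[OF z(1)] s z by simp
    then have "1 / (1 / L_hat t + r) \<le> 1 / (real k * len T z)" using pos by (intro divide_left_mono) auto
    also have "\<dots> \<le> bilip_const D T1" using bilip_const_bounds(2)[OF B(2) L z(1)] same[OF z(1)] by simp
    finally show ?thesis using r(3) by linarith
  qed
  show ?thesis using upper lower by linarith
qed

end

text \<open>Since the scaled lengths stay between \<open>1 / L\<close> and \<open>L\<close>, each
  cell contributes an error of order \<open>k powr (decay p / 2 - 1)\<close>, and there are at most
  \<open>k * (b - a)\<close> cells.\<close>

lemma (in dirichlet_energy) onto_energy_estimate:
  assumes cell: "\<And>c d s v u. a \<le> c \<Longrightarrow> c < d \<Longrightarrow> d \<le> b \<Longrightarrow> d - c \<le> l0 \<Longrightarrow> s = 1 \<or> s = -1 \<Longrightarrow>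
      unique_local_minimizer F p {c<..<d} v \<Longrightarrow> minmax_function F s {c<..<d} v u \<Longrightarrow>
      \<bar>F u - kap * (gn s (d - c))\<^sup>2\<bar> \<le> C * (d - c) powr (1 - decay p / 2)"
    and C: "C \<ge> 0" and k: "k \<ge> 1" and ne: "grid_cells {a<..<b} k \<noteq> {}" and L: "L \<ge> 1" and small: "L / real k \<le> l0"
    and T: "T \<in> onto_maps L {a<..<b} k"
    and ulm: "\<And>z. z \<in> grid_cells {a<..<b} k \<Longrightarrow> unique_local_minimizer F p (T ` rescale k (cell z)) (ut z)"
    and mm: "\<And>z. z \<in> grid_cells {a<..<b} k \<Longrightarrow> minmax_function F (sgn_cell z) (T ` rescale k (cell z)) (ut z) (u z)"
  shows "\<bar>(\<Sum>z\<in>grid_cells {a<..<b} k. F (u z))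
      - real k powr decay p * (\<Sum>z\<in>grid_cells {a<..<b} k. kap * (pre (sgn_cell z))\<^sup>2 * (real k * grid.len k T z) powr (- decay p))\<bar>
    \<le> (b - a) * C * L powr \<bar>1 - decay p / 2\<bar> * real k powr (decay p / 2)"
proof -
  interpret G: grid a b k by unfold_locales (use ab k ne in auto)
  define X where "X = L powr \<bar>1 - decay p / 2\<bar>"
  have B: "bilip L G.D T" and im: "T ` G.D = {a..b}" using T by (auto simp: onto_maps_def bilip_maps_def G.closure_Om)
  have cellwise: "\<bar>F (u z) - real k powr decay p * (kap * (pre (sgn_cell z))\<^sup>2 * (real k * G.len T z) powr (- decay p))\<bar>
      \<le> C * X * real k powr (decay p / 2 - 1)" if z: "z \<in> G.Z" for z
  proof -
    define c d where "c = min (T (G.node z)) (T (G.node (z + 1)))" and "d = max (T (G.node z)) (T (G.node (z + 1)))"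
    have img: "T ` rescale k (cell z) = {c<..<d}" unfolding c_def d_def by (rule G.cell_image[OF B L z])
    have dc: "d - c = G.len T z" unfolding c_def d_def by (rule G.len_eq)
    note lb = G.len_bounds[OF B z]
    have "0 < 1 / L" using L by simp
    then have "0 < real k * G.len T z" using lb(1) by linarith
    then have lpos: "0 < G.len T z" using G.kpos by (simp add: zero_less_mult_iff)
    have "T (G.node z) \<in> {a..b}" "T (G.node (z + 1)) \<in> {a..b}"
      unfolding im[symmetric] using z by (auto intro!: imageI G.node_in_D simp: G.Z_eq)
    then have cd: "a \<le> c" "c < d" "d \<le> b" using lpos dc by (auto simp: c_def d_def)
    have "G.len T z \<le> L / real k" using lb(2) pos_le_divide_eq[OF G.kpos, of "G.len T z" L] by (simp only: mult.commute)
    then have dl0: "d - c \<le> l0" using small dc by linarith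
    have 1: "\<bar>F (u z) - kap * (gn (sgn_cell z) (d - c))\<^sup>2\<bar> \<le> C * (d - c) powr (1 - decay p / 2)"
      by (rule cell[OF cd dl0 sgn_cell_cases]) (use ulm[OF z] mm[OF z] img in simp_all)
    have e: "(gn (sgn_cell z) (d - c))\<^sup>2 = (pre (sgn_cell z))\<^sup>2 * (real k powr decay p * (real k * G.len T z) powr (- decay p))"
    proof -
      have "(real k * G.len T z) powr (- decay p) = real k powr (- decay p) * G.len T z powr (- decay p)"
        using lpos G.kpos by (simp add: powr_mult)
      moreover have "real k powr decay p * real k powr (- decay p) = 1" using G.kpos by (simp add: powr_add[symmetric])
      ultimately have "real k powr decay p * (real k * G.len T z) powr (- decay p) = G.len T z powr (- decay p)"
        by (simp add: mult.assoc[symmetric])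
      then show ?thesis using gn_sq[of "d - c" "sgn_cell z"] lpos dc by simp
    qed
    have "(d - c) powr (1 - decay p / 2) = (real k * G.len T z) powr (1 - decay p / 2) * real k powr (decay p / 2 - 1)"
    proof -
      have "(real k * G.len T z) powr (1 - decay p / 2) = real k powr (1 - decay p / 2) * G.len T z powr (1 - decay p / 2)"
        using lpos G.kpos by (simp add: powr_mult)
      moreover have "real k powr (1 - decay p / 2) * real k powr (decay p / 2 - 1) = 1" using G.kpos by (simp add: powr_add[symmetric])
      ultimately show ?thesis unfolding dc by (simp add: ac_simps)
    qed
    also have "\<dots> \<le> X * real k powr (decay p / 2 - 1)"
      unfolding X_def by (intro mult_right_mono powr_le_abs_exponent lb L) simp
    finally have "C * (d - c) powr (1 - decay p / 2) \<le> C * (X * real k powr (decay p / 2 - 1))" using C by (rule mult_left_mono)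
    then show ?thesis using 1 unfolding e by (simp add: ac_simps)
  qed
  have "\<bar>(\<Sum>z\<in>G.Z. F (u z)) - real k powr decay p * (\<Sum>z\<in>G.Z. kap * (pre (sgn_cell z))\<^sup>2 * (real k * G.len T z) powr (- decay p))\<bar>
    = \<bar>\<Sum>z\<in>G.Z. F (u z) - real k powr decay p * (kap * (pre (sgn_cell z))\<^sup>2 * (real k * G.len T z) powr (- decay p))\<bar>"
    by (simp only: sum_subtractf sum_distrib_left)
  also have "\<dots> \<le> (\<Sum>z\<in>G.Z. \<bar>F (u z) - real k powr decay p * (kap * (pre (sgn_cell z))\<^sup>2 * (real k * G.len T z) powr (- decay p))\<bar>)"
    by (rule sum_abs)
  also have "\<dots> \<le> (\<Sum>z\<in>G.Z. C * X * real k powr (decay p / 2 - 1))" by (rule sum_mono[OF cellwise])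
  also have "\<dots> = real (card G.Z) * (C * X * real k powr (decay p / 2 - 1))" by simp
  also have "\<dots> \<le> (real k * (b - a)) * (C * X * real k powr (decay p / 2 - 1))"
    using G.card_bounds(1) C by (intro mult_right_mono mult_nonneg_nonneg) (auto simp: X_def)
  also have "\<dots> = (b - a) * C * X * (real k powr 1 * real k powr (decay p / 2 - 1))" using G.kpos by simp
  also have "real k powr 1 * real k powr (decay p / 2 - 1) = real k powr (decay p / 2)"
    unfolding powr_add[symmetric] by simp
  finally show ?thesis by (simp only: X_def)
qed

theorem lemma3p2:
  fixes a b :: real and \<Omega> :: "real set" and w :: "real \<Rightarrow> real" and cp cm p t_hat :: real
    and F :: "(real \<Rightarrow> real) \<Rightarrow> real"
    and k_Omega :: nat and kk :: "real \<Rightarrow> nat"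
    and ut u :: "nat \<Rightarrow> int \<Rightarrow> (real \<Rightarrow> real) \<Rightarrow> real \<Rightarrow> real"
    and Tt TL :: "real \<Rightarrow> nat \<Rightarrow> real \<Rightarrow> real"
  assumes "a < b" and "\<Omega> = {a<..<b}"
    and "w \<in> L2 \<Omega>" and "cp > 0" and "cm > 0" and "p > 1"
    and "F = energy cp cm p \<Omega> w"
    and "optimal_node cp cm p t_hat"
    and "\<And>t. optimal_node cp cm p t \<Longrightarrow> t = t_hat"
    and "k_Omega \<ge> 1" and "\<And>k. k \<ge> k_Omega \<Longrightarrow> grid_cells \<Omega> k \<noteq> {}"
    and "\<And>L. L \<ge> 1 \<Longrightarrow> kk L \<ge> k_Omega"
    and "\<And>L k z T. L \<ge> 1 \<Longrightarrow> k \<ge> kk L \<Longrightarrow> z \<in> grid_cells \<Omega> k \<Longrightarrow>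
           T \<in> bilip_maps L (grid_domain \<Omega> k) (closure \<Omega>) \<Longrightarrow>
           unique_local_minimizer F p (T ` rescale k (cell z)) (ut k z T)"
    and "\<And>L k z T. L \<ge> 1 \<Longrightarrow> k \<ge> kk L \<Longrightarrow> z \<in> grid_cells \<Omega> k \<Longrightarrow>
           T \<in> bilip_maps L (grid_domain \<Omega> k) (closure \<Omega>) \<Longrightarrow>
           minmax_function F (sgn_cell z) (T ` rescale k (cell z)) (ut k z T) (u k z T)"
    and "\<And>L k. L \<ge> 1 \<Longrightarrow> k \<ge> kk L \<Longrightarrow> onto_maps L \<Omega> k \<noteq> {} \<Longrightarrow>
           is_arg_min (\<lambda>T. \<Sum>z\<in>grid_cells \<Omega> k. F (u k z T)) (\<lambda>T. T \<in> onto_maps L \<Omega> k) (Tt L k)"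
    and "\<And>L k. L \<ge> 1 \<Longrightarrow> k \<ge> kk L \<Longrightarrow> onto_maps L \<Omega> k \<noteq> {} \<Longrightarrow>
           is_arg_min (bilip_const (grid_domain \<Omega> k))
             (\<lambda>T. T \<in> bilip_maps L (grid_domain \<Omega> k) (closure \<Omega>) \<and>
                (\<forall>z\<in>grid_cells \<Omega> k. T ` rescale k (cell z) = Tt L k ` rescale k (cell z))) (TL L k)"
  shows "\<forall>L > L_hat t_hat.
           (\<exists>k_hat. \<forall>k\<ge>k_hat. onto_maps L \<Omega> k \<noteq> {}) \<and>
           (\<lambda>k. bilip_const (grid_domain \<Omega> k) (TL L k)) \<longlonglongrightarrow> L_hat t_hat"
proof -

  \<comment> \<open>Constants independent of \<open>L\<close>\<close>
  define t where "t = t_hat"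
  have Om: "\<Omega> = {a<..<b}" by fact
  have Feq: "F = energy cp cm p {a<..<b} w" using assms(2,7) by simp
  interpret E: dirichlet_energy a b cp cm p w
    by unfold_locales (use assms(1-6) in auto)
  have p: "p > 1" by fact
  have ab: "a < b" by fact
  have t: "0 < t" "t < 2" using assms(8) by (auto simp: optimal_node_def t_def)
  define \<beta> where "\<beta> = decay p"
  have \<beta>: "\<beta> > 1" using p by (simp add: \<beta>_def decay_def)
  define B where "B s = (1 / 2 - 1 / (p + 1)) * (E.pre s)\<^sup>2" for s
  have Bpos: "B s > 0" for s
  proof -
    have "1 / 2 - 1 / (p + 1) > 0" using p by (simp add: field_simps)
    then show ?thesis using E.pre_pos[of s] by (simp add: B_def)
  qed
  \<comment> \<open>The Lagrange multiplier up to the factor \<open>- \<beta>\<close>: balance at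
    the optimal node gives both kinds of cells the same marginal energy.\<close>
  define \<Lambda> where "\<Lambda> = B 1 * t powr (- \<beta> - 1)"
  have bal: "B s * part_len t s powr (- \<beta> - 1) = \<Lambda>" if "s = 1 \<or> s = -1" for s
  proof (cases "s = 1")
    case False
    then have s: "s = -1" using that by simp
    have "(E.pre 1)\<^sup>2 * t powr (- \<beta> - 1) = (E.pre (-1))\<^sup>2 * (2 - t) powr (- \<beta> - 1)"
      using optimal_node_balance[OF assms(4,5) p assms(8)] by (simp add: E.pre_def sgn_coeff_def t_def \<beta>_def)
    then show ?thesis by (simp add: s part_len_def B_def \<Lambda>_def mult.assoc)
  qed (simp add: part_len_def \<Lambda>_def)
  define b0 where "b0 = min (B 1) (B (-1))"
  have b0: "b0 > 0" "\<And>z. b0 \<le> B (sgn_cell z)"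
  proof -
    show "b0 > 0" using Bpos by (simp add: b0_def)
    show "b0 \<le> B (sgn_cell z)" for z using sgn_cell_cases[of z] by (auto simp: b0_def)
  qed
  obtain C l0 where C: "l0 > 0" "C \<ge> 0"
    "\<And>c d s v u. a \<le> c \<Longrightarrow> c < d \<Longrightarrow> d \<le> b \<Longrightarrow> d - c \<le> l0 \<Longrightarrow> s = 1 \<or> s = -1 \<Longrightarrow>
      unique_local_minimizer E.F p {c<..<d} v \<Longrightarrow> minmax_function E.F s {c<..<d} v u \<Longrightarrow>
      \<bar>E.F u - E.kap * (E.gn s (d - c))\<^sup>2\<bar> \<le> C * (d - c) powr (1 - decay p / 2)"
    by (rule E.cell_energy) blast
  define Lh where "Lh = L_hat t"
  have Lh1: "Lh \<ge> 1" unfolding Lh_def by (rule L_hat_bounds(1)[OF t, of 1]) simp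
  show ?thesis
    unfolding t_def[symmetric] Lh_def[symmetric]
  proof (intro allI impI)
    fix L assume L: "L > Lh"
    then have L1: "L \<ge> 1" using Lh1 by linarith

    \<comment> \<open>Rates and thresholds for a fixed \<open>L\<close>\<close>
    have inner: "1 / L < 1 / Lh" using L Lh1 by (intro divide_strict_left_mono) auto
    \<comment> \<open>The scaled lengths range over \<open>{1 / L..L}\<close>; \<open>L + 1\<close>
      is a bound they never reach, as the convexity gap asks for strict inequalities.\<close>
    obtain \<delta> where \<delta>: "\<delta> > 0" "\<And>x y. 0 < x \<Longrightarrow> x < L + 1 \<Longrightarrow> 0 < y \<Longrightarrow> y < L + 1 \<Longrightarrow>
        x powr (- \<beta>) \<ge> y powr (- \<beta>) - \<beta> * y powr (- \<beta> - 1) * (x - y) + \<delta> * (x - y)\<^sup>2"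
      by (rule powr_convexity_gap[of \<beta> "L + 1"]) (use \<beta> L1 in auto)
    define Q where "Q = (b - a) * C * L powr \<bar>1 - \<beta> / 2\<bar>"
    have Q: "Q \<ge> 0" using ab C by (simp add: Q_def)
    define q where "q k = 3 / (real k * (b - a) - 3)" for k
    \<comment> \<open>The root bounds the distance of the minimizing lengths from the competitor
      lengths, the second term the distance of the latter from \<open>t\<close> or
      \<open>2 - t\<close>.\<close>
    define r where "r k = sqrt (2 * Q * real k powr (- \<beta> / 2) / (b0 * \<delta>)) + 2 * q k" for k
    have qlim: "q \<longlonglongrightarrow> 0"
    proof -
      have "filterlim (\<lambda>k. - 3 + real k * (b - a)) at_top sequentially"
        using ab by (intro filterlim_tendsto_add_at_top[OF tendsto_const] filterlim_at_top_mult_tendsto_pos[OF tendsto_const _ filterlim_real_sequentially]) auto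
      then have "(\<lambda>k. 3 / (- 3 + real k * (b - a))) \<longlonglongrightarrow> 0" by (rule tendsto_divide_0[OF tendsto_const filterlim_at_top_imp_at_infinity])
      then show ?thesis by (simp add: q_def[abs_def] algebra_simps)
    qed
    have rlim: "r \<longlonglongrightarrow> 0"
    proof -
      have "(\<lambda>k. real k powr (- \<beta> / 2)) \<longlonglongrightarrow> 0" using \<beta> by (intro tendsto_neg_powr filterlim_real_sequentially) simp
      then have "(\<lambda>k. 2 * Q * real k powr (- \<beta> / 2) / (b0 * \<delta>)) \<longlonglongrightarrow> 2 * Q * 0 / (b0 * \<delta>)"
        by (intro tendsto_divide tendsto_mult tendsto_const) (use b0 \<delta> in auto)
      then have "(\<lambda>k. sqrt (2 * Q * real k powr (- \<beta> / 2) / (b0 * \<delta>)) + 2 * q k) \<longlonglongrightarrow> sqrt (2 * Q * 0 / (b0 * \<delta>)) + 2 * 0"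
        by (intro tendsto_add tendsto_real_sqrt tendsto_mult tendsto_const qlim)
      then show ?thesis by (simp add: r_def[abs_def])
    qed
    \<comment> \<open>The last two conditions keep the competitor lengths inside
      \<open>{1 / L..L}\<close>; here the strict inequality \<open>L > Lh\<close> enters. The value
      \<open>4\<close> exceeds the \<open>3\<close> lost in the sum of the ideal lengths and also
      guarantees cells of both signs.\<close>
    define adm where "adm k \<longleftrightarrow> k \<ge> kk L \<and> real k * (b - a) \<ge> 4 \<and> L / real k \<le> l0
        \<and> 2 * q k \<le> L - Lh \<and> 2 * q k \<le> 1 / Lh - 1 / L" for k
    have adm: "eventually adm sequentially"
    proof -
      have 1: "eventually (\<lambda>k. real k \<ge> max (4 / (b - a)) (L / l0)) sequentially"
        using filterlim_real_sequentially unfolding filterlim_at_top by blast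
      have q2: "(\<lambda>k. 2 * q k) \<longlonglongrightarrow> 2 * 0" by (rule tendsto_mult[OF tendsto_const qlim])
      have 2: "eventually (\<lambda>k. 2 * q k < L - Lh) sequentially" "eventually (\<lambda>k. 2 * q k < 1 / Lh - 1 / L) sequentially"
        using order_tendstoD(2)[OF q2, of "L - Lh"] order_tendstoD(2)[OF q2, of "1 / Lh - 1 / L"] L inner by auto
      have 3: "eventually (\<lambda>k. k \<ge> max 1 (kk L)) sequentially" by (rule eventually_ge_at_top)
      show ?thesis
        using 1 2 3
      proof eventually_elim
        case (elim k)
        have kp: "real k > 0" using elim(4) by simp
        have "4 / (b - a) \<le> real k" "L / l0 \<le> real k" using elim(1) by auto
        then have "4 \<le> real k * (b - a)" "L / real k \<le> l0" using ab C(1) kp by (simp_all add: field_simps)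
        then show ?case using elim unfolding adm_def by auto
      qed
    qed

    \<comment> \<open>Uniform closeness of the scaled cell lengths to the ideal ones\<close>
    have main: "onto_maps L {a<..<b} k \<noteq> {} \<and>
        (\<forall>z\<in>grid_cells {a<..<b} k. \<bar>real k * grid.len k (Tt L k) z - part_len t (sgn_cell z)\<bar> \<le> r k)" if ad: "adm k" for k
    proof -
      have kL: "k \<ge> kk L" and large: "real k * (b - a) \<ge> 4" and small: "L / real k \<le> l0"
        and q: "2 * q k \<le> L - Lh" "2 * q k \<le> 1 / Lh - 1 / L" using ad by (auto simp: adm_def)
      have kO: "k \<ge> k_Omega" using assms(12)[OF L1] kL by linarith
      have k1: "k \<ge> 1" using kO assms(10) by linarith
      have ne: "grid_cells {a<..<b} k \<noteq> {}" using assms(11)[OF kO] Om by simp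
      interpret G: grid a b k by unfold_locales (use ab k1 ne in auto)
      have "real k * (b - a) > 3" using large by linarith
      then obtain \<theta> where \<theta>: "\<theta> > 0" "\<bar>\<theta> - 1\<bar> \<le> q k" "(\<Sum>z\<in>G.Z. \<theta> * part_len t (sgn_cell z)) = real k * (b - a)"
        using G.scaled_part_len[OF t] unfolding q_def by metis
      define y where "y z = \<theta> * part_len t (sgn_cell z)" for z
      have pl: "0 < part_len t (sgn_cell z)" "part_len t (sgn_cell z) < 2" for z using t by (auto simp: part_len_def)
      have ydev: "\<bar>y z - part_len t (sgn_cell z)\<bar> \<le> 2 * q k" for z
      proof -
        have "y z - part_len t (sgn_cell z) = (\<theta> - 1) * part_len t (sgn_cell z)" by (simp add: y_def left_diff_distrib)
        then have "\<bar>y z - part_len t (sgn_cell z)\<bar> = \<bar>\<theta> - 1\<bar> * part_len t (sgn_cell z)" using pl[of z] by (simp add: abs_mult)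
        also have "\<dots> \<le> q k * 2" using \<theta>(2) pl[of z] by (intro mult_mono) auto
        finally show ?thesis by simp
      qed
      have ybd: "1 / L \<le> y z" "y z \<le> L" for z
        using ydev[of z] q L_hat_bounds(2,3)[OF t sgn_cell_cases[of z]] unfolding Lh_def by linarith+
      have ysum: "(\<Sum>z\<in>G.Z. y z) = real k * (b - a)" using \<theta>(3) by (simp add: y_def)
      \<comment> \<open>The competitor with the rescaled ideal lengths is compared with the
        minimizer and at the same time proves that onto maps exist.\<close>
      obtain T where T: "T \<in> onto_maps L {a<..<b} k" "\<And>z. z \<in> G.Z \<Longrightarrow> G.len T z = y z / real k"
      proof (rule G.onto_map_exists[OF L1, of "\<lambda>z. y z / real k"])
        show "(\<Sum>z\<in>G.Z. y z / real k) = b - a" using ysum G.kpos by (simp add: sum_divide_distrib[symmetric])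
      qed (use ybd G.kpos in auto)
      have onto: "onto_maps L {a<..<b} k \<noteq> {}" using T(1) by blast
      define T0 where "T0 = Tt L k"
      have arg: "is_arg_min (\<lambda>T. \<Sum>z\<in>G.Z. E.F (u k z T)) (\<lambda>T. T \<in> onto_maps L {a<..<b} k) T0"
        using assms(15)[OF L1 kL] onto unfolding Om Feq T0_def by simp
      then have T0: "T0 \<in> onto_maps L {a<..<b} k" and le: "(\<Sum>z\<in>G.Z. E.F (u k z T0)) \<le> (\<Sum>z\<in>G.Z. E.F (u k z T))"
        using T(1) by (auto simp: is_arg_min_def not_less)
      have est: "\<bar>(\<Sum>z\<in>G.Z. E.F (u k z T)) - real k powr \<beta> * (\<Sum>z\<in>G.Z. B (sgn_cell z) * (real k * G.len T z) powr (- \<beta>))\<bar>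
          \<le> Q * real k powr (\<beta> / 2)" if T: "T \<in> onto_maps L {a<..<b} k" for T
      proof -
        have bm: "T \<in> bilip_maps L (grid_domain \<Omega> k) (closure \<Omega>)" using T by (simp add: onto_maps_def Om)
        show ?thesis
          unfolding B_def \<beta>_def Q_def
          by (rule E.onto_energy_estimate[where ut="\<lambda>z. ut k z T" and u="\<lambda>z. u k z T", OF C(3) C(2) k1 ne L1 small T])
            (use assms(13)[OF L1 kL _ bm] assms(14)[OF L1 kL _ bm] in \<open>simp_all add: Om Feq\<close>)
      qed
      define x where "x z = real k * G.len T0 z" for z
      have BT0: "bilip L G.D T0" using T0 by (simp add: onto_maps_def bilip_maps_def)
      have xbd: "1 / L \<le> x z" "x z \<le> L" if "z \<in> G.Z" for z unfolding x_def using G.len_bounds[OF BT0 that] by auto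
      have xsum: "(\<Sum>z\<in>G.Z. x z) = real k * (b - a)"
        unfolding x_def using G.onto_sum_len[OF T0 L1] by (simp add: sum_distrib_left[symmetric])
      have Tlen: "(\<Sum>z\<in>G.Z. B (sgn_cell z) * (real k * G.len T z) powr (- \<beta>)) = (\<Sum>z\<in>G.Z. B (sgn_cell z) * y z powr (- \<beta>))"
        using T(2) G.kpos by (intro sum.cong) auto
      \<comment> \<open>The energy estimate is used once for the minimizer and once for the
        competitor, whence \<open>2 * Q\<close>; dividing by \<open>real k powr \<beta>\<close>
        turns the exponent \<open>\<beta> / 2\<close> into \<open>- \<beta> / 2\<close>.\<close>
      have excess: "(\<Sum>z\<in>G.Z. B (sgn_cell z) * x z powr (- \<beta>)) \<le> (\<Sum>z\<in>G.Z. B (sgn_cell z) * y z powr (- \<beta>)) + 2 * Q * real k powr (- \<beta> / 2)"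
      proof -
        define P where "P = real k powr \<beta>"
        have P: "P > 0" using G.kpos by (simp add: P_def)
        have half: "real k powr (\<beta> / 2) = P * real k powr (- \<beta> / 2)"
          unfolding P_def powr_add[symmetric] by simp
        have "P * (\<Sum>z\<in>G.Z. B (sgn_cell z) * x z powr (- \<beta>)) \<le> P * (\<Sum>z\<in>G.Z. B (sgn_cell z) * y z powr (- \<beta>)) + 2 * (Q * real k powr (\<beta> / 2))"
          using est[OF T0] est[OF T(1)] le unfolding Tlen x_def[symmetric] P_def by linarith
        also have "\<dots> = P * ((\<Sum>z\<in>G.Z. B (sgn_cell z) * y z powr (- \<beta>)) + 2 * Q * real k powr (- \<beta> / 2))"
          unfolding half by (simp add: algebra_simps)
        finally show ?thesis using P by simp
      qed
      have "\<bar>x z - part_len t (sgn_cell z)\<bar> \<le> r k" if z: "z \<in> G.Z" for z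
      proof -
        have Lp: "0 < 1 / L" using L1 by simp
        have "\<bar>x z - y z\<bar> \<le> sqrt (2 * Q * real k powr (- \<beta> / 2) / (b0 * \<delta>))"
        proof (rule quadratic_stability[OF G.finite_Z \<delta>(2) _ _ b0(2) b0(1) \<delta>(1) _ _ z excess])
          show "0 < x i \<and> x i < L + 1" if "i \<in> G.Z" for i using xbd[OF that] Lp by linarith
          show "0 < y i \<and> y i < L + 1" for i using ybd[of i] Lp by linarith
          show "(\<Sum>i\<in>G.Z. x i) = (\<Sum>i\<in>G.Z. y i)" using xsum ysum by simp
          \<comment> \<open>The common factor \<open>\<theta>\<close> only rescales the
            multiplier.\<close>
          show "B (sgn_cell i) * y i powr (- \<beta> - 1) = \<theta> powr (- \<beta> - 1) * \<Lambda>" for i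
          proof -
            have "y i powr (- \<beta> - 1) = \<theta> powr (- \<beta> - 1) * part_len t (sgn_cell i) powr (- \<beta> - 1)"
              unfolding y_def using \<theta>(1) pl[of i] by (simp add: powr_mult)
            then show ?thesis using bal[OF sgn_cell_cases[of i]] by (simp add: ac_simps)
          qed
        qed auto
        then show ?thesis using ydev[of z] unfolding r_def by linarith
      qed
      then show ?thesis using onto by (simp add: x_def T0_def)
    qed
    have part1: "\<exists>k_hat. \<forall>k\<ge>k_hat. onto_maps L \<Omega> k \<noteq> {}"
      using adm main unfolding eventually_sequentially Om by blast

    \<comment> \<open>The limit of the optimal bilipschitz constants\<close>
    have part2: "(\<lambda>k. bilip_const (grid_domain \<Omega> k) (TL L k)) \<longlonglongrightarrow> Lh"
    proof (rule tendstoI)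
      fix e' :: real assume e': "e' > 0"
      \<comment> \<open>Half of the tolerance turns the weak inequality of the closeness estimate
        into a strict one.\<close>
      define e where "e = e' / 2"
      have e: "e > 0" "e < e'" using e' by (auto simp: e_def)
      have gap: "0 < 1 / Lh - 1 / (Lh + e)" using e(1) Lh1 by (simp add: divide_strict_left_mono)
      have "(\<lambda>k. 1 / (1 / Lh + r k)) \<longlonglongrightarrow> 1 / (1 / Lh + 0)"
        using Lh1 by (intro tendsto_divide tendsto_add tendsto_const rlim) auto
      then have lim: "(\<lambda>k. 1 / (1 / Lh + r k)) \<longlonglongrightarrow> Lh" by simp
      have "eventually (\<lambda>k. r k < e) sequentially" "eventually (\<lambda>k. r k < 1 / Lh - 1 / (Lh + e)) sequentially"
        "eventually (\<lambda>k. Lh - e < 1 / (1 / Lh + r k)) sequentially"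
        using order_tendstoD(2)[OF rlim e(1)] order_tendstoD(2)[OF rlim gap] order_tendstoD(1)[OF lim, of "Lh - e"] e by auto
      then show "eventually (\<lambda>k. dist (bilip_const (grid_domain \<Omega> k) (TL L k)) Lh < e') sequentially"
        using adm
      proof eventually_elim
        case (elim k)
        have kL: "k \<ge> kk L" and large: "real k * (b - a) \<ge> 4" using elim(4) by (auto simp: adm_def)
        have kO: "k \<ge> k_Omega" using assms(12)[OF L1] kL by linarith
        have k1: "k \<ge> 1" using kO assms(10) by linarith
        have ne: "grid_cells {a<..<b} k \<noteq> {}" using assms(11)[OF kO] Om by simp
        interpret G: grid a b k by unfold_locales (use ab k1 ne in auto)
        have onto: "onto_maps L {a<..<b} k \<noteq> {}" and close: "\<And>z. z \<in> G.Z \<Longrightarrow> \<bar>real k * G.len (Tt L k) z - part_len t (sgn_cell z)\<bar> \<le> r k"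
          using main[OF elim(4)] by auto
        have "Tt L k \<in> onto_maps L {a<..<b} k" using assms(15)[OF L1 kL] onto unfolding Om by (simp add: is_arg_min_def)
        then have Tt: "Tt L k \<in> bilip_maps L G.D (closure {a<..<b})" by (simp add: onto_maps_def)
        have "is_arg_min (bilip_const G.D) (\<lambda>T'. T' \<in> bilip_maps L G.D (closure {a<..<b}) \<and>
            (\<forall>z\<in>G.Z. T' ` rescale k (cell z) = Tt L k ` rescale k (cell z))) (TL L k)"
          using assms(16)[OF L1 kL] onto unfolding Om by simp
        from G.bilip_const_close[OF Tt L1 this t large close e(1)] elim(1-3)
        have "\<bar>bilip_const G.D (TL L k) - Lh\<bar> \<le> e" unfolding Lh_def by simp
        then show ?case using e(2) by (simp add: dist_real_def Om)
      qed
    qed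
    show "(\<exists>k_hat. \<forall>k\<ge>k_hat. onto_maps L \<Omega> k \<noteq> {}) \<and> (\<lambda>k. bilip_const (grid_domain \<Omega> k) (TL L k)) \<longlonglongrightarrow> Lh"
      using part1 part2 by blast
  qed
qed

end
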